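(* Let $\mathcal A$ be a unital C$^*$-algebra, $n$ a positive integer and $\mathcal B=\mathcal A\otimes\mathcal M_n(\mathbb C)$. If $x_1,\ldots,x_m$ is a finite family of self-adjoint elements generating $\mathcal A$ and $y_1,\ldots,y_p$ is a finite family of self-adjoint elements generating $\mathcal B$, then $$\mathfrak K_{top}^{(2)}(y_1,\ldots,y_p)\le\mathfrak K_{top}^{(2)}(x_1,\ldots,x_m).$$ (The left side is computed in $\mathcal B$, the right side in $\mathcal A$.)
   Context: Microstates. Let $\mathcal A$ be a unital C$^*$-algebra and $x_1,\dots,x_n$ self-adjoint elements of $\mathcal A$. Let $\{P_r\}_{r\ge1}$ enumerate all noncommutative polynomials in the indeterminates $X_1,\dots,X_n$ whose coefficients have rational real and imaginary parts (constants allowed). $\mathcal M_k^{s.a.}(\mathbb C)$ is the set of self-adjoint $k\times k$ complex matrices and $\tau_k=\frac1k\mathrm{Tr}$. For $R,\epsilon>0$ and $r,k\in\mathbb N$, $\Gamma_R^{(top)}(x_1,\dots,x_n;k,\epsilon,P_1,\dots,P_r)$ is the set of $(A_1,\dots,A_n)\in\mathcal M_k^{s.a.}(\mathbb C)^n$ with $\max_i\|A_i\|\le R$ and $\big|\|P_j(A_1,\dots,A_n)\|-\|P_j(x_1,\dots,x_n)\|\big|\le\epsilon$ for $1\le j\le r$. Covering numbers. On $\mathcal M_k(\mathbb C)^n$ put $\|(A_i)\|_2=(\sum_i\tau_k(A_i^*A_i))^{1/2}$. The $\omega$-orbit ball centred at $(B_i)$ is the set of $(A_i)$ such that some unitary $W\in\mathcal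 M_k(\mathbb C)$ satisfies $\|(A_i)-(WB_iW^* )\|_2<\omega$; for $\Sigma\subseteq\mathcal M_k(\mathbb C)^n$, $o_2(\Sigma,\omega)$ is the minimal number of $\omega$-orbit balls centred at points of $\Sigma$ covering $\Sigma$. Convention $\log 0=-\infty$. Topological orbit dimension: $\mathfrak K^{(2)}_{top}(x_1,\dots,x_n;\omega)=\sup_{R>0}\inf_{\epsilon>0,r\in\mathbb N}\limsup_{k\to\infty}\frac{\log o_2(\Gamma_R^{(top)}(x_1,\dots,x_n;k,\epsilon,P_1,\dots,P_r),\omega)}{k^2}$ and $\mathfrak K_{top}^{(2)}(x_1,\dots,x_n)=\limsup_{\omega\to0^+}\mathfrak K_{top}^{(2)}(x_1,\dots,x_n;\omega)$. *)

theory Defs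
  imports Complex_Main "HOL-Library.Poly_Mapping" "HOL-Library.List_Lexorder"
    "HOL-Library.Extended_Real" "HOL-Library.Liminf_Limsup"
begin

record 'a calg =
  ca_carrier :: "'a set"
  ca_add :: "'a \<Rightarrow> 'a \<Rightarrow> 'a"
  ca_mul :: "'a \<Rightarrow> 'a \<Rightarrow> 'a"
  ca_smult :: "complex \<Rightarrow> 'a \<Rightarrow> 'a"
  ca_star :: "'a \<Rightarrow> 'a"
  ca_one :: "'a"
  ca_zero :: "'a"
  ca_norm :: "'a \<Rightarrow> real"

definition ca_sub :: "'a calg \<Rightarrow> 'a \<Rightarrow> 'a \<Rightarrow> 'a" where
  "ca_sub S x y = ca_add S x (ca_smult S (-1) y)"

definition unital_cstar_algebra :: "'a calg \<Rightarrow> bool" where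
  "unital_cstar_algebra S \<longleftrightarrow>
    (let C = ca_carrier S; add = ca_add S; mul = ca_mul S; sm = ca_smult S;
         st = ca_star S; e = ca_one S; z = ca_zero S; nr = ca_norm S in
     z \<in> C \<and> e \<in> C \<and>
     (\<forall>x\<in>C. \<forall>y\<in>C. add x y \<in> C \<and> mul x y \<in> C) \<and>
     (\<forall>c. \<forall>x\<in>C. sm c x \<in> C) \<and> (\<forall>x\<in>C. st x \<in> C) \<and>
     (\<forall>x\<in>C. \<forall>y\<in>C. \<forall>w\<in>C. add (add x y) w = add x (add y w)) \<and>
     (\<forall>x\<in>C. \<forall>y\<in>C. add x y = add y x) \<and>
     (\<forall>x\<in>C. add z x = x) \<and>
     (\<forall>x\<in>C. add x (sm (-1) x) = z) \<and>
     (\<forall>c. \<forall>x\<in>C. \<forall>y\<in>C. sm c (add x y) = add (sm c x) (sm c y)) \<and>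
     (\<forall>c d. \<forall>x\<in>C. sm (c + d) x = add (sm c x) (sm d x)) \<and>
     (\<forall>c d. \<forall>x\<in>C. sm c (sm d x) = sm (c * d) x) \<and>
     (\<forall>x\<in>C. sm 1 x = x) \<and>
     (\<forall>x\<in>C. \<forall>y\<in>C. \<forall>w\<in>C. mul (mul x y) w = mul x (mul y w)) \<and>
     (\<forall>x\<in>C. mul e x = x \<and> mul x e = x) \<and>
     (\<forall>x\<in>C. \<forall>y\<in>C. \<forall>w\<in>C. mul x (add y w) = add (mul x y) (mul x w)
                          \<and> mul (add y w) x = add (mul y x) (mul w x)) \<and>
     (\<forall>c. \<forall>x\<in>C. \<forall>y\<in>C. sm c (mul x y) = mul (sm c x) y \<and> sm c (mul x y) = mul x (sm c y)) \<and>
     (\<forall>x\<in>C. st (st x) = x) \<and>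
     (\<forall>x\<in>C. \<forall>y\<in>C. st (add x y) = add (st x) (st y)) \<and>
     (\<forall>c. \<forall>x\<in>C. st (sm c x) = sm (cnj c) (st x)) \<and>
     (\<forall>x\<in>C. \<forall>y\<in>C. st (mul x y) = mul (st y) (st x)) \<and>
     (\<forall>x\<in>C. 0 \<le> nr x \<and> (nr x = 0 \<longleftrightarrow> x = z)) \<and>
     (\<forall>x\<in>C. \<forall>y\<in>C. nr (add x y) \<le> nr x + nr y) \<and>
     (\<forall>c. \<forall>x\<in>C. nr (sm c x) = cmod c * nr x) \<and>
     (\<forall>x\<in>C. \<forall>y\<in>C. nr (mul x y) \<le> nr x * nr y) \<and>
     (\<forall>x\<in>C. nr (mul (st x) x) = (nr x)\<^sup>2) \<and>
     (\<forall>X::nat \<Rightarrow> 'a. (\<forall>k. X k \<in> C) \<and>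
          (\<forall>\<epsilon>>0. \<exists>N. \<forall>a\<ge>N. \<forall>b\<ge>N. nr (ca_sub S (X a) (X b)) < \<epsilon>) \<longrightarrow>
          (\<exists>L\<in>C. \<forall>\<epsilon>>0. \<exists>N. \<forall>a\<ge>N. nr (ca_sub S (X a) L) < \<epsilon>)))"

definition self_adjoint :: "'a calg \<Rightarrow> 'a \<Rightarrow> bool" where
  "self_adjoint S x \<longleftrightarrow> x \<in> ca_carrier S \<and> ca_star S x = x"

definition invertible_in :: "'a calg \<Rightarrow> 'a \<Rightarrow> bool" where
  "invertible_in S x \<longleftrightarrow>
     (\<exists>y\<in>ca_carrier S. ca_mul S x y = ca_one S \<and> ca_mul S y x = ca_one S)"

definition spec_radius :: "'a calg \<Rightarrow> 'a \<Rightarrow> real" where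
  "spec_radius S a = Sup (insert 0 {cmod l | l.
      \<not> invertible_in S (ca_sub S (ca_smult S l (ca_one S)) a)})"

text \<open>A noncommutative polynomial is a finitely supported function from words
  (lists of variable indices; index i stands for X_(i+1)) to coefficients.\<close>
type_synonym ncpoly = "nat list \<Rightarrow>\<^sub>0 complex"

definition ncpoly_in_vars :: "nat \<Rightarrow> ncpoly \<Rightarrow> bool" where
  "ncpoly_in_vars m P \<longleftrightarrow> (\<forall>w\<in>Poly_Mapping.keys P. \<forall>i\<in>set w. i < m)"

definition rat_ncpolys :: "nat \<Rightarrow> ncpoly set" where
  "rat_ncpolys m = {P. ncpoly_in_vars m P \<and>
      (\<forall>w. Re (Poly_Mapping.lookup P w) \<in> \<rat> \<and> Im (Poly_Mapping.lookup P w) \<in> \<rat>)}"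

definition word_prod :: "'a calg \<Rightarrow> 'a list \<Rightarrow> nat list \<Rightarrow> 'a" where
  "word_prod S xs w = foldr (\<lambda>i acc. ca_mul S (xs ! i) acc) w (ca_one S)"

definition ca_sum :: "'a calg \<Rightarrow> ('b::linorder \<Rightarrow> 'a) \<Rightarrow> 'b set \<Rightarrow> 'a" where
  "ca_sum S f F = foldr (\<lambda>w acc. ca_add S (f w) acc) (sorted_list_of_set F) (ca_zero S)"

definition ncp_eval :: "'a calg \<Rightarrow> ncpoly \<Rightarrow> 'a list \<Rightarrow> 'a" where
  "ncp_eval S P xs = ca_sum S (\<lambda>w. ca_smult S (Poly_Mapping.lookup P w) (word_prod S xs w)) (Poly_Mapping.keys P)"

text \<open>xs generates S as a (unital) C*-algebra: the polynomials in xs are norm-dense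
  (the generators are self-adjoint, so *-polynomials reduce to polynomials).\<close>
definition generates :: "'a calg \<Rightarrow> 'a list \<Rightarrow> bool" where
  "generates S xs \<longleftrightarrow>
     (\<forall>a\<in>ca_carrier S. \<forall>\<epsilon>>0. \<exists>P. ncpoly_in_vars (length xs) P \<and>
         ca_norm S (ca_sub S a (ncp_eval S P xs)) < \<epsilon>)"

definition mat_alg0 :: "'a calg \<Rightarrow> nat \<Rightarrow> (nat \<Rightarrow> nat \<Rightarrow> 'a) calg" where
  "mat_alg0 S n =
    \<lparr> ca_carrier = {X. (\<forall>i j. i < n \<and> j < n \<longrightarrow> X i j \<in> ca_carrier S) \<and>
                        (\<forall>i j. \<not> (i < n \<and> j < n) \<longrightarrow> X i j = ca_zero S)},
      ca_add = (\<lambda>X Y i j. if i < n \<and> j < n then ca_add S (X i j) (Y i j) else ca_zero S),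
      ca_mul = (\<lambda>X Y i j. if i < n \<and> j < n then
                   foldr (\<lambda>l acc. ca_add S (ca_mul S (X i l) (Y l j)) acc) [0..<n] (ca_zero S)
                 else ca_zero S),
      ca_smult = (\<lambda>c X i j. if i < n \<and> j < n then ca_smult S c (X i j) else ca_zero S),
      ca_star = (\<lambda>X i j. if i < n \<and> j < n then ca_star S (X j i) else ca_zero S),
      ca_one = (\<lambda>i j. if i < n \<and> j < n \<and> i = j then ca_one S else ca_zero S),
      ca_zero = (\<lambda>i j. ca_zero S),
      ca_norm = (\<lambda>X. 0) \<rparr>"

text \<open>The C*-algebra A \<otimes> M_n(C), realised as M_n(A) with its (unique) C*-norm
  ||X|| = sqrt(r(X^* X)), r the spectral radius in M_n(A).\<close>
definition mat_alg :: "'a calg \<Rightarrow> nat \<Rightarrow> (nat \<Rightarrow> nat \<Rightarrow> 'a) calg" where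
  "mat_alg S n = (mat_alg0 S n)
     \<lparr> ca_norm := (\<lambda>X. sqrt (spec_radius (mat_alg0 S n)
                            (ca_mul (mat_alg0 S n) (ca_star (mat_alg0 S n) X) X))) \<rparr>"

definition CC :: "complex calg" where
  "CC = \<lparr> ca_carrier = UNIV, ca_add = (+), ca_mul = (*), ca_smult = (*),
          ca_star = cnj, ca_one = 1, ca_zero = 0, ca_norm = cmod \<rparr>"

definition op_norm :: "nat \<Rightarrow> (nat \<Rightarrow> nat \<Rightarrow> complex) \<Rightarrow> real" where
  "op_norm k M = Sup (insert 0 {sqrt (\<Sum>i<k. (cmod (\<Sum>j<k. M i j * v j))\<^sup>2) | v.
                                  (\<Sum>j<k. (cmod (v j))\<^sup>2) = 1})"

definition cmat :: "nat \<Rightarrow> (nat \<Rightarrow> nat \<Rightarrow> complex) calg" where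
  "cmat k = (mat_alg0 CC k) \<lparr> ca_norm := op_norm k \<rparr>"

definition tau :: "nat \<Rightarrow> (nat \<Rightarrow> nat \<Rightarrow> complex) \<Rightarrow> complex" where
  "tau k M = (\<Sum>i<k. M i i) / of_nat k"

definition norm2 :: "nat \<Rightarrow> (nat \<Rightarrow> nat \<Rightarrow> complex) list \<Rightarrow> real" where
  "norm2 k As = sqrt (\<Sum>i<length As.
        Re (tau k (ca_mul (cmat k) (ca_star (cmat k) (As ! i)) (As ! i))))"

definition unitary_mat :: "nat \<Rightarrow> (nat \<Rightarrow> nat \<Rightarrow> complex) \<Rightarrow> bool" where
  "unitary_mat k W \<longleftrightarrow> W \<in> ca_carrier (cmat k) \<and>
     ca_mul (cmat k) (ca_star (cmat k) W) W = ca_one (cmat k)"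

definition orbit_ball :: "nat \<Rightarrow> real \<Rightarrow> (nat \<Rightarrow> nat \<Rightarrow> complex) list
                          \<Rightarrow> (nat \<Rightarrow> nat \<Rightarrow> complex) list set" where
  "orbit_ball k \<omega> Bs = {As. length As = length Bs \<and> (\<forall>A\<in>set As. A \<in> ca_carrier (cmat k)) \<and>
      (\<exists>W. unitary_mat k W \<and>
         norm2 k (map2 (\<lambda>A B. ca_sub (cmat k) A
                   (ca_mul (cmat k) (ca_mul (cmat k) W B) (ca_star (cmat k) W))) As Bs) < \<omega>)}"

definition o2 :: "nat \<Rightarrow> (nat \<Rightarrow> nat \<Rightarrow> complex) list set \<Rightarrow> real \<Rightarrow> nat" where
  "o2 k \<Sigma> \<omega> = Inf {card F | F. finite F \<and> F \<subseteq> \<Sigma> \<and> \<Sigma> \<subseteq> (\<Union>B\<in>F. orbit_ball k \<omega> B)}"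

definition Gamma_top :: "'a calg \<Rightarrow> 'a list \<Rightarrow> (nat \<Rightarrow> ncpoly) \<Rightarrow> real \<Rightarrow> nat \<Rightarrow> real \<Rightarrow> nat
                          \<Rightarrow> (nat \<Rightarrow> nat \<Rightarrow> complex) list set" where
  "Gamma_top S xs P R k \<epsilon> r = {As. length As = length xs \<and>
      (\<forall>A\<in>set As. self_adjoint (cmat k) A \<and> op_norm k A \<le> R) \<and>
      (\<forall>j\<in>{1..r}. \<bar>ca_norm (cmat k) (ncp_eval (cmat k) (P j) As)
                    - ca_norm S (ncp_eval S (P j) xs)\<bar> \<le> \<epsilon>)}"

definition log_ratio :: "nat \<Rightarrow> nat \<Rightarrow> ereal" where
  "log_ratio c k = (if c = 0 then -\<infinity> else ereal (ln (real c) / (real k)\<^sup>2))"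

definition K_top_omega :: "'a calg \<Rightarrow> 'a list \<Rightarrow> (nat \<Rightarrow> ncpoly) \<Rightarrow> real \<Rightarrow> ereal" where
  "K_top_omega S xs P \<omega> =
     (SUP R\<in>{0<..}. INF p\<in>{0<..} \<times> {1..}.
        limsup (\<lambda>k. log_ratio (o2 k (Gamma_top S xs P R k (fst p) (snd p)) \<omega>) k))"

definition K_top :: "'a calg \<Rightarrow> 'a list \<Rightarrow> (nat \<Rightarrow> ncpoly) \<Rightarrow> ereal" where
  "K_top S xs P = Limsup (at_right 0) (K_top_omega S xs P)"

end

theory Submission
  imports Defs "HOL-Analysis.Analysis" "HOL-Computational_Algebra.Fundamental_Theorem_Algebra"
begin

text \<open>Matrix units of \<open>M\<^sub>n(A)\<close> are limits of polynomials in the \<open>y\<close>, so a good microstate \<open>B\<close> of the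
  \<open>y\<close> in \<open>M\<^sub>k\<close> contains approximate matrix units. Correcting them to exact isometries \<open>T\<^sub>s\<close> shows that
  \<open>k = n l\<close> and yields a microstate \<open>D\<close> of the \<open>x\<close> in \<open>M\<^sub>l\<close> such that \<open>B\<close> is close to
  \<open>\<Sum>\<^sub>s\<^sub>t T\<^sub>s f\<^sub>s\<^sub>t(D) T\<^sub>t\<^sup>*\<close> for fixed polynomials \<open>f\<^sub>s\<^sub>t\<close>. Polynomials are Lipschitz for the
  Hilbert-Schmidt norm, so an orbit cover of the microstates of the \<open>x\<close> in \<open>M\<^sub>l\<close> induces one of the same
  cardinality for the \<open>y\<close> in \<open>M\<^sub>k\<close>, and \<open>k\<^sup>2 \<ge> l\<^sup>2\<close>. The C*-norm of \<open>M\<^sub>n(A)\<close>, which is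
  given through the spectral radius, is identified with the operator norm on the Hilbert module \<open>A\<^sup>n\<close>.\<close>

text \<open>No rate is ever computed for how \<open>\<epsilon>\<close> and \<open>r\<close> force a
  microstate of the \<open>y\<close> to lift. If no pair did, there would be a sequence of
  counterexamples with tolerance tending to \<open>0\<close>, and along it every relation of
  \<open>M\<^sub>n(A)\<close> holds up to vanishing errors. The sequence runs through matrices of
  varying size, so these must share a type: \<open>ucs\<close> contains a copy of every C*-algebra
  carried by a given type, the unit of the algebra becoming a projection. For this reason
  polynomials are evaluated with a prescribed unit, and representations are not assumed unital. The
  norms of the lifted \<open>D\<close> are controlled by those of the \<open>x\<close>, not by the
  cut-off \<open>R0\<close> for the \<open>y\<close>; one fixed \<open>R\<close> on the right
  therefore serves the supremum over all \<open>R0\<close> on the left. A size \<open>k\<close> that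
  is not a multiple of \<open>n\<close> admits no good microstate, and the convention
  \<open>log 0 = -\<infinity>\<close> disposes of it. Since the norm of \<open>mat_alg\<close> is a
  spectral radius, the C*-property of matrices rests on two classical facts proved here: a
  self-adjoint element attains its norm in the spectrum, and \<open>adj a * a\<close> is
  positive.\<close>

class cstar = real_normed_algebra_1 + complete_space +
  fixes cs :: "complex \<Rightarrow> 'a \<Rightarrow> 'a" (infixr "*\<^sub>C" 75)
    and adj :: "'a \<Rightarrow> 'a"
  assumes cs_add_right: "c *\<^sub>C (x + y) = c *\<^sub>C x + c *\<^sub>C y"
    and cs_add_left: "(c + d) *\<^sub>C x = c *\<^sub>C x + d *\<^sub>C x"
    and cs_cs [simp]: "c *\<^sub>C d *\<^sub>C x = (c * d) *\<^sub>C x"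
    and cs_of_real: "complex_of_real r *\<^sub>C x = scaleR r x"
    and mult_cs_left [simp]: "(c *\<^sub>C x) * y = c *\<^sub>C (x * y)"
    and mult_cs_right [simp]: "x * (c *\<^sub>C y) = c *\<^sub>C (x * y)"
    and norm_cs [simp]: "norm (c *\<^sub>C x) = cmod c * norm x"
    and adj_adj [simp]: "adj (adj x) = x"
    and adj_add [simp]: "adj (x + y) = adj x + adj y"
    and adj_mult [simp]: "adj (x * y) = adj y * adj x"
    and adj_cs [simp]: "adj (c *\<^sub>C x) = cnj c *\<^sub>C adj x"
    and norm_adj_mult: "norm (adj x * x) = (norm x)\<^sup>2"
begin

subclass banach ..

end

lemma cs_one [simp]: "1 *\<^sub>C x = x"
  using cs_of_real[of 1 x] by (simp add: scaleR_one)

lemma cs_zero_left [simp]: "0 *\<^sub>C x = 0"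
  using cs_add_left[of 0 0 x] by simp

lemma cs_minus_one: "(-1) *\<^sub>C x = - x"
  using cs_add_left[of 1 "-1" x] by (simp add: eq_neg_iff_add_eq_0 add.commute)

lemma cs_zero_right [simp]: "c *\<^sub>C 0 = 0"
  by (metis add_cancel_right_right cs_add_right)

lemma cs_minus_right [simp]: "c *\<^sub>C (- x) = - (c *\<^sub>C x)"
  using cs_add_right[of c x "- x"] by (simp add: eq_neg_iff_add_eq_0 add.commute)

lemma cs_minus_left [simp]: "(- c) *\<^sub>C x = - (c *\<^sub>C x)"
  using cs_add_left[of c "- c" x] by (simp add: eq_neg_iff_add_eq_0 add.commute)

lemma cs_diff_right: "c *\<^sub>C (x - y) = c *\<^sub>C x - c *\<^sub>C y"
  using cs_add_right[of c x "- y"] by simp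

lemma cs_diff_left: "(c - d) *\<^sub>C x = c *\<^sub>C x - d *\<^sub>C x"
  using cs_add_left[of c "- d" x] by simp

lemma adj_zero [simp]: "adj 0 = 0"
  using adj_cs[of 0 0] by simp

lemma adj_minus [simp]: "adj (- x) = - adj x"
  by (metis adj_cs cs_minus_one complex_cnj_one complex_cnj_minus)

lemma adj_diff [simp]: "adj (x - y) = adj x - adj y"
  by (metis adj_add adj_minus diff_conv_add_uminus)

lemma adj_one [simp]: "adj 1 = 1"
  by (metis adj_adj adj_mult mult_1_left mult_1_right)

lemma adj_power [simp]: "adj (x ^ n) = adj x ^ n"
  by (induct n) (simp_all add: power_commutes)

lemma adj_scaleR [simp]: "adj (scaleR r x) = scaleR r (adj x)"
  by (simp flip: cs_of_real)

lemma norm_adj [simp]: "norm (adj x) = norm x"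
proof -
  have *: "norm y \<le> norm (adj y)" for y
  proof (cases "norm y = 0")
    case False
    have "norm y * norm y = norm (adj y * y)" by (simp only: norm_adj_mult power2_eq_square)
    also have "\<dots> \<le> norm (adj y) * norm y" by (rule norm_mult_ineq)
    finally show ?thesis using False by simp
  qed simp
  show ?thesis using *[of x] *[of "adj x"] by simp
qed

lemma adj_sum [simp]: "adj (sum f A) = (\<Sum>i\<in>A. adj (f i :: 'a::cstar))"
  by (induct A rule: infinite_finite_induct) auto

lemma cs_sum_right: "c *\<^sub>C sum f A = (\<Sum>i\<in>A. c *\<^sub>C (f i :: 'a::cstar))"
  by (induct A rule: infinite_finite_induct) (auto simp: cs_add_right)

subsection \<open>Spectrum\<close>

definition iv :: "'a::cstar \<Rightarrow> bool" where
  "iv x \<longleftrightarrow> (\<exists>y. x * y = 1 \<and> y * x = 1)"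

definition spec :: "'a::cstar \<Rightarrow> complex \<Rightarrow> bool" where
  "spec h c \<longleftrightarrow> \<not> iv (c *\<^sub>C 1 - h)"

lemma ivI: "x * y = 1 \<Longrightarrow> z * x = 1 \<Longrightarrow> iv (x::'a::cstar)"
  unfolding iv_def by (metis mult.assoc mult_1_left mult_1_right)

lemma iv_mult: "iv x \<Longrightarrow> iv y \<Longrightarrow> iv (x * y)"
proof -
  assume "iv x" "iv y"
  then obtain a b where ab: "x * a = 1" "a * x = 1" "y * b = 1" "b * y = 1" unfolding iv_def by blast
  have "(x * y) * (b * a) = x * (y * b) * a" "(b * a) * (x * y) = b * (a * x) * y" by (simp_all add: mult.assoc)
  then show ?thesis unfolding iv_def using ab by (intro exI[of _ "b * a"]) simp
qed

text \<open>Commutation turns an inverse \<open>z\<close> of \<open>x * y\<close> into a right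
  inverse \<open>y * z\<close> and a left inverse \<open>z * y\<close> of \<open>x\<close>. The
  application is to polynomials in one element.\<close>

lemma iv_commute_factor: "iv (x * y) \<Longrightarrow> x * y = y * x \<Longrightarrow> iv x"
  unfolding iv_def[of "x * y"] by (metis ivI mult.assoc)

lemma iv_cs: assumes "c \<noteq> 0" shows "iv (c *\<^sub>C x) \<longleftrightarrow> iv x"
proof -
  have *: "iv (d *\<^sub>C z)" if "iv z" "d \<noteq> 0" for d and z :: 'a
  proof -
    from that(1) obtain y where "z * y = 1" "y * z = 1" unfolding iv_def by blast
    then show ?thesis unfolding iv_def using that(2) by (intro exI[of _ "inverse d *\<^sub>C y"]) simp
  qed
  have e: "inverse c *\<^sub>C c *\<^sub>C x = x" using assms by simp
  show ?thesis
  proof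
    assume "iv (c *\<^sub>C x)"
    from *[OF this, of "inverse c"] show "iv x" using assms unfolding e by simp
  next
    assume "iv x"
    then show "iv (c *\<^sub>C x)" using assms by (rule *)
  qed
qed

lemma iv_minus: "iv (- x) \<longleftrightarrow> iv x"
  using iv_cs[of "-1" x] by (simp add: cs_minus_one)

text \<open>Neumann series: multiplied by \<open>1 - a\<close> from either side, it telescopes to
  \<open>1\<close>.\<close>

lemma iv_one_minus: assumes "norm a < 1" shows "iv (1 - a :: 'a::cstar)"
proof -
  have s: "summable (\<lambda>n. a ^ n)" by (rule complete_algebra_summable_geometric[OF assms])
  have "(1 - a) * suminf (\<lambda>n. a ^ n) = suminf (\<lambda>n. (1 - a) * a ^ n)" by (rule suminf_mult[OF s, symmetric])
  also have "\<dots> = suminf (\<lambda>n. a ^ n - a ^ Suc n)" by (simp add: algebra_simps)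
  also have "\<dots> = a ^ 0 - 0"
    by (intro sums_unique[symmetric] telescope_sums' LIMSEQ_power_zero assms)
  finally have 1: "(1 - a) * suminf (\<lambda>n. a ^ n) = 1" by simp
  have "suminf (\<lambda>n. a ^ n) * (1 - a) = suminf (\<lambda>n. a ^ n * (1 - a))" by (rule suminf_mult2[OF s])
  also have "\<dots> = suminf (\<lambda>n. a ^ n - a ^ Suc n)" by (simp add: algebra_simps power_commutes)
  also have "\<dots> = a ^ 0 - 0"
    by (intro sums_unique[symmetric] telescope_sums' LIMSEQ_power_zero assms)
  finally show ?thesis using 1 ivI by fastforce
qed

lemma spec_norm: assumes "spec h c" shows "cmod c \<le> norm h"
proof (rule ccontr)
  assume "\<not> ?thesis"
  then have c: "cmod c > norm h" "c \<noteq> 0" by auto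
  have "iv (1 - inverse c *\<^sub>C h)" by (rule iv_one_minus) (use c in \<open>simp add: norm_divide inverse_eq_divide field_simps\<close>)
  then have "iv (c *\<^sub>C (1 - inverse c *\<^sub>C h))" using c by (simp add: iv_cs)
  then show False using assms c by (simp add: spec_def cs_diff_right)
qed

lemma spec_shift: "spec (s *\<^sub>C 1 - h) (s - c) \<longleftrightarrow> spec h c"
proof -
  have e: "(s - c) *\<^sub>C 1 - (s *\<^sub>C 1 - h) = - (c *\<^sub>C 1 - h)"
    unfolding cs_diff_left by (simp only: minus_diff_eq diff_diff_eq2 diff_add_eq add_diff_cancel_left' diff_diff_add diff_add_cancel) (simp add: algebra_simps)
  show ?thesis unfolding spec_def e iv_minus ..
qed

lemma spec_shift_add: "spec (h + s *\<^sub>C 1) (c + s) \<longleftrightarrow> spec h c"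
proof -
  have "(c + s) *\<^sub>C 1 - (h + s *\<^sub>C 1) = c *\<^sub>C 1 - h" by (simp add: cs_add_left)
  then show ?thesis unfolding spec_def by (rule arg_cong)
qed

lemma spec_cs: "s \<noteq> 0 \<Longrightarrow> spec (s *\<^sub>C h) (s * c) \<longleftrightarrow> spec h c"
  unfolding spec_def using iv_cs[of s "c *\<^sub>C 1 - h"] by (simp add: cs_diff_right)

text \<open>Jacobson's identity: if \<open>y\<close> inverts \<open>c - b a\<close>, then
  \<open>inverse c *\<^sub>C (1 + a * y * b)\<close> inverts \<open>c - a b\<close>. The division is
  the reason for \<open>c \<noteq> 0\<close>.\<close>

lemma spec_mult_commute: assumes "spec (a * b) c" "c \<noteq> 0" shows "spec (b * a) c"
proof (rule ccontr)
  assume "\<not> ?thesis"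
  then obtain y where y: "(c *\<^sub>C 1 - b * a) * y = 1" "y * (c *\<^sub>C 1 - b * a) = 1"
    unfolding spec_def iv_def by blast
  have y1: "c *\<^sub>C y = 1 + b * a * y" using y(1) by (simp add: left_diff_distrib diff_eq_eq)
  have y2: "c *\<^sub>C y = 1 + y * b * a" using y(2) by (simp add: right_diff_distrib diff_eq_eq mult.assoc)
  have e1: "a * (c *\<^sub>C y) * b = a * b + a * b * (a * y * b)" unfolding y1 by (simp add: algebra_simps)
  have e2: "a * (c *\<^sub>C y) * b = a * b + (a * y * b) * (a * b)" unfolding y2 by (simp add: algebra_simps)
  have "(c *\<^sub>C 1 - a * b) * (1 + a * y * b) = c *\<^sub>C 1"
    using e1 by (simp add: algebra_simps cs_add_right)
  moreover have "(1 + a * y * b) * (c *\<^sub>C 1 - a * b) = c *\<^sub>C 1"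
    using e2 by (simp add: algebra_simps cs_add_right)
  ultimately have "iv (c *\<^sub>C 1 - a * b)"
    using assms(2) by (intro ivI[of _ "inverse c *\<^sub>C (1 + a * y * b)" "inverse c *\<^sub>C (1 + a * y * b)"]) simp_all
  then show False using assms(1) by (simp add: spec_def)
qed

text \<open>Arens' trick: \<open>h + i t\<close> has norm at most \<open>sqrt (norm h ^ 2 + t ^ 2)\<close>, which excludes
  \<open>\<alpha> + i \<beta>\<close> from the spectrum once \<open>t\<close> is large.\<close>
lemma spec_self_adjoint_real:
  assumes "adj h = h" "spec h c" shows "Im c = 0"
proof (rule ccontr)
  assume ne: "Im c \<noteq> 0"
  define b where "b = Im c"
  define N where "N = (norm h)\<^sup>2"
  have *: "(b + t)\<^sup>2 \<le> N + t\<^sup>2" for t :: real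
  proof -
    define g where "g = h + (\<i> * t) *\<^sub>C 1"
    have "spec g (c + \<i> * t)" unfolding g_def using assms(2) by (simp add: spec_shift_add)
    then have "cmod (c + \<i> * t) \<le> norm g" by (rule spec_norm)
    moreover have "\<bar>b + t\<bar> \<le> cmod (c + \<i> * t)"
      using abs_Im_le_cmod[of "c + \<i> * t"] by (simp add: b_def)
    ultimately have "(b + t)\<^sup>2 \<le> (norm g)\<^sup>2"
      by (metis abs_ge_zero order_trans power2_abs power_mono)
    also have "(norm g)\<^sup>2 = norm (adj g * g)" by (simp add: norm_adj_mult)
    also have "adj g * g = h * h + (t\<^sup>2) *\<^sub>R 1"
      by (simp add: g_def assms(1) algebra_simps cs_diff_right power2_eq_square flip: cs_of_real)
    also have "norm \<dots> \<le> norm (h * h) + t\<^sup>2"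
      by (rule order_trans[OF norm_triangle_ineq]) simp
    also have "norm (h * h) = N" unfolding N_def using norm_adj_mult[of h] assms(1) by simp
    finally show ?thesis .
  qed
  \<comment> \<open>With the shift \<open>t = N / b\<close> the cross term \<open>2 b t\<close>
    equals \<open>2 N\<close> and outweighs the \<open>N\<close> on the right.\<close>
  have "(b + N / b)\<^sup>2 \<le> N + (N / b)\<^sup>2" by (rule *)
  then have "b\<^sup>2 + 2 * N \<le> N" using ne by (simp add: b_def power2_sum)
  moreover have "b\<^sup>2 > 0" "N \<ge> 0" using ne by (auto simp: b_def N_def)
  ultimately show False by linarith
qed

text \<open>Compactness replaces analyticity: points with unbounded resolvent would accumulate at
  some \<open>w\<close> in the disc, whereas the resolvent identity gives
  \<open>norm (F x) \<le> norm (F w) + norm (F x) / 2\<close> for \<open>x\<close> near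
  \<open>w\<close>.\<close>

lemma resolvent_bounded:
  fixes h :: "'a::cstar"
  assumes "\<And>z. cmod z \<le> 1 \<Longrightarrow> F z * (1 - z *\<^sub>C h) = 1 \<and> (1 - z *\<^sub>C h) * F z = 1"
  shows "\<exists>M>0. \<forall>z. cmod z \<le> 1 \<longrightarrow> norm (F z) \<le> M"
proof (rule ccontr)
  assume neg: "\<not> ?thesis"
  have "\<exists>z. cmod z \<le> 1 \<and> norm (F z) > real (Suc n)" for n
    using neg by (metis not_less of_nat_0_less_iff zero_less_Suc)
  then obtain z where z: "\<And>n. cmod (z n) \<le> 1" "\<And>n. norm (F (z n)) > real (Suc n)" by metis
  have "\<forall>n. z n \<in> cball 0 1" using z(1) by simp
  then obtain w r where w: "w \<in> cball 0 1" and r: "strict_mono r" "(z \<circ> r) \<longlonglongrightarrow> w"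
    using compact_cball[of "0::complex" 1] unfolding compact_def by metis
  define C where "C = norm (h * F w) + 1"
  have C: "C > 0" by (simp add: C_def add_nonneg_pos)
  have cw: "cmod w \<le> 1" using w by simp
  have "eventually (\<lambda>n. dist (z (r n)) w < 1 / (2 * C)) sequentially"
    using r(2) C unfolding tendsto_iff comp_def by simp
  moreover have "eventually (\<lambda>n. real n \<ge> 2 * norm (F w)) sequentially"
    by (metis eventually_at_top_linorder nat_ceiling_le_eq)
  ultimately have "eventually (\<lambda>n. False) sequentially"
  proof eventually_elim
    case (elim n)
    define x where "x = z (r n)"
    have cx: "cmod x \<le> 1" using z(1) x_def by simp
    have "F x = F x * ((1 - w *\<^sub>C h) * F w)" using assms[OF cw] by simp
    also have "\<dots> = F x * (1 - x *\<^sub>C h) * F w + F x * ((x - w) *\<^sub>C h * F w)"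
      by (simp add: algebra_simps cs_diff_left)
    also have "\<dots> = F w + (x - w) *\<^sub>C (F x * (h * F w))" using assms[OF cx] by simp
    finally have "norm (F x) \<le> norm (F w) + cmod (x - w) * norm (F x * (h * F w))"
      by (metis norm_cs norm_triangle_ineq)
    also have "norm (F x * (h * F w)) \<le> norm (F x) * C"
      by (rule order_trans[OF norm_mult_ineq]) (simp add: C_def mult_left_mono)
    finally have "norm (F x) \<le> norm (F w) + cmod (x - w) * (norm (F x) * C)"
      by (simp add: mult_left_mono)
    also have "\<dots> \<le> norm (F w) + 1 / (2 * C) * (norm (F x) * C)"
      using elim(1) C by (intro add_left_mono mult_right_mono) (auto simp: x_def dist_norm)
    finally have "norm (F x) \<le> 2 * norm (F w)" using C by simp
    moreover have "real n < norm (F x)" using z(2)[of "r n"] seq_suble[OF r(1), of n] unfolding x_def by linarith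
    ultimately show ?case using elim(2) by linarith
  qed
  then show False by simp
qed

text \<open>If no point of the unit circle were spectral, the resolvent would be Lipschitz on the closed
  unit disc. Averaging over \<open>2^k\<close>-th roots of unity turns \<open>(1 - z h)\<^sup>-\<^sup>1\<close> into \<open>(1 - z\<^sup>N h\<^sup>N)\<^sup>-\<^sup>1\<close> with
  \<open>N = 2^k\<close>, which is near \<open>1\<close> inside the disc but not on the circle, as \<open>h\<^sup>N\<close> has norm \<open>1\<close>.\<close>
lemma spec_radius_normalized:
  fixes h :: "'a::cstar"
  assumes sa: "adj h = h" and n1: "norm h = 1"
  shows "\<exists>c. spec h c \<and> cmod c = 1"
proof (rule ccontr)
  assume neg: "\<not> ?thesis"
  have ivz: "iv (1 - z *\<^sub>C h)" if "cmod z \<le> 1" for z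
  proof (cases "z = 0")
    case True then show ?thesis unfolding iv_def by (intro exI[of _ 1]) simp
  next
    case False
    have "\<not> spec h (inverse z)"
    proof
      assume s: "spec h (inverse z)"
      from spec_norm[OF this] have "inverse (cmod z) \<le> 1" using n1 by (simp only: norm_inverse)
      then have "cmod z = 1" using that False by (simp only: inverse_le_1_iff) simp
      then have "cmod (inverse z) = 1" by (simp add: norm_inverse)
      then show False using neg s by blast
    qed
    then have "iv (z *\<^sub>C (inverse z *\<^sub>C 1 - h))" using False by (simp add: spec_def iv_cs)
    then show ?thesis using False by (simp add: cs_diff_right)
  qed
  then obtain F where F: "\<And>z. cmod z \<le> 1 \<Longrightarrow> F z * (1 - z *\<^sub>C h) = 1 \<and> (1 - z *\<^sub>C h) * F z = 1"
    unfolding iv_def by metis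
  then obtain M where M: "M > 0" "\<And>z. cmod z \<le> 1 \<Longrightarrow> norm (F z) \<le> M" using resolvent_bounded by metis
  have lip: "norm (F z - F w) \<le> M * M * cmod (z - w)" if "cmod z \<le> 1" "cmod w \<le> 1" for z w
  proof -
    have "F z - F w = F z * ((1 - w *\<^sub>C h) * F w) - (F z * (1 - z *\<^sub>C h)) * F w" using F that by simp
    also have "\<dots> = (z - w) *\<^sub>C (F z * h * F w)" by (simp add: algebra_simps cs_diff_left)
    finally have "norm (F z - F w) = cmod (z - w) * norm (F z * h * F w)" by simp
    also have "norm (F z * h * F w) \<le> norm (F z) * norm h * norm (F w)"
      by (meson mult_right_mono norm_ge_zero norm_mult_ineq order_trans)
    also have "\<dots> \<le> M * M" using M that n1 by (simp add: mult_mono)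
    finally show ?thesis by (simp add: mult.commute[of "cmod (z - w)"] mult_right_mono)
  qed
  \<comment> \<open>The gap between the unit circle and the circle of radius
    \<open>w = 1 - d\<close> is so narrow that the Lipschitz bound keeps the inverses at
    corresponding points within \<open>1/8\<close> of each other.\<close>
  define d where "d = min (1/2) (1 / (8 * M * M))"
  have d: "0 < d" "d \<le> 1/2" "M * M * d \<le> 1/8" using M(1) by (auto simp: d_def min_def field_simps)
  define w where "w = 1 - d"
  have w: "0 < w" "w < 1" using d by (auto simp: w_def)
  \<comment> \<open>The bound \<open>1/8\<close> has to survive every \<open>k\<close>. It does,
    because an inverse at level \<open>Suc k\<close> is the mean of the inverses at level
    \<open>k\<close> for the two square roots of \<open>\<zeta>\<close>, and means do not enlarge
    distances.\<close>
  have D: "\<forall>\<zeta>. cmod \<zeta> = 1 \<longrightarrow> (\<exists>y y'. y * (1 - \<zeta> *\<^sub>C h ^ (2^k)) = 1 \<and> (1 - \<zeta> *\<^sub>C h ^ (2^k)) * y = 1 \<and>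
      y' * (1 - (\<zeta> * w ^ (2^k)) *\<^sub>C h ^ (2^k)) = 1 \<and> (1 - (\<zeta> * w ^ (2^k)) *\<^sub>C h ^ (2^k)) * y' = 1 \<and> norm (y - y') \<le> 1/8)" for k :: nat
  proof (induct k)
    case 0
    have "norm (F \<zeta> - F (\<zeta> * w)) \<le> 1/8" if "cmod \<zeta> = 1" for \<zeta>
    proof -
      have "cmod (\<zeta> * w) \<le> 1" using that w by (simp add: norm_mult)
      then have "norm (F \<zeta> - F (\<zeta> * w)) \<le> M * M * cmod (\<zeta> - \<zeta> * w)" using lip that by simp
      also have "\<zeta> - \<zeta> * w = \<zeta> * of_real d" by (simp add: w_def algebra_simps)
      finally show ?thesis using d that by (simp add: norm_mult)
    qed
    then show ?case using F w by (auto simp: norm_mult intro!: exI)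
  next
    case (Suc k)
    define u where "u = h ^ (2^k)"
    define v where "v = w ^ (2^k)"
    have u2: "h ^ (2 ^ Suc k) = u * u" by (simp add: u_def mult_2 flip: power_add)
    have v2: "w ^ (2 ^ Suc k) = v * v" by (simp add: v_def mult_2 flip: power_add)
    show ?case unfolding u2 v2
    proof (intro allI impI)
      fix \<zeta> :: complex assume z: "cmod \<zeta> = 1"
      define \<xi> where "\<xi> = csqrt \<zeta>"
      have xi: "\<xi> * \<xi> = \<zeta>" by (metis \<xi>_def power2_csqrt power2_eq_square)
      have cxi: "cmod \<xi> = 1" using z xi by (metis abs_norm_cancel norm_mult power2_eq_square power2_eq_1_iff abs_1 abs_minus_cancel)
      obtain a a' where a: "a * (1 - \<xi> *\<^sub>C u) = 1" "(1 - \<xi> *\<^sub>C u) * a = 1"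
        "a' * (1 - (\<xi> * v) *\<^sub>C u) = 1" "(1 - (\<xi> * v) *\<^sub>C u) * a' = 1" "norm (a - a') \<le> 1/8"
        using Suc[rule_format, OF cxi] unfolding u_def v_def by auto
      obtain b b' where b: "b * (1 + \<xi> *\<^sub>C u) = 1" "(1 + \<xi> *\<^sub>C u) * b = 1"
        "b' * (1 + (\<xi> * v) *\<^sub>C u) = 1" "(1 + (\<xi> * v) *\<^sub>C u) * b' = 1" "norm (b - b') \<le> 1/8"
        using Suc[rule_format, of "- \<xi>"] cxi unfolding u_def v_def by auto
      \<comment> \<open>The mean of \<open>(1 - x)\<^sup>-\<^sup>1\<close> and
        \<open>(1 + x)\<^sup>-\<^sup>1\<close> is \<open>(1 - x\<^sup>2)\<^sup>-\<^sup>1\<close>,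
        used with \<open>x = \<theta> u\<close>.\<close>
      have avg: "(1/2) *\<^sub>R (x + y) * (1 - (\<theta> * \<theta>) *\<^sub>C (u * u)) = 1 \<and> (1 - (\<theta> * \<theta>) *\<^sub>C (u * u)) * ((1/2) *\<^sub>R (x + y)) = 1"
        if x: "x * (1 - \<theta> *\<^sub>C u) = 1" "(1 - \<theta> *\<^sub>C u) * x = 1" and y: "y * (1 + \<theta> *\<^sub>C u) = 1" "(1 + \<theta> *\<^sub>C u) * y = 1" for x y \<theta>
      proof -
        have e: "1 - (\<theta> * \<theta>) *\<^sub>C (u * u) = (1 - \<theta> *\<^sub>C u) * (1 + \<theta> *\<^sub>C u)"
          "1 - (\<theta> * \<theta>) *\<^sub>C (u * u) = (1 + \<theta> *\<^sub>C u) * (1 - \<theta> *\<^sub>C u)" by (simp_all add: algebra_simps cs_diff_right cs_add_right)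
        have l: "x * (1 - (\<theta> * \<theta>) *\<^sub>C (u * u)) = 1 + \<theta> *\<^sub>C u" "y * (1 - (\<theta> * \<theta>) *\<^sub>C (u * u)) = 1 - \<theta> *\<^sub>C u"
          "(1 - (\<theta> * \<theta>) *\<^sub>C (u * u)) * x = 1 + \<theta> *\<^sub>C u" "(1 - (\<theta> * \<theta>) *\<^sub>C (u * u)) * y = 1 - \<theta> *\<^sub>C u"
          subgoal unfolding e(1) mult.assoc[symmetric] x(1) by simp
          subgoal unfolding e(2) mult.assoc[symmetric] y(1) by simp
          subgoal unfolding e(2) mult.assoc x(2) by simp
          subgoal unfolding e(1) mult.assoc y(2) by simp
          done
        have t: "(1/2) *\<^sub>R ((1 + \<theta> *\<^sub>C u) + (1 - \<theta> *\<^sub>C u)) = 1" by (simp flip: scaleR_2)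
        show ?thesis using l t by (simp only: mult_scaleR_left mult_scaleR_right distrib_left distrib_right)
      qed
      have p: "(1/2) *\<^sub>R (a + b) * (1 - \<zeta> *\<^sub>C (u * u)) = 1 \<and> (1 - \<zeta> *\<^sub>C (u * u)) * ((1/2) *\<^sub>R (a + b)) = 1"
        using avg[OF a(1,2) b(1,2)] by (simp add: xi)
      have sq: "(\<xi> * complex_of_real v) * (\<xi> * complex_of_real v) = \<zeta> * of_real (v * v)"
        by (simp add: algebra_simps flip: xi)
      have q: "(1/2) *\<^sub>R (a' + b') * (1 - (\<zeta> * of_real (v * v)) *\<^sub>C (u * u)) = 1 \<and> (1 - (\<zeta> * of_real (v * v)) *\<^sub>C (u * u)) * ((1/2) *\<^sub>R (a' + b')) = 1"
        using avg[OF a(3,4) b(3,4)] unfolding sq .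
      have "(1/2) *\<^sub>R (a + b) - (1/2) *\<^sub>R (a' + b') = (1/2) *\<^sub>R ((a - a') + (b - b'))"
        by (simp add: algebra_simps)
      then have n: "norm ((1/2) *\<^sub>R (a + b) - (1/2) *\<^sub>R (a' + b')) \<le> 1/8"
        using norm_triangle_ineq[of "a - a'" "b - b'"] a(5) b(5) by simp
      show "\<exists>y y'. y * (1 - \<zeta> *\<^sub>C (u * u)) = 1 \<and> (1 - \<zeta> *\<^sub>C (u * u)) * y = 1 \<and>
        y' * (1 - (\<zeta> * complex_of_real (v * v)) *\<^sub>C (u * u)) = 1 \<and> (1 - (\<zeta> * complex_of_real (v * v)) *\<^sub>C (u * u)) * y' = 1 \<and> norm (y - y') \<le> 1 / 8"
        using p q n by blast
    qed
  qed
  have nk: "norm (h ^ (2 ^ k)) = 1" for k :: nat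
  proof (induct k)
    case (Suc k)
    have "norm (h ^ (2 ^ Suc k)) = norm (adj (h ^ (2^k)) * h ^ (2^k))" by (simp add: sa mult_2 flip: power_add)
    then show ?case using Suc norm_adj_mult[of "h ^ (2^k)"] by simp
  qed (simp add: n1)
  have "(\<lambda>n. w ^ n) \<longlonglongrightarrow> 0" using w by (intro LIMSEQ_power_zero) simp
  then have "eventually (\<lambda>n. norm (w ^ n) < 1/16) sequentially"
    by (rule order_tendstoD(2)[OF tendsto_norm_zero]) simp
  then obtain n0 where n0: "\<And>n. n \<ge> n0 \<Longrightarrow> norm (w ^ n) < 1/16" unfolding eventually_sequentially by blast
  define N :: nat where "N = 2 ^ n0"
  have "n0 \<le> N" unfolding N_def by (simp add: less_imp_le)
  then have wN: "w ^ N < 1/16" using n0[of N] w by simp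
  define u where "u = h ^ N"
  have nu: "norm u = 1" using nk[of n0] by (simp add: u_def N_def)
  obtain y y' where y: "y * (1 - u) = 1" "y' * (1 - of_real (w ^ N) *\<^sub>C u) = 1" "norm (y - y') \<le> 1/8"
    using D[of n0, rule_format, of 1] by (auto simp: u_def N_def)
  \<comment> \<open>Contradiction at \<open>\<zeta> = 1\<close>: as \<open>w ^ N < 1/16\<close>, the
    inner inverse \<open>y'\<close> is within \<open>1/8\<close> of \<open>1\<close>, so
    \<open>y\<close> is within \<open>1/4\<close>. Then \<open>u = (y - 1) * (1 - u)\<close> has
    norm at most \<open>1/2\<close>, although \<open>norm u = 1\<close>.\<close>
  have y'1: "y' = 1 + (w ^ N) *\<^sub>R (y' * u)"
    using y(2) by (simp add: right_diff_distrib diff_eq_eq flip: cs_of_real)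
  have "norm (y' * u) \<le> norm y'" using norm_mult_ineq[of y' u] nu by simp
  then have "w ^ N * norm (y' * u) \<le> 1/16 * norm y'" using wN w by (intro mult_mono) auto
  then have b: "norm ((w ^ N) *\<^sub>R (y' * u)) \<le> 1/16 * norm y'" using w by simp
  have "norm y' \<le> 1 + norm ((w ^ N) *\<^sub>R (y' * u))"
    by (metis norm_one norm_triangle_ineq y'1)
  then have "norm y' \<le> 2" using b by linarith
  moreover have "norm (y' - 1) \<le> 1/16 * norm y'" using b y'1 by (metis add_diff_cancel_left')
  ultimately have "norm (y' - 1) \<le> 1/8" by linarith
  then have "norm (y - 1) \<le> 1/4" using y(3) norm_triangle_ineq[of "y - y'" "y' - 1"] by simp
  moreover have "u = (y - 1) * (1 - u)" using y(1) by (simp add: algebra_simps)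
  then have "norm u \<le> norm (y - 1) * norm (1 - u)" by (metis norm_mult_ineq)
  moreover have "norm (1 - u) \<le> 2" using norm_triangle_ineq4[of 1 u] nu by simp
  ultimately show False using nu mult_mono[of "norm (y - 1)" "1/4" "norm (1 - u)" 2] by simp
qed

lemma spec_radius_self_adjoint:
  fixes h :: "'a::cstar"
  assumes sa: "adj h = h" shows "\<exists>r::real. spec h (complex_of_real r) \<and> \<bar>r\<bar> = norm h"
proof (cases "h = 0")
  case True
  have "spec (0::'a) 0" by (simp add: spec_def iv_def)
  then show ?thesis using True by (intro exI[of _ 0]) simp
next
  case False
  define s where "s = complex_of_real (inverse (norm h))"
  have s: "s \<noteq> 0" using False by (simp add: s_def)
  have "norm (s *\<^sub>C h) = 1" using False by (simp add: s_def norm_inverse)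
  moreover have "adj (s *\<^sub>C h) = s *\<^sub>C h" by (simp add: s_def sa)
  ultimately obtain c where c: "spec (s *\<^sub>C h) c" "cmod c = 1" using spec_radius_normalized by blast
  then have "spec h (c / s)" using spec_cs[OF s, of h "c / s"] s by simp
  moreover from this have "Im (c / s) = 0" using spec_self_adjoint_real[OF sa] by blast
  then have r: "c / s = of_real (Re (c / s))" by (simp add: complex_eq_iff)
  have "cmod (c / s) = norm h" using c by (simp add: s_def norm_divide norm_inverse divide_inverse norm_mult)
  then have "\<bar>Re (c / s)\<bar> = norm h" using r by (metis norm_of_real)
  ultimately show ?thesis using r by metis
qed

subsection \<open>Positivity\<close>

definition pev :: "complex poly \<Rightarrow> 'a::cstar \<Rightarrow> 'a" where
  "pev p h = (\<Sum>i\<le>degree p. coeff p i *\<^sub>C h ^ i)"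

lemma pev_altdef: assumes "degree p \<le> N" shows "pev p h = (\<Sum>i\<le>N. coeff p i *\<^sub>C h ^ i)"
  unfolding pev_def by (rule sum.mono_neutral_left) (use assms in \<open>auto simp: coeff_eq_0\<close>)

lemma pev_0 [simp]: "pev 0 h = 0"
  by (simp add: pev_def)

lemma pev_add: "pev (p + q) h = pev p h + pev q h"
proof -
  define N where "N = max (degree p) (degree q)"
  have "degree (p + q) \<le> N" "degree p \<le> N" "degree q \<le> N" by (auto simp: N_def degree_add_le)
  then show ?thesis by (simp add: pev_altdef[of _ N] cs_add_left sum.distrib)
qed

lemma pev_smult: "pev (smult c p) h = c *\<^sub>C pev p h"
  by (cases "c = 0") (simp_all add: pev_def cs_sum_right)

lemma pev_pCons: "pev (pCons a p) h = a *\<^sub>C 1 + h * pev p h"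
proof -
  have "pev (pCons a p) h = (\<Sum>i\<le>Suc (degree p). coeff (pCons a p) i *\<^sub>C h ^ i)"
    by (rule pev_altdef) (simp add: degree_pCons_le)
  also have "\<dots> = a *\<^sub>C 1 + (\<Sum>i\<le>degree p. coeff p i *\<^sub>C h ^ Suc i)"
    by (subst sum.atMost_Suc_shift) simp
  also have "(\<Sum>i\<le>degree p. coeff p i *\<^sub>C h ^ Suc i) = h * pev p h"
    by (simp add: pev_def sum_distrib_left)
  finally show ?thesis .
qed

lemma pev_mult: "pev (p * q) h = pev p h * pev q h"
  by (induct p) (simp_all add: pev_add pev_smult pev_pCons algebra_simps)

lemma pev_power: "pev (p ^ n) h = pev p h ^ n"
  by (induct n) (simp_all add: pev_mult pev_pCons one_pCons del: One_nat_def)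

text \<open>By the fundamental theorem of algebra \<open>p - c\<close> splits into linear factors;
  if none of its roots were spectral for \<open>h\<close>, all factors would be invertible. For
  \<open>p = [:c:]\<close> the conclusion would be that the spectrum of \<open>h\<close> is
  nonempty, hence the exclusion.\<close>

lemma spec_pev:
  assumes "spec (pev p h) c" "p \<noteq> [:c:]" shows "\<exists>d. spec h d \<and> poly p d = c"
proof -
  have *: "iv (pev q h)" if "q \<noteq> 0" "\<And>d. poly q d = 0 \<Longrightarrow> \<not> spec h d" for q
    using that
  proof (induct "degree q" arbitrary: q)
    case 0
    then obtain a where a: "q = [:a:]" "a \<noteq> 0" by (metis degree_eq_zeroE pCons_0_0)
    have "iv (a *\<^sub>C (1::'a))" unfolding iv_cs[OF a(2)] by (auto simp: iv_def)
    then show ?case by (simp add: a pev_pCons)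
  next
    case (Suc n)
    then obtain d where d: "poly q d = 0"
      using fundamental_theorem_of_algebra[of q] constant_degree[of q] by auto
    then have "[:- d, 1:] dvd q" unfolding poly_eq_0_iff_dvd .
    then obtain r where r: "q = [:- d, 1:] * r" by (rule dvdE)
    have r0: "r \<noteq> 0" using Suc(3) r by auto
    have "degree q = Suc (degree r)" unfolding r using r0 degree_mult_eq[of "[:- d, 1:]" r] by (simp del: mult_pCons_left)
    then have "iv (pev r h)" using Suc r r0 by (intro Suc(1)) auto
    moreover have "iv (- (d *\<^sub>C 1 - h))" using Suc(4)[OF d] by (simp add: spec_def iv_minus del: minus_diff_eq)
    moreover have "pev [:- d, 1:] h = - (d *\<^sub>C 1 - h)" by (simp add: pev_pCons)
    ultimately show ?case unfolding r pev_mult by (simp add: iv_mult)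
  qed
  have e: "pev (p - [:c:]) h = - (c *\<^sub>C 1 - pev p h)"
    using pev_add[of "p - [:c:]" "[:c:]" h] by (simp add: pev_pCons)
  have "\<not> iv (pev (p - [:c:]) h)" using assms(1) unfolding e iv_minus by (simp add: spec_def)
  moreover have "p - [:c:] \<noteq> 0" using assms(2) by simp
  ultimately obtain d where "poly (p - [:c:]) d = 0" "spec h d" using * by metis
  then show ?thesis by auto
qed

text \<open>The linear factor \<open>h - d\<close> of \<open>p(h) - p(d)\<close> commutes with its
  cofactor, so it would inherit invertibility from the product.\<close>

lemma spec_pev_mem: assumes "spec h d" shows "spec (pev p h) (poly p d)"
proof -
  have "poly (p - [:poly p d:]) d = 0" by simp
  then have "[:- d, 1:] dvd p - [:poly p d:]" unfolding poly_eq_0_iff_dvd .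
  then obtain r where r: "p - [:poly p d:] = [:- d, 1:] * r" by (rule dvdE)
  have e: "pev (p - [:poly p d:]) h = - (poly p d *\<^sub>C 1 - pev p h)"
    using pev_add[of "p - [:poly p d:]" "[:poly p d:]" h] by (simp add: pev_pCons)
  have f: "pev [:- d, 1:] h = - (d *\<^sub>C 1 - h)" by (simp add: pev_pCons)
  show ?thesis
  proof (rule ccontr)
    assume "\<not> ?thesis"
    then have "iv (pev (p - [:poly p d:]) h)" unfolding e iv_minus by (simp add: spec_def)
    then have "iv (pev [:- d, 1:] h * pev r h)" unfolding r pev_mult .
    moreover have "pev [:- d, 1:] h * pev r h = pev r h * pev [:- d, 1:] h"
      by (metis mult.commute pev_mult)
    ultimately have "iv (pev [:- d, 1:] h)" by (rule iv_commute_factor)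
    then show False using assms unfolding f iv_minus by (simp add: spec_def)
  qed
qed

text \<open>For self-adjoint \<open>h\<close> the inequality places the spectrum in
  \<open>[0, 2 s]\<close>. In this form closure under sums is just the triangle inequality; the
  description by the spectrum is recovered in \<open>pos_spec\<close> and
  \<open>pos_iff_spec\<close>.\<close>

definition pos :: "'a::cstar \<Rightarrow> bool" where
  "pos h \<longleftrightarrow> adj h = h \<and> (\<exists>s\<ge>0. norm (s *\<^sub>R 1 - h) \<le> s)"

lemma pos_add: assumes "pos g" "pos h" shows "pos (g + h)"
proof -
  obtain s t where st: "s \<ge> 0" "norm (s *\<^sub>R 1 - g) \<le> s" "t \<ge> 0" "norm (t *\<^sub>R 1 - h) \<le> t"
    using assms unfolding pos_def by auto
  have e: "(s + t) *\<^sub>R 1 - (g + h) = (s *\<^sub>R 1 - g) + (t *\<^sub>R 1 - h)" by (simp add: algebra_simps)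
  have "norm ((s + t) *\<^sub>R 1 - (g + h)) \<le> s + t"
    unfolding e by (rule order_trans[OF norm_triangle_ineq]) (use st in linarith)
  then show ?thesis using assms st unfolding pos_def by (auto intro!: exI[of _ "s + t"])
qed

lemma pos_scaleR: assumes "pos h" "c \<ge> 0" shows "pos (c *\<^sub>R h)"
proof -
  obtain s where s: "s \<ge> 0" "norm (s *\<^sub>R 1 - h) \<le> s" using assms unfolding pos_def by auto
  have "(c * s) *\<^sub>R 1 - c *\<^sub>R h = c *\<^sub>R (s *\<^sub>R 1 - h)" by (simp add: algebra_simps)
  then have "norm ((c * s) *\<^sub>R 1 - c *\<^sub>R h) \<le> c * s" using s assms(2) by (simp add: mult_left_mono)
  moreover have "adj (c *\<^sub>R h) = c *\<^sub>R h" using assms(1) by (simp add: pos_def)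
  ultimately show ?thesis using s assms(2) unfolding pos_def by (auto intro!: exI[of _ "c * s"])
qed

lemma pos_0 [simp]: "pos 0"
  by (auto simp: pos_def intro!: exI[of _ 0])

lemma pos_sum: "(\<And>i. i \<in> A \<Longrightarrow> pos (f i)) \<Longrightarrow> pos (sum f A)"
  by (induct A rule: infinite_finite_induct) (auto intro: pos_add)

lemma pos_norm_minus: assumes "adj k = k" "norm k \<le> t" shows "pos (t *\<^sub>R 1 - k)"
proof -
  have "t \<ge> 0" using assms(2) norm_ge_zero[of k] by linarith
  then show ?thesis using assms unfolding pos_def by (auto intro!: exI[of _ t])
qed

lemma pos_spec: assumes "pos h" "spec h (complex_of_real r)" shows "r \<ge> 0"
proof -
  obtain s where s: "s \<ge> 0" "norm (s *\<^sub>R 1 - h) \<le> s" using assms unfolding pos_def by auto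
  have "spec (of_real s *\<^sub>C 1 - h) (of_real s - of_real r)" using assms(2) by (simp only: spec_shift)
  from spec_norm[OF this] have "cmod (of_real (s - r)) \<le> s" using s(2) by (simp add: cs_of_real)
  then show ?thesis by (simp only: norm_of_real)
qed

text \<open>Take \<open>s = norm h\<close>. The element \<open>s - h\<close> attains its norm at a
  spectral point \<open>m\<close>, and \<open>s - m\<close> is then a spectral point of
  \<open>h\<close>, hence in \<open>[0, s]\<close>; so
  \<open>norm (s - h) = |m| \<le> s\<close>.\<close>

lemma pos_iff_spec: 
  assumes sa: "adj h = h" and sp: "\<And>r. spec h (complex_of_real r) \<Longrightarrow> r \<ge> 0" shows "pos h"
proof -
  define s where "s = norm h"
  have "adj (of_real s *\<^sub>C 1 - h) = of_real s *\<^sub>C 1 - h" using sa by simp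
  then obtain m where m: "spec (of_real s *\<^sub>C 1 - h) (complex_of_real m)" "\<bar>m\<bar> = norm (of_real s *\<^sub>C 1 - h)"
    using spec_radius_self_adjoint by blast
  have "spec h (complex_of_real (s - m))" using m(1) spec_shift[of "of_real s" h "of_real (s - m)"] by simp
  from sp[OF this] spec_norm[OF this] have "s - m \<ge> 0" "\<bar>s - m\<bar> \<le> s" by (simp_all add: s_def del: of_real_diff)
  then have "\<bar>m\<bar> \<le> s" by linarith
  then have "norm (s *\<^sub>R 1 - h) \<le> s" using m(2) by (simp add: cs_of_real)
  then show ?thesis using sa unfolding pos_def s_def by (auto intro!: exI[of _ "norm h"])
qed

text \<open>With \<open>t = norm (g + h)\<close>, the element
  \<open>t - h = (t - (g + h)) + g\<close> is a sum of positive elements. As \<open>h\<close>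
  attains its norm at a nonnegative spectral point \<open>m\<close>, positivity yields
  \<open>m \<le> t\<close>. All norm comparisons for columns rest on this.\<close>

lemma norm_le_norm_add_pos: assumes "pos g" "pos h" shows "norm h \<le> norm (g + h)"
proof -
  define t where "t = norm (g + h)"
  have sa: "adj h = h" using assms(2) by (simp add: pos_def)
  then obtain m where m: "spec h (complex_of_real m)" "\<bar>m\<bar> = norm h"
    using spec_radius_self_adjoint by blast
  have "pos (t *\<^sub>R 1 - (g + h))" using pos_add[OF assms] by (intro pos_norm_minus) (auto simp: pos_def t_def)
  then have "pos (t *\<^sub>R 1 - (g + h) + g)" using assms(1) by (rule pos_add)
  then have "pos (of_real t *\<^sub>C 1 - h)" by (simp add: cs_of_real)
  moreover have "spec (of_real t *\<^sub>C 1 - h) (complex_of_real (t - m))"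
    using m(1) spec_shift[of "of_real t" h "of_real m"] by simp
  ultimately have "t - m \<ge> 0" by (rule pos_spec)
  moreover have "m \<ge> 0" using assms(2) m(1) by (rule pos_spec)
  ultimately show ?thesis using m(2) by (simp add: t_def)
qed

text \<open>If \<open>r = - v\<^sup>2 < 0\<close>, then
  \<open>u\<^sup>2 - r = (\<i> v - u) (- \<i> v - u)\<close>, and both factors are invertible
  because the spectrum of \<open>u\<close> is real.\<close>

lemma pos_square: assumes sa: "adj u = u" shows "pos (u * u)"
proof (rule pos_iff_spec)
  show "adj (u * u) = u * u" using sa by simp
  fix r assume sp: "spec (u * u) (complex_of_real r)"
  show "r \<ge> 0"
  proof (rule ccontr)
    assume "\<not> r \<ge> 0"
    define v where "v = sqrt (- r)"
    have v: "v > 0" "v * v = - r" using \<open>\<not> r \<ge> 0\<close> by (auto simp: v_def)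
    have i: "iv ((\<i> * of_real t) *\<^sub>C 1 - u)" if "t \<noteq> 0" for t :: real
      using spec_self_adjoint_real[OF sa, of "\<i> * of_real t"] that by (auto simp: spec_def)
    have "((\<i> * of_real v) *\<^sub>C 1 - u) * ((\<i> * of_real (- v)) *\<^sub>C 1 - u) = u * u + (of_real (v * v)) *\<^sub>C 1"
      by (simp add: algebra_simps cs_diff_right)
    also have "\<dots> = - (of_real r *\<^sub>C 1 - u * u)" unfolding v(2) by simp
    finally have "iv (- (of_real r *\<^sub>C 1 - u * u))" using iv_mult[OF i[of v] i[of "- v"]] v(1) by simp
    then show False using sp unfolding iv_minus spec_def by simp
  qed
qed

text \<open>\<open>u\<close> and \<open>v\<close> are the real and the imaginary part of
  \<open>b\<close>. Together with \<open>pos_square\<close> this makes the symmetric sum positive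
  before anything is known about \<open>adj b * b\<close> alone.\<close>

lemma real_part_decomp:
  "\<exists>u v. adj u = u \<and> adj v = v \<and> adj b * b + b * adj b = 2 *\<^sub>R (u * u + v * v)" for b :: "'a::cstar"
proof (intro exI conjI)
  let ?u = "(1/2) *\<^sub>R (b + adj b)" and ?v = "(- \<i> / 2) *\<^sub>C (b - adj b)"
  show "adj ?u = ?u" "adj ?v = ?v" by (simp_all add: add.commute cs_diff_right)
  have "?v * ?v = (-1/4::complex) *\<^sub>C ((b - adj b) * (b - adj b))" by simp
  also have "\<dots> = (-1/4::real) *\<^sub>R ((b - adj b) * (b - adj b))" by (simp flip: cs_of_real)
  finally have v0: "?v * ?v = (-1/4::real) *\<^sub>R ((b - adj b) * (b - adj b))" .
  have v: "2 *\<^sub>R (?v * ?v) = (1/2) *\<^sub>R (adj b * b + b * adj b) - (1/2) *\<^sub>R (b * b + adj b * adj b)"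
    unfolding v0 by (simp add: algebra_simps)
  have u: "2 *\<^sub>R (?u * ?u) = (1/2) *\<^sub>R (adj b * b + b * adj b) + (1/2) *\<^sub>R (b * b + adj b * adj b)"
    by (simp add: algebra_simps)
  have "2 *\<^sub>R (?u * ?u + ?v * ?v) = 2 *\<^sub>R (?u * ?u) + 2 *\<^sub>R (?v * ?v)" by (rule scaleR_add_right)
  also have "\<dots> = (1/2) *\<^sub>R (adj b * b + b * adj b) + (1/2) *\<^sub>R (adj b * b + b * adj b)"
    by (simp only: u v) simp
  also have "\<dots> = adj b * b + b * adj b" by (simp flip: scaleR_add_left)
  finally show "adj b * b + b * adj b = 2 *\<^sub>R (?u * ?u + ?v * ?v)" ..
qed

text \<open>Each of the \<open>n + 1\<close> terms of the geometric sum is at least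
  \<open>x ^ n\<close>, and \<open>1 - x\<close> times that sum is at most \<open>1\<close>.\<close>

lemma max_x_times_power: assumes "0 \<le> x" "x \<le> (1::real)" shows "(1 - x) * x ^ n \<le> 1 / real (Suc n)"
proof -
  have "real (Suc n) * x ^ n = (\<Sum>i\<le>n. x ^ n)" by simp
  also have "\<dots> \<le> (\<Sum>i\<le>n. x ^ i)" using assms by (intro sum_mono power_decreasing) auto
  finally have "(1 - x) * (real (Suc n) * x ^ n) \<le> (1 - x) * (\<Sum>i\<le>n. x ^ i)"
    using assms by (intro mult_left_mono) auto
  also have "\<dots> = 1 - x ^ Suc n" by (simp only: one_diff_power_eq[of x "Suc n"] lessThan_Suc_atMost)
  also have "\<dots> \<le> 1" using assms by simp
  finally show ?thesis by (simp add: field_simps)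
qed

text \<open>With \<open>h = a\<^sup>* a\<close> of norm at most \<open>1\<close> and \<open>b = a (1 - h)\<^sup>N\<close>, the element \<open>b\<^sup>* b = h (1 - h)\<^sup>2\<^sup>N\<close> is
  at most \<open>1 / (2 N + 1)\<close>; as \<open>b\<^sup>* b + b b\<^sup>*\<close> is positive, \<open>b b\<^sup>*\<close> and hence \<open>b\<^sup>* b\<close> has no spectrum below
  \<open>- 1 / (2 N + 1)\<close>. A negative point of the spectrum of \<open>h\<close> would be pushed below that bound.\<close>
lemma pos_adj_mult_normalized:
  fixes a :: "'a::cstar" assumes n1: "norm a \<le> 1" shows "pos (adj a * a)"
proof (rule pos_iff_spec)
  show "adj (adj a * a) = adj a * a" by simp
  fix r assume sp: "spec (adj a * a) (complex_of_real r)"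
  show "r \<ge> 0"
  proof (rule ccontr)
    assume "\<not> r \<ge> 0"
    define h where "h = adj a * a"
    have sah: "adj h = h" by (simp add: h_def)
    have nh: "norm h \<le> 1" using n1 by (simp add: h_def norm_adj_mult power_le_one)
    define d where "d = - r"
    have d: "d > 0" "spec h (complex_of_real (- d))" using sp \<open>\<not> r \<ge> 0\<close> by (auto simp: d_def h_def)
    \<comment> \<open>\<open>N\<close> is so large that the bound \<open>1 / (2 N + 1)\<close> on
      \<open>adj b * b\<close> falls below the distance \<open>d\<close> of the supposed negative
      point from \<open>0\<close>.\<close>
    obtain N :: nat where N: "1 / d < real N" using reals_Archimedean2 by blast
    define n where "n = 2 * N"
    define e where "e = 1 / real (Suc n)"
    have e: "e < d"
    proof -
      have "1 < d * real N" using N d by (simp add: field_simps)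
      also have "\<dots> \<le> d * real (Suc n)" using d by (simp add: n_def)
      finally show ?thesis by (simp add: e_def field_simps)
    qed
    define p :: "complex poly" where "p = [:0, 1:] * [:1, -1:] ^ n"
    have p: "pev p h = h * (1 - h) ^ n" by (simp add: p_def pev_mult pev_power pev_pCons)
    have pp: "poly p (of_real x) = of_real (x * (1 - x) ^ n)" for x :: real
      by (simp add: p_def poly_power)
    define b where "b = a * (1 - h) ^ N"
    have comm: "(1 - h) ^ N * h = h * (1 - h) ^ N"
      by (induct N) (simp_all add: algebra_simps power_commutes)
    have "adj b * b = (1 - h) ^ N * h * (1 - h) ^ N"
      by (simp add: b_def h_def mult.assoc)
    also have "\<dots> = h * (1 - h) ^ n" unfolding comm by (simp add: n_def mult_2 power_add mult.assoc)
    finally have bb: "adj b * b = pev p h" by (simp add: p)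
    have p_nc: "p \<noteq> [:c:]" for c
    proof
      assume "p = [:c:]"
      then have "degree p = 0" by simp
      moreover have "degree p = 1 + n" unfolding p_def by (subst degree_mult_eq) (auto simp: degree_power_eq)
      ultimately show False by simp
    qed
    have posd: "pos (of_real e *\<^sub>C 1 - adj b * b)"
    proof (rule pos_iff_spec)
      show "adj (of_real e *\<^sub>C 1 - adj b * b) = of_real e *\<^sub>C 1 - adj b * b" by simp
      fix m assume "spec (of_real e *\<^sub>C 1 - adj b * b) (complex_of_real m)"
      then have "spec (adj b * b) (complex_of_real (e - m))"
        using spec_shift[of "of_real e" "adj b * b" "of_real (e - m)"] by simp
      then obtain c where c: "spec h c" "poly p c = complex_of_real (e - m)"
        using spec_pev p_nc unfolding bb by blast
      define x where "x = Re c"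
      have cx: "c = of_real x" using spec_self_adjoint_real[OF sah c(1)] by (simp add: x_def complex_eq_iff)
      have em: "e - m = x * (1 - x) ^ n" using c(2) unfolding cx pp of_real_eq_iff by simp
      have "\<bar>x\<bar> \<le> 1" using spec_norm[OF c(1)] nh unfolding cx by simp
      have "x * (1 - x) ^ n \<le> e"
      proof (cases "x \<ge> 0")
        case True
        then show ?thesis using max_x_times_power[of "1 - x" n] \<open>\<bar>x\<bar> \<le> 1\<close> by (simp add: e_def)
      next
        case False
        then have "x * (1 - x) ^ n \<le> 0" by (simp add: mult_nonpos_nonneg)
        then show ?thesis by (simp add: e_def order_trans)
      qed
      then show "m \<ge> 0" using em by linarith
    qed
    obtain u v where uv: "adj u = u" "adj v = v" "adj b * b + b * adj b = 2 *\<^sub>R (u * u + v * v)"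
      using real_part_decomp by blast
    have "pos (2 *\<^sub>R (u * u + v * v))" using uv by (intro pos_scaleR pos_add pos_square) auto
    then have "pos (2 *\<^sub>R (u * u + v * v) + (of_real e *\<^sub>C 1 - adj b * b))" using posd by (rule pos_add)
    then have pb: "pos (of_real e *\<^sub>C 1 + b * adj b)" unfolding uv(3)[symmetric] by (simp add: algebra_simps)
    define q where "q = - d * (1 + d) ^ n"
    have "spec (adj b * b) (complex_of_real q)"
      using spec_pev_mem[OF d(2), of p] unfolding bb pp by (simp add: q_def)
    moreover have q: "q \<le> - d" "q \<noteq> 0" using d(1) one_le_power[of "1 + d" n] by (auto simp: q_def)
    ultimately have "spec (b * adj b) (complex_of_real q)"
      using spec_mult_commute[of "adj b" b "complex_of_real q"] by simp
    then have "spec (b * adj b + of_real e *\<^sub>C 1) (complex_of_real (q + e))"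
      by (simp only: of_real_add spec_shift_add)
    then have "q + e \<ge> 0" using pos_spec[OF pb, of "q + e"] by (simp add: add.commute)
    then show False using e q by linarith
  qed
qed

lemma pos_adj_mult: "pos (adj a * a)" for a :: "'a::cstar"
proof -
  define t where "t = norm a + 1"
  have t: "t > 0" by (simp add: t_def add_nonneg_pos)
  have "norm ((1 / t) *\<^sub>R a) \<le> 1" using t by (simp add: t_def)
  then have "pos (adj ((1 / t) *\<^sub>R a) * ((1 / t) *\<^sub>R a))" by (rule pos_adj_mult_normalized)
  then have "pos ((t * t) *\<^sub>R (adj ((1 / t) *\<^sub>R a) * ((1 / t) *\<^sub>R a)))" by (rule pos_scaleR) (use t in simp)
  then show ?thesis using t by simp
qed

subsection \<open>Columns and matrices over a C*-algebra\<close>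

definition mip :: "nat \<Rightarrow> (nat \<Rightarrow> 'a) \<Rightarrow> (nat \<Rightarrow> 'a) \<Rightarrow> 'a::cstar" where
  "mip n v w = (\<Sum>i<n. adj (v i) * w i)"

definition mnorm :: "nat \<Rightarrow> (nat \<Rightarrow> 'a::cstar) \<Rightarrow> real" where
  "mnorm n v = sqrt (norm (mip n v v))"

lemma mnorm_sq: "(mnorm n v)\<^sup>2 = norm (mip n v v)"
  by (simp add: mnorm_def)

lemma mnorm_ge_0 [simp]: "mnorm n v \<ge> 0"
  by (simp add: mnorm_def)

lemma pos_mip: "pos (mip n v v)"
  unfolding mip_def by (intro pos_sum pos_adj_mult)

lemma adj_mip: "adj (mip n v w) = mip n w v"
  by (simp add: mip_def)

lemma mip_cong: "(\<And>i. i < n \<Longrightarrow> v i = v' i) \<Longrightarrow> (\<And>i. i < n \<Longrightarrow> w i = w' i) \<Longrightarrow> mip n v w = mip n v' w'"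
  unfolding mip_def by (intro sum.cong) auto

lemma mip_add_right: "mip n v (\<lambda>i. w i + w' i) = mip n v w + mip n v w'"
  by (simp add: mip_def algebra_simps sum.distrib)

lemma mip_add_left: "mip n (\<lambda>i. v i + v' i) w = mip n v w + mip n v' w"
  by (simp add: mip_def algebra_simps sum.distrib)

lemma mip_mult_right: "mip n v (\<lambda>i. w i * a) = mip n v w * a"
  by (simp add: mip_def sum_distrib_right mult.assoc)

lemma mip_mult_left: "mip n (\<lambda>i. v i * a) w = adj a * mip n v w"
  by (simp add: mip_def sum_distrib_left mult.assoc)

lemma mip_minus_right: "mip n v (\<lambda>i. - w i) = - mip n v w"
  by (simp add: mip_def sum_negf)

lemma mip_minus_left: "mip n (\<lambda>i. - v i) w = - mip n v w"
  by (simp add: mip_def sum_negf)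

lemma mnorm_scaleR: "mnorm n (\<lambda>i. r *\<^sub>R v i) = \<bar>r\<bar> * mnorm n v"
proof -
  have "mip n (\<lambda>i. r *\<^sub>R v i) (\<lambda>i. r *\<^sub>R v i) = (r * r) *\<^sub>R mip n v v"
    by (simp add: mip_def scaleR_sum_right)
  then show ?thesis by (simp add: mnorm_def real_sqrt_mult)
qed

text \<open>Expanding the positive element \<open>mip n z z\<close> for \<open>z = v a - w\<close>
  with \<open>a = mip n v w\<close> gives \<open>z\<^sup>* z + 2 a\<^sup>* a = a\<^sup>* (v\<^sup>*
  v) a + w\<^sup>* w\<close>. Dropping the positive first term can only lower the norm, so \<open>2
  (norm a)\<^sup>2 \<le> (norm a)\<^sup>2 + (mnorm n w)\<^sup>2\<close>.\<close>

lemma mip_cauchy_schwarz_normalized: assumes "norm (mip n v v) \<le> 1" shows "norm (mip n v w) \<le> mnorm n w"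
proof -
  define a where "a = mip n v w"
  define z where "z = (\<lambda>i. v i * a + - w i)"
  have w: "mip n w v = adj a" by (simp add: a_def adj_mip)
  have "mip n z z = adj a * mip n v v * a - adj a * a - adj a * a + mip n w w"
    unfolding z_def mip_add_left mip_add_right mip_mult_left mip_mult_right mip_minus_left mip_minus_right w
    by (simp add: a_def[symmetric] algebra_simps)
  then have e: "mip n z z + 2 *\<^sub>R (adj a * a) = adj a * mip n v v * a + mip n w w"
    by (simp add: algebra_simps scaleR_2)
  have "norm (2 *\<^sub>R (adj a * a)) \<le> norm (mip n z z + 2 *\<^sub>R (adj a * a))"
    by (intro norm_le_norm_add_pos pos_mip pos_scaleR pos_adj_mult) auto
  also have "\<dots> \<le> norm (adj a * mip n v v * a) + norm (mip n w w)" unfolding e by (rule norm_triangle_ineq)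
  also have "norm (adj a * mip n v v * a) \<le> norm (adj a) * norm (mip n v v) * norm a"
    by (meson mult_right_mono norm_ge_zero norm_mult_ineq order_trans)
  also have "\<dots> \<le> norm a * 1 * norm a" unfolding norm_adj
    using assms by (intro mult_right_mono mult_left_mono) auto
  finally have "(norm a)\<^sup>2 \<le> (mnorm n w)\<^sup>2" by (simp add: norm_adj_mult mnorm_sq power2_eq_square[of "norm a"])
  then show ?thesis unfolding a_def by (rule power2_le_imp_le) simp
qed

text \<open>Scaling by any \<open>s\<close> above \<open>mnorm n v\<close> and letting
  \<open>s\<close> decrease to it avoids a division by zero.\<close>

lemma mip_cauchy_schwarz: "norm (mip n v w) \<le> mnorm n v * mnorm n w"
proof -
  have *: "norm (mip n v w) \<le> s * mnorm n w" if "s > mnorm n v" for s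
  proof -
    have s: "s > 0" using that mnorm_ge_0[of n v] by linarith
    define u where "u = (\<lambda>i. (1/s) *\<^sub>R v i)"
    have "mnorm n u \<le> 1" using that s by (simp add: u_def mnorm_scaleR)
    then have "(mnorm n u)\<^sup>2 \<le> 1" by (simp add: power_le_one)
    then have "norm (mip n u w) \<le> mnorm n w" unfolding mnorm_sq by (rule mip_cauchy_schwarz_normalized)
    moreover have "mip n u w = (1/s) *\<^sub>R mip n v w" by (simp add: u_def mip_def scaleR_sum_right)
    ultimately show ?thesis using s by (simp add: field_simps)
  qed
  show ?thesis
  proof (cases "mnorm n w = 0")
    case True then show ?thesis using *[of "mnorm n v + 1"] by simp
  next
    case False
    then have "mnorm n w > 0" by (simp add: order_less_le)
    then show ?thesis using * by (metis dense_ge pos_divide_le_eq)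
  qed
qed

lemma mnorm_triangle: "mnorm n (\<lambda>i. v i + w i) \<le> mnorm n v + mnorm n w"
proof (rule power2_le_imp_le)
  have "(mnorm n (\<lambda>i. v i + w i))\<^sup>2 = norm (mip n v v + mip n w v + (mip n v w + mip n w w))"
    unfolding mnorm_sq mip_add_right mip_add_left ..
  also have "\<dots> \<le> norm (mip n v v) + norm (mip n w v) + (norm (mip n v w) + norm (mip n w w))"
    by (intro order_trans[OF norm_triangle_ineq] add_mono) (auto intro: norm_triangle_ineq)
  also have "\<dots> \<le> (mnorm n v)\<^sup>2 + mnorm n w * mnorm n v + (mnorm n v * mnorm n w + (mnorm n w)\<^sup>2)"
    by (intro add_mono mip_cauchy_schwarz) (auto simp: mnorm_sq)
  also have "\<dots> = (mnorm n v + mnorm n w)\<^sup>2" by (simp add: power2_eq_square algebra_simps)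
  finally show "(mnorm n (\<lambda>i. v i + w i))\<^sup>2 \<le> (mnorm n v + mnorm n w)\<^sup>2" .
qed simp

lemma mnorm_sum: "mnorm n (\<lambda>i. \<Sum>j\<in>A. f j i) \<le> (\<Sum>j\<in>A. mnorm n (f j))"
proof (induct A rule: infinite_finite_induct)
  case (insert x F)
  then show ?case using mnorm_triangle[of n "f x" "\<lambda>i. \<Sum>j\<in>F. f j i"] by simp
qed (simp_all add: mnorm_def mip_def)

lemma norm_le_mnorm: assumes "i < n" shows "norm (v i) \<le> mnorm n v"
proof (rule power2_le_imp_le)
  have "mip n v v = (\<Sum>j\<in>{..<n} - {i}. adj (v j) * v j) + adj (v i) * v i"
    unfolding mip_def using assms by (subst sum.remove[of _ i]) (auto simp: add.commute)
  moreover have "norm (adj (v i) * v i) \<le> norm ((\<Sum>j\<in>{..<n} - {i}. adj (v j) * v j) + adj (v i) * v i)"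
    by (intro norm_le_norm_add_pos pos_sum pos_adj_mult)
  ultimately have "norm (adj (v i) * v i) \<le> norm (mip n v v)" by simp
  then show "(norm (v i))\<^sup>2 \<le> (mnorm n v)\<^sup>2" by (simp add: norm_adj_mult mnorm_sq)
qed simp

lemma mnorm_single: assumes "j < n" shows "mnorm n (\<lambda>i. if i = j then c else 0) = norm c"
proof -
  have "mip n (\<lambda>i. if i = j then c else 0) (\<lambda>i. if i = j then c else 0) = adj c * c"
    unfolding mip_def using assms by (subst sum.remove[of _ j]) (auto intro!: sum.neutral)
  then show ?thesis by (simp add: mnorm_def norm_adj_mult)
qed

lemma mnorm_cong: "(\<And>i. i < n \<Longrightarrow> v i = w i) \<Longrightarrow> mnorm n v = mnorm n w"
  unfolding mnorm_def by (simp cong: mip_cong)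

definition mvm :: "nat \<Rightarrow> (nat \<Rightarrow> nat \<Rightarrow> 'a) \<Rightarrow> (nat \<Rightarrow> 'a) \<Rightarrow> nat \<Rightarrow> 'a::cstar" where
  "mvm n X v = (\<lambda>i. \<Sum>j<n. X i j * v j)"

definition mmul :: "nat \<Rightarrow> (nat \<Rightarrow> nat \<Rightarrow> 'a) \<Rightarrow> (nat \<Rightarrow> nat \<Rightarrow> 'a) \<Rightarrow> nat \<Rightarrow> nat \<Rightarrow> 'a::cstar" where
  "mmul n X Y = (\<lambda>i k. \<Sum>j<n. X i j * Y j k)"

definition madj :: "(nat \<Rightarrow> nat \<Rightarrow> 'a) \<Rightarrow> nat \<Rightarrow> nat \<Rightarrow> 'a::cstar" where
  "madj X = (\<lambda>i j. adj (X j i))"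

text \<open>The inserted \<open>0\<close> covers \<open>n = 0\<close>, where no column has norm
  \<open>1\<close>; the shape is that of \<open>op_norm\<close>, to which \<open>opn\<close>
  specialises over the complex numbers.\<close>

definition opn :: "nat \<Rightarrow> (nat \<Rightarrow> nat \<Rightarrow> 'a::cstar) \<Rightarrow> real" where
  "opn n X = Sup (insert 0 {mnorm n (mvm n X v) | v. mnorm n v = 1})"

lemma mvm_mmul: "mvm n (mmul n X Y) v = mvm n X (mvm n Y v)"
proof
  fix i
  have "mvm n (mmul n X Y) v i = (\<Sum>k<n. \<Sum>j<n. X i j * (Y j k * v k))"
    by (simp add: mvm_def mmul_def sum_distrib_right mult.assoc)
  also have "\<dots> = (\<Sum>j<n. \<Sum>k<n. X i j * (Y j k * v k))" by (rule sum.swap)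
  finally show "mvm n (mmul n X Y) v i = mvm n X (mvm n Y v) i" by (simp add: mvm_def sum_distrib_left)
qed

lemma mip_mvm: "mip n (mvm n X v) w = mip n v (mvm n (madj X) w)"
proof -
  have "mip n (mvm n X v) w = (\<Sum>i<n. \<Sum>j<n. adj (v j) * (adj (X i j) * w i))"
    by (simp add: mip_def mvm_def sum_distrib_right mult.assoc)
  also have "\<dots> = (\<Sum>j<n. \<Sum>i<n. adj (v j) * (adj (X i j) * w i))" by (rule sum.swap)
  finally show ?thesis by (simp add: mip_def mvm_def madj_def sum_distrib_left)
qed

lemma mnorm_mvm_bound: "mnorm n (mvm n X v) \<le> (\<Sum>i<n. \<Sum>j<n. norm (X i j)) * mnorm n v"
proof -
  have "mnorm n (mvm n X v) = mnorm n (\<lambda>i. \<Sum>k<n. if i = k then mvm n X v k else 0)"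
    by (rule mnorm_cong) simp
  also have "\<dots> \<le> (\<Sum>k<n. mnorm n (\<lambda>i. if i = k then mvm n X v k else 0))" by (rule mnorm_sum)
  also have "\<dots> = (\<Sum>k<n. norm (mvm n X v k))" by (intro sum.cong) (simp_all add: mnorm_single)
  also have "\<dots> \<le> (\<Sum>k<n. (\<Sum>j<n. norm (X k j) * mnorm n v))"
    unfolding mvm_def by (intro sum_mono order_trans[OF norm_sum] order_trans[OF norm_mult_ineq] mult_left_mono norm_le_mnorm) auto
  finally show ?thesis by (simp add: sum_distrib_right)
qed

lemma opn_bdd: "bdd_above (insert 0 {mnorm n (mvm n X v) | v. mnorm n v = 1})"
proof (rule bdd_aboveI)
  fix x assume "x \<in> insert 0 {mnorm n (mvm n X v) | v. mnorm n v = 1}"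
  then consider "x = 0" | v where "x = mnorm n (mvm n X v)" "mnorm n v = 1" by blast
  then show "x \<le> (\<Sum>i<n. \<Sum>j<n. norm (X i j))"
  proof cases
    case 1 then show ?thesis by (simp add: sum_nonneg)
  next
    case 2 then show ?thesis using mnorm_mvm_bound[of n X v] by simp
  qed
qed

lemma opn_ge_0 [simp]: "opn n X \<ge> 0"
  unfolding opn_def by (rule cSup_upper[OF _ opn_bdd]) simp

lemma mnorm_mvm_le: "mnorm n (mvm n X v) \<le> opn n X * mnorm n v"
proof (cases "mnorm n v = 0")
  case True
  then show ?thesis using mnorm_mvm_bound[of n X v] by simp
next
  case False
  then have m: "mnorm n v > 0" by (simp add: order_less_le)
  define w where "w = (\<lambda>i. (1 / mnorm n v) *\<^sub>R v i)"
  have "mnorm n w = 1" unfolding w_def mnorm_scaleR using m by simp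
  then have "mnorm n (mvm n X w) \<le> opn n X"
    unfolding opn_def by (intro cSup_upper[OF _ opn_bdd]) auto
  moreover have "mvm n X w = (\<lambda>i. (1 / mnorm n v) *\<^sub>R mvm n X v i)"
    by (simp add: mvm_def w_def scaleR_sum_right)
  ultimately show ?thesis using m by (simp add: mnorm_scaleR field_simps)
qed

lemma opn_least: assumes "c \<ge> 0" "\<And>v. mnorm n (mvm n X v) \<le> c * mnorm n v" shows "opn n X \<le> c"
  unfolding opn_def
proof (rule cSup_least)
  fix x assume "x \<in> insert 0 {mnorm n (mvm n X v) | v. mnorm n v = 1}"
  then consider "x = 0" | v where "x = mnorm n (mvm n X v)" "mnorm n v = 1" by blast
  then show "x \<le> c"
  proof cases
    case 1 then show ?thesis using assms(1) by simp
  next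
    case 2 then show ?thesis using assms(2)[of v] by simp
  qed
qed simp

lemma opn_le_sum: "opn n X \<le> (\<Sum>i<n. \<Sum>j<n. norm (X i j))"
  by (rule opn_least) (auto intro!: sum_nonneg mnorm_mvm_bound)

lemma mvm_single: "j < n \<Longrightarrow> mvm n X (\<lambda>i. if i = j then c else 0) = (\<lambda>i. X i j * c)"
  unfolding mvm_def by (rule ext, subst sum.remove[of _ j]) (auto intro!: sum.neutral)

lemma norm_le_opn: assumes "i < n" "j < n" shows "norm (X i j) \<le> opn n X"
proof -
  have "norm (X i j) = norm (mvm n X (\<lambda>i. if i = j then 1 else 0) i)" using assms by (simp add: mvm_single)
  also have "\<dots> \<le> mnorm n (mvm n X (\<lambda>i. if i = j then 1 else 0))" using assms(1) by (rule norm_le_mnorm)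
  also have "\<dots> \<le> opn n X" using mnorm_mvm_le[of n X "\<lambda>i. if i = j then 1 else 0"] assms by (simp add: mnorm_single)
  finally show ?thesis .
qed

lemma opn_add: "opn n (\<lambda>i j. X i j + Y i j) \<le> opn n X + opn n Y"
proof (rule opn_least)
  fix v
  have "mvm n (\<lambda>i j. X i j + Y i j) v = (\<lambda>i. mvm n X v i + mvm n Y v i)"
    by (simp add: mvm_def algebra_simps sum.distrib)
  then have "mnorm n (mvm n (\<lambda>i j. X i j + Y i j) v) \<le> mnorm n (mvm n X v) + mnorm n (mvm n Y v)"
    by (simp only: mnorm_triangle)
  also have "\<dots> \<le> (opn n X + opn n Y) * mnorm n v" unfolding distrib_right by (intro add_mono mnorm_mvm_le)
  finally show "mnorm n (mvm n (\<lambda>i j. X i j + Y i j) v) \<le> (opn n X + opn n Y) * mnorm n v" .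
qed simp

lemma mnorm_cs: "mnorm n (\<lambda>i. c *\<^sub>C v i) = cmod c * mnorm n v"
proof -
  have "mip n (\<lambda>i. c *\<^sub>C v i) (\<lambda>i. c *\<^sub>C v i) = (cnj c * c) *\<^sub>C mip n v v"
    by (simp add: mip_def cs_sum_right mult.commute)
  then show ?thesis by (simp add: mnorm_def real_sqrt_mult norm_mult)
qed

lemma opn_cs_le: "opn n (\<lambda>i j. c *\<^sub>C X i j) \<le> cmod c * opn n X"
proof (rule opn_least)
  fix v
  have "mvm n (\<lambda>i j. c *\<^sub>C X i j) v = (\<lambda>i. c *\<^sub>C mvm n X v i)"
    by (simp add: mvm_def cs_sum_right)
  then show "mnorm n (mvm n (\<lambda>i j. c *\<^sub>C X i j) v) \<le> cmod c * opn n X * mnorm n v"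
    by (simp add: mnorm_cs mult.assoc mult_left_mono mnorm_mvm_le)
qed simp

lemma opn_cs: "opn n (\<lambda>i j. c *\<^sub>C X i j) = cmod c * opn n X"
proof (cases "c = 0")
  case True
  then have "opn n (\<lambda>i j. c *\<^sub>C X i j) \<le> 0" using opn_cs_le[of n c X] by simp
  then have "opn n (\<lambda>i j. c *\<^sub>C X i j) = 0" using opn_ge_0 by (rule antisym)
  then show ?thesis using True by simp
next
  case False
  have "opn n X = opn n (\<lambda>i j. inverse c *\<^sub>C c *\<^sub>C X i j)" using False by simp
  also have "\<dots> \<le> cmod (inverse c) * opn n (\<lambda>i j. c *\<^sub>C X i j)" by (rule opn_cs_le)
  finally have "cmod c * opn n X \<le> opn n (\<lambda>i j. c *\<^sub>C X i j)" using False by (simp add: norm_divide field_simps)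
  then show ?thesis using opn_cs_le[of n c X] by simp
qed

lemma opn_mmul: "opn n (mmul n X Y) \<le> opn n X * opn n Y"
proof (rule opn_least)
  fix v
  have "mnorm n (mvm n X (mvm n Y v)) \<le> opn n X * mnorm n (mvm n Y v)" by (rule mnorm_mvm_le)
  also have "\<dots> \<le> opn n X * (opn n Y * mnorm n v)" by (intro mult_left_mono mnorm_mvm_le) simp
  finally show "mnorm n (mvm n (mmul n X Y) v) \<le> opn n X * opn n Y * mnorm n v" by (simp add: mvm_mmul mult.assoc)
qed simp

text \<open>Moving \<open>X\<close> to the other side of the inner product turns
  \<open>mip n (X v) (X v)\<close> into \<open>mip n v (X\<^sup>* X v)\<close>, to which
  Cauchy-Schwarz applies.\<close>

lemma opn_madj_mmul_ge: "(opn n X)\<^sup>2 \<le> opn n (mmul n (madj X) X)"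
proof -
  have "opn n X \<le> sqrt (opn n (mmul n (madj X) X))"
  proof (rule opn_least)
    fix v
    have "(mnorm n (mvm n X v))\<^sup>2 = norm (mip n v (mvm n (mmul n (madj X) X) v))"
      by (simp add: mnorm_sq mip_mvm mvm_mmul)
    also have "\<dots> \<le> mnorm n v * mnorm n (mvm n (mmul n (madj X) X) v)" by (rule mip_cauchy_schwarz)
    also have "\<dots> \<le> mnorm n v * (opn n (mmul n (madj X) X) * mnorm n v)"
      by (intro mult_left_mono mnorm_mvm_le) simp
    also have "\<dots> = (sqrt (opn n (mmul n (madj X) X)) * mnorm n v)\<^sup>2"
      by (simp add: power_mult_distrib power2_eq_square[of "mnorm n v"])
    finally show "mnorm n (mvm n X v) \<le> sqrt (opn n (mmul n (madj X) X)) * mnorm n v"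
      by (rule power2_le_imp_le) simp
  qed simp
  then show ?thesis by (metis opn_ge_0 power_mono real_sqrt_pow2)
qed

lemma madj_madj [simp]: "madj (madj X) = X"
  by (simp add: madj_def)

lemma opn_madj: "opn n (madj X) = opn n X"
proof -
  have *: "opn n Y \<le> opn n (madj Y)" for Y :: "nat \<Rightarrow> nat \<Rightarrow> 'a"
  proof (cases "opn n Y = 0")
    case False
    have "opn n Y * opn n Y \<le> opn n (madj Y) * opn n Y"
      using opn_madj_mmul_ge[of n Y] opn_mmul[of n "madj Y" Y] by (simp add: power2_eq_square)
    moreover have "opn n Y > 0" using False opn_ge_0[of n Y] by linarith
    ultimately show ?thesis by simp
  qed simp
  show ?thesis using *[of X] *[of "madj X"] by simp
qed

lemma opn_madj_mmul: "opn n (mmul n (madj X) X) = (opn n X)\<^sup>2"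
  using opn_madj_mmul_ge[of n X] opn_mmul[of n "madj X" X] by (simp add: opn_madj power2_eq_square)

subsection \<open>Record algebras inside a type class\<close>

locale ucalg = fixes S :: "'a calg" assumes uc: "unital_cstar_algebra S"
begin

lemmas ax = uc[unfolded unital_cstar_algebra_def Let_def]

lemma closed [simp, intro]:
  "ca_zero S \<in> ca_carrier S" "ca_one S \<in> ca_carrier S"
  "x \<in> ca_carrier S \<Longrightarrow> y \<in> ca_carrier S \<Longrightarrow> ca_add S x y \<in> ca_carrier S"
  "x \<in> ca_carrier S \<Longrightarrow> y \<in> ca_carrier S \<Longrightarrow> ca_mul S x y \<in> ca_carrier S"
  "x \<in> ca_carrier S \<Longrightarrow> ca_smult S c x \<in> ca_carrier S"
  "x \<in> ca_carrier S \<Longrightarrow> ca_star S x \<in> ca_carrier S"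
proof -
  have r: "ca_zero S \<in> ca_carrier S"
    "ca_one S \<in> ca_carrier S"
    "\<forall>x\<in>ca_carrier S. \<forall>y\<in>ca_carrier S. ca_add S x y \<in> ca_carrier S \<and> ca_mul S x y \<in> ca_carrier S"
    "\<forall>c. \<forall>x\<in>ca_carrier S. ca_smult S c x \<in> ca_carrier S"
    "\<forall>x\<in>ca_carrier S. ca_star S x \<in> ca_carrier S"
    using ax by - (elim conjE, assumption)+
  show "ca_zero S \<in> ca_carrier S" "ca_one S \<in> ca_carrier S"
  "x \<in> ca_carrier S \<Longrightarrow> y \<in> ca_carrier S \<Longrightarrow> ca_add S x y \<in> ca_carrier S"
  "x \<in> ca_carrier S \<Longrightarrow> y \<in> ca_carrier S \<Longrightarrow> ca_mul S x y \<in> ca_carrier S"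
  "x \<in> ca_carrier S \<Longrightarrow> ca_smult S c x \<in> ca_carrier S"
  "x \<in> ca_carrier S \<Longrightarrow> ca_star S x \<in> ca_carrier S"
    using r by simp_all
qed

lemma add_laws:
  "x \<in> ca_carrier S \<Longrightarrow> y \<in> ca_carrier S \<Longrightarrow> w \<in> ca_carrier S \<Longrightarrow> ca_add S (ca_add S x y) w = ca_add S x (ca_add S y w)"
  "x \<in> ca_carrier S \<Longrightarrow> y \<in> ca_carrier S \<Longrightarrow> ca_add S x y = ca_add S y x"
  "x \<in> ca_carrier S \<Longrightarrow> ca_add S (ca_zero S) x = x"
  "x \<in> ca_carrier S \<Longrightarrow> ca_add S x (ca_smult S (-1) x) = ca_zero S"
proof -
  have r: "\<forall>x\<in>ca_carrier S. \<forall>y\<in>ca_carrier S. \<forall>w\<in>ca_carrier S. ca_add S (ca_add S x y) w = ca_add S x (ca_add S y w)"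
    "\<forall>x\<in>ca_carrier S. \<forall>y\<in>ca_carrier S. ca_add S x y = ca_add S y x"
    "\<forall>x\<in>ca_carrier S. ca_add S (ca_zero S) x = x"
    "\<forall>x\<in>ca_carrier S. ca_add S x (ca_smult S (-1) x) = ca_zero S"
    using ax by - (elim conjE, assumption)+
  show "x \<in> ca_carrier S \<Longrightarrow> y \<in> ca_carrier S \<Longrightarrow> w \<in> ca_carrier S \<Longrightarrow> ca_add S (ca_add S x y) w = ca_add S x (ca_add S y w)"
  "x \<in> ca_carrier S \<Longrightarrow> y \<in> ca_carrier S \<Longrightarrow> ca_add S x y = ca_add S y x"
  "x \<in> ca_carrier S \<Longrightarrow> ca_add S (ca_zero S) x = x"
  "x \<in> ca_carrier S \<Longrightarrow> ca_add S x (ca_smult S (-1) x) = ca_zero S"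
    using r by simp_all
qed

lemma smult_laws:
  "x \<in> ca_carrier S \<Longrightarrow> y \<in> ca_carrier S \<Longrightarrow> ca_smult S c (ca_add S x y) = ca_add S (ca_smult S c x) (ca_smult S c y)"
  "x \<in> ca_carrier S \<Longrightarrow> ca_smult S (c + d) x = ca_add S (ca_smult S c x) (ca_smult S d x)"
  "x \<in> ca_carrier S \<Longrightarrow> ca_smult S c (ca_smult S d x) = ca_smult S (c * d) x"
  "x \<in> ca_carrier S \<Longrightarrow> ca_smult S 1 x = x"
proof -
  have r: "\<forall>c. \<forall>x\<in>ca_carrier S. \<forall>y\<in>ca_carrier S. ca_smult S c (ca_add S x y) = ca_add S (ca_smult S c x) (ca_smult S c y)"
    "\<forall>c d. \<forall>x\<in>ca_carrier S. ca_smult S (c + d) x = ca_add S (ca_smult S c x) (ca_smult S d x)"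
    "\<forall>c d. \<forall>x\<in>ca_carrier S. ca_smult S c (ca_smult S d x) = ca_smult S (c * d) x"
    "\<forall>x\<in>ca_carrier S. ca_smult S 1 x = x"
    using ax by - (elim conjE, assumption)+
  show "x \<in> ca_carrier S \<Longrightarrow> y \<in> ca_carrier S \<Longrightarrow> ca_smult S c (ca_add S x y) = ca_add S (ca_smult S c x) (ca_smult S c y)"
  "x \<in> ca_carrier S \<Longrightarrow> ca_smult S (c + d) x = ca_add S (ca_smult S c x) (ca_smult S d x)"
  "x \<in> ca_carrier S \<Longrightarrow> ca_smult S c (ca_smult S d x) = ca_smult S (c * d) x"
  "x \<in> ca_carrier S \<Longrightarrow> ca_smult S 1 x = x"
    using r by simp_all
qed

lemma mul_laws:
  "x \<in> ca_carrier S \<Longrightarrow> y \<in> ca_carrier S \<Longrightarrow> w \<in> ca_carrier S \<Longrightarrow> ca_mul S (ca_mul S x y) w = ca_mul S x (ca_mul S y w)"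
  "x \<in> ca_carrier S \<Longrightarrow> ca_mul S (ca_one S) x = x"
  "x \<in> ca_carrier S \<Longrightarrow> ca_mul S x (ca_one S) = x"
  "x \<in> ca_carrier S \<Longrightarrow> y \<in> ca_carrier S \<Longrightarrow> w \<in> ca_carrier S \<Longrightarrow> ca_mul S x (ca_add S y w) = ca_add S (ca_mul S x y) (ca_mul S x w)"
  "x \<in> ca_carrier S \<Longrightarrow> y \<in> ca_carrier S \<Longrightarrow> w \<in> ca_carrier S \<Longrightarrow> ca_mul S (ca_add S y w) x = ca_add S (ca_mul S y x) (ca_mul S w x)"
  "x \<in> ca_carrier S \<Longrightarrow> y \<in> ca_carrier S \<Longrightarrow> ca_mul S (ca_smult S c x) y = ca_smult S c (ca_mul S x y)"
  "x \<in> ca_carrier S \<Longrightarrow> y \<in> ca_carrier S \<Longrightarrow> ca_mul S x (ca_smult S c y) = ca_smult S c (ca_mul S x y)"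
proof -
  have r: "\<forall>x\<in>ca_carrier S. \<forall>y\<in>ca_carrier S. \<forall>w\<in>ca_carrier S. ca_mul S (ca_mul S x y) w = ca_mul S x (ca_mul S y w)"
    "\<forall>x\<in>ca_carrier S. ca_mul S (ca_one S) x = x \<and> ca_mul S x (ca_one S) = x"
    "\<forall>x\<in>ca_carrier S. \<forall>y\<in>ca_carrier S. \<forall>w\<in>ca_carrier S. ca_mul S x (ca_add S y w) = ca_add S (ca_mul S x y) (ca_mul S x w) \<and> ca_mul S (ca_add S y w) x = ca_add S (ca_mul S y x) (ca_mul S w x)"
    "\<forall>c. \<forall>x\<in>ca_carrier S. \<forall>y\<in>ca_carrier S. ca_smult S c (ca_mul S x y) = ca_mul S (ca_smult S c x) y \<and> ca_smult S c (ca_mul S x y) = ca_mul S x (ca_smult S c y)"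
    using ax by - (elim conjE, assumption)+
  show "x \<in> ca_carrier S \<Longrightarrow> y \<in> ca_carrier S \<Longrightarrow> w \<in> ca_carrier S \<Longrightarrow> ca_mul S (ca_mul S x y) w = ca_mul S x (ca_mul S y w)"
  "x \<in> ca_carrier S \<Longrightarrow> ca_mul S (ca_one S) x = x"
  "x \<in> ca_carrier S \<Longrightarrow> ca_mul S x (ca_one S) = x"
  "x \<in> ca_carrier S \<Longrightarrow> y \<in> ca_carrier S \<Longrightarrow> w \<in> ca_carrier S \<Longrightarrow> ca_mul S x (ca_add S y w) = ca_add S (ca_mul S x y) (ca_mul S x w)"
  "x \<in> ca_carrier S \<Longrightarrow> y \<in> ca_carrier S \<Longrightarrow> w \<in> ca_carrier S \<Longrightarrow> ca_mul S (ca_add S y w) x = ca_add S (ca_mul S y x) (ca_mul S w x)"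
  "x \<in> ca_carrier S \<Longrightarrow> y \<in> ca_carrier S \<Longrightarrow> ca_mul S (ca_smult S c x) y = ca_smult S c (ca_mul S x y)"
  "x \<in> ca_carrier S \<Longrightarrow> y \<in> ca_carrier S \<Longrightarrow> ca_mul S x (ca_smult S c y) = ca_smult S c (ca_mul S x y)"
    using r by metis+
qed

lemma star_laws:
  "x \<in> ca_carrier S \<Longrightarrow> ca_star S (ca_star S x) = x"
  "x \<in> ca_carrier S \<Longrightarrow> y \<in> ca_carrier S \<Longrightarrow> ca_star S (ca_add S x y) = ca_add S (ca_star S x) (ca_star S y)"
  "x \<in> ca_carrier S \<Longrightarrow> ca_star S (ca_smult S c x) = ca_smult S (cnj c) (ca_star S x)"
  "x \<in> ca_carrier S \<Longrightarrow> y \<in> ca_carrier S \<Longrightarrow> ca_star S (ca_mul S x y) = ca_mul S (ca_star S y) (ca_star S x)"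
proof -
  have r: "\<forall>x\<in>ca_carrier S. ca_star S (ca_star S x) = x"
    "\<forall>x\<in>ca_carrier S. \<forall>y\<in>ca_carrier S. ca_star S (ca_add S x y) = ca_add S (ca_star S x) (ca_star S y)"
    "\<forall>c. \<forall>x\<in>ca_carrier S. ca_star S (ca_smult S c x) = ca_smult S (cnj c) (ca_star S x)"
    "\<forall>x\<in>ca_carrier S. \<forall>y\<in>ca_carrier S. ca_star S (ca_mul S x y) = ca_mul S (ca_star S y) (ca_star S x)"
    using ax by - (elim conjE, assumption)+
  show "x \<in> ca_carrier S \<Longrightarrow> ca_star S (ca_star S x) = x"
  "x \<in> ca_carrier S \<Longrightarrow> y \<in> ca_carrier S \<Longrightarrow> ca_star S (ca_add S x y) = ca_add S (ca_star S x) (ca_star S y)"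
  "x \<in> ca_carrier S \<Longrightarrow> ca_star S (ca_smult S c x) = ca_smult S (cnj c) (ca_star S x)"
  "x \<in> ca_carrier S \<Longrightarrow> y \<in> ca_carrier S \<Longrightarrow> ca_star S (ca_mul S x y) = ca_mul S (ca_star S y) (ca_star S x)"
    using r by simp_all
qed

lemma norm_laws:
  "x \<in> ca_carrier S \<Longrightarrow> 0 \<le> ca_norm S x"
  "x \<in> ca_carrier S \<Longrightarrow> ca_norm S x = 0 \<longleftrightarrow> x = ca_zero S"
  "x \<in> ca_carrier S \<Longrightarrow> y \<in> ca_carrier S \<Longrightarrow> ca_norm S (ca_add S x y) \<le> ca_norm S x + ca_norm S y"
  "x \<in> ca_carrier S \<Longrightarrow> ca_norm S (ca_smult S c x) = cmod c * ca_norm S x"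
  "x \<in> ca_carrier S \<Longrightarrow> y \<in> ca_carrier S \<Longrightarrow> ca_norm S (ca_mul S x y) \<le> ca_norm S x * ca_norm S y"
  "x \<in> ca_carrier S \<Longrightarrow> ca_norm S (ca_mul S (ca_star S x) x) = (ca_norm S x)\<^sup>2"
proof -
  have r: "\<forall>x\<in>ca_carrier S. 0 \<le> ca_norm S x \<and> (ca_norm S x = 0 \<longleftrightarrow> x = ca_zero S)"
    "\<forall>x\<in>ca_carrier S. \<forall>y\<in>ca_carrier S. ca_norm S (ca_add S x y) \<le> ca_norm S x + ca_norm S y"
    "\<forall>c. \<forall>x\<in>ca_carrier S. ca_norm S (ca_smult S c x) = cmod c * ca_norm S x"
    "\<forall>x\<in>ca_carrier S. \<forall>y\<in>ca_carrier S. ca_norm S (ca_mul S x y) \<le> ca_norm S x * ca_norm S y"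
    "\<forall>x\<in>ca_carrier S. ca_norm S (ca_mul S (ca_star S x) x) = (ca_norm S x)\<^sup>2"
    using ax by - (elim conjE, assumption)+
  show "x \<in> ca_carrier S \<Longrightarrow> 0 \<le> ca_norm S x"
  "x \<in> ca_carrier S \<Longrightarrow> ca_norm S x = 0 \<longleftrightarrow> x = ca_zero S"
  "x \<in> ca_carrier S \<Longrightarrow> y \<in> ca_carrier S \<Longrightarrow> ca_norm S (ca_add S x y) \<le> ca_norm S x + ca_norm S y"
  "x \<in> ca_carrier S \<Longrightarrow> ca_norm S (ca_smult S c x) = cmod c * ca_norm S x"
  "x \<in> ca_carrier S \<Longrightarrow> y \<in> ca_carrier S \<Longrightarrow> ca_norm S (ca_mul S x y) \<le> ca_norm S x * ca_norm S y"
  "x \<in> ca_carrier S \<Longrightarrow> ca_norm S (ca_mul S (ca_star S x) x) = (ca_norm S x)\<^sup>2"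
    using r by simp_all
qed

lemma complete:
  fixes X :: "nat \<Rightarrow> 'a"
  assumes "\<And>k. X k \<in> ca_carrier S"
    "\<And>\<epsilon>. \<epsilon> > 0 \<Longrightarrow> \<exists>N. \<forall>a\<ge>N. \<forall>b\<ge>N. ca_norm S (ca_sub S (X a) (X b)) < \<epsilon>"
  shows "\<exists>L\<in>ca_carrier S. \<forall>\<epsilon>>0. \<exists>N. \<forall>a\<ge>N. ca_norm S (ca_sub S (X a) L) < \<epsilon>"
proof -
  have "\<forall>X::nat \<Rightarrow> 'a. (\<forall>k. X k \<in> ca_carrier S) \<and>
          (\<forall>\<epsilon>>0. \<exists>N. \<forall>a\<ge>N. \<forall>b\<ge>N. ca_norm S (ca_sub S (X a) (X b)) < \<epsilon>) \<longrightarrow>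
          (\<exists>L\<in>ca_carrier S. \<forall>\<epsilon>>0. \<exists>N. \<forall>a\<ge>N. ca_norm S (ca_sub S (X a) L) < \<epsilon>)"
    using ax by (elim conjE) assumption
  then show ?thesis using assms by blast
qed

lemma smult_0: assumes x: "x \<in> ca_carrier S" shows "ca_smult S 0 x = ca_zero S"
  using smult_laws(2)[OF x, of 1 "-1"] add_laws(4)[OF x] smult_laws(4)[OF x] by simp

lemma norm_zero: "ca_norm S (ca_zero S) = 0"
  using norm_laws(2) by blast

lemma star_one: "ca_star S (ca_one S) = ca_one S"
  by (metis closed(2) closed(6) mul_laws(2,3) star_laws(1,4))

lemma smult_zero: "ca_smult S c (ca_zero S) = ca_zero S"
  by (metis smult_0 closed(1) mult_zero_right smult_laws(3))

lemma mul_zero: assumes x: "x \<in> ca_carrier S" shows "ca_mul S x (ca_zero S) = ca_zero S" "ca_mul S (ca_zero S) x = ca_zero S"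
  using mul_laws(6)[OF closed(1) x, of 0] mul_laws(7)[OF x closed(1), of 0] smult_0 x by simp_all

lemma star_zero: "ca_star S (ca_zero S) = ca_zero S"
  using star_laws(3)[OF closed(1), of 0] smult_0 by simp

text \<open>By the C*-identity this norm equals its own square, so it is \<open>0\<close> or
  \<open>1\<close>. The axioms admit the zero algebra, so no more than an inequality can be
  claimed.\<close>

lemma norm_one_le: "ca_norm S (ca_one S) \<le> 1"
proof -
  have "ca_norm S (ca_one S) = (ca_norm S (ca_one S))\<^sup>2"
    using norm_laws(6)[OF closed(2)] star_one mul_laws(2)[OF closed(2)] by simp
  then have "ca_norm S (ca_one S) * (ca_norm S (ca_one S) - 1) = 0" by (simp add: power2_eq_square algebra_simps)
  then show ?thesis by auto
qed

end

text \<open>An element consists of a complex number and a bounded choice of one element in each unital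
  C*-algebra on the type \<open>'a\<close>, so that all of these algebras live in a single instance of \<open>cstar\<close>.
  The complex component only serves to make \<open>0 \<noteq> 1\<close>.\<close>
typedef 'a ucs = "{x :: complex \<times> ('a calg \<Rightarrow> 'a).
    (\<forall>S. unital_cstar_algebra S \<longrightarrow> snd x S \<in> ca_carrier S) \<and>
    (\<forall>S. \<not> unital_cstar_algebra S \<longrightarrow> snd x S = undefined) \<and>
    (\<exists>M. \<forall>S. unital_cstar_algebra S \<longrightarrow> ca_norm S (snd x S) \<le> M)}"
proof
  show "(0, \<lambda>S. if unital_cstar_algebra S then ca_zero S else undefined) \<in> {x :: complex \<times> ('a calg \<Rightarrow> 'a).
    (\<forall>S. unital_cstar_algebra S \<longrightarrow> snd x S \<in> ca_carrier S) \<and>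
    (\<forall>S. \<not> unital_cstar_algebra S \<longrightarrow> snd x S = undefined) \<and>
    (\<exists>M. \<forall>S. unital_cstar_algebra S \<longrightarrow> ca_norm S (snd x S) \<le> M)}"
    by (auto simp: ucalg_def ucalg.norm_zero intro!: exI[of _ 0] ucalg.closed)
qed

text \<open>Records that are not C*-algebras receive a fixed value, so that equality of elements is
  decided by the complex component and the C*-algebras alone.\<close>

definition ucs_of :: "complex \<Rightarrow> ('a calg \<Rightarrow> 'a) \<Rightarrow> 'a ucs" where
  "ucs_of c f = Abs_ucs (c, \<lambda>S. if unital_cstar_algebra S then f S else undefined)"

definition ucs0 :: "'a ucs \<Rightarrow> complex" where "ucs0 x = fst (Rep_ucs x)"

definition ucs_at :: "'a ucs \<Rightarrow> 'a calg \<Rightarrow> 'a" where "ucs_at x S = snd (Rep_ucs x) S"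

lemma ucs_of_eval:
  assumes "\<And>S. unital_cstar_algebra S \<Longrightarrow> f S \<in> ca_carrier S"
    and "\<And>S. unital_cstar_algebra S \<Longrightarrow> ca_norm S (f S) \<le> M"
  shows "ucs0 (ucs_of c f) = c" "unital_cstar_algebra S \<Longrightarrow> ucs_at (ucs_of c f) S = f S"
proof -
  have "Rep_ucs (ucs_of c f) = (c, \<lambda>S. if unital_cstar_algebra S then f S else undefined)"
    unfolding ucs_of_def by (rule Abs_ucs_inverse) (use assms in auto)
  then show "ucs0 (ucs_of c f) = c" "unital_cstar_algebra S \<Longrightarrow> ucs_at (ucs_of c f) S = f S"
    by (simp_all add: ucs0_def ucs_at_def)
qed

lemma ucs_eqI:
  assumes "ucs0 x = ucs0 y" "\<And>S. unital_cstar_algebra S \<Longrightarrow> ucs_at x S = ucs_at y S" shows "x = y"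
proof -
  have "snd (Rep_ucs x) S = snd (Rep_ucs y) S" for S
    using assms(2)[of S] Rep_ucs[of x] Rep_ucs[of y] by (cases "unital_cstar_algebra S") (auto simp: ucs_at_def)
  then have "Rep_ucs x = Rep_ucs y" using assms(1) by (intro prod_eqI) (auto simp: ucs0_def)
  then show ?thesis by (simp add: Rep_ucs_inject)
qed

lemma ucs_at_closed [simp]: "unital_cstar_algebra S \<Longrightarrow> ucs_at x S \<in> ca_carrier S"
  using Rep_ucs[of x] by (auto simp: ucs_at_def)

definition ucs_bound :: "'a ucs \<Rightarrow> real" where
  "ucs_bound x = Sup (insert (cmod (ucs0 x)) {ca_norm S (ucs_at x S) | S. unital_cstar_algebra S})"

lemma ucs_bound_bdd: "bdd_above (insert (cmod (ucs0 x)) {ca_norm S (ucs_at x S) | S. unital_cstar_algebra S})"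
proof -
  obtain M where "\<And>S. unital_cstar_algebra S \<Longrightarrow> ca_norm S (ucs_at x S) \<le> M"
    using Rep_ucs[of x] by (auto simp: ucs_at_def)
  then have "bdd_above {ca_norm S (ucs_at x S) | S. unital_cstar_algebra S}" by (intro bdd_aboveI[of _ M]) auto
  then show ?thesis by simp
qed

lemma ucs0_le_bound: "cmod (ucs0 x) \<le> ucs_bound x"
  unfolding ucs_bound_def by (rule cSup_upper[OF _ ucs_bound_bdd]) simp

lemma ucs_at_le_bound: "unital_cstar_algebra S \<Longrightarrow> ca_norm S (ucs_at x S) \<le> ucs_bound x"
  unfolding ucs_bound_def by (rule cSup_upper[OF _ ucs_bound_bdd]) blast

lemma ucs_bound_least:
  assumes "cmod (ucs0 x) \<le> M" "\<And>S. unital_cstar_algebra S \<Longrightarrow> ca_norm S (ucs_at x S) \<le> M"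
  shows "ucs_bound x \<le> M"
  unfolding ucs_bound_def by (rule cSup_least) (use assms in auto)

lemma ucs_bound_ge_0: "ucs_bound x \<ge> 0"
  using ucs0_le_bound[of x] norm_ge_zero order_trans by blast

instantiation ucs :: (type) "{zero, one, plus, minus, uminus, times, scaleR}"
begin

definition "0 = ucs_of 0 ca_zero"
definition "1 = ucs_of 1 ca_one"
definition "x + y = ucs_of (ucs0 x + ucs0 y) (\<lambda>S. ca_add S (ucs_at x S) (ucs_at y S))"
definition "- x = ucs_of (- ucs0 x) (\<lambda>S. ca_smult S (-1) (ucs_at x S))"
definition "(x :: 'a ucs) - y = x + - y"
definition "x * y = ucs_of (ucs0 x * ucs0 y) (\<lambda>S. ca_mul S (ucs_at x S) (ucs_at y S))"
definition "r *\<^sub>R x = ucs_of (of_real r * ucs0 x) (\<lambda>S. ca_smult S (of_real r) (ucs_at x S))"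
instance ..

end

definition ucs_cs :: "complex \<Rightarrow> 'a ucs \<Rightarrow> 'a ucs" where
  "ucs_cs c x = ucs_of (c * ucs0 x) (\<lambda>S. ca_smult S c (ucs_at x S))"

definition ucs_adj :: "'a ucs \<Rightarrow> 'a ucs" where
  "ucs_adj x = ucs_of (cnj (ucs0 x)) (\<lambda>S. ca_star S (ucs_at x S))"

lemma ca_norm_star_le: assumes "unital_cstar_algebra S" "x \<in> ca_carrier S" shows "ca_norm S (ca_star S x) \<le> ca_norm S x"
proof -
  interpret ucalg S using assms(1) by (simp add: ucalg_def)
  note x = assms(2)
  have "(ca_norm S (ca_star S x))\<^sup>2 = ca_norm S (ca_mul S x (ca_star S x))"
    using norm_laws(6)[of "ca_star S x"] x by (simp add: star_laws)
  also have "\<dots> \<le> ca_norm S x * ca_norm S (ca_star S x)" using x by (intro norm_laws) auto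
  finally have "ca_norm S (ca_star S x) * ca_norm S (ca_star S x) \<le> ca_norm S x * ca_norm S (ca_star S x)"
    by (simp add: power2_eq_square)
  then show ?thesis using norm_laws(1)[OF x] norm_laws(1)[OF closed(6)[OF x]]
    by (cases "ca_norm S (ca_star S x) = 0") auto
qed

lemma ucs_eval:
  fixes x y :: "'a ucs"
  shows
  "ucs0 (0::'a ucs) = 0" "ucs0 (1::'a ucs) = 1" "ucs0 (x + y) = ucs0 x + ucs0 y" "ucs0 (- x) = - ucs0 x"
  "ucs0 (x * y) = ucs0 x * ucs0 y" "ucs0 (r *\<^sub>R x) = of_real r * ucs0 x"
  "ucs0 (ucs_cs c x) = c * ucs0 x" "ucs0 (ucs_adj x) = cnj (ucs0 x)"
  and ucs_at_eval:
  "unital_cstar_algebra S \<Longrightarrow> ucs_at (0::'a ucs) S = ca_zero S"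
  "unital_cstar_algebra S \<Longrightarrow> ucs_at (1::'a ucs) S = ca_one S"
  "unital_cstar_algebra S \<Longrightarrow> ucs_at (x + y) S = ca_add S (ucs_at x S) (ucs_at y S)"
  "unital_cstar_algebra S \<Longrightarrow> ucs_at (- x) S = ca_smult S (-1) (ucs_at x S)"
  "unital_cstar_algebra S \<Longrightarrow> ucs_at (x * y) S = ca_mul S (ucs_at x S) (ucs_at y S)"
  "unital_cstar_algebra S \<Longrightarrow> ucs_at (r *\<^sub>R x) S = ca_smult S (of_real r) (ucs_at x S)"
  "unital_cstar_algebra S \<Longrightarrow> ucs_at (ucs_cs c x) S = ca_smult S c (ucs_at x S)"
  "unital_cstar_algebra S \<Longrightarrow> ucs_at (ucs_adj x) S = ca_star S (ucs_at x S)"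
proof -
  have sm: "ca_smult S c (ucs_at x S) \<in> ca_carrier S" "ca_norm S (ca_smult S c (ucs_at x S)) \<le> cmod c * ucs_bound x"
    if "unital_cstar_algebra S" for S :: "'a calg" and c x
  proof -
    interpret ucalg S using that by (simp add: ucalg_def)
    show "ca_smult S c (ucs_at x S) \<in> ca_carrier S" "ca_norm S (ca_smult S c (ucs_at x S)) \<le> cmod c * ucs_bound x"
      using that by (auto simp: norm_laws intro!: mult_left_mono ucs_at_le_bound)
  qed
  have ad: "ca_add S (ucs_at x S) (ucs_at y S) \<in> ca_carrier S"
    "ca_norm S (ca_add S (ucs_at x S) (ucs_at y S)) \<le> ucs_bound x + ucs_bound y"
    if "unital_cstar_algebra S" for S :: "'a calg" and x y
  proof -
    interpret ucalg S using that by (simp add: ucalg_def)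
    show "ca_add S (ucs_at x S) (ucs_at y S) \<in> ca_carrier S" using that by simp
    show "ca_norm S (ca_add S (ucs_at x S) (ucs_at y S)) \<le> ucs_bound x + ucs_bound y"
      by (rule order_trans[OF norm_laws(3)]) (use that in \<open>auto intro!: add_mono ucs_at_le_bound\<close>)
  qed
  have mu: "ca_mul S (ucs_at x S) (ucs_at y S) \<in> ca_carrier S"
    "ca_norm S (ca_mul S (ucs_at x S) (ucs_at y S)) \<le> ucs_bound x * ucs_bound y"
    if "unital_cstar_algebra S" for S :: "'a calg" and x y
  proof -
    interpret ucalg S using that by (simp add: ucalg_def)
    show "ca_mul S (ucs_at x S) (ucs_at y S) \<in> ca_carrier S" using that by simp
    show "ca_norm S (ca_mul S (ucs_at x S) (ucs_at y S)) \<le> ucs_bound x * ucs_bound y"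
      by (rule order_trans[OF norm_laws(5)]) (use that in \<open>auto intro!: mult_mono ucs_at_le_bound norm_laws ucs_bound_ge_0\<close>)
  qed
  have st: "ca_star S (ucs_at x S) \<in> ca_carrier S" "ca_norm S (ca_star S (ucs_at x S)) \<le> ucs_bound x"
    if "unital_cstar_algebra S" for S :: "'a calg" and x
  proof -
    interpret ucalg S using that by (simp add: ucalg_def)
    show "ca_star S (ucs_at x S) \<in> ca_carrier S" using that by simp
    show "ca_norm S (ca_star S (ucs_at x S)) \<le> ucs_bound x"
      by (rule order_trans[OF ca_norm_star_le]) (use that in \<open>auto intro!: ucs_at_le_bound\<close>)
  qed
  have z: "ca_zero S \<in> ca_carrier S" "ca_norm S (ca_zero S) \<le> 0"
    and o: "ca_one S \<in> ca_carrier S" "ca_norm S (ca_one S) \<le> 1" if "unital_cstar_algebra S" for S :: "'a calg"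
  proof -
    interpret ucalg S using that by (simp add: ucalg_def)
    show "ca_zero S \<in> ca_carrier S" "ca_norm S (ca_zero S) \<le> 0" "ca_one S \<in> ca_carrier S" "ca_norm S (ca_one S) \<le> 1"
      by (simp_all add: norm_zero norm_one_le)
  qed
  note d = zero_ucs_def one_ucs_def plus_ucs_def uminus_ucs_def times_ucs_def scaleR_ucs_def ucs_cs_def ucs_adj_def
  show "ucs0 (0::'a ucs) = 0" "ucs0 (1::'a ucs) = 1" "ucs0 (x + y) = ucs0 x + ucs0 y" "ucs0 (- x) = - ucs0 x"
    "ucs0 (x * y) = ucs0 x * ucs0 y" "ucs0 (r *\<^sub>R x) = of_real r * ucs0 x"
    "ucs0 (ucs_cs c x) = c * ucs0 x" "ucs0 (ucs_adj x) = cnj (ucs0 x)"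
    "unital_cstar_algebra S \<Longrightarrow> ucs_at (0::'a ucs) S = ca_zero S"
    "unital_cstar_algebra S \<Longrightarrow> ucs_at (1::'a ucs) S = ca_one S"
    "unital_cstar_algebra S \<Longrightarrow> ucs_at (x + y) S = ca_add S (ucs_at x S) (ucs_at y S)"
    "unital_cstar_algebra S \<Longrightarrow> ucs_at (- x) S = ca_smult S (-1) (ucs_at x S)"
    "unital_cstar_algebra S \<Longrightarrow> ucs_at (x * y) S = ca_mul S (ucs_at x S) (ucs_at y S)"
    "unital_cstar_algebra S \<Longrightarrow> ucs_at (r *\<^sub>R x) S = ca_smult S (of_real r) (ucs_at x S)"
    "unital_cstar_algebra S \<Longrightarrow> ucs_at (ucs_cs c x) S = ca_smult S c (ucs_at x S)"
    "unital_cstar_algebra S \<Longrightarrow> ucs_at (ucs_adj x) S = ca_star S (ucs_at x S)"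
    unfolding d
    by - (rule ucs_of_eval(1), erule z o ad sm mu st, erule z o ad sm mu st
      | rule ucs_of_eval(2), erule z o ad sm mu st, erule z o ad sm mu st, assumption)+
qed

instantiation ucs :: (type) real_normed_algebra_1
begin

definition "norm x = ucs_bound (x :: 'a ucs)"
definition "dist x y = norm (x - y :: 'a ucs)"
definition "sgn x = (inverse (norm x)) *\<^sub>R (x :: 'a ucs)"
definition uniformity_ucs :: "('a ucs \<times> 'a ucs) filter" where
  "uniformity_ucs = (INF e\<in>{0<..}. principal {(x, y). dist x y < e})"
definition open_ucs :: "'a ucs set \<Rightarrow> bool" where
  "open_ucs U = (\<forall>x\<in>U. eventually (\<lambda>(x', y). x' = x \<longrightarrow> y \<in> U) uniformity)"

instance
proof
  fix x y z :: "'a ucs" and r s :: real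
  note e = ucs_eval ucs_at_eval minus_ucs_def
  note I = ucalg.intro
  show "x + y + z = x + (y + z)"
    by (rule ucs_eqI) (simp_all add: e ucalg.add_laws(1)[OF I])
  show "x + y = y + x"
    by (rule ucs_eqI) (simp_all add: e ucalg.add_laws(2)[OF I, of _ "ucs_at x _" "ucs_at y _"])
  show "0 + x = x"
    by (rule ucs_eqI) (simp_all add: e ucalg.add_laws(3)[OF I])
  show "- x + x = 0"
    by (rule ucs_eqI) (simp_all add: e ucalg.add_laws(4)[OF I] ucalg.closed[OF I]
        ucalg.add_laws(2)[OF I, of _ "ca_smult _ (- 1) (ucs_at x _)" "ucs_at x _"])
  show "x - y = x + - y" by (simp add: minus_ucs_def)
  show "r *\<^sub>R (x + y) = r *\<^sub>R x + r *\<^sub>R y"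
    by (rule ucs_eqI) (simp_all add: e ucalg.smult_laws[OF I] algebra_simps)
  show "(r + s) *\<^sub>R x = r *\<^sub>R x + s *\<^sub>R x"
    by (rule ucs_eqI) (simp_all add: e ucalg.smult_laws[OF I] algebra_simps)
  show "r *\<^sub>R s *\<^sub>R x = (r * s) *\<^sub>R x"
    by (rule ucs_eqI) (simp_all add: e ucalg.smult_laws[OF I])
  show "1 *\<^sub>R x = x"
    by (rule ucs_eqI) (simp_all add: e ucalg.smult_laws[OF I])
  show "x * y * z = x * (y * z)"
    by (rule ucs_eqI) (simp_all add: e ucalg.mul_laws[OF I])
  show "(x + y) * z = x * z + y * z" "x * (y + z) = x * y + x * z"
    by (rule ucs_eqI; simp add: e ucalg.mul_laws[OF I] algebra_simps)+
  show "r *\<^sub>R x * y = r *\<^sub>R (x * y)" "x * r *\<^sub>R y = r *\<^sub>R (x * y)"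
    by (rule ucs_eqI; simp add: e ucalg.mul_laws[OF I])+
  show "1 * x = x" "x * 1 = x"
    by (rule ucs_eqI; simp add: e ucalg.mul_laws[OF I])+
  show "(0::'a ucs) \<noteq> 1"
    using ucs_eval(1,2) by (metis zero_neq_one)
  show "dist x y = norm (x - y)" by (rule dist_ucs_def)
  show "sgn x = x /\<^sub>R norm x" by (rule sgn_ucs_def)
  show "(uniformity :: ('a ucs \<times> 'a ucs) filter) = (INF e\<in>{0<..}. principal {(x, y). dist x y < e})"
    by (rule uniformity_ucs_def)
  show "open U = (\<forall>x\<in>U. \<forall>\<^sub>F (x', y) in uniformity. x' = x \<longrightarrow> y \<in> U)" for U :: "'a ucs set"
    by (rule open_ucs_def)
  show "norm x = 0 \<longleftrightarrow> x = 0"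
  proof
    assume n: "norm x = 0"
    show "x = 0"
    proof (rule ucs_eqI)
      show "ucs0 x = ucs0 0" using ucs0_le_bound[of x] n by (simp add: e norm_ucs_def)
      fix S :: "'a calg" assume S: "unital_cstar_algebra S"
      then interpret ucalg S by (rule I)
      have "ca_norm S (ucs_at x S) = 0" using ucs_at_le_bound[OF S, of x] n norm_laws(1)[of "ucs_at x S"] S by (simp add: norm_ucs_def)
      then show "ucs_at x S = ucs_at 0 S" using S norm_laws(2)[of "ucs_at x S"] by (simp add: e)
    qed
  next
    assume "x = 0"
    then have "ucs_bound x \<le> 0" by (intro ucs_bound_least) (auto simp: e ucalg.norm_zero[OF I])
    then show "norm x = 0" using ucs_bound_ge_0[of x] by (simp add: norm_ucs_def)
  qed
  show "norm (x + y) \<le> norm x + norm y" unfolding norm_ucs_def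
  proof (rule ucs_bound_least)
    show "cmod (ucs0 (x + y)) \<le> ucs_bound x + ucs_bound y"
      unfolding e by (rule order_trans[OF norm_triangle_ineq]) (intro add_mono ucs0_le_bound)
    show "ca_norm S (ucs_at (x + y) S) \<le> ucs_bound x + ucs_bound y" if "unital_cstar_algebra S" for S
      unfolding ucs_at_eval(3)[OF that]
      by (rule order_trans[OF ucalg.norm_laws(3)[OF I]]) (use that in \<open>auto intro!: add_mono ucs_at_le_bound\<close>)
  qed
  show "norm (x * y) \<le> norm x * norm y" unfolding norm_ucs_def
  proof (rule ucs_bound_least)
    show "cmod (ucs0 (x * y)) \<le> ucs_bound x * ucs_bound y"
      unfolding e norm_mult by (intro mult_mono ucs0_le_bound) (auto simp: ucs_bound_ge_0)
    show "ca_norm S (ucs_at (x * y) S) \<le> ucs_bound x * ucs_bound y" if "unital_cstar_algebra S" for S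
      unfolding ucs_at_eval(5)[OF that]
      by (rule order_trans[OF ucalg.norm_laws(5)[OF I]])
         (use that in \<open>auto intro!: mult_mono ucs_at_le_bound ucs_bound_ge_0 ucalg.norm_laws[OF I]\<close>)
  qed
  show "norm (r *\<^sub>R x) = \<bar>r\<bar> * norm x"
  proof -
    have le: "norm (t *\<^sub>R w) \<le> \<bar>t\<bar> * norm w" for t and w :: "'a ucs"
      unfolding norm_ucs_def
      by (rule ucs_bound_least)
        (auto simp: e norm_mult ucalg.norm_laws[OF I] intro!: mult_left_mono ucs_at_le_bound ucs0_le_bound)
    show ?thesis
    proof (cases "r = 0")
      case True
      then show ?thesis using le[of 0 x] ucs_bound_ge_0[of "0 *\<^sub>R x"] by (simp add: norm_ucs_def)
    next
      case False
      have "x = (1 / r) *\<^sub>R r *\<^sub>R x"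
        by (rule ucs_eqI) (use False in \<open>simp_all add: e ucalg.smult_laws[OF I]\<close>)
      then have "norm x \<le> \<bar>1 / r\<bar> * norm (r *\<^sub>R x)" using le by metis
      then have "\<bar>r\<bar> * norm x \<le> norm (r *\<^sub>R x)" using False by (simp add: field_simps)
      then show ?thesis using le[of r x] by simp
    qed
  qed
  show "norm (1::'a ucs) = 1"
  proof -
    have "ucs_bound (1::'a ucs) \<le> 1" by (rule ucs_bound_least) (auto simp: e ucalg.norm_one_le[OF I])
    then show ?thesis using ucs0_le_bound[of "1::'a ucs"] by (simp add: e norm_ucs_def)
  qed
qed

end

text \<open>Extension by zero in every other component, the complex one included. The map is
  isometric and multiplicative but never unital: the unit of \<open>S\<close> becomes a central
  projection.\<close>

definition emb :: "'a calg \<Rightarrow> 'a \<Rightarrow> 'a ucs" where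
  "emb S x = ucs_of 0 (\<lambda>S'. if S' = S then x else ca_zero S')"

context ucalg
begin

lemma emb_eval:
  assumes "x \<in> ca_carrier S"
  shows "ucs0 (emb S x) = 0"
    "unital_cstar_algebra S' \<Longrightarrow> ucs_at (emb S x) S' = (if S' = S then x else ca_zero S')"
proof -
  have 1: "(if S' = S then x else ca_zero S') \<in> ca_carrier S'" if "unital_cstar_algebra S'" for S'
    using assms ucalg.closed(1)[OF ucalg.intro[OF that]] by simp
  have 2: "ca_norm S' (if S' = S then x else ca_zero S') \<le> ca_norm S x" if "unital_cstar_algebra S'" for S'
    using norm_laws(1)[OF assms] ucalg.norm_zero[OF ucalg.intro[OF that]] by simp
  show "ucs0 (emb S x) = 0" unfolding emb_def by (rule ucs_of_eval(1), erule 1, erule 2)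
  show "unital_cstar_algebra S' \<Longrightarrow> ucs_at (emb S x) S' = (if S' = S then x else ca_zero S')"
    unfolding emb_def by (rule ucs_of_eval(2), erule 1, erule 2, assumption)
qed

lemma emb_add: assumes "x \<in> ca_carrier S" "y \<in> ca_carrier S" shows "emb S (ca_add S x y) = emb S x + emb S y"
proof (rule ucs_eqI)
  show "ucs0 (emb S (ca_add S x y)) = ucs0 (emb S x + emb S y)"
    by (simp only: ucs_eval emb_eval assms closed) simp
  fix S' :: "'a calg" assume S': "unital_cstar_algebra S'"
  show "ucs_at (emb S (ca_add S x y)) S' = ucs_at (emb S x + emb S y) S'"
    using ucalg.add_laws(3)[OF ucalg.intro[OF S']] ucalg.closed(1)[OF ucalg.intro[OF S']]
    by (simp add: ucs_at_eval emb_eval assms S')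
qed

lemma emb_mul: assumes "x \<in> ca_carrier S" "y \<in> ca_carrier S" shows "emb S (ca_mul S x y) = emb S x * emb S y"
proof (rule ucs_eqI)
  show "ucs0 (emb S (ca_mul S x y)) = ucs0 (emb S x * emb S y)"
    by (simp only: ucs_eval emb_eval assms closed) simp
  fix S' :: "'a calg" assume S': "unital_cstar_algebra S'"
  show "ucs_at (emb S (ca_mul S x y)) S' = ucs_at (emb S x * emb S y) S'"
    using ucalg.mul_zero[OF ucalg.intro[OF S']] ucalg.closed(1)[OF ucalg.intro[OF S']]
    by (simp add: ucs_at_eval emb_eval assms S')
qed

lemma emb_smult0: assumes "x \<in> ca_carrier S" shows "emb S (ca_smult S c x) = ucs_cs c (emb S x)"
proof (rule ucs_eqI)
  show "ucs0 (emb S (ca_smult S c x)) = ucs0 (ucs_cs c (emb S x))"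
    by (simp only: ucs_eval emb_eval assms closed) simp
  fix S' :: "'a calg" assume S': "unital_cstar_algebra S'"
  show "ucs_at (emb S (ca_smult S c x)) S' = ucs_at (ucs_cs c (emb S x)) S'"
    using ucalg.smult_zero[OF ucalg.intro[OF S']]
    by (simp add: ucs_at_eval emb_eval assms S')
qed

lemma emb_star0: assumes "x \<in> ca_carrier S" shows "emb S (ca_star S x) = ucs_adj (emb S x)"
proof (rule ucs_eqI)
  show "ucs0 (emb S (ca_star S x)) = ucs0 (ucs_adj (emb S x))"
    by (simp only: ucs_eval emb_eval assms closed) simp
  fix S' :: "'a calg" assume S': "unital_cstar_algebra S'"
  show "ucs_at (emb S (ca_star S x)) S' = ucs_at (ucs_adj (emb S x)) S'"
    using ucalg.star_zero[OF ucalg.intro[OF S']]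
    by (simp add: ucs_at_eval emb_eval assms S')
qed

lemma norm_emb: assumes "x \<in> ca_carrier S" shows "norm (emb S x) = ca_norm S x"
proof (rule antisym)
  show "norm (emb S x) \<le> ca_norm S x" unfolding norm_ucs_def
    by (rule ucs_bound_least)
       (use assms norm_laws(1)[OF assms] in \<open>auto simp: emb_eval ucalg.norm_zero ucalg.intro\<close>)
  show "ca_norm S x \<le> norm (emb S x)"
    using ucs_at_le_bound[OF uc, of "emb S x"] by (simp add: emb_eval assms uc norm_ucs_def)
qed

lemma ucs_minus_eq: "- x = ucs_cs (-1) x" for x :: "'a ucs"
  by (rule ucs_eqI) (simp_all add: ucs_eval ucs_at_eval)

lemma emb_sub: assumes "x \<in> ca_carrier S" "y \<in> ca_carrier S" shows "emb S (ca_sub S x y) = emb S x - emb S y"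
  unfolding ca_sub_def using assms by (simp add: emb_add emb_smult0 minus_ucs_def ucs_minus_eq)

lemma sub_closed [simp, intro]: "x \<in> ca_carrier S \<Longrightarrow> y \<in> ca_carrier S \<Longrightarrow> ca_sub S x y \<in> ca_carrier S"
  by (simp add: ca_sub_def)

lemma norm_sub: "x \<in> ca_carrier S \<Longrightarrow> y \<in> ca_carrier S \<Longrightarrow> ca_norm S (ca_sub S x y) = norm (emb S x - emb S y)"
  by (simp only: sub_closed norm_emb[symmetric] emb_sub)

end

lemma ucs_at_sub: "unital_cstar_algebra S \<Longrightarrow> ucs_at (x - y) S = ca_sub S (ucs_at x S) (ucs_at y S)"
  unfolding minus_ucs_def by (simp only: ucs_at_eval ca_sub_def)

lemma ucs0_sub: "ucs0 (x - y) = ucs0 x - ucs0 y"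
  unfolding minus_ucs_def by (simp only: ucs_eval diff_conv_add_uminus)

instantiation ucs :: (type) cstar
begin

definition "cs c x = ucs_cs c (x :: 'a ucs)"
definition "adj x = ucs_adj (x :: 'a ucs)"

instance
proof
  fix X :: "nat \<Rightarrow> 'a ucs" assume "Cauchy X"
  then have C: "\<exists>N. \<forall>a\<ge>N. \<forall>b\<ge>N. norm (X a - X b) < e" if "e > 0" for e
    using that by (simp add: Cauchy_iff)
  have "Cauchy (\<lambda>n. ucs0 (X n))"
  proof (rule CauchyI)
    fix e :: real assume "e > 0"
    then obtain N where N: "\<forall>a\<ge>N. \<forall>b\<ge>N. norm (X a - X b) < e" using C by blast
    have "cmod (ucs0 (X a) - ucs0 (X b)) \<le> norm (X a - X b)" for a b
      using ucs0_le_bound[of "X a - X b"] by (simp add: ucs0_sub norm_ucs_def)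
    then show "\<exists>M. \<forall>m\<ge>M. \<forall>n\<ge>M. cmod (ucs0 (X m) - ucs0 (X n)) < e"
      using N by (meson order_le_less_trans)
  qed
  then obtain l where l: "(\<lambda>n. ucs0 (X n)) \<longlonglongrightarrow> l" using Cauchy_convergent_iff convergent_def by blast
  have "\<exists>L\<in>ca_carrier S. \<forall>\<epsilon>>0. \<exists>N. \<forall>a\<ge>N. ca_norm S (ca_sub S (ucs_at (X a) S) L) < \<epsilon>"
    if S: "unital_cstar_algebra S" for S
  proof (rule ucalg.complete[OF ucalg.intro[OF S]])
    show "ucs_at (X k) S \<in> ca_carrier S" for k using S by simp
    fix e :: real assume "e > 0"
    then obtain N where N: "\<forall>a\<ge>N. \<forall>b\<ge>N. norm (X a - X b) < e" using C by blast
    have "ca_norm S (ca_sub S (ucs_at (X a) S) (ucs_at (X b) S)) \<le> norm (X a - X b)" for a b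
      using ucs_at_le_bound[OF S, of "X a - X b"] by (simp add: ucs_at_sub S norm_ucs_def)
    then show "\<exists>N. \<forall>a\<ge>N. \<forall>b\<ge>N. ca_norm S (ca_sub S (ucs_at (X a) S) (ucs_at (X b) S)) < e"
      using N by (meson order_le_less_trans)
  qed
  then obtain L where L: "\<And>S. unital_cstar_algebra S \<Longrightarrow> L S \<in> ca_carrier S"
    and Lim: "\<And>S \<epsilon>. unital_cstar_algebra S \<Longrightarrow> \<epsilon> > 0 \<Longrightarrow> \<exists>N. \<forall>a\<ge>N. ca_norm S (ca_sub S (ucs_at (X a) S) (L S)) < \<epsilon>"
    by metis
  \<comment> \<open>The Cauchy estimate does not depend on \<open>S\<close>, so the limits
    \<open>L S\<close>, found in each algebra separately, are approached uniformly. This yields both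
    the bound that makes \<open>L\<close> an element of the type and the convergence in
    norm.\<close>
  have U: "ca_norm S (ca_sub S (ucs_at (X a) S) (L S)) \<le> e"
    if N: "\<forall>a\<ge>N. \<forall>b\<ge>N. norm (X a - X b) < e / 2" and "e > 0" "a \<ge> N" and S: "unital_cstar_algebra S" for N e a S
  proof -
    interpret ucalg S using S by (rule ucalg.intro)
    obtain N' where N': "\<forall>a\<ge>N'. ca_norm S (ca_sub S (ucs_at (X a) S) (L S)) < e / 2"
      using Lim[OF S, of "e / 2"] \<open>e > 0\<close> by auto
    define b where "b = max N N'"
    have 1: "ca_norm S (ca_sub S (ucs_at (X b) S) (L S)) < e / 2" using N' by (simp add: b_def)
    have "ca_norm S (ca_sub S (ucs_at (X a) S) (ucs_at (X b) S)) \<le> norm (X a - X b)"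
      using ucs_at_le_bound[OF S, of "X a - X b"] by (simp add: ucs_at_sub S norm_ucs_def)
    also have "\<dots> < e / 2" using N \<open>a \<ge> N\<close> by (simp add: b_def)
    finally have 2: "ca_norm S (ca_sub S (ucs_at (X a) S) (ucs_at (X b) S)) < e / 2" .
    show ?thesis using 1 2 L[OF S] S norm_triangle_ineq[of "emb S (ucs_at (X a) S) - emb S (ucs_at (X b) S)" "emb S (ucs_at (X b) S) - emb S (L S)"]
      by (simp add: norm_sub)
  qed
  obtain N1 where N1: "\<forall>a\<ge>N1. \<forall>b\<ge>N1. norm (X a - X b) < 1 / 2" using C[of "1/2"] by auto
  have B: "ca_norm S (L S) \<le> norm (X N1) + 1" if S: "unital_cstar_algebra S" for S
  proof -
    interpret ucalg S using S by (rule ucalg.intro)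
    have "ca_norm S (ca_sub S (ucs_at (X N1) S) (L S)) \<le> 1" using U[OF N1, of N1 S] S by simp
    moreover have "ca_norm S (ucs_at (X N1) S) \<le> norm (X N1)" unfolding norm_ucs_def by (rule ucs_at_le_bound[OF S])
    moreover have "norm (emb S (L S)) \<le> norm (emb S (ucs_at (X N1) S)) + norm (emb S (ucs_at (X N1) S) - emb S (L S))"
      using norm_triangle_sub[of "emb S (L S)" "emb S (ucs_at (X N1) S)"] by (simp add: norm_minus_commute)
    ultimately show ?thesis using L[OF S] S by (simp add: norm_sub norm_emb)
  qed
  define Y where "Y = ucs_of l L"
  have Y0: "ucs0 Y = l" unfolding Y_def by (rule ucs_of_eval(1), erule L, erule B)
  have YS: "unital_cstar_algebra S \<Longrightarrow> ucs_at Y S = L S" for S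
    unfolding Y_def by (rule ucs_of_eval(2), erule L, erule B, assumption)
  have "X \<longlonglongrightarrow> Y"
  proof (rule LIMSEQ_I)
    fix r :: real assume "r > 0"
    define e where "e = r / 2"
    have e: "e > 0" "e < r" using \<open>r > 0\<close> by (auto simp: e_def)
    then obtain N where N: "\<forall>a\<ge>N. \<forall>b\<ge>N. norm (X a - X b) < e / 2" using C[of "e / 2"] by auto
    obtain N' where N': "\<forall>a\<ge>N'. norm (ucs0 (X a) - l) < e" using LIMSEQ_D[OF l e(1)] by auto
    have "norm (X a - Y) \<le> e" if "a \<ge> max N N'" for a
      unfolding norm_ucs_def
    proof (rule ucs_bound_least)
      show "cmod (ucs0 (X a - Y)) \<le> e" using N' that by (simp add: ucs0_sub Y0 less_imp_le)
      show "ca_norm S (ucs_at (X a - Y) S) \<le> e" if "unital_cstar_algebra S" for S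
        using U[OF N e(1) _ that, of a] \<open>a \<ge> max N N'\<close> by (simp add: ucs_at_sub that YS)
    qed
    then show "\<exists>no. \<forall>n\<ge>no. norm (X n - Y) < r" using e(2) by (meson order_le_less_trans)
  qed
  then show "convergent X" by (auto simp: convergent_def)
next
  fix x y :: "'a ucs" and c d :: complex and r :: real
  note e = ucs_eval ucs_at_eval cs_ucs_def adj_ucs_def
  note I = ucalg.intro
  show "c *\<^sub>C (x + y) = c *\<^sub>C x + c *\<^sub>C y" "(c + d) *\<^sub>C x = c *\<^sub>C x + d *\<^sub>C x"
    "c *\<^sub>C d *\<^sub>C x = (c * d) *\<^sub>C x" "complex_of_real r *\<^sub>C x = r *\<^sub>R x"
    by (rule ucs_eqI; simp add: e ucalg.smult_laws[OF I] algebra_simps)+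
  show "c *\<^sub>C x * y = c *\<^sub>C (x * y)" "x * c *\<^sub>C y = c *\<^sub>C (x * y)"
    by (rule ucs_eqI; simp add: e ucalg.mul_laws[OF I] algebra_simps)+
  show "adj (adj x) = x" "adj (x + y) = adj x + adj y" "adj (x * y) = adj y * adj x" "adj (c *\<^sub>C x) = cnj c *\<^sub>C adj x"
    by (rule ucs_eqI; simp add: e ucalg.star_laws[OF I] algebra_simps)+
  show "norm (c *\<^sub>C x) = cmod c * norm x"
  proof -
    have le: "norm (t *\<^sub>C w) \<le> cmod t * norm w" for t and w :: "'a ucs"
      unfolding norm_ucs_def
      by (rule ucs_bound_least)
        (auto simp: e norm_mult ucalg.norm_laws[OF I] intro!: mult_left_mono ucs_at_le_bound ucs0_le_bound)
    show ?thesis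
    proof (cases "c = 0")
      case True
      then show ?thesis using le[of 0 x] by simp
    next
      case False
      have "x = inverse c *\<^sub>C c *\<^sub>C x"
        by (rule ucs_eqI) (use False in \<open>simp_all add: e ucalg.smult_laws[OF I]\<close>)
      then have "norm x \<le> cmod (inverse c) * norm (c *\<^sub>C x)" using le[of "inverse c" "c *\<^sub>C x"] by simp
      then have "cmod c * norm x \<le> norm (c *\<^sub>C x)" using False by (simp add: norm_divide field_simps)
      then show ?thesis using le[of c x] by simp
    qed
  qed
  show "norm (adj x * x) = (norm x)\<^sup>2"
  proof (rule antisym)
    have "norm (adj x) \<le> norm x" unfolding norm_ucs_def
    proof (rule ucs_bound_least)
      show "cmod (ucs0 (adj x)) \<le> ucs_bound x" by (simp add: e ucs0_le_bound)
      show "ca_norm S (ucs_at (adj x) S) \<le> ucs_bound x" if "unital_cstar_algebra S" for S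
        using ca_norm_star_le[OF that, of "ucs_at x S"] ucs_at_le_bound[OF that, of x] that by (simp add: e)
    qed
    then show "norm (adj x * x) \<le> (norm x)\<^sup>2"
      unfolding power2_eq_square by (intro order_trans[OF norm_mult_ineq] mult_right_mono) auto
    have "norm x \<le> sqrt (norm (adj x * x))" unfolding norm_ucs_def
    proof (rule ucs_bound_least)
      have "(cmod (ucs0 x))\<^sup>2 = cmod (ucs0 (adj x * x))" by (simp add: e norm_mult power2_eq_square)
      also have "\<dots> \<le> ucs_bound (adj x * x)" by (rule ucs0_le_bound)
      finally show "cmod (ucs0 x) \<le> sqrt (ucs_bound (adj x * x))" by (rule real_le_rsqrt)
      fix S :: "'a calg" assume S: "unital_cstar_algebra S"
      have "(ca_norm S (ucs_at x S))\<^sup>2 = ca_norm S (ucs_at (adj x * x) S)"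
        using S by (simp add: e ucalg.norm_laws(6)[OF I])
      also have "\<dots> \<le> ucs_bound (adj x * x)" by (rule ucs_at_le_bound[OF S])
      finally show "ca_norm S (ucs_at x S) \<le> sqrt (ucs_bound (adj x * x))" by (rule real_le_rsqrt)
    qed
    then have "(norm x)\<^sup>2 \<le> (sqrt (norm (adj x * x)))\<^sup>2" by (intro power_mono) auto
    then show "(norm x)\<^sup>2 \<le> norm (adj x * x)" by simp
  qed
qed

end

instantiation complex :: cstar
begin

definition "cs c x = c * (x :: complex)"
definition "adj x = cnj (x :: complex)"

instance
  by standard (auto simp: cs_complex_def adj_complex_def algebra_simps norm_mult power2_eq_square scaleR_conv_of_real)

end

context ucalg
begin

lemma emb_smult: "x \<in> ca_carrier S \<Longrightarrow> emb S (ca_smult S c x) = c *\<^sub>C emb S x"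
  by (simp add: emb_smult0 cs_ucs_def)

lemma emb_star: "x \<in> ca_carrier S \<Longrightarrow> emb S (ca_star S x) = adj (emb S x)"
  by (simp add: emb_star0 adj_ucs_def)

text \<open>On the complement of the copy of \<open>S\<close> the element
  \<open>c *\<^sub>C 1 - emb S h\<close> acts as the scalar \<open>c\<close>. An inverse found in
  \<open>S\<close> is therefore completed by \<open>inverse c\<close> times the complementary
  projection \<open>1 - E\<close>, which needs \<open>c \<noteq> 0\<close>.\<close>

lemma invertible_emb:
  assumes h: "h \<in> ca_carrier S"
  shows "iv (c *\<^sub>C 1 - emb S h) \<Longrightarrow> invertible_in S (ca_sub S (ca_smult S c (ca_one S)) h)"
    and "c \<noteq> 0 \<Longrightarrow> invertible_in S (ca_sub S (ca_smult S c (ca_one S)) h) \<Longrightarrow> iv (c *\<^sub>C 1 - emb S h)"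
proof -
  assume "iv (c *\<^sub>C 1 - emb S h)"
  then obtain y where y: "(c *\<^sub>C 1 - emb S h) * y = 1" "y * (c *\<^sub>C 1 - emb S h) = 1" unfolding iv_def by blast
  have "ucs_at ((c *\<^sub>C 1 - emb S h) * y) S = ca_one S" "ucs_at (y * (c *\<^sub>C 1 - emb S h)) S = ca_one S"
    unfolding y by (simp_all add: ucs_at_eval uc)
  then show "invertible_in S (ca_sub S (ca_smult S c (ca_one S)) h)"
    unfolding invertible_in_def
    by (intro bexI[of _ "ucs_at y S"]) (simp_all add: ucs_at_eval ucs_at_sub emb_eval h uc cs_ucs_def)
next
  assume c: "c \<noteq> 0" and "invertible_in S (ca_sub S (ca_smult S c (ca_one S)) h)"
  then obtain y where y: "y \<in> ca_carrier S" "ca_mul S (ca_sub S (ca_smult S c (ca_one S)) h) y = ca_one S"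
    "ca_mul S y (ca_sub S (ca_smult S c (ca_one S)) h) = ca_one S" unfolding invertible_in_def by blast
  define E where "E = emb S (ca_one S)"
  have Eh: "E * emb S h = emb S h" "emb S h * E = emb S h" "E * emb S y = emb S y" "emb S y * E = emb S y"
    using h y(1) unfolding E_def by (simp_all flip: emb_mul add: mul_laws)
  have 1: "(c *\<^sub>C E - emb S h) * emb S y = E"
    using arg_cong[OF y(2), of "emb S"] h y(1) by (simp add: emb_mul emb_sub emb_smult E_def)
  have 2: "emb S y * (c *\<^sub>C E - emb S h) = E"
    using arg_cong[OF y(3), of "emb S"] h y(1) by (simp add: emb_mul emb_sub emb_smult E_def)
  show "iv (c *\<^sub>C 1 - emb S h)" unfolding iv_def
  proof (intro exI conjI)
    let ?z = "emb S y + inverse c *\<^sub>C (1 - E)"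
    show "(c *\<^sub>C 1 - emb S h) * ?z = 1"
      using 1 c by (simp add: algebra_simps Eh cs_diff_right cs_add_right)
    show "?z * (c *\<^sub>C 1 - emb S h) = 1"
      using 2 c by (simp add: algebra_simps Eh cs_diff_right cs_add_right)
  qed
qed

text \<open>Away from \<open>0\<close> the spectra of \<open>h\<close> and \<open>emb S h\<close>
  agree, and \<open>0\<close> does no harm because \<open>spec_radius\<close> includes it in any
  case. What remains is that a self-adjoint element attains its norm in the spectrum.\<close>

lemma spec_radius_eq_norm:
  assumes h: "h \<in> ca_carrier S" and sa: "ca_star S h = h" shows "spec_radius S h = ca_norm S h"
proof -
  define X where "X = insert 0 {cmod l | l. \<not> invertible_in S (ca_sub S (ca_smult S l (ca_one S)) h)}"
  have up: "x \<le> ca_norm S h" if xX: "x \<in> X" for x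
  proof (cases "x = 0")
    case True then show ?thesis using norm_laws(1)[OF h] by simp
  next
    case False
    then obtain l where l: "x = cmod l" "\<not> invertible_in S (ca_sub S (ca_smult S l (ca_one S)) h)"
      using xX False unfolding X_def by blast
    then have "spec (emb S h) l" using invertible_emb(1)[OF h, of l] by (auto simp: spec_def)
    then show ?thesis using spec_norm[of "emb S h" l] by (simp add: norm_emb[OF h] l(1))
  qed
  have mem: "ca_norm S h \<in> X"
  proof (cases "ca_norm S h = 0")
    case False
    have "adj (emb S h) = emb S h" using emb_star[OF h] sa by simp
    then obtain r where r: "spec (emb S h) (complex_of_real r)" "\<bar>r\<bar> = norm (emb S h)"
      using spec_radius_self_adjoint by blast
    have "complex_of_real r \<noteq> 0" using r(2) False norm_emb[OF h] by auto
    then have "\<not> invertible_in S (ca_sub S (ca_smult S (complex_of_real r) (ca_one S)) h)"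
      using invertible_emb(2)[OF h] r(1) unfolding spec_def by blast
    moreover have "ca_norm S h = cmod (complex_of_real r)" using r(2) norm_emb[OF h] by simp
    ultimately show ?thesis unfolding X_def by blast
  qed (simp add: X_def)
  have "spec_radius S h = Sup X" by (simp add: spec_radius_def X_def)
  also have "\<dots> = ca_norm S h" by (rule cSup_eq_maximum[OF mem up])
  finally show ?thesis .
qed

end

subsection \<open>Matrices over a C*-algebra form a C*-algebra\<close>

lemma mmul_assoc: "mmul n (mmul n X Y) Z = mmul n X (mmul n Y Z)"
proof (intro ext)
  fix i k
  have "mmul n (mmul n X Y) Z i k = (\<Sum>j<n. \<Sum>l<n. X i l * (Y l j * Z j k))"
    by (simp add: mmul_def sum_distrib_right mult.assoc)
  also have "\<dots> = (\<Sum>l<n. \<Sum>j<n. X i l * (Y l j * Z j k))" by (rule sum.swap)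
  finally show "mmul n (mmul n X Y) Z i k = mmul n X (mmul n Y Z) i k" by (simp add: mmul_def sum_distrib_left)
qed

lemma mmul_add_right: "mmul n X (\<lambda>i j. Y i j + Z i j) = (\<lambda>i j. mmul n X Y i j + mmul n X Z i j)"
  by (simp add: mmul_def distrib_left sum.distrib)

lemma mmul_add_left: "mmul n (\<lambda>i j. Y i j + Z i j) X = (\<lambda>i j. mmul n Y X i j + mmul n Z X i j)"
  by (simp add: mmul_def distrib_right sum.distrib)

lemma mmul_cs_left: "mmul n (\<lambda>i j. c *\<^sub>C X i j) Y = (\<lambda>i j. c *\<^sub>C mmul n X Y i j)"
  by (simp add: mmul_def cs_sum_right)

lemma mmul_cs_right: "mmul n X (\<lambda>i j. c *\<^sub>C Y i j) = (\<lambda>i j. c *\<^sub>C mmul n X Y i j)"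
  by (simp add: mmul_def cs_sum_right)

lemma madj_mmul: "madj (mmul n X Y) = mmul n (madj Y) (madj X)"
  by (simp add: madj_def mmul_def)

text \<open>An isometric representation that need not be unital. Beside \<open>emb S\<close> and the
  identity on \<open>CC\<close>, the later instances are corners: \<open>mu s s\<close> places
  \<open>A\<close> on the diagonal of its matrix algebra, and \<open>cem k\<close> places
  \<open>cmat l\<close> inside \<open>cmat k\<close>.\<close>

locale crep = ucalg S for S :: "'a calg" +
  fixes e :: "'a \<Rightarrow> 'b::cstar"
  assumes e_add: "x \<in> ca_carrier S \<Longrightarrow> y \<in> ca_carrier S \<Longrightarrow> e (ca_add S x y) = e x + e y"
    and e_mul: "x \<in> ca_carrier S \<Longrightarrow> y \<in> ca_carrier S \<Longrightarrow> e (ca_mul S x y) = e x * e y"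
    and e_smult: "x \<in> ca_carrier S \<Longrightarrow> e (ca_smult S c x) = c *\<^sub>C e x"
    and e_star: "x \<in> ca_carrier S \<Longrightarrow> e (ca_star S x) = adj (e x)"
    and norm_e: "x \<in> ca_carrier S \<Longrightarrow> norm (e x) = ca_norm S x"
begin

lemma e_zero [simp]: "e (ca_zero S) = 0"
  using norm_e[of "ca_zero S"] norm_zero by simp

lemma e_sub: assumes "x \<in> ca_carrier S" "y \<in> ca_carrier S" shows "e (ca_sub S x y) = e x - e y"
  unfolding ca_sub_def using assms by (simp add: e_add e_smult)

lemma sub_in [simp, intro]: "x \<in> ca_carrier S \<Longrightarrow> y \<in> ca_carrier S \<Longrightarrow> ca_sub S x y \<in> ca_carrier S"
  by (simp add: ca_sub_def)

lemma e_inj: assumes "x \<in> ca_carrier S" "y \<in> ca_carrier S" "e x = e y" shows "x = y"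
proof -
  have "norm (e (ca_sub S x y)) = 0" unfolding e_sub[OF assms(1,2)] assms(3) by simp
  then have z: "ca_sub S x y = ca_zero S" using norm_e[of "ca_sub S x y"] norm_laws(2)[of "ca_sub S x y"] assms by simp
  have "x = ca_add S (ca_sub S x y) y"
    unfolding ca_sub_def using assms(1,2) add_laws(1)[of x "ca_smult S (-1) y" y] add_laws(2)[of y "ca_smult S (-1) y"]
      add_laws(4)[of y] add_laws(2)[of x "ca_zero S"] add_laws(3)[of x] by simp
  then show ?thesis unfolding z using assms(2) add_laws(3) by simp
qed

lemma e_one_mult: "x \<in> ca_carrier S \<Longrightarrow> e (ca_one S) * e x = e x" "x \<in> ca_carrier S \<Longrightarrow> e x * e (ca_one S) = e x"
  by (simp_all flip: e_mul add: mul_laws)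

lemma foldr_add:
  assumes "\<And>l. l \<in> set ls \<Longrightarrow> f l \<in> ca_carrier S"
  shows "foldr (\<lambda>l acc. ca_add S (f l) acc) ls (ca_zero S) \<in> ca_carrier S"
    and "e (foldr (\<lambda>l acc. ca_add S (f l) acc) ls (ca_zero S)) = (\<Sum>l\<leftarrow>ls. e (f l))"
proof -
  have "foldr (\<lambda>l acc. ca_add S (f l) acc) ls (ca_zero S) \<in> ca_carrier S \<and>
    e (foldr (\<lambda>l acc. ca_add S (f l) acc) ls (ca_zero S)) = (\<Sum>l\<leftarrow>ls. e (f l))"
    using assms by (induct ls) (simp_all add: e_add)
  then show "foldr (\<lambda>l acc. ca_add S (f l) acc) ls (ca_zero S) \<in> ca_carrier S"
    "e (foldr (\<lambda>l acc. ca_add S (f l) acc) ls (ca_zero S)) = (\<Sum>l\<leftarrow>ls. e (f l))" by auto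
qed

definition em :: "(nat \<Rightarrow> nat \<Rightarrow> 'a) \<Rightarrow> nat \<Rightarrow> nat \<Rightarrow> 'b" where
  "em X = (\<lambda>i j. e (X i j))"

lemma mat_in: "X \<in> ca_carrier (mat_alg0 S n) \<Longrightarrow> X i j \<in> ca_carrier S"
  by (cases "i < n \<and> j < n") (auto simp: mat_alg0_def)

lemma mat_out: "X \<in> ca_carrier (mat_alg0 S n) \<Longrightarrow> \<not> (i < n \<and> j < n) \<Longrightarrow> X i j = ca_zero S"
  by (auto simp: mat_alg0_def)

lemma em_inj: assumes "X \<in> ca_carrier (mat_alg0 S n)" "Y \<in> ca_carrier (mat_alg0 S n)" "em X = em Y" shows "X = Y"
proof (intro ext)
  fix i j
  have "e (X i j) = e (Y i j)" using assms(3) by (simp add: em_def fun_eq_iff)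
  then show "X i j = Y i j" using e_inj mat_in[OF assms(1)] mat_in[OF assms(2)] by blast
qed

lemma mat_closed [simp]:
  "ca_zero (mat_alg0 S n) \<in> ca_carrier (mat_alg0 S n)" "ca_one (mat_alg0 S n) \<in> ca_carrier (mat_alg0 S n)"
  "X \<in> ca_carrier (mat_alg0 S n) \<Longrightarrow> Y \<in> ca_carrier (mat_alg0 S n) \<Longrightarrow> ca_add (mat_alg0 S n) X Y \<in> ca_carrier (mat_alg0 S n)"
  "X \<in> ca_carrier (mat_alg0 S n) \<Longrightarrow> Y \<in> ca_carrier (mat_alg0 S n) \<Longrightarrow> ca_mul (mat_alg0 S n) X Y \<in> ca_carrier (mat_alg0 S n)"
  "X \<in> ca_carrier (mat_alg0 S n) \<Longrightarrow> ca_smult (mat_alg0 S n) c X \<in> ca_carrier (mat_alg0 S n)"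
  "X \<in> ca_carrier (mat_alg0 S n) \<Longrightarrow> ca_star (mat_alg0 S n) X \<in> ca_carrier (mat_alg0 S n)"
  by (auto simp: mat_alg0_def intro!: foldr_add)

lemma em_laws:
  "em (ca_zero (mat_alg0 S n)) = (\<lambda>i j. 0)"
  "X \<in> ca_carrier (mat_alg0 S n) \<Longrightarrow> Y \<in> ca_carrier (mat_alg0 S n) \<Longrightarrow>
    em (ca_add (mat_alg0 S n) X Y) = (\<lambda>i j. em X i j + em Y i j)"
  "X \<in> ca_carrier (mat_alg0 S n) \<Longrightarrow> Y \<in> ca_carrier (mat_alg0 S n) \<Longrightarrow> em (ca_mul (mat_alg0 S n) X Y) = mmul n (em X) (em Y)"
  "X \<in> ca_carrier (mat_alg0 S n) \<Longrightarrow> em (ca_smult (mat_alg0 S n) c X) = (\<lambda>i j. c *\<^sub>C em X i j)"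
  "X \<in> ca_carrier (mat_alg0 S n) \<Longrightarrow> em (ca_star (mat_alg0 S n) X) = madj (em X)"
proof -
  show "em (ca_zero (mat_alg0 S n)) = (\<lambda>i j. 0)" by (simp add: em_def mat_alg0_def)
  assume X: "X \<in> ca_carrier (mat_alg0 S n)"
  note x = mat_in[OF X] mat_out[OF X]
  show "em (ca_smult (mat_alg0 S n) c X) = (\<lambda>i j. c *\<^sub>C em X i j)" "em (ca_star (mat_alg0 S n) X) = madj (em X)"
    using x by (auto simp: em_def mat_alg0_def fun_eq_iff madj_def e_smult e_star)
  assume Y: "Y \<in> ca_carrier (mat_alg0 S n)"
  note y = mat_in[OF Y] mat_out[OF Y]
  show "em (ca_add (mat_alg0 S n) X Y) = (\<lambda>i j. em X i j + em Y i j)"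
    using x y by (auto simp: em_def mat_alg0_def fun_eq_iff e_add)
  show "em (ca_mul (mat_alg0 S n) X Y) = mmul n (em X) (em Y)"
  proof (intro ext)
    fix i j
    show "em (ca_mul (mat_alg0 S n) X Y) i j = mmul n (em X) (em Y) i j"
    proof (cases "i < n \<and> j < n")
      case True
      have "em (ca_mul (mat_alg0 S n) X Y) i j = e (foldr (\<lambda>l acc. ca_add S (ca_mul S (X i l) (Y l j)) acc) [0..<n] (ca_zero S))"
        using True by (simp add: em_def mat_alg0_def)
      also have "\<dots> = (\<Sum>l\<leftarrow>[0..<n]. e (ca_mul S (X i l) (Y l j)))" by (rule foldr_add) (simp add: x y)
      also have "\<dots> = (\<Sum>l<n. e (ca_mul S (X i l) (Y l j)))"
        by (simp add: interv_sum_list_conv_sum_set_nat atLeast0LessThan)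
      finally show ?thesis by (simp add: mmul_def em_def e_mul x y)
    next
      case False
      then have "X i l = ca_zero S \<or> Y l j = ca_zero S" for l using x(2) y(2) by blast
      then have "e (X i l) * e (Y l j) = 0" for l by (metis e_zero mult_zero_left mult_zero_right)
      then show ?thesis using False by (auto simp: mmul_def em_def mat_alg0_def)
    qed
  qed
qed

lemma em_one:
  assumes X: "X \<in> ca_carrier (mat_alg0 S n)"
  shows "mmul n (em (ca_one (mat_alg0 S n))) (em X) = em X" "mmul n (em X) (em (ca_one (mat_alg0 S n))) = em X"
proof -
  note x = mat_in[OF X] mat_out[OF X]
  have o: "em (ca_one (mat_alg0 S n)) i j = (if i < n \<and> j < n \<and> i = j then e (ca_one S) else 0)" for i j
    by (simp add: em_def mat_alg0_def)
  have z: "em X i j = 0" if "\<not> (i < n \<and> j < n)" for i j using x(2)[OF that] by (simp add: em_def)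
  have 1: "e (ca_one S) * em X i j = em X i j" "em X i j * e (ca_one S) = em X i j" for i j
    by (simp_all add: em_def e_one_mult x)
  show "mmul n (em (ca_one (mat_alg0 S n))) (em X) = em X"
  proof (intro ext)
    fix i k
    have "mmul n (em (ca_one (mat_alg0 S n))) (em X) i k = (\<Sum>j<n. if j = i then em X i k else 0)"
      unfolding mmul_def o by (intro sum.cong) (auto simp: 1)
    then show "mmul n (em (ca_one (mat_alg0 S n))) (em X) i k = em X i k" using z[of i k] by auto
  qed
  show "mmul n (em X) (em (ca_one (mat_alg0 S n))) = em X"
  proof (intro ext)
    fix i k
    have "mmul n (em X) (em (ca_one (mat_alg0 S n))) i k = (\<Sum>j<n. if j = k then em X i k else 0)"
      unfolding mmul_def o by (intro sum.cong) (auto simp: 1)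
    then show "mmul n (em X) (em (ca_one (mat_alg0 S n))) i k = em X i k" using z[of i k] by auto
  qed
qed

lemma em_sub: assumes "X \<in> ca_carrier (mat_alg0 S n)" "Y \<in> ca_carrier (mat_alg0 S n)"
  shows "em (ca_sub (mat_alg0 S n) X Y) = (\<lambda>i j. em X i j - em Y i j)"
  unfolding ca_sub_def using assms by (simp add: em_laws)

text \<open>The parameter \<open>N\<close> may take any value off the carrier, which matters because the norm of
  \<open>mat_alg\<close> is defined through the spectral radius.\<close>
lemma matrix_algebra_cstar:
  assumes N: "\<And>X. X \<in> ca_carrier (mat_alg0 S n) \<Longrightarrow> N X = opn n (em X)"
  shows "unital_cstar_algebra (mat_alg0 S n\<lparr>ca_norm := N\<rparr>)"
proof -
  define M where "M = mat_alg0 S n"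
  define C where "C = ca_carrier M"
  note fold = M_def[symmetric] C_def[symmetric]
  note cl = mat_closed[where n=n, unfolded M_def[symmetric], folded C_def]
  note lw = em_laws[where n=n, unfolded M_def[symmetric], folded C_def]
  note on = em_one[where n=n, unfolded M_def[symmetric], folded C_def]
  note inj = em_inj[where n=n, unfolded M_def[symmetric], folded C_def]
  note N' = N[unfolded M_def[symmetric], folded C_def]
  note sb = em_sub[where n=n, unfolded M_def[symmetric], folded C_def]
  have sc: "ca_sub M X Y \<in> C" if "X \<in> C" "Y \<in> C" for X Y using that by (simp add: ca_sub_def cl)
  have a1: "\<forall>x\<in>C. \<forall>y\<in>C. \<forall>w\<in>C. ca_add M (ca_add M x y) w = ca_add M x (ca_add M y w)"
    and a2: "\<forall>x\<in>C. \<forall>y\<in>C. ca_add M x y = ca_add M y x"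
    and a3: "\<forall>x\<in>C. ca_add M (ca_zero M) x = x"
    and a4: "\<forall>x\<in>C. ca_add M x (ca_smult M (-1) x) = ca_zero M"
    and s1: "\<forall>c. \<forall>x\<in>C. \<forall>y\<in>C. ca_smult M c (ca_add M x y) = ca_add M (ca_smult M c x) (ca_smult M c y)"
    and s2: "\<forall>c d. \<forall>x\<in>C. ca_smult M (c + d) x = ca_add M (ca_smult M c x) (ca_smult M d x)"
    and s3: "\<forall>c d. \<forall>x\<in>C. ca_smult M c (ca_smult M d x) = ca_smult M (c * d) x"
    and s4: "\<forall>x\<in>C. ca_smult M 1 x = x"
    by (intro allI ballI inj; simp add: cl lw algebra_simps cs_add_right cs_add_left)+
  have m1: "\<forall>x\<in>C. \<forall>y\<in>C. \<forall>w\<in>C. ca_mul M (ca_mul M x y) w = ca_mul M x (ca_mul M y w)"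
    by (intro ballI inj) (simp_all add: cl lw mmul_assoc)
  have m2: "\<forall>x\<in>C. ca_mul M (ca_one M) x = x \<and> ca_mul M x (ca_one M) = x"
    by (intro ballI conjI inj) (simp_all add: cl lw on)
  have m3: "\<forall>x\<in>C. \<forall>y\<in>C. \<forall>w\<in>C. ca_mul M x (ca_add M y w) = ca_add M (ca_mul M x y) (ca_mul M x w)
                          \<and> ca_mul M (ca_add M y w) x = ca_add M (ca_mul M y x) (ca_mul M w x)"
    by (intro ballI conjI inj) (simp_all add: cl lw mmul_add_left mmul_add_right)
  have m4: "\<forall>c. \<forall>x\<in>C. \<forall>y\<in>C. ca_smult M c (ca_mul M x y) = ca_mul M (ca_smult M c x) y \<and> ca_smult M c (ca_mul M x y) = ca_mul M x (ca_smult M c y)"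
    by (intro allI ballI conjI inj) (simp_all add: cl lw mmul_cs_left mmul_cs_right)
  have t1: "\<forall>x\<in>C. ca_star M (ca_star M x) = x"
    and t2: "\<forall>x\<in>C. \<forall>y\<in>C. ca_star M (ca_add M x y) = ca_add M (ca_star M x) (ca_star M y)"
    and t3: "\<forall>c. \<forall>x\<in>C. ca_star M (ca_smult M c x) = ca_smult M (cnj c) (ca_star M x)"
    by (intro allI ballI inj; simp add: cl lw; simp add: madj_def)+
  have t4: "\<forall>x\<in>C. \<forall>y\<in>C. ca_star M (ca_mul M x y) = ca_mul M (ca_star M y) (ca_star M x)"
    by (intro allI ballI inj) (simp_all add: cl lw madj_mmul)
  have n1: "\<forall>x\<in>C. 0 \<le> N x \<and> (N x = 0 \<longleftrightarrow> x = ca_zero M)"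
  proof (intro ballI conjI iffI)
    fix x assume x: "x \<in> C"
    show "0 \<le> N x" using x by (simp add: N')
    { assume "N x = 0"
      then have o: "opn n (em x) = 0" using x by (simp add: N')
      show "x = ca_zero M"
      proof (rule inj[OF x cl(1)], intro ext)
        fix i j
        show "em x i j = em (ca_zero M) i j"
        proof (cases "i < n \<and> j < n")
          case True
          then show ?thesis using norm_le_opn[of i n j "em x"] o by (simp add: lw)
        next
          case False
          then show ?thesis using mat_out[of x n i j] x by (auto simp: em_def C_def M_def mat_alg0_def)
        qed
      qed }
    assume "x = ca_zero M"
    moreover have "opn n (\<lambda>i j. 0 :: 'b) \<le> 0" using opn_le_sum[of n "\<lambda>i j. 0 :: 'b"] by simp
    ultimately show "N x = 0" using x by (simp add: N' lw antisym)
  qed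
  have n2: "\<forall>x\<in>C. \<forall>y\<in>C. N (ca_add M x y) \<le> N x + N y"
    by (simp add: N' cl lw opn_add)
  have n3: "\<forall>c. \<forall>x\<in>C. N (ca_smult M c x) = cmod c * N x"
    by (simp add: N' cl lw opn_cs)
  have n4: "\<forall>x\<in>C. \<forall>y\<in>C. N (ca_mul M x y) \<le> N x * N y"
    by (simp add: N' cl lw opn_mmul)
  have n5: "\<forall>x\<in>C. N (ca_mul M (ca_star M x) x) = (N x)\<^sup>2"
    by (simp add: N' cl lw opn_madj_mmul)
  have c: "\<exists>L\<in>C. \<forall>\<epsilon>>0. \<exists>K. \<forall>a\<ge>K. N (ca_sub M (X a) L) < \<epsilon>"
    if X: "\<And>k. X k \<in> C" and Ca: "\<And>\<epsilon>. \<epsilon> > 0 \<Longrightarrow> \<exists>K. \<forall>a\<ge>K. \<forall>b\<ge>K. N (ca_sub M (X a) (X b)) < \<epsilon>"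
    for X :: "nat \<Rightarrow> nat \<Rightarrow> nat \<Rightarrow> 'a"
  proof -
    have Xc: "X k i j \<in> ca_carrier S" for k i j using X mat_in unfolding C_def M_def by blast
    have "\<exists>L\<in>ca_carrier S. \<forall>\<epsilon>>0. \<exists>K. \<forall>a\<ge>K. ca_norm S (ca_sub S (X a i j) L) < \<epsilon>"
      if "i < n" "j < n" for i j
    proof (rule complete)
      show "X k i j \<in> ca_carrier S" for k by (rule Xc)
      fix \<epsilon> :: real assume "\<epsilon> > 0"
      then obtain K where K: "\<forall>a\<ge>K. \<forall>b\<ge>K. N (ca_sub M (X a) (X b)) < \<epsilon>" using Ca by blast
      have "ca_norm S (ca_sub S (X a i j) (X b i j)) \<le> N (ca_sub M (X a) (X b))" for a b
        using norm_le_opn[OF that, of "em (ca_sub M (X a) (X b))"] Xc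
        by (simp add: N' sc X sb) (simp add: em_def flip: e_sub norm_e)
      then show "\<exists>K. \<forall>a\<ge>K. \<forall>b\<ge>K. ca_norm S (ca_sub S (X a i j) (X b i j)) < \<epsilon>"
        using K by (meson order_le_less_trans)
    qed
    then obtain L where L: "\<And>i j. i < n \<Longrightarrow> j < n \<Longrightarrow> L i j \<in> ca_carrier S"
      and Lim: "\<And>i j \<epsilon>. i < n \<Longrightarrow> j < n \<Longrightarrow> \<epsilon> > 0 \<Longrightarrow> \<exists>K. \<forall>a\<ge>K. ca_norm S (ca_sub S (X a i j) (L i j)) < \<epsilon>"
      by metis
    define Y where "Y = (\<lambda>i j. if i < n \<and> j < n then L i j else ca_zero S)"
    have Y: "Y \<in> C" using L by (auto simp: C_def M_def mat_alg0_def Y_def)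
    have lim: "(\<lambda>a. norm (e (X a i j) - e (L i j))) \<longlonglongrightarrow> 0" if ij: "i < n" "j < n" for i j
    proof (rule LIMSEQ_I)
      fix r :: real assume "r > 0"
      then obtain K where "\<forall>a\<ge>K. ca_norm S (ca_sub S (X a i j) (L i j)) < r" using Lim ij by blast
      then show "\<exists>K. \<forall>a\<ge>K. norm (norm (e (X a i j) - e (L i j)) - 0) < r"
        using L[OF ij] Xc by (auto simp flip: e_sub norm_e)
    qed
    have "(\<lambda>a. \<Sum>i<n. \<Sum>j<n. norm (e (X a i j) - e (L i j))) \<longlonglongrightarrow> (\<Sum>i<n. \<Sum>j<n. 0)"
      by (intro tendsto_sum lim) auto
    then have lims: "(\<lambda>a. \<Sum>i<n. \<Sum>j<n. norm (e (X a i j) - e (L i j))) \<longlonglongrightarrow> 0" by simp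
    have le: "N (ca_sub M (X a) Y) \<le> (\<Sum>i<n. \<Sum>j<n. norm (e (X a i j) - e (L i j)))" for a
    proof -
      have "N (ca_sub M (X a) Y) \<le> (\<Sum>i<n. \<Sum>j<n. norm (em (X a) i j - em Y i j))"
        using opn_le_sum[of n "\<lambda>i j. em (X a) i j - em Y i j"] by (simp add: N' sc X Y sb)
      also have "\<dots> = (\<Sum>i<n. \<Sum>j<n. norm (e (X a i j) - e (L i j)))"
        by (intro sum.cong) (auto simp: em_def Y_def)
      finally show ?thesis .
    qed
    show ?thesis
    proof (intro bexI[OF _ Y] allI impI)
      fix \<epsilon> :: real assume "\<epsilon> > 0"
      then have "eventually (\<lambda>a. (\<Sum>i<n. \<Sum>j<n. norm (e (X a i j) - e (L i j))) < \<epsilon>) sequentially"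
        using lims by (rule order_tendstoD(2)[rotated])
      then show "\<exists>K. \<forall>a\<ge>K. N (ca_sub M (X a) Y) < \<epsilon>"
        unfolding eventually_sequentially using le by (meson order_le_less_trans)
    qed
  qed
  have subM: "ca_sub (M\<lparr>ca_norm := N\<rparr>) X Y = ca_sub M X Y" for X Y by (simp add: ca_sub_def)
  have c': "\<forall>X::nat \<Rightarrow> nat \<Rightarrow> nat \<Rightarrow> 'a. (\<forall>k. X k \<in> C) \<and>
          (\<forall>\<epsilon>>0. \<exists>K. \<forall>a\<ge>K. \<forall>b\<ge>K. N (ca_sub M (X a) (X b)) < \<epsilon>) \<longrightarrow>
          (\<exists>L\<in>C. \<forall>\<epsilon>>0. \<exists>K. \<forall>a\<ge>K. N (ca_sub M (X a) L) < \<epsilon>)"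
    by (intro allI impI c) blast+
  have cl': "ca_zero M \<in> C" "ca_one M \<in> C" "\<forall>x\<in>C. \<forall>y\<in>C. ca_add M x y \<in> C \<and> ca_mul M x y \<in> C"
    "\<forall>c. \<forall>x\<in>C. ca_smult M c x \<in> C" "\<forall>x\<in>C. ca_star M x \<in> C"
    by (simp_all add: cl)
  have sel: "ca_carrier (M\<lparr>ca_norm := N\<rparr>) = C" "ca_add (M\<lparr>ca_norm := N\<rparr>) = ca_add M"
    "ca_mul (M\<lparr>ca_norm := N\<rparr>) = ca_mul M" "ca_smult (M\<lparr>ca_norm := N\<rparr>) = ca_smult M"
    "ca_star (M\<lparr>ca_norm := N\<rparr>) = ca_star M" "ca_one (M\<lparr>ca_norm := N\<rparr>) = ca_one M"
    "ca_zero (M\<lparr>ca_norm := N\<rparr>) = ca_zero M" "ca_norm (M\<lparr>ca_norm := N\<rparr>) = N"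
    by (simp_all add: C_def)
  show ?thesis
    unfolding unital_cstar_algebra_def Let_def M_def[symmetric] sel subM
    by (intro conjI cl' a1 a2 a3 a4 s1 s2 s3 s4 m1 m2 m3 m4 t1 t2 t3 t4 n1 n2 n3 n4 n5 c')
qed

end

lemma crep_emb: "unital_cstar_algebra S \<Longrightarrow> crep S (emb S)"
  by (intro crep.intro crep_axioms.intro ucalg.intro)
     (simp_all add: ucalg.emb_add ucalg.emb_mul ucalg.emb_smult ucalg.emb_star ucalg.norm_emb ucalg_def)

lemma spec_radius_norm_update: "spec_radius (S\<lparr>ca_norm := N\<rparr>) x = spec_radius S x"
  by (simp add: spec_radius_def invertible_in_def ca_sub_def)

section \<open>The spectral-radius norm of \<open>mat_alg\<close> as an operator norm\<close>

text \<open>Equipped with the operator norm, \<open>mat_alg0 A n\<close> is a C*-algebra, so there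
  the spectral radius of \<open>X\<^sup>* X\<close> is the square of that norm. The spectral radius
  depends on the algebraic operations only, hence it is the one occurring in
  \<open>mat_alg\<close>.\<close>

lemma mat_alg_norm:
  assumes A: "unital_cstar_algebra A" and X: "X \<in> ca_carrier (mat_alg0 A n)"
  shows "ca_norm (mat_alg A n) X = opn n (\<lambda>i j. emb A (X i j))"
proof -
  interpret crep A "emb A" using A by (rule crep_emb)
  define M where "M = mat_alg0 A n\<lparr>ca_norm := \<lambda>X. opn n (em X)\<rparr>"
  have "unital_cstar_algebra M" unfolding M_def by (rule matrix_algebra_cstar) simp
  then interpret M: ucalg M by (rule ucalg.intro)
  define h where "h = ca_mul (mat_alg0 A n) (ca_star (mat_alg0 A n) X) X"
  have h: "h \<in> ca_carrier (mat_alg0 A n)" unfolding h_def using X by simp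
  have hM: "h = ca_mul M (ca_star M X) X" by (simp add: M_def h_def)
  have XM: "X \<in> ca_carrier M" using X by (simp add: M_def)
  have sa: "ca_star M h = h" unfolding hM using XM by (simp add: M.star_laws)
  have "spec_radius M h = ca_norm M h"
    by (rule M.spec_radius_eq_norm) (use h sa in \<open>simp_all add: M_def\<close>)
  also have "\<dots> = (ca_norm M X)\<^sup>2" unfolding hM by (rule M.norm_laws(6)[OF XM])
  finally have "spec_radius (mat_alg0 A n) h = (opn n (em X))\<^sup>2"
    unfolding M_def spec_radius_norm_update by simp
  then show ?thesis by (simp add: mat_alg_def h_def em_def)
qed

lemma mat_alg_cstar:
  assumes A: "unital_cstar_algebra A" shows "unital_cstar_algebra (mat_alg A n)"
proof -
  interpret crep A "emb A" using A by (rule crep_emb)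
  show ?thesis unfolding mat_alg_def
    by (rule matrix_algebra_cstar) (use mat_alg_norm[OF A] in \<open>simp add: em_def mat_alg_def\<close>)
qed

lemma CC_cstar: "unital_cstar_algebra CC"
proof -
  have "\<exists>L. \<forall>\<epsilon>>0. \<exists>N. \<forall>a\<ge>N. cmod (X a - L) < \<epsilon>"
    if "\<forall>\<epsilon>>0. \<exists>N. \<forall>a\<ge>N. \<forall>b\<ge>N. cmod (X a - X b) < \<epsilon>" for X :: "nat \<Rightarrow> complex"
  proof -
    have "Cauchy X" using that by (simp add: Cauchy_iff)
    then obtain L where "X \<longlonglongrightarrow> L" using Cauchy_convergent_iff convergent_def by blast
    then show ?thesis by (auto simp: LIMSEQ_iff)
  qed
  then show ?thesis
    unfolding unital_cstar_algebra_def Let_def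
    by (simp add: CC_def ca_sub_def algebra_simps norm_mult norm_triangle_ineq power2_eq_square)
qed

interpretation CCr: crep CC "\<lambda>x. x"
  by (intro crep.intro crep_axioms.intro ucalg.intro CC_cstar)
     (simp_all add: CC_def cs_complex_def adj_complex_def)

lemma mnorm_complex: "mnorm k v = sqrt (\<Sum>j<k. (cmod (v j))\<^sup>2)"
proof -
  have "mip k v v = complex_of_real (\<Sum>j<k. (cmod (v j))\<^sup>2)"
    by (simp add: mip_def adj_complex_def mult.commute flip: complex_norm_square)
  moreover have "(\<Sum>j<k. (cmod (v j))\<^sup>2) \<ge> 0" by (intro sum_nonneg) simp
  ultimately show ?thesis by (simp only: mnorm_def norm_of_real abs_of_nonneg)
qed

lemma op_norm_eq_opn: "op_norm k M = opn k M"
  unfolding op_norm_def opn_def mnorm_complex mvm_def by simp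

lemma cmat_cstar: "unital_cstar_algebra (cmat k)"
  unfolding cmat_def by (rule CCr.matrix_algebra_cstar) (simp add: op_norm_eq_opn CCr.em_def)

subsection \<open>Newton iteration for partial isometries\<close>

lemma norm_projection_le: assumes "f * f = f" "adj f = f" shows "norm (f :: 'a::cstar) \<le> 1"
proof -
  have "(norm f)\<^sup>2 = norm f" using norm_adj_mult[of f] assms by simp
  then have "norm f * (norm f - 1) = 0" by (simp add: power2_eq_square algebra_simps)
  then show ?thesis by auto
qed

text \<open>The norm of a projection is \<open>0\<close> or \<open>1\<close>. This gap turns an
  approximate equality of nested projections into an exact one.\<close>

lemma norm_projection_small: assumes "f * f = f" "adj f = f" "norm (f :: 'a::cstar) < 1" shows "f = 0"
proof -
  have "(norm f)\<^sup>2 = norm f" using norm_adj_mult[of f] assms by simp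
  then have "norm f * (norm f - 1) = 0" by (simp add: power2_eq_square algebra_simps)
  then show ?thesis using assms(3) by auto
qed

lemma norm_partial_isometry_le: assumes "adj v * v = f" "f * f = f" shows "norm (v :: 'a::cstar) \<le> 1"
proof -
  have "adj f = f" unfolding assms(1)[symmetric] by simp
  then have "(norm v)\<^sup>2 \<le> 1" using norm_adj_mult[of v] norm_projection_le[OF assms(2)] assms(1) by simp
  then show ?thesis using power2_le_imp_le[of "norm v" 1] by simp
qed

lemma partial_isometry_right: assumes "adj v * v = f" "f * f = f" shows "v * f = (v :: 'a::cstar)"
proof -
  have af: "adj f = f" unfolding assms(1)[symmetric] by simp
  have avv: "adj v * (v * y) = f * y" for y by (simp add: assms(1) flip: mult.assoc)
  have "adj (v - v * f) * (v - v * f) = f - f * f - f * f + f * (f * f)"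
    by (simp add: algebra_simps af assms(1) avv)
  then have "(norm (v - v * f))\<^sup>2 = 0" using norm_adj_mult[of "v - v * f"] assms(2) by simp
  then show ?thesis by simp
qed

lemma tendsto_adj: "(f \<longlongrightarrow> l) F \<Longrightarrow> ((\<lambda>x. adj (f x)) \<longlongrightarrow> adj (l :: 'a::cstar)) F"
  unfolding tendsto_iff by (simp add: dist_norm flip: adj_diff)

text \<open>\<open>T \<mapsto> T (3 f - T\<^sup>* T) / 2\<close> is Newton's iteration for the polar part of \<open>T\<close>; every left identity \<open>g\<close>
  of \<open>T\<close> survives it, which is how membership in an ideal and orthogonality conditions are kept.\<close>
lemma newton_partial_isometry:
  fixes T f :: "'a::cstar"
  assumes f: "f * f = f" "adj f = f" and Tf: "T * f = T" and d: "norm (adj T * T - f) \<le> d" "d \<le> 1/4"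
  shows "\<exists>W. W * f = W \<and> adj W * W = f \<and> norm (W - T) \<le> 2 * d \<and> (\<forall>g. g * T = T \<longrightarrow> g * W = W)
    \<and> (adj T = T \<longrightarrow> adj W = W)"
proof -
  define N where "N X = (1/2) *\<^sub>R (X * (3 *\<^sub>R f - adj X * X))" for X
  define t where "t j = (N ^^ j) T" for j
  have t0: "t 0 = T" and tS: "t (Suc j) = N (t j)" for j by (simp_all add: t_def)
  have d0: "0 \<le> d" using d(1) norm_ge_zero order_trans by blast
  have nf: "norm f \<le> 1" using f by (rule norm_projection_le)
  \<comment> \<open>With \<open>D = adj X * X - f\<close>, one step turns the defect into
    \<open>(D\<^sup>3 - 3 D\<^sup>2) / 4\<close>. It is at least quartered as long as
    \<open>norm D \<le> 1/4\<close>, whence the bound on \<open>d\<close>.\<close>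
  have inv: "t j * f = t j \<and> norm (adj (t j) * t j - f) \<le> d * (1/4) ^ j" for j
  proof (induct j)
    case 0 show ?case using Tf d by (simp add: t0)
  next
    case (Suc j)
    define X where "X = t j"
    define D where "D = adj X * X - f"
    have Xf: "X * f = X" and nD: "norm D \<le> d * (1/4) ^ j" using Suc by (auto simp: X_def D_def)
    have fX: "f * adj X = adj X" using arg_cong[OF Xf, of adj] f by simp
    have G: "adj X * X = f + D" by (simp add: D_def)
    have fD: "f * D = D" "D * f = D" unfolding D_def
      by (simp_all add: right_diff_distrib left_diff_distrib f(1) mult.assoc Xf) (simp flip: mult.assoc add: fX)
    have aD: "adj D = D" by (simp add: D_def f(2))
    have NX: "N X = (1/2) *\<^sub>R (X * (2 *\<^sub>R f - D))" unfolding N_def G by (simp add: scaleR_add_left[of 2 1 f, simplified] algebra_simps scaleR_2)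
    have "adj (N X) * N X = (1/4) *\<^sub>R ((2 *\<^sub>R f - D) * (adj X * X) * (2 *\<^sub>R f - D))"
      unfolding NX by (simp add: f(2) aD mult.assoc)
    also have "(2 *\<^sub>R f - D) * (adj X * X) * (2 *\<^sub>R f - D) = 4 *\<^sub>R f - 3 *\<^sub>R (D * D) + D * D * D"
    proof -
      have "(2 *\<^sub>R f - D) * (f + D) = 2 *\<^sub>R f + D - D * D"
        by (simp add: algebra_simps f(1) fD scaleR_2)
      moreover have "(2 *\<^sub>R f + D - D * D) * (2 *\<^sub>R f - D) = 4 *\<^sub>R f - 3 *\<^sub>R (D * D) + D * D * D"
      proof -
        have "D * D * f = D * D" by (simp add: mult.assoc fD)
        moreover have "3 *\<^sub>R (D * D) = D * D + 2 *\<^sub>R (D * D)" using scaleR_add_left[of 1 2 "D * D"] by simp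
        ultimately show ?thesis by (simp add: algebra_simps f(1) fD)
      qed
      ultimately show ?thesis by (simp add: G)
    qed
    finally have e: "adj (N X) * N X - f = (1/4) *\<^sub>R (D * D * D - 3 *\<^sub>R (D * D))"
      by (simp add: algebra_simps)
    have q: "(1/4 :: real) ^ j \<le> 1" by (simp add: power_le_one)
    have nD1: "norm D \<le> 1/4"
      using nD mult_mono[OF d(2) q] d0 by simp
    have DD: "norm (D * D) \<le> norm D * norm D" by (rule norm_mult_ineq)
    also have "\<dots> \<le> norm D * (1/4)" using nD1 by (intro mult_left_mono) auto
    finally have DD: "norm (D * D) \<le> norm D * (1/4)" .
    have DDD: "norm (D * D * D) \<le> norm (D * D) * (1/4)"
      by (rule order_trans[OF norm_mult_ineq]) (intro mult_left_mono nD1 norm_ge_zero)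
    have "norm (D * D * D - 3 *\<^sub>R (D * D)) \<le> norm (D * D * D) + 3 * norm (D * D)"
      by (rule order_trans[OF norm_triangle_ineq4]) simp
    also have "\<dots> \<le> norm D" using DD DDD norm_ge_zero[of D] by linarith
    finally have "norm (adj (N X) * N X - f) \<le> (1/4) * norm D" unfolding e by simp
    then have "norm (adj (N X) * N X - f) \<le> d * (1/4) ^ Suc j" using nD by simp
    moreover have "N X * f = N X" unfolding NX by (simp add: mult.assoc left_diff_distrib f(1) fD)
    ultimately show ?case by (simp add: tS X_def)
  qed
  \<comment> \<open>Steps of length at most \<open>d * (1/4) ^ j\<close> have total length at most
    \<open>4/3 * d\<close>, rounded up to \<open>2 * d\<close> in the conclusion.\<close>
  have step: "norm (t (Suc j) - t j) \<le> d * (1/4) ^ j" for j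
  proof -
    define X where "X = t j"
    have Xf: "X * f = X" and nD: "norm (adj X * X - f) \<le> d * (1/4) ^ j" using inv[of j] by (auto simp: X_def)
    have "N X = X + (1/2) *\<^sub>R (X * (f - adj X * X))"
    proof -
      have "3 *\<^sub>R X = X + 2 *\<^sub>R X" using scaleR_add_left[of 1 2 X] by simp
      then show ?thesis unfolding N_def by (simp add: algebra_simps Xf)
    qed
    then have "norm (N X - X) = 1/2 * norm (X * (f - adj X * X))" by simp
    also have "\<dots> \<le> 1/2 * (norm X * norm (f - adj X * X))" by (intro mult_left_mono norm_mult_ineq) simp
    also have "norm (f - adj X * X) = norm (adj X * X - f)" by (rule norm_minus_commute)
    finally have 1: "norm (N X - X) \<le> 1/2 * (norm X * norm (adj X * X - f))" .
    have "(1/4 :: real) ^ j \<le> 1" by (simp add: power_le_one)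
    then have dj: "d * (1/4) ^ j \<le> 1/4" using mult_mono[OF d(2), of "(1/4)^j" 1] d0 by simp
    have "(norm X)\<^sup>2 = norm ((adj X * X - f) + f)" using norm_adj_mult[of X] by simp
    also have "\<dots> \<le> norm (adj X * X - f) + norm f" by (rule norm_triangle_ineq)
    also have "\<dots> \<le> 2\<^sup>2" using nD dj nf by simp
    finally have "norm X \<le> 2" by (rule power2_le_imp_le) simp
    then have "norm X * norm (adj X * X - f) \<le> 2 * (d * (1/4) ^ j)"
      using nD by (intro mult_mono) auto
    then show ?thesis using 1 by (simp add: tS X_def)
  qed
  have sg: "summable (\<lambda>j. d * (1/4 :: real) ^ j)" by (intro summable_mult summable_geometric) simp
  have sn: "summable (\<lambda>j. norm (t (Suc j) - t j))"
    by (rule summable_comparison_test'[OF sg, of 0]) (simp add: step)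
  have s: "summable (\<lambda>j. t (Suc j) - t j)" by (rule summable_norm_cancel[OF sn])
  define W where "W = T + suminf (\<lambda>j. t (Suc j) - t j)"
  have "(\<lambda>k. \<Sum>j<k. t (Suc j) - t j) \<longlonglongrightarrow> suminf (\<lambda>j. t (Suc j) - t j)"
    using summable_LIMSEQ[OF s] .
  then have lim: "t \<longlonglongrightarrow> W"
    using tendsto_add[OF tendsto_const[of T], of "\<lambda>k. \<Sum>j<k. t (Suc j) - t j"]
    by (simp add: W_def sum_lessThan_telescope t0)
  have "norm (W - T) \<le> suminf (\<lambda>j. norm (t (Suc j) - t j))" unfolding W_def using summable_norm[OF sn] by simp
  also have "\<dots> \<le> suminf (\<lambda>j. d * (1/4) ^ j)" by (rule suminf_le[OF step sn sg])
  also have "\<dots> = d * suminf (\<lambda>j. (1/4::real) ^ j)" by (rule suminf_mult) (simp add: summable_geometric)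
  also have "\<dots> = d * (4/3)" by (subst suminf_geometric) simp_all
  also have "\<dots> \<le> 2 * d" using d0 by simp
  finally have nW: "norm (W - T) \<le> 2 * d" .
  have Wf: "W * f = W"
  proof -
    have "(\<lambda>j. t j * f) \<longlonglongrightarrow> W * f" by (intro tendsto_mult lim tendsto_const)
    then have "t \<longlonglongrightarrow> W * f" using inv by simp
    then show ?thesis using lim LIMSEQ_unique by blast
  qed
  have WW: "adj W * W = f"
  proof -
    have "(\<lambda>j. d * (1/4 :: real) ^ j) \<longlonglongrightarrow> 0" by (rule summable_LIMSEQ_zero[OF sg])
    then have "(\<lambda>j. adj (t j) * t j - f) \<longlonglongrightarrow> 0"
      by (rule Lim_null_comparison[rotated]) (use inv in simp)
    moreover have "(\<lambda>j. adj (t j) * t j - f) \<longlonglongrightarrow> adj W * W - f"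
      by (intro tendsto_diff tendsto_mult tendsto_adj lim tendsto_const)
    ultimately have "adj W * W - f = 0" using LIMSEQ_unique by blast
    then show ?thesis by simp
  qed
  have gW: "g * W = W" if g: "g * T = T" for g
  proof -
    have gt: "g * t j = t j" for j
    proof (induct j)
      case (Suc j)
      then show ?case by (simp add: tS N_def flip: mult.assoc)
    qed (simp add: t0 g)
    have "(\<lambda>j. g * t j) \<longlonglongrightarrow> g * W" by (intro tendsto_mult lim tendsto_const)
    then show ?thesis unfolding gt using lim LIMSEQ_unique by blast
  qed
  have aW: "adj W = W" if a: "adj T = T"
  proof -
    have at: "adj (t j) = t j" for j
    proof (induct j)
      case (Suc j)
      have "f * t j = t j" using arg_cong[OF conjunct1[OF inv[of j]], of adj] Suc f by simp
      then show ?case using inv[of j] Suc by (simp add: tS N_def algebra_simps f(2))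
    qed (simp add: t0 a)
    have "(\<lambda>j. adj (t j)) \<longlonglongrightarrow> adj W" by (intro tendsto_adj lim)
    then show ?thesis unfolding at using lim LIMSEQ_unique by blast
  qed
  show ?thesis using Wf WW nW gW aW by blast
qed

text \<open>The self-adjoint \<open>u = 2 e - E\<close> is almost a symmetry of the corner of
  \<open>E\<close>, since \<open>u\<^sup>2 - E = 4 (e\<^sup>2 - e)\<close>. Newton's iteration makes
  it an exact symmetry \<open>W\<close> without losing self-adjointness, and
  \<open>(W + E) / 2\<close> is a projection. The factor \<open>4\<close> turns the threshold
  \<open>1/4\<close> of the iteration into \<open>1/16\<close>.\<close>

lemma projection_near:
  fixes e E :: "'a::cstar"
  assumes E: "E * E = E" "adj E = E" and e: "e * E = e" "adj e = e" and d: "norm (e * e - e) \<le> d" "d \<le> 1/16"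
  shows "\<exists>q. q * q = q \<and> adj q = q \<and> E * q = q \<and> norm (q - e) \<le> 4 * d"
proof -
  define u where "u = 2 *\<^sub>R e - E"
  have Ee: "E * e = e" using arg_cong[OF e(1), of adj] E(2) e(2) by simp
  have uE: "u * E = u" "E * u = u" "adj u = u" by (simp_all add: u_def algebra_simps e E Ee)
  have "adj u * u - E = 4 *\<^sub>R (e * e - e)"
    unfolding uE(3) by (simp add: u_def algebra_simps e Ee E flip: scaleR_2)
  then have "norm (adj u * u - E) \<le> 4 * d" using d by simp
  then obtain W where W: "W * E = W" "adj W * W = E" "norm (W - u) \<le> 2 * (4 * d)" "E * W = W" "adj W = W"
    using newton_partial_isometry[OF E uE(1), of "4 * d"] d(2) uE by auto
  define q where "q = (1/2) *\<^sub>R (W + E)"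
  have "q * q = q" unfolding q_def using W E by (simp add: algebra_simps flip: scaleR_add_left)
  moreover have "adj q = q" by (simp add: q_def W E)
  moreover have "E * q = q" by (simp add: q_def algebra_simps W E)
  moreover have "q - e = (1/2) *\<^sub>R (W - u)" by (simp add: q_def u_def algebra_simps)
  ultimately show ?thesis using W(3) by auto
qed

subsection \<open>Asymptotic representations\<close>

definition rat_complex :: "complex set" where
  "rat_complex = {z. Re z \<in> \<rat> \<and> Im z \<in> \<rat>}"

text \<open>At index \<open>r\<close> take a \<open>z\<close> that meets the first
  \<open>G r\<close> requirements, with \<open>G r\<close> maximal below \<open>r\<close>; then
  \<open>G r\<close> tends to infinity. Requirement \<open>0\<close> is demanded at every
  \<open>r\<close>, which makes the maximum exist and keeps that requirement without
  exception.\<close>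

lemma diagonal_choice:
  assumes "\<And>J. eventually (\<lambda>r. \<exists>z. \<forall>j\<le>J. P j r z) sequentially" and "\<And>r. \<exists>z. P 0 r z"
  shows "\<exists>z. (\<forall>r. P 0 r (z r)) \<and> (\<forall>j::nat. eventually (\<lambda>r::nat. P j r (z r)) sequentially)"
proof -
  define G where "G r = (GREATEST J. J \<le> r \<and> (\<exists>z. \<forall>j\<le>J. P j r z))" for r
  have G: "G r \<le> r \<and> (\<exists>z. \<forall>j\<le>G r. P j r z)" for r
    unfolding G_def by (rule GreatestI_nat[of _ 0 r]) (use assms(2) in auto)
  then obtain z where z: "\<And>r j. j \<le> G r \<Longrightarrow> P j r (z r)" by metis
  have "eventually (\<lambda>r. P J r (z r)) sequentially" for J
    using assms(1)[of J] eventually_ge_at_top[of J]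
  proof eventually_elim
    case (elim r)
    have "J \<le> G r" unfolding G_def by (rule Greatest_le_nat[of _ _ r]) (use elim in auto)
    then show ?case by (rule z)
  qed
  then show ?thesis using z by blast
qed

text \<open>A member of \<open>Q\<close> pairs an element of the limit algebra with a sequence
  approximating it; in use, both are values of one polynomial, at the generators and at the
  microstates. Scalars are restricted to \<open>rat_complex\<close> because the enumeration controls
  rational polynomials only.\<close>

locale asymp =
  fixes Q :: "('b::cstar \<times> (nat \<Rightarrow> 'd::cstar)) set"
  assumes Q_add: "(c, z) \<in> Q \<Longrightarrow> (c', z') \<in> Q \<Longrightarrow> (c + c', \<lambda>r. z r + z' r) \<in> Q"
    and Q_mul: "(c, z) \<in> Q \<Longrightarrow> (c', z') \<in> Q \<Longrightarrow> (c * c', \<lambda>r. z r * z' r) \<in> Q"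
    and Q_adj: "(c, z) \<in> Q \<Longrightarrow> (adj c, \<lambda>r. adj (z r)) \<in> Q"
    and Q_cs: "(c, z) \<in> Q \<Longrightarrow> a \<in> rat_complex \<Longrightarrow> (a *\<^sub>C c, \<lambda>r. a *\<^sub>C z r) \<in> Q"
    and Q_norm: "(c, z) \<in> Q \<Longrightarrow> (\<lambda>r. norm (z r)) \<longlonglongrightarrow> norm c"
begin

text \<open>The closure of \<open>Q\<close>. Modulo sequences tending to \<open>0\<close> it is the
  graph of an isometric map respecting sums, products and adjoints, so every relation among
  represented elements holds along the sequences up to vanishing errors.\<close>

definition rep :: "'b \<Rightarrow> (nat \<Rightarrow> 'd) \<Rightarrow> bool" where
  "rep c z \<longleftrightarrow> (\<forall>\<epsilon>>0. \<exists>q s. (q, s) \<in> Q \<and> norm (c - q) < \<epsilon> \<and> eventually (\<lambda>r. norm (z r - s r) < \<epsilon>) sequentially)"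

lemma repD: "rep c z \<Longrightarrow> \<epsilon> > 0 \<Longrightarrow> \<exists>q s. (q, s) \<in> Q \<and> norm (c - q) < \<epsilon> \<and> eventually (\<lambda>r. norm (z r - s r) < \<epsilon>) sequentially"
  by (simp add: rep_def)

lemma rep_Q: "(c, z) \<in> Q \<Longrightarrow> rep c z"
  unfolding rep_def by (intro allI impI exI[of _ c] exI[of _ z]) auto

lemma rep_norm: assumes "rep c z" shows "(\<lambda>r. norm (z r)) \<longlonglongrightarrow> norm c"
  unfolding tendsto_iff
proof (intro allI impI)
  fix e :: real assume "e > 0"
  then obtain q s where q: "(q, s) \<in> Q" "norm (c - q) < e / 3" and ev: "eventually (\<lambda>r. norm (z r - s r) < e / 3) sequentially"
    using repD[OF assms, of "e / 3"] by auto
  have "eventually (\<lambda>r. dist (norm (s r)) (norm q) < e / 3) sequentially"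
    using tendstoD[OF Q_norm[OF q(1)], of "e / 3"] \<open>e > 0\<close> by simp
  then show "eventually (\<lambda>r. dist (norm (z r)) (norm c) < e) sequentially"
    using ev
  proof eventually_elim
    case (elim r)
    have "\<bar>norm (z r) - norm (s r)\<bar> < e / 3" using elim(2) norm_triangle_ineq3[of "z r" "s r"] by linarith
    moreover have "\<bar>norm c - norm q\<bar> < e / 3" using q(2) norm_triangle_ineq3[of c q] by linarith
    ultimately show ?case using elim(1) unfolding dist_real_def by linarith
  qed
qed

lemma rep_add: assumes "rep c z" "rep c' z'" shows "rep (c + c') (\<lambda>r. z r + z' r)"
  unfolding rep_def
proof (intro allI impI)
  fix e :: real assume e: "e > 0"
  obtain q s where q: "(q, s) \<in> Q" "norm (c - q) < e / 2" and ev: "eventually (\<lambda>r. norm (z r - s r) < e / 2) sequentially"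
    using repD[OF assms(1), of "e / 2"] e by auto
  obtain q' s' where q': "(q', s') \<in> Q" "norm (c' - q') < e / 2" and ev': "eventually (\<lambda>r. norm (z' r - s' r) < e / 2) sequentially"
    using repD[OF assms(2), of "e / 2"] e by auto
  have *: "norm (a + b - (x + y)) < e" if "norm (a - x) < e / 2" "norm (b - y) < e / 2" for a b x y :: "'x::real_normed_vector"
    using norm_diff_triangle_ineq[of a b x y] that by linarith
  have "eventually (\<lambda>r. norm (z r + z' r - (s r + s' r)) < e) sequentially"
    using ev ev' by eventually_elim (rule *)
  then show "\<exists>q s. (q, s) \<in> Q \<and> norm (c + c' - q) < e \<and> eventually (\<lambda>r. norm (z r + z' r - s r) < e) sequentially"
    using Q_add[OF q(1) q'(1)] *[OF q(2) q'(2)] by blast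
qed

lemma rep_adj: assumes "rep c z" shows "rep (adj c) (\<lambda>r. adj (z r))"
  unfolding rep_def
proof (intro allI impI)
  fix e :: real assume e: "e > 0"
  obtain q s where q: "(q, s) \<in> Q" "norm (c - q) < e" "eventually (\<lambda>r. norm (z r - s r) < e) sequentially"
    using repD[OF assms(1) e] by blast
  have "norm (adj c - adj q) = norm (c - q)" "norm (adj (z r) - adj (s r)) = norm (z r - s r)" for r
    by (simp_all flip: adj_diff)
  then show "\<exists>q s. (q, s) \<in> Q \<and> norm (adj c - q) < e \<and> eventually (\<lambda>r. norm (adj (z r) - s r) < e) sequentially"
    using Q_adj[OF q(1)] q(2,3) by (intro exI[of _ "adj q"] exI[of _ "\<lambda>r. adj (s r)"]) simp
qed

lemma rep_cs: assumes "rep c z" "a \<in> rat_complex" shows "rep (a *\<^sub>C c) (\<lambda>r. a *\<^sub>C z r)"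
  unfolding rep_def
proof (intro allI impI)
  fix e :: real assume e: "e > 0"
  define e' where "e' = e / (cmod a + 1)"
  have p: "cmod a + 1 > 0" by (simp add: add_nonneg_pos)
  have e': "e' > 0" using e p by (simp add: e'_def)
  obtain q s where q: "(q, s) \<in> Q" "norm (c - q) < e'" "eventually (\<lambda>r. norm (z r - s r) < e') sequentially"
    using repD[OF assms(1) e'] by blast
  have *: "norm (a *\<^sub>C x - a *\<^sub>C y) < e" if "norm (x - y) < e'" for x y :: "'x::cstar"
  proof -
    have "norm (a *\<^sub>C x - a *\<^sub>C y) = cmod a * norm (x - y)" by (simp flip: cs_diff_right)
    also have "\<dots> \<le> cmod a * e'" using that by (intro mult_left_mono) auto
    also have "\<dots> < (cmod a + 1) * e'" using e' by simp
    also have "\<dots> = e" using p by (simp add: e'_def)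
    finally show ?thesis .
  qed
  have "eventually (\<lambda>r. norm (a *\<^sub>C z r - a *\<^sub>C s r) < e) sequentially" using q(3) by eventually_elim (rule *)
  then show "\<exists>q s. (q, s) \<in> Q \<and> norm (a *\<^sub>C c - q) < e \<and> eventually (\<lambda>r. norm (a *\<^sub>C z r - s r) < e) sequentially"
    using Q_cs[OF q(1) assms(2)] *[OF q(2)] by blast
qed

lemma rep_diff: assumes "rep c z" "rep c' z'" shows "rep (c - c') (\<lambda>r. z r - z' r)"
  using rep_add[OF assms(1) rep_cs[OF assms(2), of "-1"]] by (simp add: rat_complex_def)

lemma rep_cong: assumes "rep c z" "(\<lambda>r. norm (z r - z' r)) \<longlonglongrightarrow> 0" shows "rep c z'"
  unfolding rep_def
proof (intro allI impI)
  fix e :: real assume e: "e > 0"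
  obtain q s where q: "(q, s) \<in> Q" "norm (c - q) < e / 2" and ev: "eventually (\<lambda>r. norm (z r - s r) < e / 2) sequentially"
    using repD[OF assms(1), of "e / 2"] e by auto
  have "eventually (\<lambda>r. norm (z r - z' r) < e / 2) sequentially"
    using order_tendstoD(2)[OF assms(2), of "e / 2"] e by simp
  then have "eventually (\<lambda>r. norm (z' r - s r) < e) sequentially"
    using ev
  proof eventually_elim
    case (elim r)
    then show ?case using norm_triangle_ineq[of "z' r - z r" "z r - s r"] by (simp add: norm_minus_commute)
  qed
  then show "\<exists>q s. (q, s) \<in> Q \<and> norm (c - q) < e \<and> eventually (\<lambda>r. norm (z' r - s r) < e) sequentially"
    using q e by (intro exI[of _ q] exI[of _ s]) auto
qed

lemma rep_unique: assumes "rep c z" "rep c z'" shows "(\<lambda>r. norm (z r - z' r)) \<longlonglongrightarrow> 0"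
  using rep_norm[OF rep_diff[OF assms]] by simp

lemma rep_bounded: assumes "rep c z" shows "eventually (\<lambda>r. norm (z r) < norm c + 1) sequentially"
  using order_tendstoD(2)[OF rep_norm[OF assms], of "norm c + 1"] by simp

lemma rep_mul: assumes "rep c z" "rep c' z'" shows "rep (c * c') (\<lambda>r. z r * z' r)"
  unfolding rep_def
proof (intro allI impI)
  fix e :: real assume e: "e > 0"
  \<comment> \<open>\<open>K\<close> bounds all factors of both products, those of the approximants
    within distance \<open>1\<close> included, and \<open>2 * K * e' \<le> e\<close> pays for the
    two error terms.\<close>
  define K where "K = norm c + norm c' + 3"
  have K: "K > 0" "norm c + 1 \<le> K" "norm c' + 2 \<le> K" by (auto simp: K_def add_nonneg_pos)
  define e' where "e' = min 1 (e / (2 * K))"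
  have e': "e' > 0" "e' \<le> 1" "2 * K * e' \<le> e" using e K by (auto simp: e'_def min_def field_simps)
  obtain q s where q: "(q, s) \<in> Q" "norm (c - q) < e'" and ev: "eventually (\<lambda>r. norm (z r - s r) < e') sequentially"
    using repD[OF assms(1) e'(1)] by blast
  obtain q' s' where q': "(q', s') \<in> Q" "norm (c' - q') < e'" and ev': "eventually (\<lambda>r. norm (z' r - s' r) < e') sequentially"
    using repD[OF assms(2) e'(1)] by blast
  have *: "norm (a * b - x * y) < e" if "norm (a - x) < e'" "norm (b - y) < e'" "norm a < norm c + 1" "norm b < norm c' + 1"
    for a b x y :: "'x::cstar"
  proof -
    have "norm y \<le> norm b + norm (b - y)" using norm_triangle_ineq4[of b "b - y"] by simp
    then have y: "norm y \<le> K" using that e' K by linarith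
    have a: "norm a \<le> K" using that K by linarith
    have "a * b - x * y = a * (b - y) + (a - x) * y" by (simp add: algebra_simps)
    then have "norm (a * b - x * y) \<le> norm (a * (b - y)) + norm ((a - x) * y)" by (metis norm_triangle_ineq)
    also have "\<dots> \<le> norm a * norm (b - y) + norm (a - x) * norm y" by (intro add_mono norm_mult_ineq)
    also have "\<dots> \<le> K * norm (b - y) + norm (a - x) * K" using a y K(1) by (intro add_mono mult_mono) auto
    also have "\<dots> < K * e' + e' * K"
      using that(1,2) K by (intro add_strict_mono mult_strict_left_mono mult_strict_right_mono)
    also have "\<dots> \<le> e" using e' by (simp add: algebra_simps)
    finally show ?thesis .
  qed
  have "eventually (\<lambda>r. norm (z r * z' r - s r * s' r) < e) sequentially"
    using ev ev' rep_bounded[OF assms(1)] rep_bounded[OF assms(2)] by eventually_elim (rule *)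
  moreover have "norm (c * c' - q * q') < e" using q q' by (intro *) auto
  ultimately show "\<exists>q s. (q, s) \<in> Q \<and> norm (c * c' - q) < e \<and> eventually (\<lambda>r. norm (z r * z' r - s r) < e) sequentially"
    using Q_mul[OF q(1) q'(1)] by blast
qed

lemma rep_scaleR: assumes "rep c z" "a \<in> \<rat>" shows "rep (a *\<^sub>R c) (\<lambda>r. a *\<^sub>R z r)"
  using rep_cs[OF assms(1), of "complex_of_real a"] assms(2) by (simp add: rat_complex_def cs_of_real)

text \<open>An empty sum would require \<open>rep 0 (\<lambda>r. 0)\<close>, which is available only
  once something is represented; hence \<open>F \<noteq> {}\<close>.\<close>

lemma rep_sum: assumes "finite F" "F \<noteq> {}" "\<And>i. i \<in> F \<Longrightarrow> rep (c i) (z i)" shows "rep (\<Sum>i\<in>F. c i) (\<lambda>r. \<Sum>i\<in>F. z i r)"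
  using assms by (induct F rule: finite_ne_induct) (auto intro: rep_add)

lemma rep_0: assumes "rep c z" shows "rep 0 (\<lambda>r. 0)"
  using rep_diff[OF assms assms] by simp

text \<open>An element that is only a limit of first components \<open>q j\<close> is represented by
  passing slowly along the sequences \<open>s j\<close>. Each \<open>z r\<close> is a genuine value
  of some sequence in \<open>Q\<close>, so exact properties of these values, such as absorption of
  the unit, are kept.\<close>

lemma rep_exists:
  assumes "\<And>\<epsilon>. \<epsilon> > 0 \<Longrightarrow> \<exists>q s. (q, s) \<in> Q \<and> norm (c - q) < \<epsilon>"
  shows "\<exists>z. rep c z \<and> (\<forall>r. \<exists>q s. (q, s) \<in> Q \<and> z r = s r)"
proof -
  have "\<exists>q s. (q, s) \<in> Q \<and> norm (c - q) < (1/2) ^ j" for j :: nat by (rule assms) simp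
  then obtain q s where q: "\<And>j. (q j, s j) \<in> Q" "\<And>j::nat. norm (c - q j) < (1/2) ^ j" by metis
  \<comment> \<open>The guard \<open>j > 0\<close> reduces \<open>P 0\<close> to membership, which
    holds at every \<open>r\<close> as \<open>diagonal_choice\<close> demands.\<close>
  define P where "P j r z \<longleftrightarrow> (\<exists>q s. (q, s) \<in> Q \<and> z = s r) \<and> (j > 0 \<longrightarrow> norm (z - s j r) < 2 * (1/2) ^ j)" for j r z
  have "eventually (\<lambda>r. \<exists>z. \<forall>j\<le>J. P j r z) sequentially" for J
  proof -
    have "eventually (\<lambda>r. norm (s J r - s j r) < 2 * (1/2) ^ j) sequentially" if "j \<le> J" for j
    proof -
      have "norm (q J - q j) \<le> norm (c - q j) + norm (c - q J)"
        using norm_triangle_ineq4[of "c - q j" "c - q J"] by simp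
      also have "\<dots> < (1/2) ^ j + (1/2) ^ J" using q(2)[of j] q(2)[of J] by linarith
      also have "(1/2::real) ^ J \<le> (1/2) ^ j" using that by (intro power_decreasing) auto
      finally have l: "norm (q J - q j) < 2 * (1/2) ^ j" by simp
      show ?thesis
        using order_tendstoD(2)[OF rep_norm[OF rep_diff[OF rep_Q[OF q(1)[of J]] rep_Q[OF q(1)[of j]]]] l] .
    qed
    then have "eventually (\<lambda>r. \<forall>j\<in>{..J}. norm (s J r - s j r) < 2 * (1/2) ^ j) sequentially"
      by (intro eventually_ball_finite) auto
    then show ?thesis
    proof eventually_elim
      case (elim r)
      then show ?case using q(1) unfolding P_def by (intro exI[of _ "s J r"]) blast
    qed
  qed
  moreover have "\<exists>z. P 0 r z" for r unfolding P_def using q(1) by auto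
  ultimately obtain z where z: "\<And>r. P 0 r (z r)" "\<And>j. eventually (\<lambda>r. P j r (z r)) sequentially"
    using diagonal_choice[of P] by blast
  have "rep c z" unfolding rep_def
  proof (intro allI impI)
    fix e :: real assume e: "e > 0"
    obtain j0 where j0: "(1/2 :: real) ^ j0 < e / 2" using real_arch_pow_inv[of "e / 2" "1/2"] e by auto
    define j where "j = Suc j0"
    have j: "j > 0" "2 * (1/2 :: real) ^ j < e" using j0 e by (simp_all add: j_def)
    moreover have "(0::real) \<le> (1/2) ^ j" by simp
    ultimately have "(1/2 :: real) ^ j < e" by linarith
    then have "norm (c - q j) < e" using q(2)[of j] by linarith
    moreover have "eventually (\<lambda>r. norm (z r - s j r) < e) sequentially"
      using z(2)[of j] by eventually_elim (use j in \<open>auto simp: P_def\<close>)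
    ultimately show "\<exists>q s. (q, s) \<in> Q \<and> norm (c - q) < e \<and> eventually (\<lambda>r. norm (z r - s r) < e) sequentially"
      using q(1) by blast
  qed
  moreover have "\<forall>r. \<exists>q s. (q, s) \<in> Q \<and> z r = s r" using z(1) unfolding P_def by blast
  ultimately show ?thesis by blast
qed

end

subsection \<open>Evaluation of noncommutative polynomials\<close>

text \<open>\<open>E\<close> is the value of the empty word: in \<open>ucs\<close> the unit of the
  algebra under consideration is a projection \<open>E\<close>, not \<open>1\<close>.\<close>

definition wpr :: "'a::cstar \<Rightarrow> (nat \<Rightarrow> 'a) \<Rightarrow> nat list \<Rightarrow> 'a" where
  "wpr E X w = foldr (\<lambda>i acc. X i * acc) w E"

definition npe :: "'a::cstar \<Rightarrow> (nat \<Rightarrow> 'a) \<Rightarrow> ncpoly \<Rightarrow> 'a" where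
  "npe E X P = (\<Sum>w\<in>Poly_Mapping.keys P. Poly_Mapping.lookup P w *\<^sub>C wpr E X w)"

lemma wpr_simps [simp]: "wpr E X [] = E" "wpr E X (i # w) = X i * wpr E X w"
  by (simp_all add: wpr_def)

lemma npe_superset:
  assumes "finite F" "Poly_Mapping.keys P \<subseteq> F"
  shows "npe E X P = (\<Sum>w\<in>F. Poly_Mapping.lookup P w *\<^sub>C wpr E X w)"
  unfolding npe_def by (rule sum.mono_neutral_left) (use assms in \<open>auto simp: in_keys_iff\<close>)

lemma npe_0 [simp]: "npe E X 0 = 0"
  by (simp add: npe_def)

lemma npe_add: "npe E X (P + P') = npe E X P + npe E X P'"
proof -
  define F where "F = Poly_Mapping.keys P \<union> Poly_Mapping.keys P'"
  have F: "finite F" "Poly_Mapping.keys P \<subseteq> F" "Poly_Mapping.keys P' \<subseteq> F" "Poly_Mapping.keys (P + P') \<subseteq> F"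
    using Poly_Mapping.keys_add[of P P'] by (auto simp: F_def)
  show ?thesis unfolding npe_superset[OF F(1,2)] npe_superset[OF F(1,3)] npe_superset[OF F(1,4)]
    by (simp add: lookup_add cs_add_left sum.distrib)
qed

lemma npe_sum: "npe E X (sum f F) = (\<Sum>i\<in>F. npe E X (f i))"
  by (induct F rule: infinite_finite_induct) (simp_all add: npe_add)

lemma npe_single: "npe E X (Poly_Mapping.single w c) = c *\<^sub>C wpr E X w"
  by (simp add: npe_def)

lemma in_vars_add: "ncpoly_in_vars m P \<Longrightarrow> ncpoly_in_vars m P' \<Longrightarrow> ncpoly_in_vars m (P + P')"
  using Poly_Mapping.keys_add[of P P'] by (auto simp: ncpoly_in_vars_def)

lemma rat_ncpolys_0: "0 \<in> rat_ncpolys m"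
  by (simp add: rat_ncpolys_def ncpoly_in_vars_def)

lemma rat_ncpolys_add: "P \<in> rat_ncpolys m \<Longrightarrow> P' \<in> rat_ncpolys m \<Longrightarrow> P + P' \<in> rat_ncpolys m"
  by (auto simp: rat_ncpolys_def in_vars_add lookup_add)

lemma rat_ncpolys_sum: "(\<And>i. i \<in> F \<Longrightarrow> f i \<in> rat_ncpolys m) \<Longrightarrow> sum f F \<in> rat_ncpolys m"
  by (induct F rule: infinite_finite_induct) (auto intro: rat_ncpolys_add rat_ncpolys_0)

lemma rat_ncpolys_single: "\<forall>i\<in>set w. i < m \<Longrightarrow> c \<in> rat_complex \<Longrightarrow> Poly_Mapping.single w c \<in> rat_ncpolys m"
  by (auto simp: rat_ncpolys_def ncpoly_in_vars_def lookup_single when_def rat_complex_def)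

lemma rat_ncpolys_lookup: "P \<in> rat_ncpolys m \<Longrightarrow> Poly_Mapping.lookup P w \<in> rat_complex"
  by (simp add: rat_ncpolys_def rat_complex_def)

lemma rat_ncpolys_vars: "P \<in> rat_ncpolys m \<Longrightarrow> w \<in> Poly_Mapping.keys P \<Longrightarrow> i \<in> set w \<Longrightarrow> i < m"
  by (auto simp: rat_ncpolys_def ncpoly_in_vars_def)

lemma rat_complex_mult: "a \<in> rat_complex \<Longrightarrow> b \<in> rat_complex \<Longrightarrow> a * b \<in> rat_complex"
  by (auto simp: rat_complex_def)

lemma rat_complex_cnj: "a \<in> rat_complex \<Longrightarrow> cnj a \<in> rat_complex"
  by (auto simp: rat_complex_def)

definition nc_mult :: "ncpoly \<Rightarrow> ncpoly \<Rightarrow> ncpoly" where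
  "nc_mult P P' = (\<Sum>u\<in>Poly_Mapping.keys P. \<Sum>v\<in>Poly_Mapping.keys P'.
     Poly_Mapping.single (u @ v) (Poly_Mapping.lookup P u * Poly_Mapping.lookup P' v))"

definition nc_adj :: "ncpoly \<Rightarrow> ncpoly" where
  "nc_adj P = (\<Sum>u\<in>Poly_Mapping.keys P. Poly_Mapping.single (rev u) (cnj (Poly_Mapping.lookup P u)))"

definition nc_scale :: "complex \<Rightarrow> ncpoly \<Rightarrow> ncpoly" where
  "nc_scale a P = (\<Sum>u\<in>Poly_Mapping.keys P. Poly_Mapping.single u (a * Poly_Mapping.lookup P u))"

lemma nc_rat:
  "P \<in> rat_ncpolys m \<Longrightarrow> P' \<in> rat_ncpolys m \<Longrightarrow> nc_mult P P' \<in> rat_ncpolys m"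
  "P \<in> rat_ncpolys m \<Longrightarrow> nc_adj P \<in> rat_ncpolys m"
  "P \<in> rat_ncpolys m \<Longrightarrow> a \<in> rat_complex \<Longrightarrow> nc_scale a P \<in> rat_ncpolys m"
  unfolding nc_mult_def nc_adj_def nc_scale_def
  by (intro rat_ncpolys_sum rat_ncpolys_single rat_complex_mult rat_complex_cnj;
      auto intro: rat_ncpolys_lookup rat_ncpolys_vars)+

lemma npe_scale: "npe E X (nc_scale a P) = a *\<^sub>C npe E X P"
  unfolding nc_scale_def npe_sum npe_single by (simp add: npe_def cs_sum_right)

lemma wpr_append:
  assumes "E * E = E" "\<And>i. i \<in> set v \<Longrightarrow> E * X i = X i"
  shows "wpr E X (u @ v) = wpr E X u * wpr E X v"
proof (induct u)
  case Nil
  show ?case by (cases v) (use assms in \<open>auto simp flip: mult.assoc\<close>)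
qed (simp add: mult.assoc)

lemma npe_mult:
  assumes "E * E = E" "\<And>i. i < m \<Longrightarrow> E * X i = X i" "P' \<in> rat_ncpolys m"
  shows "npe E X (nc_mult P P') = npe E X P * npe E X P'"
proof -
  have "npe E X (nc_mult P P') = (\<Sum>u\<in>Poly_Mapping.keys P. \<Sum>v\<in>Poly_Mapping.keys P'.
      (Poly_Mapping.lookup P u * Poly_Mapping.lookup P' v) *\<^sub>C (wpr E X u * wpr E X v))"
    unfolding nc_mult_def npe_sum npe_single
    by (intro sum.cong refl arg_cong[where f="\<lambda>z. _ *\<^sub>C z"] wpr_append assms(1,2) rat_ncpolys_vars[OF assms(3)])
  also have "\<dots> = npe E X P * npe E X P'"
    unfolding npe_def sum_product by (simp add: mult.commute)
  finally show ?thesis .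
qed

lemma wpr_rev:
  assumes "E * E = E" "adj E = E" "\<And>i. i \<in> set w \<Longrightarrow> E * X i = X i \<and> adj (X i) = X i"
  shows "adj (wpr E X w) = wpr E X (rev w)"
  using assms(3)
proof (induct w)
  case (Cons i w)
  have i: "E * X i = X i" "adj (X i) = X i" using Cons(2)[of i] by simp_all
  have "X i * E = adj (E * X i)" by (simp only: adj_mult i(2) assms(2))
  then have XE: "X i * E = X i" by (simp only: i)
  have "wpr E X (rev (i # w)) = wpr E X (rev w) * wpr E X [i]"
    unfolding rev.simps by (rule wpr_append) (use assms(1) Cons(2) in auto)
  then show ?case using Cons by (simp add: XE)
qed (simp add: assms)

lemma npe_adj:
  assumes "E * E = E" "adj E = E" "\<And>i. i < m \<Longrightarrow> E * X i = X i \<and> adj (X i) = X i" "P \<in> rat_ncpolys m"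
  shows "npe E X (nc_adj P) = adj (npe E X P)"
proof -
  have "npe E X (nc_adj P) = (\<Sum>u\<in>Poly_Mapping.keys P. cnj (Poly_Mapping.lookup P u) *\<^sub>C adj (wpr E X u))"
    unfolding nc_adj_def npe_sum npe_single
    by (intro sum.cong refl arg_cong[where f="\<lambda>z. _ *\<^sub>C z"] wpr_rev[symmetric] assms(1-3) rat_ncpolys_vars[OF assms(4)])
  then show ?thesis by (simp add: npe_def)
qed

lemma rat_complex_dense: assumes "e > 0" shows "\<exists>q\<in>rat_complex. cmod (c - q) < e"
proof -
  obtain a where a: "a \<in> \<rat>" "Re c - e / 2 < a" "a < Re c" using Rats_dense_in_real[of "Re c - e / 2" "Re c"] assms by auto
  obtain b where b: "b \<in> \<rat>" "Im c - e / 2 < b" "b < Im c" using Rats_dense_in_real[of "Im c - e / 2" "Im c"] assms by auto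
  have "cmod (c - Complex a b) \<le> \<bar>Re (c - Complex a b)\<bar> + \<bar>Im (c - Complex a b)\<bar>" by (rule cmod_le)
  also have "\<dots> < e" using a b by simp
  finally show ?thesis using a b by (intro bexI[of _ "Complex a b"]) (auto simp: rat_complex_def)
qed

text \<open>The mesh \<open>e / K\<close> for the coefficients is fitted to the word values at the
  given \<open>X\<close>, so the rational polynomial depends on the point of evaluation.\<close>

lemma npe_rat_approx:
  assumes "ncpoly_in_vars m P" "e > 0"
  shows "\<exists>P'\<in>rat_ncpolys m. norm (npe E X P - npe E X P') < e"
proof -
  define K where "K = (\<Sum>w\<in>Poly_Mapping.keys P. norm (wpr E X w)) + 1"
  have K: "K > 0" by (simp add: K_def add_nonneg_pos sum_nonneg)
  have "\<forall>w. \<exists>q\<in>rat_complex. cmod (Poly_Mapping.lookup P w - q) < e / K"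
    using rat_complex_dense K assms(2) by simp
  then obtain q where q: "\<And>w. q w \<in> rat_complex" "\<And>w. cmod (Poly_Mapping.lookup P w - q w) < e / K" by metis
  define P' where "P' = (\<Sum>w\<in>Poly_Mapping.keys P. Poly_Mapping.single w (q w))"
  have "P' \<in> rat_ncpolys m" unfolding P'_def
    by (intro rat_ncpolys_sum rat_ncpolys_single q) (use assms(1) in \<open>auto simp: ncpoly_in_vars_def\<close>)
  have "npe E X P - npe E X P' = (\<Sum>w\<in>Poly_Mapping.keys P. (Poly_Mapping.lookup P w - q w) *\<^sub>C wpr E X w)"
    unfolding P'_def npe_sum npe_single by (simp add: npe_def cs_diff_left sum_subtractf)
  also have "norm \<dots> \<le> (\<Sum>w\<in>Poly_Mapping.keys P. (e / K) * norm (wpr E X w))"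
    by (rule order_trans[OF norm_sum], rule sum_mono, unfold norm_cs, rule mult_right_mono)
       (rule less_imp_le[OF q(2)], rule norm_ge_zero)
  also have "\<dots> = (e / K) * (K - 1)" by (simp add: K_def sum_distrib_left)
  also have "\<dots> < e" using K assms(2) by (simp add: field_simps)
  finally show ?thesis using \<open>P' \<in> rat_ncpolys m\<close> by blast
qed

context asymp
begin

lemma rep_npe:
  assumes "rep E E'" "\<And>i. i < m \<Longrightarrow> rep (X i) (X' i)" "P \<in> rat_ncpolys m"
  shows "rep (npe E X P) (\<lambda>r. npe (E' r) (\<lambda>i. X' i r) P)"
proof (cases "Poly_Mapping.keys P = {}")
  case True
  then show ?thesis using rep_0[OF assms(1)] by (simp add: npe_def)
next
  case False
  have w: "rep (wpr E X w) (\<lambda>r. wpr (E' r) (\<lambda>i. X' i r) w)" if "\<forall>i\<in>set w. i < m" for w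
    using that by (induct w) (auto intro: rep_mul assms(1,2))
  show ?thesis unfolding npe_def
    by (rule rep_sum) (use False assms(3) in \<open>auto intro!: rep_cs w intro: rat_ncpolys_lookup rat_ncpolys_vars\<close>)
qed

end

context crep
begin

lemma e_word_prod:
  assumes "set xs \<subseteq> ca_carrier S" "\<forall>i\<in>set w. i < length xs"
  shows "word_prod S xs w \<in> ca_carrier S \<and> e (word_prod S xs w) = wpr (e (ca_one S)) (\<lambda>i. e (xs ! i)) w"
  using assms(2)
proof (induct w)
  case (Cons i w)
  moreover have "xs ! i \<in> ca_carrier S" using Cons(2) assms(1) by (auto simp: subset_iff)
  ultimately show ?case by (simp add: word_prod_def e_mul)
qed (simp add: word_prod_def)

lemma e_ncp_eval:
  assumes "set xs \<subseteq> ca_carrier S" "ncpoly_in_vars (length xs) P"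
  shows "ncp_eval S P xs \<in> ca_carrier S" "e (ncp_eval S P xs) = npe (e (ca_one S)) (\<lambda>i. e (xs ! i)) P"
proof -
  define L where "L = sorted_list_of_set (Poly_Mapping.keys P)"
  have L: "set L = Poly_Mapping.keys P" "distinct L" by (simp_all add: L_def)
  define f where "f w = ca_smult S (Poly_Mapping.lookup P w) (word_prod S xs w)" for w
  have w: "word_prod S xs w \<in> ca_carrier S \<and> e (word_prod S xs w) = wpr (e (ca_one S)) (\<lambda>i. e (xs ! i)) w" if "w \<in> set L" for w
    using that assms(2) by (intro e_word_prod assms(1)) (auto simp: ncpoly_in_vars_def L)
  then have f: "\<And>w. w \<in> set L \<Longrightarrow> f w \<in> ca_carrier S" by (simp add: f_def)
  have ev: "ncp_eval S P xs = foldr (\<lambda>w acc. ca_add S (f w) acc) L (ca_zero S)"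
    by (simp add: ncp_eval_def ca_sum_def L_def f_def)
  show "ncp_eval S P xs \<in> ca_carrier S" unfolding ev by (rule foldr_add) (rule f)
  have "e (ncp_eval S P xs) = (\<Sum>w\<leftarrow>L. e (f w))" unfolding ev by (rule foldr_add) (rule f)
  also have "\<dots> = (\<Sum>w\<in>set L. e (f w))" using L(2) by (simp add: sum_list_distinct_conv_sum_set)
  also have "\<dots> = (\<Sum>w\<in>set L. Poly_Mapping.lookup P w *\<^sub>C wpr (e (ca_one S)) (\<lambda>i. e (xs ! i)) w)"
    by (intro sum.cong refl) (simp add: f_def e_smult w)
  finally show "e (ncp_eval S P xs) = npe (e (ca_one S)) (\<lambda>i. e (xs ! i)) P" by (simp add: npe_def L)
qed

end

subsection \<open>Complex matrices\<close>

abbreviation cc :: "nat \<Rightarrow> (nat \<Rightarrow> nat \<Rightarrow> complex) set" where "cc k \<equiv> ca_carrier (cmat k)"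

abbreviation cem :: "nat \<Rightarrow> (nat \<Rightarrow> nat \<Rightarrow> complex) \<Rightarrow> (nat \<Rightarrow> nat \<Rightarrow> complex) ucs" where
  "cem k \<equiv> emb (cmat k)"

text \<open>Matrices are functions that vanish outside their block. So \<open>cc l\<close> is
  literally a corner of \<open>cc k\<close> for \<open>l \<le> k\<close>, and \<open>idm l\<close>
  is at once the unit of the small algebra and a projection in the large one.\<close>

definition idm :: "nat \<Rightarrow> nat \<Rightarrow> nat \<Rightarrow> complex" where
  "idm l = (\<lambda>i j. if i < l \<and> j < l \<and> i = j then 1 else 0)"

interpretation cm: crep "cmat k" "cem k" for k
  by (rule crep_emb[OF cmat_cstar])

lemma cc_iff: "X \<in> cc k \<longleftrightarrow> (\<forall>i j. \<not> (i < k \<and> j < k) \<longrightarrow> X i j = 0)"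
  by (auto simp: cmat_def mat_alg0_def CC_def)

lemma cc_mat_alg0: "cc k = ca_carrier (mat_alg0 CC k)"
  by (simp add: cmat_def)

lemma cc_mono: "l \<le> k \<Longrightarrow> X \<in> cc l \<Longrightarrow> X \<in> cc k"
  by (auto simp: cc_iff)

lemma CCr_em_id [simp]: "CCr.em X = X"
  by (simp add: CCr.em_def)

lemma cmat_one: "ca_one (cmat k) = idm k"
  by (simp add: cmat_def mat_alg0_def CC_def idm_def fun_eq_iff)

lemma cmat_zero: "ca_zero (cmat k) = (\<lambda>i j. 0)"
  by (simp add: cmat_def mat_alg0_def CC_def)

lemma cmat_ops:
  "X \<in> cc k \<Longrightarrow> Y \<in> cc k \<Longrightarrow> ca_add (cmat k) X Y = (\<lambda>i j. X i j + Y i j)"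
  "X \<in> cc k \<Longrightarrow> Y \<in> cc k \<Longrightarrow> ca_mul (cmat k) X Y = mmul k X Y"
  "X \<in> cc k \<Longrightarrow> ca_smult (cmat k) c X = (\<lambda>i j. c *\<^sub>C X i j)"
  "X \<in> cc k \<Longrightarrow> ca_star (cmat k) X = madj X"
  unfolding cc_mat_alg0 by (simp_all add: cmat_def CCr.em_laws[unfolded CCr_em_id])

lemma cmat_sub: "X \<in> cc k \<Longrightarrow> Y \<in> cc k \<Longrightarrow> ca_sub (cmat k) X Y = (\<lambda>i j. X i j - Y i j)"
proof -
  assume X: "X \<in> cc k" and Y: "Y \<in> cc k"
  then have "(\<lambda>i j. - Y i j) \<in> cc k" by (simp add: cc_iff)
  then show ?thesis using X Y by (simp add: ca_sub_def cmat_ops)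
qed

lemma cmat_norm: "ca_norm (cmat k) X = opn k X"
  by (simp add: cmat_def op_norm_eq_opn)

lemma cc_closed:
  "X \<in> cc k \<Longrightarrow> Y \<in> cc k \<Longrightarrow> mmul k X Y \<in> cc k" "X \<in> cc k \<Longrightarrow> madj X \<in> cc k"
  "l \<le> k \<Longrightarrow> idm l \<in> cc k" "X \<in> cc k \<Longrightarrow> Y \<in> cc k \<Longrightarrow> (\<lambda>i j. X i j - Y i j) \<in> cc k"
  by (auto simp: cc_iff mmul_def madj_def idm_def intro!: sum.neutral)

lemma cem_mmul: "X \<in> cc k \<Longrightarrow> Y \<in> cc k \<Longrightarrow> cem k (mmul k X Y) = cem k X * cem k Y"
  using cm.e_mul[of X k Y] by (simp add: cmat_ops)

lemma cem_madj: "X \<in> cc k \<Longrightarrow> cem k (madj X) = adj (cem k X)"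
  using cm.e_star[of X k] by (simp add: cmat_ops)

lemma cem_sub: "X \<in> cc k \<Longrightarrow> Y \<in> cc k \<Longrightarrow> cem k (\<lambda>i j. X i j - Y i j) = cem k X - cem k Y"
  using cm.e_sub[of X k Y] by (simp add: cmat_sub)

lemma norm_cem: "X \<in> cc k \<Longrightarrow> norm (cem k X) = opn k X"
  using cm.norm_e[of X k] by (simp add: cmat_norm)

lemma mmul_nested: "l \<le> k \<Longrightarrow> X \<in> cc l \<Longrightarrow> mmul k X Y = mmul l X Y"
  unfolding mmul_def
  by (intro ext sum.mono_neutral_right) (auto simp: cc_iff)

lemma mip_nested: assumes "l \<le> k" "\<And>i. i \<ge> l \<Longrightarrow> v i = 0" shows "mip k v v = mip l v v"
  unfolding mip_def by (rule sum.mono_neutral_right) (use assms in auto)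

lemma mnorm_mono: assumes "l \<le> k" shows "mnorm l v \<le> mnorm k (v :: nat \<Rightarrow> complex)"
  unfolding mnorm_complex using assms by (intro real_sqrt_le_mono sum_mono2) auto

lemma opn_nested: assumes lk: "l \<le> k" and X: "X \<in> cc l" shows "opn k X = opn l X"
proof (rule antisym)
  have mv: "mvm k X v = mvm l X v" for v :: "nat \<Rightarrow> complex"
    unfolding mvm_def using lk X by (intro ext sum.mono_neutral_right) (auto simp: cc_iff)
  have z: "mvm l X v i = 0" if "i \<ge> l" for v :: "nat \<Rightarrow> complex" and i
    unfolding mvm_def using X that by (intro sum.neutral) (auto simp: cc_iff)
  have mm: "mnorm k (mvm l X v) = mnorm l (mvm l X v)" for v :: "nat \<Rightarrow> complex"
    unfolding mnorm_def using mip_nested[OF lk z] by simp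
  show "opn k X \<le> opn l X"
  proof (rule opn_least)
    fix v :: "nat \<Rightarrow> complex"
    have "mnorm l (mvm l X v) \<le> opn l X * mnorm l v" by (rule mnorm_mvm_le)
    also have "\<dots> \<le> opn l X * mnorm k v" by (intro mult_left_mono mnorm_mono lk) simp
    finally show "mnorm k (mvm k X v) \<le> opn l X * mnorm k v" by (simp add: mv mm)
  qed simp
  show "opn l X \<le> opn k X"
  proof (rule opn_least)
    fix v :: "nat \<Rightarrow> complex"
    define w where "w = (\<lambda>i. if i < l then v i else 0)"
    have "mnorm l (mvm l X v) = mnorm k (mvm k X w)"
      unfolding mv mm by (rule mnorm_cong) (simp add: mvm_def w_def)
    also have "\<dots> \<le> opn k X * mnorm k w" by (rule mnorm_mvm_le)
    also have "mnorm k w = mnorm l w" unfolding mnorm_def using mip_nested[OF lk, of w] by (simp add: w_def)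
    also have "mnorm l w = mnorm l v" by (rule mnorm_cong) (simp add: w_def)
    finally show "mnorm l (mvm l X v) \<le> opn k X * mnorm l v" .
  qed simp
qed

text \<open>Microstates of both sizes are compared inside the single copy of \<open>cmat k\<close>.
  The operations of \<open>cmat l\<close> are those of the corner cut out by \<open>idm l\<close>,
  and the operator norm does not notice the added zeros.\<close>

lemma crep_nested: assumes "l \<le> k" shows "crep (cmat l) (cem k)"
proof (intro crep.intro crep_axioms.intro ucalg.intro cmat_cstar)
  fix X Y c assume X: "X \<in> cc l"
  note Xk = cc_mono[OF assms X]
  show "cem k (ca_smult (cmat l) c X) = c *\<^sub>C cem k X"
    using cm.e_smult[OF Xk, of c] by (simp add: cmat_ops X Xk)
  show "cem k (ca_star (cmat l) X) = adj (cem k X)"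
    using cm.e_star[OF Xk] by (simp add: cmat_ops X Xk)
  show "norm (cem k X) = ca_norm (cmat l) X"
    by (simp add: norm_cem Xk cmat_norm opn_nested[OF assms X])
  assume Y: "Y \<in> cc l"
  note Yk = cc_mono[OF assms Y]
  show "cem k (ca_add (cmat l) X Y) = cem k X + cem k Y"
    using cm.e_add[OF Xk Yk] by (simp add: cmat_ops X Xk Y Yk)
  show "cem k (ca_mul (cmat l) X Y) = cem k X * cem k Y"
    using cm.e_mul[OF Xk Yk] by (simp add: cmat_ops X Xk Y Yk mmul_nested[OF assms X])
qed

lemma cem_idm:
  assumes "l \<le> k"
  shows "cem k (idm l) * cem k (idm l) = cem k (idm l)" "adj (cem k (idm l)) = cem k (idm l)"
proof -
  interpret crep "cmat l" "cem k" using assms by (rule crep_nested)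
  show "cem k (idm l) * cem k (idm l) = cem k (idm l)" "adj (cem k (idm l)) = cem k (idm l)"
    using e_one_mult(1)[of "idm l"] e_star[of "idm l"] cm.star_one[of l] cc_closed(3)[of l l]
    by (simp_all add: cmat_one)
qed

lemma cem_idm_mult: "X \<in> cc k \<Longrightarrow> cem k (idm k) * cem k X = cem k X" "X \<in> cc k \<Longrightarrow> cem k X * cem k (idm k) = cem k X"
  using cm.e_one_mult[of X k] by (simp_all add: cmat_one)

text \<open>\<open>cem k (idm k)\<close> is the central projection of \<open>ucs\<close> onto the copy of \<open>cmat k\<close>.\<close>
lemma cem_range:
  assumes "cem k (idm k) * x = x"
  shows "ucs_at x (cmat k) \<in> cc k" "cem k (ucs_at x (cmat k)) = x"
proof -
  note c = cmat_cstar[of k]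
  have i: "idm k \<in> cc k" by (simp add: cc_closed)
  show 1: "ucs_at x (cmat k) \<in> cc k" by (simp add: c)
  show "cem k (ucs_at x (cmat k)) = x"
  proof (rule ucs_eqI)
    have "ucs0 x = ucs0 (cem k (idm k) * x)" using assms by simp
    then show "ucs0 (cem k (ucs_at x (cmat k))) = ucs0 x" by (simp add: ucs_eval cm.emb_eval 1 i)
    fix S :: "(nat \<Rightarrow> nat \<Rightarrow> complex) calg" assume S: "unital_cstar_algebra S"
    then interpret s: ucalg S by (rule ucalg.intro)
    have "ucs_at x S = ucs_at (cem k (idm k) * x) S" using assms by simp
    also have "\<dots> = (if S = cmat k then ucs_at x S else ca_zero S)"
      using S by (auto simp: ucs_at_eval cm.emb_eval[OF i] s.mul_zero) (simp add: cm.mul_laws(2) flip: cmat_one)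
    finally show "ucs_at (cem k (ucs_at x (cmat k))) S = ucs_at x S"
      using S by (simp add: cm.emb_eval 1 split: if_splits)
  qed
qed

section \<open>Traces, ranges of projections and corners\<close>

definition trc :: "nat \<Rightarrow> (nat \<Rightarrow> nat \<Rightarrow> complex) ucs \<Rightarrow> complex" where
  "trc k x = (\<Sum>i<k. ucs_at x (cmat k) i i)"

lemma trc_add: "trc k (x + y) = trc k x + trc k y"
  by (simp add: trc_def ucs_at_eval cmat_cstar cmat_ops sum.distrib)

lemma trc_zero: "trc k 0 = 0"
  by (simp add: trc_def ucs_at_eval cmat_cstar cmat_zero)

lemma trc_sum: "trc k (sum f F) = (\<Sum>i\<in>F. trc k (f i))"
  by (induct F rule: infinite_finite_induct) (simp_all add: trc_add trc_zero)

lemma trc_mult_commute: "trc k (x * y) = trc k (y * x)"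
proof -
  define X where "X = ucs_at x (cmat k)"
  define Y where "Y = ucs_at y (cmat k)"
  have "trc k (x * y) = (\<Sum>i<k. \<Sum>j<k. X i j * Y j i)" "trc k (y * x) = (\<Sum>j<k. \<Sum>i<k. Y j i * X i j)"
    by (simp_all add: trc_def ucs_at_eval cmat_cstar cmat_ops mmul_def X_def Y_def)
  then show ?thesis by (simp add: sum.swap[of "\<lambda>i j. X i j * Y j i"] mult.commute)
qed

lemma trc_cem: "X \<in> cc k \<Longrightarrow> trc k (cem k X) = (\<Sum>i<k. X i i)"
  by (simp add: trc_def cm.emb_eval cmat_cstar)

lemma trc_idm: assumes "l \<le> k" shows "trc k (cem k (idm l)) = of_nat l"
proof -
  have "trc k (cem k (idm l)) = (\<Sum>i<k. idm l i i)" using assms by (simp add: trc_cem cc_closed)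
  also have "\<dots> = (\<Sum>i<l. idm l i i)"
    using assms by (intro sum.mono_neutral_right) (auto simp: idm_def)
  finally show ?thesis by (simp add: idm_def)
qed

text \<open>A projection satisfies \<open>Z = Z\<^sup>* Z\<close>, so a diagonal entry is the
  squared length of its column.\<close>

lemma trc_adj_mult: assumes "Z \<in> cc k" "madj Z = Z" "mmul k Z Z = Z"
  shows "Z j j = of_real (\<Sum>i<k. (cmod (Z i j))\<^sup>2)"
proof -
  have "Z j j = mmul k (madj Z) Z j j" using assms by simp
  then show ?thesis by (simp add: mmul_def madj_def adj_complex_def mult.commute flip: complex_norm_square)
qed

text \<open>An orthonormal family in the range of \<open>q\<close>, stored as the first \<open>l\<close> columns of \<open>V\<close>, is extended as
  long as \<open>q - V V\<^sup>*\<close> has a nonzero column.\<close>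
lemma projection_isometry:
  assumes qc: "q \<in> cc k" and qq: "mmul k q q = q" and qa: "madj q = q"
  shows "\<exists>l\<le>k. \<exists>V\<in>cc k. mmul k (madj V) V = idm l \<and> mmul k V (madj V) = q"
proof -
  define ON where "ON l V \<longleftrightarrow> V \<in> cc k \<and> mmul k (madj V) V = idm l \<and> mmul k q V = V" for l V
  have O0: "ON 0 (\<lambda>i j. 0)" by (simp add: ON_def cc_iff mmul_def madj_def idm_def)
  have Ok: "l \<le> k" if ONV: "ON l V" for l V
  proof (rule ccontr)
    assume "\<not> l \<le> k"
    then have "idm l k k = 1" by (simp add: idm_def)
    moreover have "V i k = 0" for i using ONV unfolding ON_def cc_iff by blast
    then have "mmul k (madj V) V k k = 0" unfolding mmul_def by simp
    moreover have "mmul k (madj V) V = idm l" using ONV unfolding ON_def by blast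
    ultimately show False by simp
  qed
  define l where "l = (GREATEST l. \<exists>V. ON l V)"
  have "\<exists>V. ON l V" unfolding l_def by (rule GreatestI_nat[of _ 0 k]) (use O0 Ok in blast)+
  then obtain V where V: "ON l V" by blast
  have nomore: "\<not> ON (Suc l) W" for W
  proof
    assume "ON (Suc l) W"
    then have "Suc l \<le> l" unfolding l_def by (intro Greatest_le_nat[of _ _ k]) (use Ok in blast)+
    then show False by simp
  qed
  have lk: "l \<le> k" using Ok V by blast
  have Vc: "V \<in> cc k" and VV: "mmul k (madj V) V = idm l" and qV: "mmul k q V = V" using V by (auto simp: ON_def)
  define Z where "Z = (\<lambda>i j. q i j - mmul k V (madj V) i j)"
  have Zc: "Z \<in> cc k" unfolding Z_def by (intro cc_closed qc Vc)
  define v where "v = cem k V"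
  define f where "f = cem k (idm l)"
  define Q where "Q = cem k q"
  define z where "z = cem k Z"
  have vv: "adj v * v = f" using arg_cong[OF VV, of "cem k"] by (simp add: cem_mmul cem_madj cc_closed Vc v_def f_def)
  have ff: "f * f = f" "adj f = f" unfolding f_def by (rule cem_idm[OF lk])+
  have vf: "v * f = v" by (rule partial_isometry_right[OF vv ff(1)])
  have QQ: "Q * Q = Q" "adj Q = Q" "Q * v = v"
    using arg_cong[OF qq, of "cem k"] arg_cong[OF qa, of "cem k"] arg_cong[OF qV, of "cem k"]
    by (simp_all add: cem_mmul cem_madj qc Vc Q_def v_def)
  have vQ: "adj v * Q = adj v"
  proof -
    have "adj v * Q = adj (Q * v)" by (simp only: adj_mult QQ(2))
    then show ?thesis by (simp only: QQ(3))
  qed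
  have z: "z = Q - v * adj v"
    unfolding z_def Z_def Q_def v_def by (simp add: cem_sub cem_mmul cem_madj cc_closed qc Vc)
  have s1: "adj v * (v * y) = f * y" "v * (f * y) = v * y" "Q * (v * y) = v * y" for y
    by (simp_all add: vv vf QQ flip: mult.assoc)
  have "f * adj v = adj (v * f)" by (simp only: adj_mult ff(2))
  then have fav: "f * adj v = adj v" by (simp only: vf)
  have zv: "z * v = 0" "adj v * z = 0" "Q * z = z" "adj z = z"
    by (simp_all add: z left_diff_distrib right_diff_distrib mult.assoc vv vf QQ vQ s1 fav)
  have "z * z = z * Q - z * v * adj v" by (subst z) (simp add: z algebra_simps)
  also have "z * Q = z"
  proof -
    have "z * Q = adj (Q * z)" by (simp only: adj_mult QQ(2) zv(4))
    then show ?thesis by (simp only: zv(3,4))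
  qed
  finally have zz: "z * z = z" using zv by simp
  have inj: "X = Y" if "X \<in> cc k" "Y \<in> cc k" "cem k X = cem k Y" for X Y
    using cm.e_inj that by blast
  have ZZ: "mmul k Z Z = Z" using zz by (intro inj cc_closed Zc) (simp add: cem_mmul Zc z_def)
  have Za: "madj Z = Z" using zv(4) by (intro inj cc_closed Zc) (simp add: cem_madj Zc z_def)
  have z0: "(\<lambda>i j. 0) \<in> cc k" by (simp add: cc_iff)
  have cz: "cem k (\<lambda>i j. 0) = 0" using cm.e_zero[of k] by (simp add: cmat_zero)
  have ZV: "mmul k Z V = (\<lambda>i j. 0)" using zv(1) by (intro inj cc_closed Zc Vc z0) (simp add: cem_mmul Zc Vc cz z_def v_def)
  have VZ: "mmul k (madj V) Z = (\<lambda>i j. 0)" using zv(2)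
    by (intro inj cc_closed Zc Vc z0) (simp add: cem_mmul cem_madj cc_closed Zc Vc cz z_def v_def)
  have qZ: "mmul k q Z = Z" using zv(3) by (intro inj cc_closed Zc qc) (simp add: cem_mmul Zc qc z_def Q_def)
  have "Z = (\<lambda>i j. 0)"
  proof (rule ccontr)
    assume "Z \<noteq> (\<lambda>i j. 0)"
    then obtain i0 j0 where ij: "Z i0 j0 \<noteq> 0" by (auto simp: fun_eq_iff)
    then have i0: "i0 < k" "j0 < k" using Zc by (auto simp: cc_iff)
    define a where "a = (\<Sum>i<k. (cmod (Z i j0))\<^sup>2)"
    have "(cmod (Z i0 j0))\<^sup>2 \<le> a" unfolding a_def using i0 by (intro member_le_sum) auto
    then have a: "a > 0" using ij by (smt (verit) zero_less_norm_iff zero_less_power)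
    have Zjj: "Re (Z j j) \<ge> 0" for j unfolding trc_adj_mult[OF Zc Za ZZ] by (simp add: sum_nonneg)
    have qjj: "Re (q j j) \<le> 1" if "j < k" for j
    proof -
      define c where "c = Re (q j j)"
      define s where "s = (\<Sum>i<k. (cmod (q i j))\<^sup>2)"
      have e: "q j j = of_real s" unfolding s_def by (rule trc_adj_mult[OF qc qa qq])
      have cs: "c = s" by (simp add: c_def e)
      have "c\<^sup>2 = (cmod (q j j))\<^sup>2" by (simp only: e norm_of_real power2_abs cs)
      also have "\<dots> \<le> s" unfolding s_def using that by (intro member_le_sum) auto
      also have "\<dots> = c" by (simp add: cs)
      finally have "c * (c - 1) \<le> 0" by (simp add: power2_eq_square algebra_simps)
      then show ?thesis unfolding c_def[symmetric] by (smt (verit) mult_pos_pos)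
    qed
    \<comment> \<open>There is room for another column: \<open>q\<close> has trace at most
      \<open>k\<close>, so \<open>q - V V\<^sup>*\<close> has trace at most \<open>k - l\<close>,
      and the positive diagonal entry \<open>a\<close> forces \<open>l < k\<close>. Column
      \<open>l\<close> is then filled with column \<open>j0\<close> of \<open>Z\<close>, normalised
      by \<open>b\<close>.\<close>
    have "trc k z = trc k Q - trc k (adj v * v)"
      using trc_add[of k z "v * adj v"] trc_mult_commute[of k v "adj v"] by (simp add: z)
    then have "(\<Sum>j<k. Z j j) = (\<Sum>j<k. q j j) - of_nat l"
      unfolding vv using trc_idm[OF lk] by (simp add: trc_cem z_def Q_def f_def Zc qc)
    then have "(\<Sum>j<k. Re (Z j j)) = (\<Sum>j<k. Re (q j j)) - real l"
      by (metis Re_complex_of_real Re_sum minus_complex.sel(1) of_real_of_nat_eq)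
    also have "(\<Sum>j<k. Re (q j j)) \<le> (\<Sum>j<k. 1)" using qjj by (intro sum_mono) auto
    finally have "(\<Sum>j<k. Re (Z j j)) \<le> real k - real l" by simp
    moreover have "Re (Z j0 j0) \<le> (\<Sum>j<k. Re (Z j j))" using i0 Zjj by (intro member_le_sum) auto
    moreover have "Re (Z j0 j0) = a" unfolding trc_adj_mult[OF Zc Za ZZ, of j0] by (simp add: a_def)
    ultimately have "l < k" using a by linarith
    define b where "b = complex_of_real (1 / sqrt a)"
    define W where "W = (\<lambda>i j. if j = l then b * Z i j0 else V i j)"
    have Wc: "W \<in> cc k" using Vc Zc \<open>l < k\<close> by (auto simp: cc_iff W_def)
    have Wl: "mmul k X W i l = b * mmul k X Z i j0" for X i
      unfolding mmul_def W_def by (simp add: sum_distrib_left algebra_simps)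
    have Wn: "mmul k X W i j = mmul k X V i j" if "j \<noteq> l" for X i j
      unfolding mmul_def W_def using that by simp
    have Wl': "mmul k (madj W) X l j = cnj b * mmul k (madj Z) X j0 j" for X j
      unfolding mmul_def W_def madj_def by (simp add: adj_complex_def sum_distrib_left algebra_simps)
    have Wn': "mmul k (madj W) X i j = mmul k (madj V) X i j" if "i \<noteq> l" for X i j
      unfolding mmul_def W_def madj_def using that by simp
    have "mmul k (madj W) W = idm (Suc l)"
    proof (intro ext)
      fix i j
      have bb: "cnj b * b * a = 1" using a by (simp add: b_def flip: of_real_mult)
      consider "i = l" "j = l" | "i = l" "j \<noteq> l" | "i \<noteq> l" "j = l" | "i \<noteq> l" "j \<noteq> l" by blast
      then show "mmul k (madj W) W i j = idm (Suc l) i j"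
      proof cases
        case 1
        have "mmul k (madj W) W l l = cnj b * b * Z j0 j0" unfolding Wl Wl' Za ZZ by simp
        then show ?thesis using 1 bb unfolding trc_adj_mult[OF Zc Za ZZ, of j0] by (simp add: a_def idm_def)
      next
        case 2
        then show ?thesis unfolding 2(1) Wl' Wn[OF 2(2)] Za ZV by (simp add: idm_def)
      next
        case 3
        then show ?thesis unfolding 3(2) Wn'[OF 3(1)] Wl VZ by (simp add: idm_def)
      next
        case 4
        then show ?thesis unfolding Wn'[OF 4(1)] Wn[OF 4(2)] VV by (auto simp: idm_def)
      qed
    qed
    moreover have "mmul k q W = W"
    proof (intro ext)
      fix i j show "mmul k q W i j = W i j"
        by (cases "j = l") (simp_all add: Wl Wn qZ qV, simp_all add: W_def)
    qed
    ultimately show False using nomore Wc unfolding ON_def by blast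
  qed
  then have "q i j = mmul k V (madj V) i j" for i j by (simp add: Z_def fun_eq_iff)
  then have "mmul k V (madj V) = q" by (simp add: fun_eq_iff)
  then show ?thesis using lk Vc VV by blast
qed

lemma corner_in: assumes X: "X \<in> cc k" and c: "mmul k (idm l) X = X" "mmul k X (idm l) = X" shows "X \<in> cc l"
  unfolding cc_iff
proof (intro allI impI)
  fix i j assume "\<not> (i < l \<and> j < l)"
  then consider "\<not> i < l" | "\<not> j < l" by blast
  then show "X i j = 0"
  proof cases
    case 1
    then have "mmul k (idm l) X i j = 0" unfolding mmul_def by (intro sum.neutral) (simp add: idm_def)
    then show ?thesis using c by simp
  next
    case 2
    then have "mmul k X (idm l) i j = 0" unfolding mmul_def by (intro sum.neutral) (simp add: idm_def)
    then show ?thesis using c by simp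
  qed
qed

subsection \<open>Matrix units\<close>

definition msing :: "nat \<Rightarrow> nat \<Rightarrow> 'a \<Rightarrow> nat \<Rightarrow> nat \<Rightarrow> 'a::cstar" where
  "msing s t x = (\<lambda>i j. if i = s \<and> j = t then x else 0)"

lemma mmul_msing_left: "t < n \<Longrightarrow> mmul n (msing s t x) Y = (\<lambda>i j. if i = s then x * Y t j else 0)"
proof (intro ext)
  fix i j assume t: "t < n"
  have "mmul n (msing s t x) Y i j = (\<Sum>l<n. if l = t then (if i = s then x * Y t j else 0) else 0)"
    unfolding mmul_def msing_def by (intro sum.cong) auto
  then show "mmul n (msing s t x) Y i j = (if i = s then x * Y t j else 0)" using t by simp
qed

lemma mmul_msing_right: "u < n \<Longrightarrow> mmul n Y (msing u v x) = (\<lambda>i j. if j = v then Y i u * x else 0)"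
proof (intro ext)
  fix i j assume u: "u < n"
  have "mmul n Y (msing u v x) i j = (\<Sum>l<n. if l = u then (if j = v then Y i u * x else 0) else 0)"
    unfolding mmul_def msing_def by (intro sum.cong) auto
  then show "mmul n Y (msing u v x) i j = (if j = v then Y i u * x else 0)" using u by simp
qed

locale matalg = ucalg A for A :: "'a calg" + fixes n :: nat
begin

abbreviation C :: "(nat \<Rightarrow> nat \<Rightarrow> 'a) calg" where "C \<equiv> mat_alg A n"

text \<open>The elementary tensor of \<open>a\<close> with the matrix unit at position
  \<open>(s, t)\<close>, viewed in the copy of the matrix algebra.\<close>

definition mu :: "nat \<Rightarrow> nat \<Rightarrow> 'a \<Rightarrow> (nat \<Rightarrow> nat \<Rightarrow> 'a) ucs" where
  "mu s t a = emb C (\<lambda>i j. if i = s \<and> j = t then a else ca_zero A)"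

sublocale ea: crep A "emb A" by (rule crep_emb[OF uc])

sublocale ec: crep C "emb C" by (rule crep_emb[OF mat_alg_cstar[OF uc]])

lemma C_carrier: "ca_carrier C = ca_carrier (mat_alg0 A n)"
  by (simp add: mat_alg_def)

lemma emC_laws:
  "X \<in> ca_carrier C \<Longrightarrow> Y \<in> ca_carrier C \<Longrightarrow> ea.em (ca_add C X Y) = (\<lambda>i j. ea.em X i j + ea.em Y i j)"
  "X \<in> ca_carrier C \<Longrightarrow> Y \<in> ca_carrier C \<Longrightarrow> ea.em (ca_mul C X Y) = mmul n (ea.em X) (ea.em Y)"
  "X \<in> ca_carrier C \<Longrightarrow> ea.em (ca_smult C c X) = (\<lambda>i j. c *\<^sub>C ea.em X i j)"
  "X \<in> ca_carrier C \<Longrightarrow> ea.em (ca_star C X) = madj (ea.em X)"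
  using ea.em_laws(2-5)[where n=n] by (simp_all add: mat_alg_def)

lemma emC_inj: "X \<in> ca_carrier C \<Longrightarrow> Y \<in> ca_carrier C \<Longrightarrow> ea.em X = ea.em Y \<Longrightarrow> X = Y"
  unfolding C_carrier by (rule ea.em_inj)

lemma norm_C: "X \<in> ca_carrier C \<Longrightarrow> norm (emb C X) = opn n (ea.em X)"
  using ec.norm_e[of X] mat_alg_norm[OF uc, of X n] by (simp add: C_carrier ea.em_def)

abbreviation sg :: "nat \<Rightarrow> nat \<Rightarrow> 'a \<Rightarrow> nat \<Rightarrow> nat \<Rightarrow> 'a" where
  "sg s t a \<equiv> (\<lambda>i j. if i = s \<and> j = t then a else ca_zero A)"

lemma sg_in: "s < n \<Longrightarrow> t < n \<Longrightarrow> a \<in> ca_carrier A \<Longrightarrow> sg s t a \<in> ca_carrier C"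
  by (auto simp: C_carrier mat_alg0_def)

lemma em_sg: "ea.em (sg s t a) = msing s t (emb A a)"
  by (auto simp: ea.em_def msing_def fun_eq_iff)

lemma mu_sandwich:
  assumes X: "X \<in> ca_carrier C" and "s < n" "t < n" "u < n" "v < n" "a \<in> ca_carrier A" "b \<in> ca_carrier A"
  shows "mu s t a * emb C X * mu u v b = mu s v (ca_mul A (ca_mul A a (X t u)) b)"
proof -
  note g = sg_in[OF assms(2,3,6)] sg_in[OF assms(4,5,7)]
  have X': "X t u \<in> ca_carrier A" using X by (simp add: C_carrier ea.mat_in)
  then have ab: "ca_mul A (ca_mul A a (X t u)) b \<in> ca_carrier A" using assms by simp
  note g' = sg_in[OF assms(2,5) ab]
  have "ca_mul C (ca_mul C (sg s t a) X) (sg u v b) = sg s v (ca_mul A (ca_mul A a (X t u)) b)"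
  proof (rule emC_inj)
    have emX: "ea.em X t u = emb A (X t u)" by (simp add: ea.em_def)
    show "ca_mul C (ca_mul C (sg s t a) X) (sg u v b) \<in> ca_carrier C" "sg s v (ca_mul A (ca_mul A a (X t u)) b) \<in> ca_carrier C"
      using g g' X by simp_all
    show "ea.em (ca_mul C (ca_mul C (sg s t a) X) (sg u v b)) = ea.em (sg s v (ca_mul A (ca_mul A a (X t u)) b))"
      using g X X' assms
      by (simp add: emC_laws em_sg mmul_msing_left mmul_msing_right emX ea.e_mul) (auto simp: msing_def emX fun_eq_iff ea.e_mul)
  qed
  then show ?thesis unfolding mu_def using g X by (simp flip: ec.e_mul)
qed

lemma mu_mult:
  assumes "s < n" "t < n" "u < n" "v < n" "a \<in> ca_carrier A" "b \<in> ca_carrier A"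
  shows "mu s t a * mu u v b = (if t = u then mu s v (ca_mul A a b) else 0)"
proof -
  note g = sg_in[OF assms(1,2,5)] sg_in[OF assms(3,4,6)]
  have ab: "ca_mul A a b \<in> ca_carrier A" using assms by simp
  note g' = sg_in[OF assms(1,4) ab]
  have "mu s t a * mu u v b = emb C (ca_mul C (sg s t a) (sg u v b))"
    unfolding mu_def using g by (simp add: ec.e_mul)
  also have "ca_mul C (sg s t a) (sg u v b) = (if t = u then sg s v (ca_mul A a b) else ca_zero C)"
  proof (cases "t = u")
    case True
    have "ca_mul C (sg s t a) (sg u v b) = sg s v (ca_mul A a b)"
      by (rule emC_inj) (use g g' assms True in \<open>simp_all add: emC_laws em_sg mmul_msing_left ea.e_mul\<close>, auto simp: msing_def fun_eq_iff)
    then show ?thesis using True by simp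
  next
    case False
    have "ca_mul C (sg s t a) (sg u v b) = ca_zero C"
      by (rule emC_inj)
         (use g assms False in \<open>simp_all add: emC_laws em_sg mmul_msing_left\<close>, auto simp: msing_def fun_eq_iff ea.em_def mat_alg_def mat_alg0_def)
    then show ?thesis using False by simp
  qed
  finally show ?thesis by (simp add: mu_def)
qed

lemma mu_adj:
  assumes "s < n" "t < n" "a \<in> ca_carrier A" shows "adj (mu s t a) = mu t s (ca_star A a)"
proof -
  have a: "ca_star A a \<in> ca_carrier A" using assms by simp
  note g = sg_in[OF assms] sg_in[OF assms(2,1) a]
  have "ca_star C (sg s t a) = sg t s (ca_star A a)"
    by (rule emC_inj) (use g assms in \<open>auto simp: emC_laws em_sg madj_def msing_def ea.e_star fun_eq_iff\<close>)
  then show ?thesis unfolding mu_def using g ec.e_star[OF g(1)] by simp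
qed

lemma mu_add:
  assumes "s < n" "t < n" "a \<in> ca_carrier A" "b \<in> ca_carrier A" shows "mu s t (ca_add A a b) = mu s t a + mu s t b"
proof -
  have ab: "ca_add A a b \<in> ca_carrier A" using assms by simp
  note g = sg_in[OF assms(1,2,3)] sg_in[OF assms(1,2,4)] sg_in[OF assms(1,2) ab]
  have "ca_add C (sg s t a) (sg s t b) = sg s t (ca_add A a b)"
    by (rule emC_inj) (use g assms in \<open>auto simp: emC_laws em_sg msing_def ea.e_add fun_eq_iff\<close>)
  then show ?thesis unfolding mu_def using g ec.e_add[OF g(1,2)] by simp
qed

lemma mu_smult:
  assumes "s < n" "t < n" "a \<in> ca_carrier A" shows "mu s t (ca_smult A c a) = c *\<^sub>C mu s t a"
proof -
  have a: "ca_smult A c a \<in> ca_carrier A" using assms by simp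
  note g = sg_in[OF assms] sg_in[OF assms(1,2) a]
  have "ca_smult C c (sg s t a) = sg s t (ca_smult A c a)"
    by (rule emC_inj) (use g assms in \<open>auto simp: emC_laws em_sg msing_def ea.e_smult fun_eq_iff\<close>)
  then show ?thesis unfolding mu_def using g ec.e_smult[OF g(1), of c] by simp
qed

lemma norm_mu:
  assumes "s < n" "t < n" "a \<in> ca_carrier A" shows "norm (mu s t a) = ca_norm A a"
proof -
  have "norm (mu s t a) = opn n (msing s t (emb A a))"
    unfolding mu_def using norm_C[OF sg_in[OF assms]] by (simp add: em_sg)
  moreover have "opn n (msing s t (emb A a)) \<le> norm (emb A a)"
  proof -
    have "(\<Sum>i<n. \<Sum>j<n. norm (msing s t (emb A a) i j)) = (\<Sum>i<n. \<Sum>j<n. if j = t then (if i = s then norm (emb A a) else 0) else 0)"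
      by (intro sum.cong) (auto simp: msing_def)
    also have "\<dots> = norm (emb A a)" using assms by simp
    finally show ?thesis using opn_le_sum[of n "msing s t (emb A a)"] by simp
  qed
  moreover have "norm (emb A a) \<le> opn n (msing s t (emb A a))"
    using norm_le_opn[OF assms(1,2), of "msing s t (emb A a)"] by (simp add: msing_def)
  ultimately show ?thesis using ea.norm_e[OF assms(3)] by simp
qed

lemma crep_mu: "s < n \<Longrightarrow> crep A (mu s s)"
  by (intro crep.intro crep_axioms.intro ucalg.intro uc)
     (simp_all add: mu_add mu_mult mu_smult mu_adj norm_mu)

lemma one_decomp: "emb C (ca_one C) = (\<Sum>s<n. mu s s (ca_one A))"
proof -
  define P where "P m = (\<lambda>i j. if i < m \<and> j < m \<and> i = j then ca_one A else ca_zero A)" for m :: nat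
  have Pin: "P m \<in> ca_carrier C" if "m \<le> n" for m using that by (auto simp: P_def C_carrier mat_alg0_def)
  have "emb C (P m) = (\<Sum>s<m. mu s s (ca_one A))" if "m \<le> n" for m
    using that
  proof (induct m)
    case 0
    have "P 0 = ca_zero C" by (simp add: P_def mat_alg_def mat_alg0_def)
    then show ?case by simp
  next
    case (Suc m)
    have g: "sg m m (ca_one A) \<in> ca_carrier C" using Suc by (intro sg_in) auto
    have p: "P m \<in> ca_carrier C" "P (Suc m) \<in> ca_carrier C" using Suc(2) by (simp_all add: Pin)
    have "P (Suc m) = ca_add C (P m) (sg m m (ca_one A))"
    proof (rule emC_inj[OF p(2)])
      show "ca_add C (P m) (sg m m (ca_one A)) \<in> ca_carrier C" using p g by simp
      show "ea.em (P (Suc m)) = ea.em (ca_add C (P m) (sg m m (ca_one A)))"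
        unfolding emC_laws(1)[OF p(1) g] em_sg by (auto simp: msing_def ea.em_def P_def fun_eq_iff)
    qed
    then show ?case using Suc p g by (simp add: ec.e_add mu_def)
  qed
  from this[of n] show ?thesis by (simp add: P_def mat_alg_def mat_alg0_def)
qed

text \<open>Compress from both sides with the diagonal projections of \<open>one_decomp\<close>;
  \<open>mu_sandwich\<close> evaluates each block.\<close>

lemma elem_decomp: assumes X: "X \<in> ca_carrier C" shows "emb C X = (\<Sum>s<n. \<Sum>t<n. mu s t (X s t))"
proof -
  have x: "X s t \<in> ca_carrier A" for s t using X by (simp add: C_carrier ea.mat_in)
  have "emb C X = emb C (ca_one C) * emb C X * emb C (ca_one C)"
    using ec.e_one_mult[OF X] by (simp add: mult.assoc)
  also have "\<dots> = (\<Sum>s<n. \<Sum>t<n. mu s s (ca_one A) * emb C X * mu t t (ca_one A))"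
    unfolding one_decomp by (simp add: sum_distrib_left sum_distrib_right) (rule sum.swap)
  also have "\<dots> = (\<Sum>s<n. \<Sum>t<n. mu s t (X s t))"
    using x by (intro sum.cong refl) (simp add: mu_sandwich[OF X] mul_laws)
  finally show ?thesis .
qed

end

text \<open>Conjugation by \<open>v\<close> moves the corner with unit \<open>L\<close> onto the
  corner with unit \<open>v v\<^sup>*\<close>. Each inner \<open>v\<^sup>* v = L\<close> is absorbed
  by the neighbouring letter, so the same polynomial is evaluated with respect to the new
  unit.\<close>

lemma npe_conj:
  assumes vv: "adj v * v = L" and vL: "v * L = v" and D: "\<And>i. i < m \<Longrightarrow> L * D i = D i \<and> D i * L = D i"
    and P: "P \<in> rat_ncpolys m"
  shows "npe (v * adj v) (\<lambda>i. v * D i * adj v) P = v * npe L D P * adj (v :: 'a::cstar)"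
proof -
  have w: "wpr (v * adj v) (\<lambda>i. v * D i * adj v) w = v * wpr L D w * adj v" if "\<forall>i\<in>set w. i < m" for w
    using that
  proof (induct w)
    case (Cons i w)
    have Di: "D i * L = D i" using D Cons(2) by simp
    have "v * D i * adj v * (v * wpr L D w * adj v) = v * (D i * (adj v * v)) * wpr L D w * adj v"
      by (simp add: mult.assoc)
    also have "\<dots> = v * (D i * wpr L D w) * adj v" unfolding vv Di by (simp add: mult.assoc)
    finally show ?case using Cons by simp
  qed (simp add: vL)
  show ?thesis
    unfolding npe_def sum_distrib_left sum_distrib_right
    by (intro sum.cong refl) (use w rat_ncpolys_vars[OF P] in simp)
qed

lemma norm_sandwich_le:
  assumes "norm a \<le> 1" "norm c \<le> 1" shows "norm (a * y * c) \<le> norm (y :: 'a::cstar)"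
proof -
  have "norm (a * y * c) \<le> norm a * norm y * norm c"
    by (rule order_trans[OF norm_mult_ineq]) (intro mult_right_mono norm_mult_ineq norm_ge_zero)
  also have "\<dots> \<le> 1 * norm y * 1" using assms by (intro mult_mono) auto
  finally show ?thesis by simp
qed

lemma norm_isometry_conj:
  assumes vv: "adj v * v = L" and LL: "L * L = L" and X: "L * X = X" "X * L = X"
  shows "norm (v * X * adj v) = norm (X :: 'a::cstar)"
proof (rule antisym)
  have nv: "norm v \<le> 1" "norm (adj v) \<le> 1" using norm_partial_isometry_le[OF vv LL] by simp_all
  show "norm (v * X * adj v) \<le> norm X" using nv by (intro norm_sandwich_le) auto
  have "adj v * (v * X * adj v) * v = (adj v * v) * X * (adj v * v)" by (simp add: mult.assoc)
  then have "adj v * (v * X * adj v) * v = X" unfolding vv X .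
  then show "norm X \<le> norm (v * X * adj v)" using norm_sandwich_le[OF nv(2,1), of "v * X * adj v"] by simp
qed

text \<open>Gram-Schmidt step: \<open>T'\<close> is made orthogonal to the isometries \<open>T i\<close> and then corrected to an exact
  isometry.\<close>
lemma orthogonal_isometry_step:
  fixes E L :: "'a::cstar" and T :: "nat \<Rightarrow> 'a"
  assumes L: "L * L = L" "adj L = L"
    and T: "\<And>i j. i < s \<Longrightarrow> j < s \<Longrightarrow> adj (T i) * T j = (if i = j then L else 0)"
    and ET: "\<And>i. i < s \<Longrightarrow> E * T i = T i" and TL: "\<And>i. i < s \<Longrightarrow> T i * L = T i"
    and T': "E * T' = T'" "T' * L = T'"
    and u: "u = (\<Sum>i<s. norm (adj (T i) * T'))"
    and d: "d = norm (adj T' * T' - L) + u * (2 * norm T' + u)" "d \<le> 1/4"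
  shows "\<exists>W. E * W = W \<and> W * L = W \<and> adj W * W = L \<and> (\<forall>i<s. adj (T i) * W = 0 \<and> adj W * T i = 0)
    \<and> norm (W - T') \<le> u + 2 * d"
proof -
  define w where "w i = adj (T i) * T'" for i
  define S where "S = T' - (\<Sum>i<s. T i * w i)"
  have nT: "norm (T i) \<le> 1" if "i < s" for i using norm_partial_isometry_le[OF _ L(1)] T[OF that that] by simp
  have u0: "u \<ge> 0" unfolding u by (intro sum_nonneg) simp
  have LT: "L * adj (T i) = adj (T i)" if "i < s" for i
  proof -
    have "L * adj (T i) = adj (T i * L)" by (simp only: adj_mult L(2))
    then show ?thesis using TL[OF that] by simp
  qed
  have SL: "S * L = S" unfolding S_def w_def by (simp add: left_diff_distrib T'(2) sum_distrib_right mult.assoc)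
  have ES: "E * S = S"
    unfolding S_def by (simp add: right_diff_distrib T'(1) sum_distrib_left ET flip: mult.assoc)
  have nS: "norm (S - T') \<le> u"
  proof -
    have "norm (S - T') = norm (\<Sum>i<s. T i * w i)" by (simp add: S_def)
    also have "\<dots> \<le> (\<Sum>i<s. norm (T i * w i))" by (rule norm_sum)
    also have "\<dots> \<le> (\<Sum>i<s. 1 * norm (w i))"
      by (intro sum_mono order_trans[OF norm_mult_ineq] mult_right_mono) (auto simp: nT)
    finally show ?thesis by (simp add: u w_def)
  qed
  have orth: "adj (T i) * S = 0" if i: "i < s" for i
  proof -
    have "adj (T i) * S = w i - (\<Sum>j<s. adj (T i) * T j * w j)"
      by (simp add: S_def right_diff_distrib sum_distrib_left w_def mult.assoc)
    also have "(\<Sum>j<s. adj (T i) * T j * w j) = (\<Sum>j<s. if j = i then L * w i else 0)"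
      using i by (intro sum.cong) (auto simp: T)
    also have "\<dots> = L * w i" using i by simp
    also have "L * w i = w i" using LT[OF i] by (simp add: w_def flip: mult.assoc)
    finally show ?thesis by simp
  qed
  \<comment> \<open>Removing the components along the \<open>T i\<close> moves \<open>T'\<close> by
    at most \<open>u\<close>. With \<open>norm S \<le> norm T' + u\<close> the defect grows by at
    most \<open>(norm T' + u) * u + u * norm T'\<close>, which explains the form of
    \<open>d\<close>.\<close>
  have "adj S * S - L = adj S * (S - T') + adj (S - T') * T' + (adj T' * T' - L)" by (simp add: algebra_simps)
  then have "norm (adj S * S - L) \<le> norm (adj S * (S - T')) + norm (adj (S - T') * T') + norm (adj T' * T' - L)"
    by (metis (no_types, lifting) add_right_mono norm_triangle_ineq order_trans)
  also have "norm (adj S * (S - T')) \<le> (norm T' + u) * u"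
  proof -
    have "norm S \<le> norm T' + u" using nS norm_triangle_sub[of S T'] by linarith
    then show ?thesis using nS by (intro order_trans[OF norm_mult_ineq] mult_mono) (auto simp: u0 add_nonneg_nonneg)
  qed
  also have "norm (adj (S - T') * T') \<le> u * norm T'"
    using nS by (intro order_trans[OF norm_mult_ineq] mult_right_mono) (simp_all only: norm_adj norm_ge_zero)
  finally have "norm (adj S * S - L) \<le> d" by (simp add: d(1) algebra_simps)
  then obtain W where W: "W * L = W" "adj W * W = L" "norm (W - S) \<le> 2 * d" and g: "\<And>g. g * S = S \<Longrightarrow> g * W = W"
    using newton_partial_isometry[OF L SL _ d(2)] by blast
  have "E * W = W" by (rule g[OF ES])
  moreover have o: "adj (T i) * W = 0" if i: "i < s" for i
  proof -
    \<comment> \<open>Orthogonality to \<open>T i\<close> is expressed as a left identity, the form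
      in which Newton's iteration preserves it.\<close>
    have "(1 - T i * adj (T i)) * S = S" by (simp add: left_diff_distrib mult.assoc orth[OF i])
    then have "(1 - T i * adj (T i)) * W = W" by (rule g)
    then have z: "T i * (adj (T i) * W) = 0" by (simp add: left_diff_distrib mult.assoc)
    have "adj (T i) * W = L * adj (T i) * W" by (simp only: LT[OF i])
    also have "\<dots> = adj (T i) * (T i * (adj (T i) * W))" using T[OF i i] by (simp flip: mult.assoc)
    finally show ?thesis by (simp only: z mult_zero_right)
  qed
  moreover have "adj W * T i = 0" if i: "i < s" for i
    using arg_cong[OF o[OF i], of adj] by simp
  moreover have "norm (W - T') \<le> u + 2 * d"
    using norm_triangle_ineq[of "W - S" "S - T'"] nS W(3) by simp
  ultimately show ?thesis using W by blast
qed

subsection \<open>Lifting matrix units to microstates\<close>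

text \<open>The hypothetical sequence of the compactness argument. Convergence is asked for rational
  polynomials, those reached by the enumeration, and the sizes \<open>k r\<close> are
  arbitrary.\<close>

locale microstates = matalg A n for A :: "'a calg" and n :: nat +
  fixes xs :: "'a list" and ys :: "(nat \<Rightarrow> nat \<Rightarrow> 'a) list"
    and k :: "nat \<Rightarrow> nat" and B :: "nat \<Rightarrow> (nat \<Rightarrow> nat \<Rightarrow> complex) list"
  assumes n0: "0 < n"
    and xs: "\<forall>x\<in>set xs. self_adjoint A x"
    and ys: "\<forall>y\<in>set ys. self_adjoint (mat_alg A n) y"
    and gen: "generates (mat_alg A n) ys"
    and lenB: "\<And>r. length (B r) = length ys"
    and saB: "\<And>r. \<forall>b\<in>set (B r). self_adjoint (cmat (k r)) b"
    and conv: "\<And>P. P \<in> rat_ncpolys (length ys) \<Longrightarrow>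
      (\<lambda>r. ca_norm (cmat (k r)) (ncp_eval (cmat (k r)) P (B r))) \<longlonglongrightarrow> ca_norm (mat_alg A n) (ncp_eval (mat_alg A n) P ys)"
begin

abbreviation EC where "EC \<equiv> emb C (ca_one C)"
abbreviation Er where "Er r \<equiv> cem (k r) (idm (k r))"
abbreviation yc where "yc i \<equiv> emb C (ys ! i)"
abbreviation yb where "yb i r \<equiv> cem (k r) (B r ! i)"
abbreviation one where "one \<equiv> ca_one A"

definition Qs :: "((nat \<Rightarrow> nat \<Rightarrow> 'a) ucs \<times> (nat \<Rightarrow> (nat \<Rightarrow> nat \<Rightarrow> complex) ucs)) set" where
  "Qs = {(npe EC yc P, \<lambda>r. npe (Er r) (\<lambda>i. yb i r) P) | P. P \<in> rat_ncpolys (length ys)}"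

lemma ys_in: "i < length ys \<Longrightarrow> ys ! i \<in> ca_carrier C" "set ys \<subseteq> ca_carrier C"
  using ys by (auto simp: self_adjoint_def)

lemma B_in: "i < length ys \<Longrightarrow> B r ! i \<in> cc (k r)" "set (B r) \<subseteq> cc (k r)"
  using saB[of r] lenB[of r] by (auto simp: self_adjoint_def)

lemma EC_laws: "EC * EC = EC" "adj EC = EC" "i < length ys \<Longrightarrow> EC * yc i = yc i \<and> adj (yc i) = yc i"
proof -
  show "EC * EC = EC" using ec.e_one_mult(1)[of "ca_one C"] by simp
  show "adj EC = EC" using ec.e_star[of "ca_one C"] ec.star_one by simp
  show "i < length ys \<Longrightarrow> EC * yc i = yc i \<and> adj (yc i) = yc i"
    using ec.e_one_mult(1)[of "ys ! i"] ec.e_star[of "ys ! i"] ys by (auto simp: self_adjoint_def)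
qed

lemma Er_laws: "Er r * Er r = Er r" "adj (Er r) = Er r" "i < length ys \<Longrightarrow> Er r * yb i r = yb i r \<and> adj (yb i r) = yb i r"
proof -
  show "Er r * Er r = Er r" "adj (Er r) = Er r" by (simp_all add: cem_idm)
  show "i < length ys \<Longrightarrow> Er r * yb i r = yb i r \<and> adj (yb i r) = yb i r"
    using cem_idm_mult(1)[of "B r ! i" "k r"] cm.e_star[of "B r ! i" "k r"] saB[of r] lenB[of r] by (auto simp: self_adjoint_def)
qed

lemma eval_C: "ncpoly_in_vars (length ys) P \<Longrightarrow> npe EC yc P = emb C (ncp_eval C P ys)"
  using ec.e_ncp_eval(2)[OF ys_in(2)] by simp

lemma eval_B: "P \<in> rat_ncpolys (length ys) \<Longrightarrow> npe (Er r) (\<lambda>i. yb i r) P = cem (k r) (ncp_eval (cmat (k r)) P (B r)) \<and>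
    ncp_eval (cmat (k r)) P (B r) \<in> cc (k r)"
  using cm.e_ncp_eval[OF B_in(2), of r P] lenB[of r] by (simp add: rat_ncpolys_def cmat_one)

sublocale asymp Qs
proof
  fix c z c' z'
  assume "(c, z) \<in> Qs"
  then obtain P where P: "P \<in> rat_ncpolys (length ys)" "c = npe EC yc P" "z = (\<lambda>r. npe (Er r) (\<lambda>i. yb i r) P)"
    by (auto simp: Qs_def)
  show "(adj c, \<lambda>r. adj (z r)) \<in> Qs"
    unfolding Qs_def P
    using npe_adj[OF EC_laws(1,2) EC_laws(3) P(1)] npe_adj[OF Er_laws(1,2) Er_laws(3) P(1)] nc_rat(2)[OF P(1)]
    by (intro CollectI exI[of _ "nc_adj P"]) simp
  show "(\<lambda>r. norm (z r)) \<longlonglongrightarrow> norm c"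
  proof -
    have "norm (z r) = ca_norm (cmat (k r)) (ncp_eval (cmat (k r)) P (B r))" for r
      using eval_B[OF P(1), of r] cm.norm_e[of "ncp_eval (cmat (k r)) P (B r)" "k r"] by (simp add: P)
    moreover have "norm c = ca_norm C (ncp_eval C P ys)"
      using P eval_C[of P] ec.norm_e[OF ec.e_ncp_eval(1)[OF ys_in(2)], of P] by (simp add: rat_ncpolys_def)
    ultimately show ?thesis using conv[OF P(1)] by simp
  qed
  show "(a *\<^sub>C c, \<lambda>r. a *\<^sub>C z r) \<in> Qs" if "a \<in> rat_complex" for a
    unfolding Qs_def P using nc_rat(3)[OF P(1) that]
    by (intro CollectI exI[of _ "nc_scale a P"]) (simp add: npe_scale)
  assume "(c', z') \<in> Qs"
  then obtain P' where P': "P' \<in> rat_ncpolys (length ys)" "c' = npe EC yc P'" "z' = (\<lambda>r. npe (Er r) (\<lambda>i. yb i r) P')"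
    by (auto simp: Qs_def)
  show "(c + c', \<lambda>r. z r + z' r) \<in> Qs"
    unfolding Qs_def P P' using rat_ncpolys_add[OF P(1) P'(1)]
    by (intro CollectI exI[of _ "P + P'"]) (simp add: npe_add)
  have "npe EC yc (nc_mult P P') = npe EC yc P * npe EC yc P'"
    by (rule npe_mult[OF EC_laws(1) _ P'(1)]) (simp add: EC_laws(3))
  moreover have "npe (Er r) (\<lambda>i. yb i r) (nc_mult P P') = npe (Er r) (\<lambda>i. yb i r) P * npe (Er r) (\<lambda>i. yb i r) P'" for r
    by (rule npe_mult[OF Er_laws(1) _ P'(1)]) (simp add: Er_laws(3))
  ultimately show "(c * c', \<lambda>r. z r * z' r) \<in> Qs"
    unfolding Qs_def P P' using nc_rat(1)[OF P(1) P'(1)]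
    by (intro CollectI exI[of _ "nc_mult P P'"]) simp
qed

lemma rep_EC: "rep EC Er"
proof (rule rep_Q)
  have "Poly_Mapping.single [] 1 \<in> rat_ncpolys (length ys)"
    by (rule rat_ncpolys_single) (auto simp: rat_complex_def)
  then show "(EC, Er) \<in> Qs" unfolding Qs_def
    by (intro CollectI exI[of _ "Poly_Mapping.single [] 1"]) (simp add: npe_single)
qed

lemma rep_y: assumes "i < length ys" shows "rep (yc i) (yb i)"
proof (rule rep_Q)
  have "Poly_Mapping.single [i] 1 \<in> rat_ncpolys (length ys)"
    by (rule rat_ncpolys_single) (use assms in \<open>auto simp: rat_complex_def\<close>)
  moreover have "yc i * EC = yc i" using ec.e_one_mult(2) ys_in(1)[OF assms] by blast
  moreover have "yb i r * Er r = yb i r" for r using cem_idm_mult(2) B_in(1)[OF assms] by blast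
  ultimately show "(yc i, yb i) \<in> Qs" unfolding Qs_def
    by (intro CollectI exI[of _ "Poly_Mapping.single [i] 1"]) (simp add: npe_single)
qed

text \<open>Polynomials in the \<open>ys\<close> are dense and their coefficients may be made
  rational. The representing matrices are themselves polynomial values, so \<open>Er r\<close> acts
  on them exactly as a unit.\<close>

lemma exists_rep: assumes c: "c \<in> ca_carrier C" shows "\<exists>z. rep (emb C c) z \<and> (\<forall>r. Er r * z r = z r)"
proof -
  have "\<exists>q s. (q, s) \<in> Qs \<and> norm (emb C c - q) < e" if e: "e > 0" for e
  proof -
    have "\<exists>P. ncpoly_in_vars (length ys) P \<and> ca_norm C (ca_sub C c (ncp_eval C P ys)) < e / 2"
      using gen c half_gt_zero[OF e] unfolding generates_def by blast
    then obtain P where P: "ncpoly_in_vars (length ys) P" "ca_norm C (ca_sub C c (ncp_eval C P ys)) < e / 2" by blast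
    have Pc: "ncp_eval C P ys \<in> ca_carrier C" by (rule ec.e_ncp_eval(1)[OF ys_in(2) P(1)])
    have "norm (emb C c - npe EC yc P) < e / 2"
      using P(2) ec.norm_e[OF ec.sub_in[OF c Pc]] by (simp add: ec.e_sub c Pc eval_C P(1))
    moreover obtain P' where P': "P' \<in> rat_ncpolys (length ys)" "norm (npe EC yc P - npe EC yc P') < e / 2"
      using npe_rat_approx[OF P(1), of "e / 2"] e by auto
    ultimately have "norm (emb C c - npe EC yc P') < e"
      using norm_triangle_ineq[of "emb C c - npe EC yc P" "npe EC yc P - npe EC yc P'"] by simp
    then show ?thesis using P'(1) unfolding Qs_def by blast
  qed
  then obtain z where z: "rep (emb C c) z" "\<And>r. \<exists>q s. (q, s) \<in> Qs \<and> z r = s r" using rep_exists by metis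
  have "Er r * z r = z r" for r
  proof -
    obtain P where P: "P \<in> rat_ncpolys (length ys)" "z r = npe (Er r) (\<lambda>i. yb i r) P"
      using z(2)[of r] by (auto simp: Qs_def)
    then show ?thesis using eval_B[OF P(1), of r] cem_idm_mult(1) by simp
  qed
  then show ?thesis using z(1) by blast
qed

lemma rep_cong_ev: assumes "rep c z" "eventually (\<lambda>r. z r = z' r) sequentially" shows "rep c z'"
proof (rule rep_cong[OF assms(1)])
  have "eventually (\<lambda>r. norm (z r - z' r) = 0) sequentially" using assms(2) by eventually_elim simp
  then show "(\<lambda>r. norm (z r - z' r)) \<longlonglongrightarrow> 0" by (rule tendsto_eventually)
qed

text \<open>\<open>v r\<close> embeds the first \<open>l r\<close> coordinates isometrically into
  the space of dimension \<open>k r\<close>. The rank \<open>l r\<close> of the lifted projection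
  \<open>v v\<^sup>*\<close> will be the size of the microstate for the \<open>x\<close>.\<close>

definition frame :: "(nat \<Rightarrow> nat) \<Rightarrow> (nat \<Rightarrow> (nat \<Rightarrow> nat \<Rightarrow> complex) ucs) \<Rightarrow> nat \<Rightarrow> bool" where
  "frame l v r \<longleftrightarrow> l r \<le> k r \<and> Er r * v r = v r \<and> adj (v r) * v r = cem (k r) (idm (l r))"

lemma frame_laws:
  assumes "frame l v r" defines "L \<equiv> cem (k r) (idm (l r))"
  shows "L * L = L" "adj L = L" "v r * L = v r" "adj (v r) * v r = L" "norm (v r) \<le> 1" "Er r * v r = v r"
    "L * adj (v r) = adj (v r)"
proof -
  show 1: "L * L = L" "adj L = L" using assms(1) unfolding L_def frame_def by (simp_all add: cem_idm)
  show 2: "adj (v r) * v r = L" "Er r * v r = v r" using assms(1) unfolding L_def frame_def by simp_all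
  show 3: "v r * L = v r" by (rule partial_isometry_right[OF 2(1) 1(1)])
  show "norm (v r) \<le> 1" by (rule norm_partial_isometry_le[OF 2(1) 1(1)])
  have "L * adj (v r) = adj (v r * L)" by (simp only: adj_mult 1)
  then show "L * adj (v r) = adj (v r)" by (simp only: 3)
qed

text \<open>An approximation of the corner projection \<open>mu 0 0 one\<close> is made
  self-adjoint, replaced by an exact projection through \<open>projection_near\<close>, and factored
  as \<open>v v\<^sup>*\<close>. Only eventually is the defect below the threshold
  \<open>1/16\<close>.\<close>

lemma exists_frame:
  "\<exists>l v. rep (mu 0 0 one) (\<lambda>r. v r * adj (v r)) \<and> eventually (frame l v) sequentially"
proof -
  obtain z where z: "rep (mu 0 0 one) z" "\<And>r. Er r * z r = z r"
    using exists_rep[OF sg_in[of 0 0 one]] n0 unfolding mu_def by auto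
  define e where "e r = (1/2) *\<^sub>R (z r + adj (z r))" for r
  have m: "adj (mu 0 0 one) = mu 0 0 one" "mu 0 0 one * mu 0 0 one = mu 0 0 one"
    using n0 by (simp_all add: mu_adj mu_mult star_one mul_laws)
  have "rep ((1/2) *\<^sub>R (mu 0 0 one + adj (mu 0 0 one))) e"
    unfolding e_def by (intro rep_scaleR rep_add rep_adj z) auto
  moreover have "(1/2) *\<^sub>R (mu 0 0 one + adj (mu 0 0 one)) = mu 0 0 one"
    unfolding m by (simp flip: scaleR_2)
  ultimately have re: "rep (mu 0 0 one) e" by simp
  define d where "d r = norm (e r * e r - e r)" for r
  have "rep (mu 0 0 one * mu 0 0 one - mu 0 0 one) (\<lambda>r. e r * e r - e r)" by (intro rep_diff rep_mul re)
  from rep_norm[OF this] have d0: "d \<longlonglongrightarrow> 0" unfolding m d_def by simp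
  have ev: "eventually (\<lambda>r. d r < 1/16) sequentially" using order_tendstoD(2)[OF d0, of "1/16"] by simp
  have "\<exists>l v. d r < 1/16 \<longrightarrow> (l \<le> k r \<and> Er r * v = v \<and> adj v * v = cem (k r) (idm l) \<and> norm (v * adj v - e r) \<le> 4 * d r)" for r
  proof (cases "d r < 1/16")
    case True
    have zE: "adj (z r) * Er r = adj (z r)"
    proof -
      have "adj (z r) * Er r = adj (Er r * z r)" by (simp only: adj_mult Er_laws(2))
      then show ?thesis by (simp only: z(2))
    qed
    have zr: "z r = cem (k r) (ucs_at (z r) (cmat (k r)))" "ucs_at (z r) (cmat (k r)) \<in> cc (k r)"
      using cem_range[OF z(2)[of r]] by simp_all
    have "z r * Er r = z r" by (subst (1 2) zr(1)) (rule cem_idm_mult(2)[OF zr(2)])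
    then have eE: "e r * Er r = e r" by (simp add: e_def algebra_simps zE)
    have ea: "adj (e r) = e r" by (simp add: e_def add.commute)
    obtain q where q: "q * q = q" "adj q = q" "Er r * q = q" "norm (q - e r) \<le> 4 * d r"
      using projection_near[OF Er_laws(1,2) eE ea, of "d r"] True by (auto simp: d_def)
    define q' where "q' = ucs_at q (cmat (k r))"
    have q': "q' \<in> cc (k r)" "cem (k r) q' = q" using cem_range[OF q(3)] by (simp_all add: q'_def)
    have "mmul (k r) q' q' = q'" "madj q' = q'"
      by - (rule cm.e_inj[of _ "k r"]; use q q' in \<open>simp add: cc_closed cem_mmul cem_madj\<close>)+
    then obtain l V where lV: "l \<le> k r" "V \<in> cc (k r)" "mmul (k r) (madj V) V = idm l" "mmul (k r) V (madj V) = q'"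
      using projection_isometry[OF q'(1)] by blast
    define v where "v = cem (k r) V"
    have "adj v * v = cem (k r) (idm l)" "v * adj v = q"
      using arg_cong[OF lV(3), of "cem (k r)"] arg_cong[OF lV(4), of "cem (k r)"] lV(2) q'(2)
      by (simp_all add: v_def cem_mmul cem_madj cc_closed)
    moreover have "Er r * v = v" unfolding v_def by (rule cem_idm_mult(1)[OF lV(2)])
    ultimately show ?thesis using lV(1) q(4) by blast
  qed simp
  then obtain l v where lv: "\<And>r. d r < 1/16 \<Longrightarrow> l r \<le> k r \<and> Er r * v r = v r \<and> adj (v r) * v r = cem (k r) (idm (l r))
      \<and> norm (v r * adj (v r) - e r) \<le> 4 * d r" by metis
  have "eventually (frame l v) sequentially" using ev by eventually_elim (use lv in \<open>simp add: frame_def\<close>)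
  moreover have "rep (mu 0 0 one) (\<lambda>r. v r * adj (v r))"
  proof (rule rep_cong[OF re])
    have "(\<lambda>r. 4 * d r) \<longlonglongrightarrow> 0" using tendsto_mult[OF tendsto_const[of 4] d0] by simp
    moreover have "eventually (\<lambda>r. norm (norm (e r - v r * adj (v r))) \<le> 4 * d r) sequentially"
      using ev by eventually_elim (use lv in \<open>simp add: norm_minus_commute\<close>)
    ultimately show "(\<lambda>r. norm (e r - v r * adj (v r))) \<longlonglongrightarrow> 0" by (rule Lim_null_comparison[rotated])
  qed
  ultimately show ?thesis by blast
qed

abbreviation Lr where "Lr l r \<equiv> cem (k r) (idm (l r))"

text \<open>\<open>z i r * v r\<close> is an approximate isometry onto the \<open>i\<close>-th
  block, and the matrix-unit relations make these approximately orthogonal. Induction on the number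
  of blocks replaces one after the other by an exact isometry orthogonal to its
  predecessors.\<close>

lemma exists_isometries:
  assumes fr: "eventually (frame l v) sequentially" and q: "rep (mu 0 0 one) (\<lambda>r. v r * adj (v r))"
    and z: "\<And>i. i < n \<Longrightarrow> rep (mu i 0 one) (z i)" "\<And>i r. i < n \<Longrightarrow> Er r * z i r = z i r" and s: "s \<le> n"
  shows "\<exists>T. eventually (\<lambda>r. \<forall>i<s. Er r * T i r = T i r \<and> T i r * Lr l r = T i r \<and>
      (\<forall>j<s. adj (T i r) * T j r = (if i = j then Lr l r else 0))) sequentially \<and>
    (\<forall>i<s. (\<lambda>r. norm (T i r - z i r * v r)) \<longlonglongrightarrow> 0)"
  using s
proof (induct s)
  case (Suc s)
  then obtain T where T: "eventually (\<lambda>r. \<forall>i<s. Er r * T i r = T i r \<and> T i r * Lr l r = T i r \<and>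
      (\<forall>j<s. adj (T i r) * T j r = (if i = j then Lr l r else 0))) sequentially"
    and lim: "\<And>i. i < s \<Longrightarrow> (\<lambda>r. norm (T i r - z i r * v r)) \<longlonglongrightarrow> 0" by auto
  have sn: "s < n" using Suc(2) by simp
  define T' where "T' r = z s r * v r" for r
  define u where "u r = (\<Sum>i<s. norm (adj (T i r) * T' r))" for r
  define d where "d r = norm (adj (T' r) * T' r - Lr l r) + u r * (2 * norm (T' r) + u r)" for r
  have nT': "eventually (\<lambda>r. norm (T' r) \<le> norm (z s r)) sequentially"
    using fr
  proof eventually_elim
    case (elim r)
    have "norm (z s r) * norm (v r) \<le> norm (z s r) * 1"
      using frame_laws(5)[OF elim] by (intro mult_left_mono) auto
    then show ?case unfolding T'_def using norm_mult_ineq[of "z s r" "v r"] by simp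
  qed
  have nz: "(\<lambda>r. norm (z s r)) \<longlonglongrightarrow> norm (mu s 0 one)" by (rule rep_norm[OF z(1)[OF sn]])
  have co: "mu 0 0 one * (adj (mu i 0 one) * mu s 0 one) * mu 0 0 one = (if i = s then mu 0 0 one else 0)" if "i < n" for i
    using that sn n0 by (simp add: mu_adj mu_mult star_one mul_laws)
  \<comment> \<open>\<open>g\<close> measures the failure of a matrix-unit relation that is exact in
    the limit algebra, so it tends to \<open>0\<close>. Compression by \<open>v\<close> turns it
    into a bound for the overlaps and for the defect of \<open>T'\<close>.\<close>
  define g where "g i r = norm (v r * adj (v r) * (adj (z i r) * z s r) * (v r * adj (v r)) - (if i = s then v r * adj (v r) else 0))" for i r
  have g0: "(\<lambda>r. g i r) \<longlonglongrightarrow> 0" if "i < n" for i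
  proof -
    have "rep (mu 0 0 one * (adj (mu i 0 one) * mu s 0 one) * mu 0 0 one - (if i = s then mu 0 0 one else 0))
      (\<lambda>r. v r * adj (v r) * (adj (z i r) * z s r) * (v r * adj (v r)) - (if i = s then v r * adj (v r) else 0))"
      using q rep_0[OF q] by (cases "i = s") (auto intro!: rep_diff rep_mul rep_adj z(1) sn n0 that)
    from rep_norm[OF this] show ?thesis unfolding co[OF that] g_def by simp
  qed
  have gl: "norm (adj (z i r * v r) * T' r - (if i = s then Lr l r else 0)) \<le> g i r" if "frame l v r" for i r
  proof -
    note f = frame_laws[OF that]
    have vq: "adj (v r) * (v r * adj (v r)) = adj (v r)" "v r * adj (v r) * v r = v r"
      by (simp_all add: f(4,7) f(3) mult.assoc flip: mult.assoc[of "adj (v r)" "v r" "adj (v r)"])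
    have "adj (z i r * v r) * T' r = adj (v r) * (v r * adj (v r)) * (adj (z i r) * z s r) * (v r * adj (v r) * v r)"
      unfolding vq by (simp add: T'_def mult.assoc)
    moreover have "Lr l r = adj (v r) * (v r * adj (v r)) * v r" unfolding vq f(4) ..
    ultimately have "adj (z i r * v r) * T' r - (if i = s then Lr l r else 0) =
      adj (v r) * (v r * adj (v r) * (adj (z i r) * z s r) * (v r * adj (v r)) - (if i = s then v r * adj (v r) else 0)) * v r"
      by (simp add: algebra_simps)
    also have "norm \<dots> \<le> g i r" unfolding g_def by (rule norm_sandwich_le) (simp_all add: f(5))
    finally show ?thesis .
  qed
  have w0: "(\<lambda>r. norm (adj (T i r) * T' r)) \<longlonglongrightarrow> 0" if i: "i < s" for i
  proof (rule Lim_null_comparison)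
    show "(\<lambda>r. norm (T i r - z i r * v r) * norm (z s r) + g i r) \<longlonglongrightarrow> 0"
      using tendsto_add[OF tendsto_mult[OF lim[OF i] nz] g0[of i]] i sn by simp
    show "eventually (\<lambda>r. norm (norm (adj (T i r) * T' r)) \<le> norm (T i r - z i r * v r) * norm (z s r) + g i r) sequentially"
      using fr nT'
    proof eventually_elim
      case (elim r)
      have "adj (T i r) * T' r = adj (T i r - z i r * v r) * T' r + adj (z i r * v r) * T' r" by (simp add: algebra_simps)
      then have "norm (adj (T i r) * T' r) \<le> norm (adj (T i r - z i r * v r) * T' r) + norm (adj (z i r * v r) * T' r)"
        by (metis norm_triangle_ineq)
      also have "norm (adj (T i r - z i r * v r) * T' r) \<le> norm (T i r - z i r * v r) * norm (z s r)"
        using elim(2) by (intro order_trans[OF norm_mult_ineq] mult_mono) (simp_all only: norm_adj norm_ge_zero order_refl)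
      also have "norm (adj (z i r * v r) * T' r) \<le> g i r" using gl[OF elim(1), of i] i by simp
      finally show ?case by simp
    qed
  qed
  have u0: "u \<longlonglongrightarrow> 0"
  proof -
    have "(\<lambda>r. \<Sum>i<s. norm (adj (T i r) * T' r)) \<longlonglongrightarrow> (\<Sum>i<s. 0)" by (intro tendsto_sum w0) auto
    then show ?thesis by (simp add: u_def[abs_def])
  qed
  have upos: "u r \<ge> 0" for r unfolding u_def by (intro sum_nonneg) simp
  have d0: "d \<longlonglongrightarrow> 0"
  proof (rule Lim_null_comparison)
    show "(\<lambda>r. g s r + u r * (2 * norm (z s r) + u r)) \<longlonglongrightarrow> 0"
      using tendsto_add[OF g0[OF sn] tendsto_mult[OF u0 tendsto_add[OF tendsto_mult[OF tendsto_const[of 2] nz] u0]]] by simp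
    show "eventually (\<lambda>r. norm (d r) \<le> g s r + u r * (2 * norm (z s r) + u r)) sequentially"
      using fr nT'
    proof eventually_elim
      case (elim r)
      have "norm (adj (T' r) * T' r - Lr l r) \<le> g s r" using gl[OF elim(1), of s] by (simp add: T'_def)
      moreover have "u r * (2 * norm (T' r) + u r) \<le> u r * (2 * norm (z s r) + u r)"
        using elim(2) upos[of r] by (intro mult_left_mono) auto
      moreover have "d r \<ge> 0" unfolding d_def using upos[of r] by (simp add: add_nonneg_nonneg)
      ultimately show ?case by (simp add: d_def)
    qed
  qed
  have "eventually (\<lambda>r. d r < 1/4) sequentially" using order_tendstoD(2)[OF d0, of "1/4"] by simp
  with T fr have "eventually (\<lambda>r. \<exists>W. (\<forall>i<s. Er r * T i r = T i r \<and> T i r * Lr l r = T i r \<and>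
      (\<forall>j<s. adj (T i r) * T j r = (if i = j then Lr l r else 0))) \<and>
      Er r * W = W \<and> W * Lr l r = W \<and> adj W * W = Lr l r \<and> (\<forall>i<s. adj (T i r) * W = 0 \<and> adj W * T i r = 0)
      \<and> norm (W - T' r) \<le> u r + 2 * d r) sequentially"
  proof eventually_elim
    case (elim r)
    note f = frame_laws[OF elim(2)]
    have ET': "Er r * T' r = T' r" unfolding T'_def using z(2)[OF sn, of r] by (simp flip: mult.assoc)
    have TL': "T' r * Lr l r = T' r" unfolding T'_def by (simp add: mult.assoc f(3))
    show ?case
      using elim(1) orthogonal_isometry_step[OF f(1,2), of s "\<lambda>i. T i r" "Er r" "T' r" "u r" "d r"] ET' TL' elim(3)
      by (simp add: u_def[of r] d_def[of r])
  qed
  then obtain W where W: "eventually (\<lambda>r. (\<forall>i<s. Er r * T i r = T i r \<and> T i r * Lr l r = T i r \<and>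
      (\<forall>j<s. adj (T i r) * T j r = (if i = j then Lr l r else 0))) \<and>
      Er r * W r = W r \<and> W r * Lr l r = W r \<and> adj (W r) * W r = Lr l r \<and> (\<forall>i<s. adj (T i r) * W r = 0 \<and> adj (W r) * T i r = 0)
      \<and> norm (W r - T' r) \<le> u r + 2 * d r) sequentially"
    unfolding eventually_ex by blast
  define T2 where "T2 i = (if i = s then W else T i)" for i
  have "eventually (\<lambda>r. \<forall>i<Suc s. Er r * T2 i r = T2 i r \<and> T2 i r * Lr l r = T2 i r \<and>
      (\<forall>j<Suc s. adj (T2 i r) * T2 j r = (if i = j then Lr l r else 0))) sequentially"
    using W by eventually_elim (auto simp: T2_def less_Suc_eq)
  moreover have "(\<lambda>r. norm (T2 i r - z i r * v r)) \<longlonglongrightarrow> 0" if "i < Suc s" for i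
  proof (cases "i = s")
    case True
    show ?thesis
    proof (rule Lim_null_comparison)
      show "(\<lambda>r. u r + 2 * d r) \<longlonglongrightarrow> 0"
        using tendsto_add[OF u0 tendsto_mult[OF tendsto_const[of 2] d0]] by simp
      show "eventually (\<lambda>r. norm (norm (T2 i r - z i r * v r)) \<le> u r + 2 * d r) sequentially"
        using W by eventually_elim (simp add: T2_def True T'_def)
    qed
  next
    case False
    then show ?thesis using that lim[of i] by (simp add: T2_def)
  qed
  ultimately show ?case by blast
qed simp

end

lemma npe_cong: assumes "\<And>i. i < m \<Longrightarrow> X i = Y i" "P \<in> rat_ncpolys m" shows "npe E X P = npe E Y P"
proof -
  have w: "wpr E X w = wpr E Y w" if "\<forall>i\<in>set w. i < m" for w
    using that by (induct w) (simp_all add: assms(1))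
  show ?thesis unfolding npe_def
    by (intro sum.cong refl) (use w rat_ncpolys_vars[OF assms(2)] in simp)
qed

text \<open>\<open>T 0, \<dots>, T (n - 1)\<close> are isometries of the \<open>l\<close>-dimensional space onto orthogonal subspaces filling
  the \<open>k\<close>-dimensional one; under the resulting identification the microstate \<open>Bs ! i\<close> is within \<open>\<delta>\<close> of the block
  matrix with entries \<open>f i s t\<close> evaluated at the microstate \<open>D\<close>.\<close>
definition lifted :: "nat \<Rightarrow> nat \<Rightarrow> (nat \<Rightarrow> nat \<Rightarrow> nat \<Rightarrow> ncpoly) \<Rightarrow> real \<Rightarrow> nat \<Rightarrow> (nat \<Rightarrow> nat \<Rightarrow> complex) list
    \<Rightarrow> nat \<Rightarrow> (nat \<Rightarrow> nat \<Rightarrow> complex) list \<Rightarrow> (nat \<Rightarrow> (nat \<Rightarrow> nat \<Rightarrow> complex) ucs) \<Rightarrow> bool" where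
  "lifted n p f \<delta> k Bs l D T \<longleftrightarrow> k = n * l \<and> (\<forall>s<n. cem k (idm k) * T s = T s) \<and>
    (\<forall>s<n. \<forall>t<n. adj (T s) * T t = (if s = t then cem k (idm l) else 0)) \<and>
    (\<Sum>s<n. T s * adj (T s)) = cem k (idm k) \<and>
    (\<forall>i<p. norm (cem k (Bs ! i) - (\<Sum>s<n. \<Sum>t<n. T s * cem k (ncp_eval (cmat l) (f i s t) D) * adj (T t))) < \<delta>)"

context microstates
begin

text \<open>Everything is read off from the isometries \<open>T\<close>: their ranges fill the space
  by the gap for projections, the trace gives \<open>k = n l\<close>, and compressing lifts of
  \<open>mu 0 0 x\<close> by \<open>v\<close> gives \<open>D\<close>. As \<open>mu 0 0\<close> is an
  isometric representation of \<open>A\<close>, polynomial norms of \<open>D\<close> converge to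
  those of the \<open>xs\<close>.\<close>

lemma eventually_lifted:
  assumes f: "\<And>i s t. i < length ys \<Longrightarrow> s < n \<Longrightarrow> t < n \<Longrightarrow> f i s t \<in> rat_ncpolys (length xs)"
    and fd: "\<And>i. i < length ys \<Longrightarrow> norm (yc i - (\<Sum>s<n. \<Sum>t<n. mu s t (ncp_eval A (f i s t) xs))) < \<delta>"
    and R: "\<And>x. x \<in> set xs \<Longrightarrow> ca_norm A x < R"
    and P: "\<And>j. j \<in> {1..r'} \<Longrightarrow> P j \<in> rat_ncpolys (length xs)" and e': "\<epsilon>' > 0"
  shows "eventually (\<lambda>r. \<exists>l D T. lifted n (length ys) f \<delta> (k r) (B r) l D T \<and> D \<in> Gamma_top A xs P R l \<epsilon>' r') sequentially"
proof -
  let ?m = "length xs"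
  have xin: "xs ! i \<in> ca_carrier A" "ca_star A (xs ! i) = xs ! i" if "i < ?m" for i
    using xs that by (auto simp: self_adjoint_def)
  have xset: "set xs \<subseteq> ca_carrier A" using xs by (auto simp: self_adjoint_def)
  obtain l v where fr: "eventually (frame l v) sequentially" and q: "rep (mu 0 0 one) (\<lambda>r. v r * adj (v r))"
    using exists_frame by blast
  have "\<exists>z. i < n \<longrightarrow> rep (mu i 0 one) z \<and> (\<forall>r. Er r * z r = z r)" for i
    using exists_rep[OF sg_in[of i 0 one]] n0 unfolding mu_def by auto
  then obtain z where z: "\<And>i. i < n \<Longrightarrow> rep (mu i 0 one) (z i)" "\<And>i r. i < n \<Longrightarrow> Er r * z i r = z i r" by metis
  obtain T where T: "eventually (\<lambda>r. \<forall>i<n. Er r * T i r = T i r \<and> T i r * Lr l r = T i r \<and>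
      (\<forall>j<n. adj (T i r) * T j r = (if i = j then Lr l r else 0))) sequentially"
    and Tlim: "\<And>i. i < n \<Longrightarrow> (\<lambda>r. norm (T i r - z i r * v r)) \<longlonglongrightarrow> 0"
    using exists_isometries[OF fr q z order_refl] by blast
  \<comment> \<open>\<open>T i r\<close> maps between spaces of different dimension and by itself
    has no counterpart in the limit algebra; \<open>T i r * adj (v r)\<close> does, namely the
    matrix unit at \<open>(i, 0)\<close>. Limits involving \<open>T\<close> are taken only of such
    products.\<close>
  have Tv: "rep (mu i 0 one) (\<lambda>r. T i r * adj (v r))" if i: "i < n" for i
  proof (rule rep_cong)
    have "mu i 0 one * mu 0 0 one = mu i 0 one" using i n0 by (simp add: mu_mult mul_laws)
    then show "rep (mu i 0 one) (\<lambda>r. z i r * (v r * adj (v r)))" using rep_mul[OF z(1)[OF i] q] by simp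
    show "(\<lambda>r. norm (z i r * (v r * adj (v r)) - T i r * adj (v r))) \<longlonglongrightarrow> 0"
    proof (rule Lim_null_comparison[OF _ Tlim[OF i]])
      show "eventually (\<lambda>r. norm (norm (z i r * (v r * adj (v r)) - T i r * adj (v r))) \<le> norm (T i r - z i r * v r)) sequentially"
        using fr
      proof eventually_elim
        case (elim r)
        have "norm ((z i r * v r - T i r) * adj (v r)) \<le> norm (z i r * v r - T i r) * 1"
          using frame_laws(5)[OF elim] by (intro order_trans[OF norm_mult_ineq] mult_left_mono) auto
        then show ?case by (simp add: left_diff_distrib mult.assoc norm_minus_commute)
      qed
    qed
  qed
  \<comment> \<open>Inserting \<open>v\<^sup>* v\<close>, which is the unit of the corner, splits
    the product into factors that are represented.\<close>
  have TT: "eventually (\<lambda>r. \<forall>s<n. \<forall>t<n. T s r * adj (T t r) = (T s r * adj (v r)) * (v r * adj (T t r))) sequentially"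
    using T fr
  proof eventually_elim
    case (elim r)
    have "(T s r * adj (v r)) * (v r * adj (T t r)) = T s r * (adj (v r) * v r) * adj (T t r)" for s t
      by (simp add: mult.assoc)
    then show ?case using elim(1) frame_laws(4)[OF elim(2)] by simp
  qed
  define p where "p r = (\<Sum>s<n. T s r * adj (T s r))" for r
  have "rep (\<Sum>s<n. mu s 0 one * adj (mu s 0 one)) (\<lambda>r. \<Sum>s<n. (T s r * adj (v r)) * adj (T s r * adj (v r)))"
    by (rule rep_sum) (use n0 in \<open>auto intro!: rep_mul rep_adj Tv simp del: adj_mult\<close>)
  moreover have "(\<Sum>s<n. mu s 0 one * adj (mu s 0 one)) = EC"
    unfolding one_decomp using n0 by (intro sum.cong refl) (simp add: mu_adj mu_mult star_one mul_laws)
  ultimately have "rep EC (\<lambda>r. \<Sum>s<n. (T s r * adj (v r)) * adj (T s r * adj (v r)))" by simp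
  then have "rep EC p"
    by (rule rep_cong_ev) (use TT in eventually_elim, simp add: p_def)
  then have "(\<lambda>r. norm (Er r - p r)) \<longlonglongrightarrow> 0" by (rule rep_unique[OF rep_EC])
  then have "eventually (\<lambda>r. norm (Er r - p r) < 1) sequentially" by (rule order_tendstoD(2)) simp
  \<comment> \<open>\<open>p r\<close> represents the unit and is an exact projection under
    \<open>Er r\<close>. Eventually their difference is a projection of norm below \<open>1\<close>,
    hence \<open>0\<close>.\<close>
  then have full: "eventually (\<lambda>r. p r = Er r) sequentially"
    using T
  proof eventually_elim
    case (elim r)
    have Tadj: "adj (T s r) * Er r = adj (T s r)" if "s < n" for s
    proof -
      have "adj (T s r) * Er r = adj (Er r * T s r)" by (simp only: adj_mult Er_laws(2))
      then show ?thesis using elim(2) that by simp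
    qed
    have "p r * p r = (\<Sum>s<n. \<Sum>t<n. T s r * (adj (T s r) * T t r) * adj (T t r))"
      by (simp add: p_def sum_product mult.assoc)
    also have "\<dots> = (\<Sum>s<n. \<Sum>t<n. if t = s then T s r * adj (T s r) else 0)"
      using elim(2) by (intro sum.cong refl) simp
    also have "\<dots> = p r" by (simp add: p_def)
    finally have pp: "p r * p r = p r" .
    have pa: "adj (p r) = p r" by (simp add: p_def)
    have Ep: "Er r * p r = p r" "p r * Er r = p r"
      unfolding p_def using elim(2) Tadj by (simp_all add: sum_distrib_left sum_distrib_right mult.assoc flip: mult.assoc[of "Er r"])
    have "Er r - p r = 0"
      by (rule norm_projection_small) (use elim(1) pp pa Ep Er_laws in \<open>simp_all add: algebra_simps\<close>)
    then show ?case by simp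
  qed
  have "\<exists>\<zeta>. i < ?m \<longrightarrow> rep (mu 0 0 (xs ! i)) \<zeta>" for i
    using exists_rep[OF sg_in[of 0 0 "xs ! i"]] n0 xin unfolding mu_def by blast
  then obtain \<zeta> where \<zeta>: "\<And>i. i < ?m \<Longrightarrow> rep (mu 0 0 (xs ! i)) (\<zeta> i)" by metis
  define w where "w i r = (1/2) *\<^sub>R (\<zeta> i r + adj (\<zeta> i r))" for i r
  have wa: "adj (w i r) = w i r" for i r by (simp add: w_def add.commute)
  have w: "rep (mu 0 0 (xs ! i)) (w i)" if i: "i < ?m" for i
  proof -
    have "rep ((1/2) *\<^sub>R (mu 0 0 (xs ! i) + adj (mu 0 0 (xs ! i)))) (w i)"
      unfolding w_def by (intro rep_scaleR rep_add rep_adj \<zeta> i) auto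
    moreover have "adj (mu 0 0 (xs ! i)) = mu 0 0 (xs ! i)" using n0 xin[OF i] by (simp add: mu_adj)
    ultimately show ?thesis by (simp flip: scaleR_2)
  qed
  \<comment> \<open>Compression by \<open>v\<close> lands exactly in the corner of
    \<open>Lr l r\<close>, so \<open>D'\<close> comes from a matrix of size \<open>l r\<close>; it
    is self-adjoint because \<open>w\<close> was made so.\<close>
  define D' where "D' i r = adj (v r) * w i r * v r" for i r
  define D where "D r = map (\<lambda>i. ucs_at (D' i r) (cmat (k r))) [0..<?m]" for r
  have Dp: "Lr l r * D' i r = D' i r" "D' i r * Lr l r = D' i r" "adj (D' i r) = D' i r" "D r ! i \<in> cc (l r)"
    "cem (k r) (D r ! i) = D' i r" "self_adjoint (cmat (l r)) (D r ! i)"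
    if g: "frame l v r" and i: "i < ?m" for r i
  proof -
    note fl = frame_laws[OF g]
    have lk: "l r \<le> k r" using g by (simp add: frame_def)
    show 1: "Lr l r * D' i r = D' i r" "D' i r * Lr l r = D' i r"
      unfolding D'_def using fl(3,7) by (simp_all add: mult.assoc) (simp add: fl(7) flip: mult.assoc)
    show 2: "adj (D' i r) = D' i r" by (simp add: D'_def wa mult.assoc)
    have "Er r * D' i r = Er r * Lr l r * D' i r" by (simp only: mult.assoc 1)
    also have "Er r * Lr l r = Lr l r" by (rule cem_idm_mult(1)) (simp add: cc_closed lk)
    finally have "Er r * D' i r = D' i r" by (simp only: 1)
    from cem_range[OF this] have Dk: "D r ! i \<in> cc (k r)" and De: "cem (k r) (D r ! i) = D' i r"
      using i by (simp_all add: D_def)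
    show "cem (k r) (D r ! i) = D' i r" by (rule De)
    have inj: "X = Y" if "X \<in> cc (k r)" "Y \<in> cc (k r)" "cem (k r) X = cem (k r) Y" for X Y
      using cm.e_inj that by blast
    show Dl: "D r ! i \<in> cc (l r)"
    proof (rule corner_in[OF Dk])
      show "mmul (k r) (idm (l r)) (D r ! i) = D r ! i" "mmul (k r) (D r ! i) (idm (l r)) = D r ! i"
        by (rule inj; simp add: cc_closed lk Dk cem_mmul De 1)+
    qed
    have "madj (D r ! i) = D r ! i" by (rule inj) (simp_all add: cc_closed Dk cem_madj De 2)
    then show "self_adjoint (cmat (l r)) (D r ! i)" using Dl by (simp add: self_adjoint_def cmat_ops)
  qed
  have lenD: "length (D r) = ?m" for r by (simp add: D_def)
  have rD: "rep (mu 0 0 (xs ! i)) (\<lambda>r. v r * D' i r * adj (v r))" if i: "i < ?m" for i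
  proof -
    have "mu 0 0 one * mu 0 0 (xs ! i) * mu 0 0 one = mu 0 0 (xs ! i)"
      using n0 xin[OF i] by (simp add: mu_mult mul_laws)
    moreover have "rep (mu 0 0 one * mu 0 0 (xs ! i) * mu 0 0 one) (\<lambda>r. v r * adj (v r) * w i r * (v r * adj (v r)))"
      by (intro rep_mul q w i)
    ultimately show ?thesis by (simp add: D'_def mult.assoc)
  qed
  define V where "V G r = cem (k r) (ncp_eval (cmat (l r)) G (D r))" for G r
  have Vp: "Lr l r * V G r = V G r" "V G r * Lr l r = V G r" "npe (Lr l r) (\<lambda>i. D' i r) G = V G r"
    "ca_norm (cmat (l r)) (ncp_eval (cmat (l r)) G (D r)) = norm (V G r)"
    if g: "frame l v r" and G: "G \<in> rat_ncpolys ?m" for r G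
  proof -
    have lk: "l r \<le> k r" using g by (simp add: frame_def)
    interpret cn: crep "cmat (l r)" "cem (k r)" by (rule crep_nested[OF lk])
    have Dset: "set (D r) \<subseteq> cc (l r)" using Dp(4)[OF g] lenD[of r] by (auto simp: in_set_conv_nth)
    have Gv: "ncpoly_in_vars (length (D r)) G" using G by (simp add: lenD rat_ncpolys_def)
    note ev = cn.e_ncp_eval[OF Dset Gv]
    show "Lr l r * V G r = V G r" "V G r * Lr l r = V G r"
      unfolding V_def using cn.e_one_mult[OF ev(1)] by (simp_all add: cmat_one)
    show "ca_norm (cmat (l r)) (ncp_eval (cmat (l r)) G (D r)) = norm (V G r)"
      unfolding V_def using cn.norm_e[OF ev(1)] by simp
    have "npe (Lr l r) (\<lambda>i. D' i r) G = npe (Lr l r) (\<lambda>i. cem (k r) (D r ! i)) G"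
      by (rule npe_cong[OF _ G]) (simp add: Dp(5)[OF g])
    then show "npe (Lr l r) (\<lambda>i. D' i r) G = V G r" using ev(2) by (simp add: V_def cmat_one)
  qed
  interpret c0: crep A "mu 0 0" using n0 by (rule crep_mu)
  have rV: "rep (mu 0 0 (ncp_eval A G xs)) (\<lambda>r. v r * V G r * adj (v r))" if G: "G \<in> rat_ncpolys ?m" for G
  proof (rule rep_cong_ev)
    have "mu 0 0 (ncp_eval A G xs) = npe (mu 0 0 one) (\<lambda>i. mu 0 0 (xs ! i)) G"
      using G by (intro c0.e_ncp_eval(2) xset) (simp add: rat_ncpolys_def)
    then show "rep (mu 0 0 (ncp_eval A G xs)) (\<lambda>r. npe (v r * adj (v r)) (\<lambda>i. v r * D' i r * adj (v r)) G)"
      using rep_npe[OF q rD G] by simp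
    show "eventually (\<lambda>r. npe (v r * adj (v r)) (\<lambda>i. v r * D' i r * adj (v r)) G = v r * V G r * adj (v r)) sequentially"
      using fr
    proof eventually_elim
      case (elim r)
      have "npe (v r * adj (v r)) (\<lambda>i. v r * D' i r * adj (v r)) G = v r * npe (Lr l r) (\<lambda>i. D' i r) G * adj (v r)"
        by (rule npe_conj[OF frame_laws(4)[OF elim] frame_laws(3)[OF elim] _ G]) (simp add: Dp(1,2)[OF elim])
      then show ?case by (simp only: Vp(3)[OF elim G])
    qed
  qed
  have evx: "ncp_eval A G xs \<in> ca_carrier A" if "G \<in> rat_ncpolys ?m" for G
    using that by (intro c0.e_ncp_eval(1) xset) (simp add: rat_ncpolys_def)
  have Pj: "eventually (\<lambda>r. \<bar>ca_norm (cmat (l r)) (ncp_eval (cmat (l r)) (P j) (D r)) - ca_norm A (ncp_eval A (P j) xs)\<bar> \<le> \<epsilon>') sequentially"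
    if j: "j \<in> {1..r'}" for j
  proof -
    note G = P[OF j]
    have "(\<lambda>r. norm (v r * V (P j) r * adj (v r))) \<longlonglongrightarrow> ca_norm A (ncp_eval A (P j) xs)"
      using rep_norm[OF rV[OF G]] norm_mu[OF n0 n0 evx[OF G]] by simp
    from tendstoD[OF this e'] show ?thesis using fr
    proof eventually_elim
      case (elim r)
      note fl = frame_laws[OF elim(2)]
      have "norm (v r * V (P j) r * adj (v r)) = norm (V (P j) r)"
        by (rule norm_isometry_conj[OF fl(4,1)]) (rule Vp[OF elim(2) G])+
      then show ?case using elim(1) Vp(4)[OF elim(2) G] by (simp add: dist_real_def)
    qed
  qed
  then have Pev: "eventually (\<lambda>r. \<forall>j\<in>{1..r'}. \<bar>ca_norm (cmat (l r)) (ncp_eval (cmat (l r)) (P j) (D r)) - ca_norm A (ncp_eval A (P j) xs)\<bar> \<le> \<epsilon>') sequentially"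
    by (intro eventually_ball_finite) auto
  have Dn: "eventually (\<lambda>r. op_norm (l r) (D r ! i) \<le> R) sequentially" if i: "i < ?m" for i
  proof -
    have "(\<lambda>r. norm (v r * D' i r * adj (v r))) \<longlonglongrightarrow> ca_norm A (xs ! i)"
      using rep_norm[OF rD[OF i]] norm_mu[OF n0 n0 xin(1)[OF i]] by simp
    moreover have "ca_norm A (xs ! i) < R" using R i by simp
    ultimately have "eventually (\<lambda>r. norm (v r * D' i r * adj (v r)) < R) sequentially" by (rule order_tendstoD(2))
    then show ?thesis using fr
    proof eventually_elim
      case (elim r)
      note fl = frame_laws[OF elim(2)]
      have lk: "l r \<le> k r" using elim(2) by (simp add: frame_def)
      have "norm (v r * D' i r * adj (v r)) = norm (D' i r)"
        by (rule norm_isometry_conj[OF fl(4,1)]) (rule Dp[OF elim(2) i])+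
      also have "\<dots> = opn (k r) (D r ! i)"
        using norm_cem[OF cc_mono[OF lk Dp(4)[OF elim(2) i]]] Dp(5)[OF elim(2) i] by simp
      also have "\<dots> = op_norm (l r) (D r ! i)" by (simp add: op_norm_eq_opn opn_nested[OF lk Dp(4)[OF elim(2) i]])
      finally show ?case using elim(1) by simp
    qed
  qed
  have "eventually (\<lambda>r. \<forall>i\<in>{..<?m}. op_norm (l r) (D r ! i) \<le> R) sequentially"
    by (intro eventually_ball_finite) (auto intro: Dn)
  with fr Pev have Gam: "eventually (\<lambda>r. D r \<in> Gamma_top A xs P R (l r) \<epsilon>' r') sequentially"
  proof eventually_elim
    case (elim r)
    have "self_adjoint (cmat (l r)) d \<and> op_norm (l r) d \<le> R" if "d \<in> set (D r)" for d
      using that elim(3) Dp(6)[OF elim(1)] lenD[of r] by (auto simp: in_set_conv_nth)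
    then show ?case using elim(2) by (simp add: Gamma_top_def lenD)
  qed
  have Bi: "eventually (\<lambda>r. norm (yb i r - (\<Sum>s<n. \<Sum>t<n. T s r * V (f i s t) r * adj (T t r))) < \<delta>) sequentially"
    if i: "i < length ys" for i
  proof -
    \<comment> \<open>The entry at \<open>(s, t)\<close> is routed through the corner at
      \<open>(0, 0)\<close>, where polynomials in \<open>D\<close> represent polynomials in the
      \<open>xs\<close>.\<close>
    have "rep (\<Sum>s<n. \<Sum>t<n. mu s 0 one * mu 0 0 (ncp_eval A (f i s t) xs) * adj (mu t 0 one))
      (\<lambda>r. \<Sum>s<n. \<Sum>t<n. (T s r * adj (v r)) * (v r * V (f i s t) r * adj (v r)) * adj (T t r * adj (v r)))"
      by (intro rep_sum rep_mul rep_adj Tv rV f i) (use n0 in auto)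
    moreover have "(\<Sum>s<n. \<Sum>t<n. mu s 0 one * mu 0 0 (ncp_eval A (f i s t) xs) * adj (mu t 0 one))
      = (\<Sum>s<n. \<Sum>t<n. mu s t (ncp_eval A (f i s t) xs))"
      using n0 f[OF i] evx by (intro sum.cong refl) (simp add: mu_adj mu_mult star_one mul_laws)
    ultimately have "rep (\<Sum>s<n. \<Sum>t<n. mu s t (ncp_eval A (f i s t) xs))
      (\<lambda>r. \<Sum>s<n. \<Sum>t<n. (T s r * adj (v r)) * (v r * V (f i s t) r * adj (v r)) * adj (T t r * adj (v r)))" by simp
    then have "rep (\<Sum>s<n. \<Sum>t<n. mu s t (ncp_eval A (f i s t) xs)) (\<lambda>r. \<Sum>s<n. \<Sum>t<n. T s r * V (f i s t) r * adj (T t r))"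
    proof (rule rep_cong_ev)
      show "eventually (\<lambda>r. (\<Sum>s<n. \<Sum>t<n. (T s r * adj (v r)) * (v r * V (f i s t) r * adj (v r)) * adj (T t r * adj (v r)))
         = (\<Sum>s<n. \<Sum>t<n. T s r * V (f i s t) r * adj (T t r))) sequentially"
        using fr
      proof eventually_elim
        case (elim r)
        note fl = frame_laws[OF elim]
        show ?case
        proof (intro sum.cong refl)
          fix s t assume st: "s \<in> {..<n}" "t \<in> {..<n}"
          have "(T s r * adj (v r)) * (v r * V (f i s t) r * adj (v r)) * adj (T t r * adj (v r))
            = T s r * ((adj (v r) * v r) * V (f i s t) r * (adj (v r) * v r)) * adj (T t r)" by (simp add: mult.assoc)
          also have "(adj (v r) * v r) * V (f i s t) r * (adj (v r) * v r) = V (f i s t) r"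
            unfolding fl(4) using Vp(1,2)[OF elim f[OF i, of s t]] st by simp
          finally show "(T s r * adj (v r)) * (v r * V (f i s t) r * adj (v r)) * adj (T t r * adj (v r))
            = T s r * V (f i s t) r * adj (T t r)" .
        qed
      qed
    qed
    \<comment> \<open>The norms of the errors converge to the corresponding norm in the limit
      algebra, which is strictly below \<open>\<delta>\<close>.\<close>
    from rep_norm[OF rep_diff[OF rep_y[OF i] this]] show ?thesis
      using fd[OF i] by (rule order_tendstoD(2))
  qed
  have "eventually (\<lambda>r. \<forall>i\<in>{..<length ys}. norm (yb i r - (\<Sum>s<n. \<Sum>t<n. T s r * V (f i s t) r * adj (T t r))) < \<delta>) sequentially"
    by (intro eventually_ball_finite) (auto intro: Bi)
  with fr T full Gam show ?thesis
  proof eventually_elim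
    case (elim r)
    have lk: "l r \<le> k r" using elim(1) by (simp add: frame_def)
    \<comment> \<open>The unit has trace \<open>k r\<close>, and by cyclicity each
      \<open>T s * adj (T s)\<close> has the trace \<open>l r\<close> of
      \<open>adj (T s) * T s\<close>.\<close>
    have "of_nat (k r) = trc (k r) (p r)" unfolding elim(3) by (simp add: trc_idm)
    also have "\<dots> = (\<Sum>s<n. trc (k r) (adj (T s r) * T s r))" unfolding p_def trc_sum
      by (intro sum.cong refl trc_mult_commute)
    also have "\<dots> = (\<Sum>s<n. of_nat (l r))" using elim(2) trc_idm[OF lk] by (intro sum.cong refl) simp
    finally have "(of_nat (k r) :: complex) = of_nat (n * l r)" by simp
    then have "k r = n * l r" by (simp only: of_nat_eq_iff)
    then have "lifted n (length ys) f \<delta> (k r) (B r) (l r) (D r) (\<lambda>s. T s r)"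
      unfolding lifted_def using elim by (simp add: p_def V_def del: of_nat_mult)
    then show ?case using elim(4) by blast
  qed
qed

end

subsection \<open>The normalized Hilbert-Schmidt norm\<close>

definition hs :: "nat \<Rightarrow> (nat \<Rightarrow> nat \<Rightarrow> complex) \<Rightarrow> real" where
  "hs k X = L2_set (\<lambda>(i, j). cmod (X i j)) ({..<k} \<times> {..<k})"

lemma hs_ge_0 [simp]: "hs k X \<ge> 0"
  by (simp add: hs_def L2_set_nonneg)

lemma hs_sq: "(hs k X)\<^sup>2 = (\<Sum>i<k. \<Sum>j<k. (cmod (X i j))\<^sup>2)"
  unfolding hs_def L2_set_def by (simp add: sum_nonneg sum.cartesian_product case_prod_beta)

lemma hs_triangle: "hs k (\<lambda>i j. X i j + Y i j) \<le> hs k X + hs k Y"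
proof -
  have "hs k (\<lambda>i j. X i j + Y i j) \<le> L2_set (\<lambda>p. (case p of (i, j) \<Rightarrow> cmod (X i j)) + (case p of (i, j) \<Rightarrow> cmod (Y i j))) ({..<k} \<times> {..<k})"
    unfolding hs_def by (rule L2_set_mono) (auto simp: norm_triangle_ineq)
  also have "\<dots> \<le> hs k X + hs k Y" unfolding hs_def by (rule L2_set_triangle_ineq)
  finally show ?thesis .
qed

lemma hs_madj: "hs k (madj X) = hs k X"
proof -
  have "(hs k (madj X))\<^sup>2 = (\<Sum>i<k. \<Sum>j<k. (cmod (X j i))\<^sup>2)"
    unfolding hs_sq by (simp add: madj_def adj_complex_def)
  also have "\<dots> = (hs k X)\<^sup>2" unfolding hs_sq by (rule sum.swap)
  finally show ?thesis by (simp add: power2_eq_iff_nonneg)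
qed

text \<open>The squared Hilbert-Schmidt norm is the sum of the squared column lengths, and
  \<open>X\<close> acts on each column separately.\<close>

lemma hs_mmul_left: "hs k (mmul k X Y) \<le> opn k X * hs k Y"
proof (rule power2_le_imp_le)
  have col: "(hs k Z)\<^sup>2 = (\<Sum>j<k. (mnorm k (\<lambda>i. Z i j))\<^sup>2)" for Z
    unfolding hs_sq mnorm_complex by (subst sum.swap) (simp add: sum_nonneg)
  have "(hs k (mmul k X Y))\<^sup>2 = (\<Sum>j<k. (mnorm k (mvm k X (\<lambda>i. Y i j)))\<^sup>2)"
    unfolding col by (simp add: mmul_def mvm_def)
  also have "\<dots> \<le> (\<Sum>j<k. (opn k X * mnorm k (\<lambda>i. Y i j))\<^sup>2)"
    by (intro sum_mono power_mono mnorm_mvm_le) simp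
  also have "\<dots> = (opn k X * hs k Y)\<^sup>2" by (simp add: power_mult_distrib col sum_distrib_left)
  finally show "(hs k (mmul k X Y))\<^sup>2 \<le> (opn k X * hs k Y)\<^sup>2" .
qed simp

lemma hs_mmul_right: "hs k (mmul k X Y) \<le> hs k X * opn k Y"
proof -
  have "hs k (mmul k X Y) = hs k (mmul k (madj Y) (madj X))" by (metis hs_madj madj_mmul)
  also have "\<dots> \<le> opn k (madj Y) * hs k (madj X)" by (rule hs_mmul_left)
  finally show ?thesis by (simp add: opn_madj hs_madj mult.commute)
qed

lemma hs_idm: "hs k (idm k) = sqrt (real k)"
proof -
  have "(hs k (idm k))\<^sup>2 = (\<Sum>i<k. \<Sum>j<k. if j = i then 1 else 0)"
    unfolding hs_sq by (intro sum.cong refl) (auto simp: idm_def)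
  also have "\<dots> = real k" by simp
  finally show ?thesis by (simp add: real_sqrt_unique)
qed

lemma hs_le_opn: assumes "X \<in> cc k" shows "hs k X \<le> sqrt (real k) * opn k X"
proof -
  have "mmul k X (idm k) = X" using cm.e_inj[of "mmul k X (idm k)" k X] cem_idm_mult(2)[OF assms] assms
    by (simp add: cc_closed cem_mmul)
  then show ?thesis using hs_mmul_left[of k X "idm k"] by (simp add: hs_idm mult.commute)
qed

lemma hs_nested: assumes "l \<le> k" "X \<in> cc l" shows "hs k X = hs l X"
proof -
  have "(hs k X)\<^sup>2 = (\<Sum>i<k. \<Sum>j<l. (cmod (X i j))\<^sup>2)"
    unfolding hs_sq using assms by (intro sum.cong refl sum.mono_neutral_right) (auto simp: cc_iff)
  also have "\<dots> = (hs l X)\<^sup>2"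
    unfolding hs_sq using assms by (intro sum.mono_neutral_right) (auto simp: cc_iff)
  finally show ?thesis by (simp add: power2_eq_iff_nonneg)
qed

text \<open>Only the component at \<open>cmat k\<close> is read, so this is a seminorm on the whole
  type, dominated by its norm. For \<open>k = 0\<close> the division makes it
  \<open>0\<close>.\<close>

definition hn :: "nat \<Rightarrow> (nat \<Rightarrow> nat \<Rightarrow> complex) ucs \<Rightarrow> real" where
  "hn k x = hs k (ucs_at x (cmat k)) / sqrt (real k)"

lemma hn_ge_0 [simp]: "hn k x \<ge> 0"
  by (simp add: hn_def)

lemma hn_add: "hn k (x + y) \<le> hn k x + hn k y"
  using hs_triangle[of k "ucs_at x (cmat k)" "ucs_at y (cmat k)"]
  by (simp add: hn_def ucs_at_eval cmat_cstar cmat_ops divide_right_mono flip: add_divide_distrib)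

lemma opn_ucs_at: "opn k (ucs_at x (cmat k)) \<le> norm x"
  using ucs_at_le_bound[OF cmat_cstar[of k], of x] by (simp add: cmat_norm norm_ucs_def)

lemma hn_mult_left: "hn k (a * x) \<le> norm a * hn k x"
proof -
  have "hs k (mmul k (ucs_at a (cmat k)) (ucs_at x (cmat k))) \<le> norm a * hs k (ucs_at x (cmat k))"
    by (rule order_trans[OF hs_mmul_left]) (intro mult_right_mono opn_ucs_at hs_ge_0)
  then show ?thesis by (simp add: hn_def ucs_at_eval cmat_cstar cmat_ops divide_right_mono)
qed

lemma hn_mult_right: "hn k (x * a) \<le> hn k x * norm a"
proof -
  have "hs k (mmul k (ucs_at x (cmat k)) (ucs_at a (cmat k))) \<le> hs k (ucs_at x (cmat k)) * norm a"
    by (rule order_trans[OF hs_mmul_right]) (intro mult_left_mono opn_ucs_at hs_ge_0)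
  then show ?thesis by (simp add: hn_def ucs_at_eval cmat_cstar cmat_ops divide_right_mono)
qed

lemma hn_le_norm: "hn k x \<le> norm x"
proof (cases "k = 0")
  case False
  have "hs k (ucs_at x (cmat k)) \<le> sqrt (real k) * norm x"
    by (rule order_trans[OF hs_le_opn]) (simp_all add: cmat_cstar opn_ucs_at mult_left_mono)
  then show ?thesis using False by (simp add: hn_def field_simps)
qed (simp add: hn_def)

lemma hn_uminus: "hn k (- x) = hn k x"
proof -
  have le: "hn k (- y) \<le> hn k y" for y using hn_mult_left[of k "- 1" y] by simp
  show ?thesis using le[of x] le[of "- x"] by simp
qed

lemma hn_zero [simp]: "hn k 0 = 0"
  using hn_le_norm[of k 0] hn_ge_0[of k 0] by simp

lemma hn_sum: "hn k (sum f F) \<le> (\<Sum>i\<in>F. hn k (f i))"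
proof (induct F rule: infinite_finite_induct)
  case (insert x F)
  then show ?case using hn_add[of k "f x" "sum f F"] by simp
qed simp_all

lemma hn_diff_triangle: "hn k (x - z) \<le> hn k (x - y) + hn k (y - z)"
  using hn_add[of k "x - y" "y - z"] by simp

lemma hn_sandwich: assumes "norm a \<le> 1" "norm b \<le> 1" shows "hn k (a * x * b) \<le> hn k x"
proof -
  have "hn k (a * x * b) \<le> hn k (a * x) * norm b" by (rule hn_mult_right)
  also have "\<dots> \<le> hn k (a * x) * 1" using assms by (intro mult_left_mono) auto
  also have "hn k (a * x) \<le> norm a * hn k x" by (rule hn_mult_left)
  also have "norm a * hn k x \<le> 1 * hn k x" using assms by (intro mult_right_mono) auto
  finally show ?thesis by simp
qed

lemma hn_cs: "hn k (c *\<^sub>C x) \<le> cmod c * hn k x"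
proof -
  have "c *\<^sub>C x = (c *\<^sub>C 1) * x" by simp
  then show ?thesis using hn_mult_left[of k "c *\<^sub>C 1" x] by simp
qed

lemma hn_cem: "X \<in> cc k \<Longrightarrow> hn k (cem k X) = hs k X / sqrt (real k)"
  by (simp add: hn_def cm.emb_eval cmat_cstar)

lemma norm2_eq:
  assumes "\<forall>A\<in>set As. A \<in> cc k"
  shows "norm2 k As = sqrt (\<Sum>i<length As. (hn k (cem k (As ! i)))\<^sup>2)"
proof -
  have "Re (tau k (ca_mul (cmat k) (ca_star (cmat k) (As ! i)) (As ! i))) = (hn k (cem k (As ! i)))\<^sup>2" if "i < length As" for i
  proof -
    have X: "As ! i \<in> cc k" using assms that by simp
    have "ca_mul (cmat k) (ca_star (cmat k) (As ! i)) (As ! i) = mmul k (madj (As ! i)) (As ! i)"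
      using X by (simp add: cmat_ops cc_closed)
    then have "tau k (ca_mul (cmat k) (ca_star (cmat k) (As ! i)) (As ! i)) = (\<Sum>j<k. \<Sum>i'<k. of_real ((cmod ((As ! i) i' j))\<^sup>2)) / of_nat k"
      by (simp add: tau_def mmul_def madj_def adj_complex_def mult.commute flip: complex_norm_square)
    also have "(\<Sum>j<k. \<Sum>i'<k. complex_of_real ((cmod ((As ! i) i' j))\<^sup>2)) = of_real ((hs k (As ! i))\<^sup>2)"
      unfolding hs_sq by (subst sum.swap) simp
    also have "of_real ((hs k (As ! i))\<^sup>2) / of_nat k = complex_of_real ((hs k (As ! i))\<^sup>2 / real k)" by simp
    finally have "Re (tau k (ca_mul (cmat k) (ca_star (cmat k) (As ! i)) (As ! i))) = (hs k (As ! i))\<^sup>2 / real k"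
      by (simp only: Re_complex_of_real)
    then show ?thesis by (simp add: hn_cem[OF X] power_divide)
  qed
  then show ?thesis by (simp add: norm2_def)
qed

lemma norm2_le_sum:
  assumes "\<forall>A\<in>set As. A \<in> cc k" shows "norm2 k As \<le> (\<Sum>i<length As. hn k (cem k (As ! i)))"
  unfolding norm2_eq[OF assms] by (rule L2_set_le_sum[unfolded L2_set_def]) simp

lemma hn_le_norm2:
  assumes "\<forall>A\<in>set As. A \<in> cc k" "i < length As" shows "hn k (cem k (As ! i)) \<le> norm2 k As"
  unfolding norm2_eq[OF assms(1)]
  by (rule real_le_rsqrt, rule member_le_sum[of i "{..<length As}" "\<lambda>i. (hn k (cem k (As ! i)))\<^sup>2"]) (use assms in auto)

section \<open>Lipschitz estimates for polynomials and conjugation by unitaries\<close>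

text \<open>A Lipschitz constant on the ball of radius \<open>R \<ge> 1\<close>. Replacing the
  letters of a word of length \<open>d\<close> one at a time costs
  \<open>d R\<^sup>d\<^sup>-\<^sup>1\<close>; the power is rounded up to
  \<open>R\<^sup>d\<close>.\<close>

definition plip :: "ncpoly \<Rightarrow> real \<Rightarrow> real" where
  "plip P R = (\<Sum>w\<in>Poly_Mapping.keys P. cmod (Poly_Mapping.lookup P w) * (real (length w) * R ^ length w))"

lemma plip_nonneg: "R \<ge> 0 \<Longrightarrow> plip P R \<ge> 0"
  unfolding plip_def by (intro sum_nonneg mult_nonneg_nonneg) auto

text \<open>One letter is changed at a time, measured in the Hilbert-Schmidt norm, while all other
  letters are bounded in operator norm. The constant does not involve the size \<open>k\<close>,
  which is what makes a covering radius uniform in \<open>k\<close> possible.\<close>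

lemma npe_lipschitz:
  assumes R: "R \<ge> 1" and E: "norm E \<le> 1" and X: "\<And>i. i < m \<Longrightarrow> norm (X i) \<le> R" and Y: "\<And>i. i < m \<Longrightarrow> norm (Y i) \<le> R"
    and d: "\<And>i. i < m \<Longrightarrow> hn k (X i - Y i) \<le> \<eta>" "\<eta> \<ge> 0" and P: "P \<in> rat_ncpolys m"
  shows "hn k (npe E X P - npe E Y P) \<le> plip P R * \<eta>"
proof -
  have nw: "norm (wpr E Y w) \<le> R ^ length w" if "\<forall>i\<in>set w. i < m" for w
    using that
  proof (induct w)
    case (Cons i w)
    have "norm (Y i * wpr E Y w) \<le> norm (Y i) * norm (wpr E Y w)" by (rule norm_mult_ineq)
    also have "\<dots> \<le> R * R ^ length w" using Cons Y R by (intro mult_mono) auto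
    finally show ?case by simp
  qed (simp add: E)
  have w: "hn k (wpr E X w - wpr E Y w) \<le> real (length w) * R ^ length w * \<eta>" if "\<forall>i\<in>set w. i < m" for w
    using that
  proof (induct w)
    case (Cons i w)
    have "X i * wpr E X w - Y i * wpr E Y w = X i * (wpr E X w - wpr E Y w) + (X i - Y i) * wpr E Y w"
      by (simp add: algebra_simps)
    then have "hn k (X i * wpr E X w - Y i * wpr E Y w) \<le> hn k (X i * (wpr E X w - wpr E Y w)) + hn k ((X i - Y i) * wpr E Y w)"
      by (metis hn_add)
    also have "hn k (X i * (wpr E X w - wpr E Y w)) \<le> R * (real (length w) * R ^ length w * \<eta>)"
      by (rule order_trans[OF hn_mult_left]) (use Cons X R in \<open>auto intro!: mult_mono\<close>)
    also have "hn k ((X i - Y i) * wpr E Y w) \<le> \<eta> * R ^ length w"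
      by (rule order_trans[OF hn_mult_right]) (use Cons(2) d nw in \<open>auto intro!: mult_mono\<close>)
    also have "\<eta> * R ^ length w \<le> \<eta> * R ^ Suc (length w)"
      using R d(2) by (intro mult_left_mono power_increasing) auto
    finally show ?case by (simp add: algebra_simps)
  qed simp
  have "npe E X P - npe E Y P = (\<Sum>w\<in>Poly_Mapping.keys P. Poly_Mapping.lookup P w *\<^sub>C (wpr E X w - wpr E Y w))"
    by (simp add: npe_def cs_diff_right sum_subtractf)
  then have "hn k (npe E X P - npe E Y P) \<le> (\<Sum>w\<in>Poly_Mapping.keys P. hn k (Poly_Mapping.lookup P w *\<^sub>C (wpr E X w - wpr E Y w)))"
    by (simp only: hn_sum)
  also have "\<dots> \<le> (\<Sum>w\<in>Poly_Mapping.keys P. cmod (Poly_Mapping.lookup P w) * (real (length w) * R ^ length w * \<eta>))"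
    by (intro sum_mono order_trans[OF hn_cs] mult_left_mono w) (use rat_ncpolys_vars[OF P] in auto)
  finally show ?thesis by (simp add: plip_def sum_distrib_right mult.assoc)
qed

text \<open>\<open>unitary_mat\<close> asks for one of the two equations only. The projection
  \<open>1 - U U\<^sup>*\<close> has trace \<open>0\<close> by cyclicity, and its trace is the sum
  of its squared entries.\<close>

lemma unitary_right: assumes "U \<in> cc l" "mmul l (madj U) U = idm l" shows "mmul l U (madj U) = idm l"
proof -
  define u where "u = cem l U"
  define E where "E = cem l (idm l)"
  have uu: "adj u * u = E" using arg_cong[OF assms(2), of "cem l"] assms(1) by (simp add: u_def E_def cem_mmul cem_madj cc_closed)
  have E: "E * E = E" "adj E = E" by (simp_all add: E_def cem_idm)
  have Eu: "E * u = u" "u * E = u" by (simp_all add: E_def u_def cem_idm_mult assms(1))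
  have "adj u * E = adj (E * u)" by (simp only: adj_mult E)
  then have uE: "adj u * E = adj u" by (simp only: Eu)
  define Z where "Z = (\<lambda>i j. idm l i j - mmul l U (madj U) i j)"
  have Zc: "Z \<in> cc l" unfolding Z_def by (intro cc_closed assms(1)) simp
  have z: "cem l Z = E - u * adj u" unfolding Z_def E_def u_def by (simp add: cem_sub cem_mmul cem_madj cc_closed assms(1))
  have "u * adj u * (u * adj u) = u * (adj u * u) * adj u" by (simp only: mult.assoc)
  also have "\<dots> = u * adj u" unfolding uu Eu ..
  finally have pp: "u * adj u * (u * adj u) = u * adj u" .
  have Ep: "E * (u * adj u) = u * adj u" "u * adj u * E = u * adj u"
    by (simp add: Eu flip: mult.assoc) (simp add: mult.assoc uE)
  have zz: "cem l Z * cem l Z = cem l Z" "adj (cem l Z) = cem l Z"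
    unfolding z by (simp_all add: right_diff_distrib left_diff_distrib pp Ep E)
  have ZZ: "mmul l Z Z = Z" "madj Z = Z"
    by - (rule cm.e_inj[of _ l]; use zz Zc in \<open>simp add: cc_closed cem_mmul cem_madj\<close>)+
  have "trc l (cem l Z) = trc l E - trc l (adj u * u)"
    using trc_add[of l "cem l Z" "u * adj u"] trc_mult_commute[of l u "adj u"] by (simp add: z)
  then have "(\<Sum>i<l. Z i i) = 0" unfolding uu using Zc by (simp add: trc_cem)
  then have "(\<Sum>j<l. complex_of_real (\<Sum>i<l. (cmod (Z i j))\<^sup>2)) = 0"
    using trc_adj_mult[OF Zc ZZ(2,1)] by simp
  then have "complex_of_real (\<Sum>j<l. \<Sum>i<l. (cmod (Z i j))\<^sup>2) = 0" by simp
  then have "(\<Sum>j<l. \<Sum>i<l. (cmod (Z i j))\<^sup>2) = 0" by (simp only: of_real_eq_0_iff)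
  then have "Z i j = 0" if "i < l" "j < l" for i j
    using that by (simp add: sum_nonneg_eq_0_iff sum_nonneg)
  then have "Z i j = 0" for i j using Zc by (cases "i < l \<and> j < l") (auto simp: cc_iff)
  then show ?thesis by (simp add: Z_def fun_eq_iff)
qed

lemma unitary_mat_iff: "unitary_mat k W \<longleftrightarrow> W \<in> cc k \<and> mmul k (madj W) W = idm k"
  by (auto simp: unitary_mat_def cmat_ops cmat_one cc_closed)

lemma cem_unitary:
  assumes "unitary_mat l U" "l \<le> k"
  shows "adj (cem k U) * cem k U = cem k (idm l)" "cem k U * adj (cem k U) = cem k (idm l)"
    "cem k (idm l) * cem k U = cem k U" "cem k U * cem k (idm l) = cem k U" "norm (cem k U) \<le> 1"
proof -
  have U: "U \<in> cc l" "mmul l (madj U) U = idm l" using assms(1) by (auto simp: unitary_mat_iff)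
  note Uk = cc_mono[OF assms(2) U(1)]
  have mk: "madj U \<in> cc l" "madj U \<in> cc k" using U Uk by (simp_all add: cc_closed)
  show 1: "adj (cem k U) * cem k U = cem k (idm l)"
    using arg_cong[OF U(2), of "cem k"] mmul_nested[OF assms(2) mk(1), of U]
      cem_mmul[OF mk(2) Uk] by (simp add: cem_madj Uk)
  show "cem k U * adj (cem k U) = cem k (idm l)"
    using arg_cong[OF unitary_right[OF U], of "cem k"] mmul_nested[OF assms(2) U(1), of "madj U"]
      cem_mmul[OF Uk mk(2)] by (simp add: cem_madj Uk)
  interpret cn: crep "cmat l" "cem k" using assms(2) by (rule crep_nested)
  show "cem k (idm l) * cem k U = cem k U" "cem k U * cem k (idm l) = cem k U"
    using cn.e_one_mult[OF U(1)] by (simp_all add: cmat_one)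
  show "norm (cem k U) \<le> 1" by (rule norm_partial_isometry_le[OF 1]) (simp add: cem_idm assms(2))
qed

text \<open>If \<open>D\<close> and \<open>D'\<close> are close up to the unitary conjugation \<open>u\<close>, then the microstates lifted from them
  are close up to conjugation by \<open>\<Sum>s. T s * u * adj (T' s)\<close>.\<close>
lemma lifted_close:
  fixes T T' :: "nat \<Rightarrow> (nat \<Rightarrow> nat \<Rightarrow> complex) ucs" and u :: "(nat \<Rightarrow> nat \<Rightarrow> complex) ucs"
  defines "L \<equiv> \<lambda>k l. cem k (idm l)"
  assumes l1: "lifted n p f \<delta> k Bs l D T" and l2: "lifted n p f \<delta> k Bs' l D' T'" and n: "0 < n"
    and len: "length D = m" "length D' = m" and Dc: "\<forall>d\<in>set D. d \<in> cc l \<and> op_norm l d \<le> R" "\<forall>d\<in>set D'. d \<in> cc l \<and> op_norm l d \<le> R"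
    and R: "R \<ge> 1" and f: "\<And>i s t. i < p \<Longrightarrow> s < n \<Longrightarrow> t < n \<Longrightarrow> f i s t \<in> rat_ncpolys m \<and> plip (f i s t) R \<le> M"
    and u: "adj u * u = L k l" "u * adj u = L k l" "L k l * u = u" "u * L k l = u" "norm u \<le> 1"
    and close: "\<And>i. i < m \<Longrightarrow> hn k (cem k (D ! i) - u * cem k (D' ! i) * adj u) \<le> \<eta>" "\<eta> \<ge> 0"
    and B': "\<And>i. i < p \<Longrightarrow> L k k * cem k (Bs' ! i) = cem k (Bs' ! i)"
  shows "\<exists>z. L k k * z = z \<and> adj z * z = L k k \<and>
    (\<forall>i<p. hn k (cem k (Bs ! i) - z * cem k (Bs' ! i) * adj z) \<le> 2 * \<delta> + real n * real n * (M * \<eta>))"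
proof -
  have k: "k = n * l" and lk: "l \<le> k" using l1 n by (auto simp: lifted_def)
  have T: "\<And>s. s < n \<Longrightarrow> L k k * T s = T s" "\<And>s t. s < n \<Longrightarrow> t < n \<Longrightarrow> adj (T s) * T t = (if s = t then L k l else 0)"
    "(\<Sum>s<n. T s * adj (T s)) = L k k"
    using l1 by (auto simp: lifted_def L_def)
  have T': "\<And>s. s < n \<Longrightarrow> L k k * T' s = T' s" "\<And>s t. s < n \<Longrightarrow> t < n \<Longrightarrow> adj (T' s) * T' t = (if s = t then L k l else 0)"
    "(\<Sum>s<n. T' s * adj (T' s)) = L k k"
    using l2 by (auto simp: lifted_def L_def)
  have LL: "L k l * L k l = L k l" "adj (L k l) = L k l" "L k k * L k k = L k k" "adj (L k k) = L k k"
    using lk by (simp_all add: L_def cem_idm)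
  have nT: "norm (T s) \<le> 1" if "s < n" for s
    using norm_partial_isometry_le[OF _ LL(1), of "T s"] T(2)[OF that that] by simp
  have TL: "T' s * L k l = T' s" if "s < n" for s
    using partial_isometry_right[OF _ LL(1), of "T' s"] T'(2)[OF that that] by simp
  have adju: "adj u * L k l = adj u" "L k l * adj u = adj u"
  proof -
    have "adj u * L k l = adj (L k l * u)" "L k l * adj u = adj (u * L k l)" by (simp_all only: adj_mult LL)
    then show "adj u * L k l = adj u" "L k l * adj u = adj u" by (simp_all only: u)
  qed
  interpret cn: crep "cmat l" "cem k" using lk by (rule crep_nested)
  define F where "F X i s t = npe (L k l) X (f i s t)" for X i s t
  have ev: "cem k (ncp_eval (cmat l) (f i s t) DD) = F (\<lambda>j. cem k (DD ! j)) i s t"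
    if "i < p" "s < n" "t < n" "length DD = m" "\<forall>d\<in>set DD. d \<in> cc l" for i s t DD
    using f[OF that(1-3)] that(4,5) cn.e_ncp_eval(2)[of DD "f i s t"]
    by (auto simp: F_def L_def cmat_one rat_ncpolys_def)
  define X where "X j = cem k (D ! j)" for j
  define Y where "Y j = cem k (D' ! j)" for j
  have bX: "norm (X j) \<le> R" and bY: "norm (Y j) \<le> R" and YL: "L k l * Y j = Y j" "Y j * L k l = Y j" if "j < m" for j
    using Dc len that cn.norm_e[of "D ! j"] cn.norm_e[of "D' ! j"] cn.e_one_mult[of "D' ! j"]
    by (auto simp: X_def Y_def L_def cmat_norm op_norm_eq_opn cmat_one)
  define z where "z = (\<Sum>s<n. T s * u * adj (T' s))"
  have zE: "L k k * z = z" unfolding z_def sum_distrib_left using T(1) by (intro sum.cong refl) (simp flip: mult.assoc)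
  have zT: "z * T' t = T t * u" if t: "t < n" for t
  proof -
    have "z * T' t = (\<Sum>s<n. T s * u * (adj (T' s) * T' t))" unfolding z_def sum_distrib_right by (simp add: mult.assoc)
    also have "\<dots> = (\<Sum>s<n. if s = t then T t * (u * L k l) else 0)"
      using T'(2) t by (intro sum.cong refl) (simp add: mult.assoc)
    also have "\<dots> = T t * u" using t u by simp
    finally show ?thesis .
  qed
  have zz: "adj z * z = L k k"
  proof -
    have "adj z * z = (\<Sum>s<n. \<Sum>t<n. T' s * adj u * (adj (T s) * T t) * u * adj (T' t))"
      unfolding z_def by (simp add: sum_product mult.assoc)
    also have "\<dots> = (\<Sum>s<n. \<Sum>t<n. if t = s then T' s * (adj u * L k l * u) * adj (T' s) else 0)"
      using T(2) by (intro sum.cong refl) (auto simp: mult.assoc)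
    also have "\<dots> = (\<Sum>s<n. T' s * L k l * adj (T' s))" by (simp add: adju u)
    also have "\<dots> = L k k" using TL T'(3) by simp
    finally show ?thesis .
  qed
  have nz: "norm z \<le> 1" by (rule norm_partial_isometry_le[OF zz LL(3)])
  have main: "hn k (cem k (Bs ! i) - z * cem k (Bs' ! i) * adj z) \<le> 2 * \<delta> + real n * real n * (M * \<eta>)" if i: "i < p" for i
  proof -
    \<comment> \<open>\<open>G1\<close> and \<open>G3\<close> are the block matrices built from
      \<open>D\<close> and from \<open>D'\<close>, each within \<open>\<delta>\<close> of its
      microstate. Conjugation by \<open>z\<close> carries \<open>G3\<close> exactly to
      \<open>G2\<close>, so the remaining cost is the Lipschitz estimate between \<open>G1\<close>
      and \<open>G2\<close>, summed over \<open>n\<^sup>2\<close> blocks.\<close>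
    define G1 where "G1 = (\<Sum>s<n. \<Sum>t<n. T s * F X i s t * adj (T t))"
    define G2 where "G2 = (\<Sum>s<n. \<Sum>t<n. T s * (u * F Y i s t * adj u) * adj (T t))"
    define G3 where "G3 = (\<Sum>s<n. \<Sum>t<n. T' s * F Y i s t * adj (T' t))"
    have "G1 = (\<Sum>s<n. \<Sum>t<n. T s * cem k (ncp_eval (cmat l) (f i s t) D) * adj (T t))"
      unfolding G1_def X_def using ev i len Dc by (intro sum.cong refl) simp
    moreover have "norm (cem k (Bs ! i) - (\<Sum>s<n. \<Sum>t<n. T s * cem k (ncp_eval (cmat l) (f i s t) D) * adj (T t))) < \<delta>"
      using l1 i unfolding lifted_def by blast
    ultimately have "norm (cem k (Bs ! i) - G1) < \<delta>" by (simp only:)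
    then have 1: "hn k (cem k (Bs ! i) - G1) \<le> \<delta>" using hn_le_norm[of k "cem k (Bs ! i) - G1"] by linarith
    have "G3 = (\<Sum>s<n. \<Sum>t<n. T' s * cem k (ncp_eval (cmat l) (f i s t) D') * adj (T' t))"
      unfolding G3_def Y_def using ev i len Dc by (intro sum.cong refl) simp
    moreover have "norm (cem k (Bs' ! i) - (\<Sum>s<n. \<Sum>t<n. T' s * cem k (ncp_eval (cmat l) (f i s t) D') * adj (T' t))) < \<delta>"
      using l2 i unfolding lifted_def by blast
    ultimately have "norm (cem k (Bs' ! i) - G3) < \<delta>" by (simp only:)
    then have "hn k (G3 - cem k (Bs' ! i)) \<le> \<delta>"
      using hn_le_norm[of k "G3 - cem k (Bs' ! i)"] by (simp add: norm_minus_commute)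
    then have "hn k (z * (G3 - cem k (Bs' ! i)) * adj z) \<le> \<delta>"
      using hn_sandwich[of z "adj z" k "G3 - cem k (Bs' ! i)"] nz by simp
    moreover have "z * G3 * adj z = G2"
    proof -
      have e: "z * (T' s * F Y i s t * adj (T' t)) * adj z = (z * T' s) * F Y i s t * adj (z * T' t)" for s t
        by (simp add: mult.assoc)
      then have "z * (T' s * F Y i s t * adj (T' t)) * adj z = T s * (u * F Y i s t * adj u) * adj (T t)" if "s < n" "t < n" for s t
        unfolding e zT[OF that(1)] zT[OF that(2)] by (simp add: mult.assoc)
      then show ?thesis unfolding G2_def G3_def sum_distrib_left sum_distrib_right by (intro sum.cong refl) simp
    qed
    ultimately have 3: "hn k (G2 - z * cem k (Bs' ! i) * adj z) \<le> \<delta>" by (simp add: right_diff_distrib left_diff_distrib)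
    have st: "hn k (T s * F X i s t * adj (T t) - T s * (u * F Y i s t * adj u) * adj (T t)) \<le> M * \<eta>" if st: "s < n" "t < n" for s t
    proof -
      note fP = f[OF i st]
      have "u * F Y i s t * adj u = npe (u * adj u) (\<lambda>j. u * Y j * adj u) (f i s t)"
        unfolding F_def by (rule npe_conj[symmetric, OF u(1,4) _ conjunct1[OF fP]]) (simp add: YL)
      then have e: "u * F Y i s t * adj u = npe (L k l) (\<lambda>j. u * Y j * adj u) (f i s t)" by (simp only: u(2))
      have "hn k (F X i s t - u * F Y i s t * adj u) \<le> plip (f i s t) R * \<eta>"
        unfolding e unfolding F_def
      proof (rule npe_lipschitz[OF R norm_projection_le[OF LL(1,2)] _ _ _ close(2) conjunct1[OF fP]])
        show "norm (u * Y j * adj u) \<le> R" if "j < m" for j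
          using norm_sandwich_le[of u "adj u" "Y j"] u(5) bY[OF that] by simp
        show "hn k (X j - u * Y j * adj u) \<le> \<eta>" if "j < m" for j
          using close(1)[OF that] by (simp add: X_def Y_def)
      qed (rule bX)
      also have "\<dots> \<le> M * \<eta>" using fP close(2) by (intro mult_right_mono) auto
      finally have "hn k (T s * (F X i s t - u * F Y i s t * adj u) * adj (T t)) \<le> M * \<eta>"
        using hn_sandwich[of "T s" "adj (T t)" k "F X i s t - u * F Y i s t * adj u"] nT st by simp
      then show ?thesis by (simp add: right_diff_distrib left_diff_distrib)
    qed
    have "G1 - G2 = (\<Sum>s<n. \<Sum>t<n. T s * F X i s t * adj (T t) - T s * (u * F Y i s t * adj u) * adj (T t))"
      by (simp add: G1_def G2_def sum_subtractf)
    also have "hn k \<dots> \<le> (\<Sum>s<n. \<Sum>t<n. M * \<eta>)"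
      by (rule order_trans[OF hn_sum], rule sum_mono, rule order_trans[OF hn_sum], rule sum_mono, rule st) auto
    finally have 2: "hn k (G1 - G2) \<le> real n * real n * (M * \<eta>)" by simp
    show ?thesis
      using 1 2 3 hn_diff_triangle[of k "cem k (Bs ! i)" "z * cem k (Bs' ! i) * adj z" G1]
        hn_diff_triangle[of k G1 "z * cem k (Bs' ! i) * adj z" G2] by linarith
  qed
  show ?thesis using zE zz main by blast
qed

subsection \<open>Covering numbers\<close>

text \<open>Each of the \<open>n\<^sup>2\<close> entries is approximated separately, and the
  isometry of \<open>mu s t\<close> lets the errors add up. The \<open>+ 1\<close> in the
  denominator makes the final inequality strict.\<close>

lemma (in matalg) entrywise_approx:
  assumes xs: "set xs \<subseteq> ca_carrier A" and gen: "generates A xs" and X: "X \<in> ca_carrier C" and d: "\<delta> > 0"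
  shows "\<exists>g. (\<forall>s<n. \<forall>t<n. g s t \<in> rat_ncpolys (length xs)) \<and>
    norm (emb C X - (\<Sum>s<n. \<Sum>t<n. mu s t (ncp_eval A (g s t) xs))) < \<delta>"
proof -
  define e where "e = \<delta> / (real n * real n + 1)"
  have n1: "real n * real n + 1 > 0" by (simp add: add_nonneg_pos)
  have e: "e > 0" using d n1 by (simp add: e_def)
  have x: "X s t \<in> ca_carrier A" for s t using X by (simp add: C_carrier ea.mat_in)
  have "\<exists>G\<in>rat_ncpolys (length xs). ca_norm A (ca_sub A (X s t) (ncp_eval A G xs)) < e" for s t
  proof -
    obtain G0 where G0: "ncpoly_in_vars (length xs) G0" "ca_norm A (ca_sub A (X s t) (ncp_eval A G0 xs)) < e / 2"
      using gen x half_gt_zero[OF e] unfolding generates_def by blast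
    obtain G where G: "G \<in> rat_ncpolys (length xs)"
      "norm (npe (emb A (ca_one A)) (\<lambda>i. emb A (xs ! i)) G0 - npe (emb A (ca_one A)) (\<lambda>i. emb A (xs ! i)) G) < e / 2"
      using npe_rat_approx[OF G0(1) half_gt_zero[OF e]] by blast
    have v: "ncpoly_in_vars (length xs) G" using G(1) by (simp add: rat_ncpolys_def)
    note ev = ea.e_ncp_eval[OF xs G0(1)] ea.e_ncp_eval[OF xs v]
    have "norm (emb A (X s t) - emb A (ncp_eval A G0 xs)) < e / 2"
      using G0(2) norm_sub[OF x ev(1)] by simp
    moreover have "norm (emb A (ncp_eval A G0 xs) - emb A (ncp_eval A G xs)) < e / 2"
      using G(2) unfolding ev(2) ev(4) .
    ultimately have "norm (emb A (X s t) - emb A (ncp_eval A G xs)) < e"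
      using norm_triangle_ineq[of "emb A (X s t) - emb A (ncp_eval A G0 xs)" "emb A (ncp_eval A G0 xs) - emb A (ncp_eval A G xs)"] by simp
    then show ?thesis using G(1) norm_sub[OF x ev(3)] by (intro bexI[of _ G]) simp_all
  qed
  then obtain g where g: "\<And>s t. g s t \<in> rat_ncpolys (length xs)" "\<And>s t. ca_norm A (ca_sub A (X s t) (ncp_eval A (g s t) xs)) < e"
    by metis
  have gin: "ncp_eval A (g s t) xs \<in> ca_carrier A" for s t
    using g(1)[of s t] by (intro ea.e_ncp_eval(1) xs) (simp add: rat_ncpolys_def)
  have st: "norm (mu s t (X s t) - mu s t (ncp_eval A (g s t) xs)) \<le> e" if "s < n" "t < n" for s t
  proof -
    have "mu s t (X s t) - mu s t (ncp_eval A (g s t) xs) = mu s t (ca_sub A (X s t) (ncp_eval A (g s t) xs))"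
      unfolding ca_sub_def using that x gin by (simp add: mu_add mu_smult)
    then show ?thesis using norm_mu[OF that] g(2)[of s t] x gin by (simp add: ca_sub_def)
  qed
  have "emb C X - (\<Sum>s<n. \<Sum>t<n. mu s t (ncp_eval A (g s t) xs)) = (\<Sum>s<n. \<Sum>t<n. mu s t (X s t) - mu s t (ncp_eval A (g s t) xs))"
    unfolding elem_decomp[OF X] by (simp add: sum_subtractf)
  also have "norm \<dots> \<le> (\<Sum>s<n. \<Sum>t<n. e)"
    by (rule order_trans[OF norm_sum], rule sum_mono, rule order_trans[OF norm_sum], rule sum_mono, rule st) auto
  also have "\<dots> = real n * real n * e" by simp
  also have "\<dots> < (real n * real n + 1) * e" using e by simp
  also have "\<dots> = \<delta>" using n1 by (simp add: e_def)
  finally show ?thesis using g(1) by blast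
qed

lemma Gamma_topD:
  assumes "As \<in> Gamma_top S xs P R k \<epsilon> r"
  shows "length As = length xs" "\<forall>B\<in>set As. B \<in> cc k \<and> op_norm k B \<le> R" "\<forall>B\<in>set As. self_adjoint (cmat k) B"
    "j \<in> {1..r} \<Longrightarrow> \<bar>ca_norm (cmat k) (ncp_eval (cmat k) (P j) As) - ca_norm S (ncp_eval S (P j) xs)\<bar> \<le> \<epsilon>"
  using assms by (auto simp: Gamma_top_def self_adjoint_def)

text \<open>A failure for every \<open>r0\<close> would supply microstates of quality
  \<open>1 / (r + 1)\<close> without a lift. Every rational polynomial has some index in the
  enumeration, so its norm converges along them, and \<open>eventually_lifted\<close> applies. The
  single \<open>r0\<close> serves as tolerance and as number of polynomials, uniformly in
  \<open>k\<close>.\<close>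

lemma uniform_lift:
  fixes A :: "'a calg"
  assumes A: "unital_cstar_algebra A" and n: "0 < n" and xs: "\<forall>x\<in>set xs. self_adjoint A x"
    and ys: "\<forall>y\<in>set ys. self_adjoint (mat_alg A n) y" and gen: "generates (mat_alg A n) ys"
    and P: "bij_betw P {1..} (rat_ncpolys (length xs))" and Q: "bij_betw Q {1..} (rat_ncpolys (length ys))"
    and f: "\<And>i s t. i < length ys \<Longrightarrow> s < n \<Longrightarrow> t < n \<Longrightarrow> f i s t \<in> rat_ncpolys (length xs)"
    and fd: "\<And>i. i < length ys \<Longrightarrow>
      norm (emb (mat_alg A n) (ys ! i) - (\<Sum>s<n. \<Sum>t<n. matalg.mu A n s t (ncp_eval A (f i s t) xs))) < \<delta>"
    and R: "\<And>x. x \<in> set xs \<Longrightarrow> ca_norm A x < R" and e': "\<epsilon>' > 0"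
  shows "\<exists>r0\<ge>1. \<forall>k. \<forall>Bs\<in>Gamma_top (mat_alg A n) ys Q R0 k (1 / real r0) r0.
    \<exists>l D T. lifted n (length ys) f \<delta> k Bs l D T \<and> D \<in> Gamma_top A xs P R l \<epsilon>' r'"
proof (rule ccontr)
  assume neg: "\<not> ?thesis"
  have "\<exists>k Bs. Bs \<in> Gamma_top (mat_alg A n) ys Q R0 k (1 / real (Suc r)) (Suc r) \<and>
    \<not> (\<exists>l D T. lifted n (length ys) f \<delta> k Bs l D T \<and> D \<in> Gamma_top A xs P R l \<epsilon>' r')" for r
    using neg by (metis le_add1 plus_1_eq_Suc)
  then obtain k B where B: "\<And>r. B r \<in> Gamma_top (mat_alg A n) ys Q R0 (k r) (1 / real (Suc r)) (Suc r)"
    and no: "\<And>r. \<not> (\<exists>l D T. lifted n (length ys) f \<delta> (k r) (B r) l D T \<and> D \<in> Gamma_top A xs P R l \<epsilon>' r')" by metis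
  interpret m: microstates A n xs ys k B
  proof
    show "unital_cstar_algebra A" "0 < n" by (rule A, rule n)
    show "\<forall>x\<in>set xs. self_adjoint A x" "\<forall>y\<in>set ys. self_adjoint (mat_alg A n) y" "generates (mat_alg A n) ys"
      by (rule xs, rule ys, rule gen)
    show "length (B r) = length ys" "\<forall>b\<in>set (B r). self_adjoint (cmat (k r)) b" for r
      using Gamma_topD[OF B[of r]] by auto
    fix G assume "G \<in> rat_ncpolys (length ys)"
    then have "G \<in> Q ` {1..}" using Q unfolding bij_betw_def by blast
    then obtain j where j: "j \<ge> 1" "Q j = G" by auto
    show "(\<lambda>r. ca_norm (cmat (k r)) (ncp_eval (cmat (k r)) G (B r))) \<longlonglongrightarrow> ca_norm (mat_alg A n) (ncp_eval (mat_alg A n) G ys)"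
    proof (rule LIM_zero_cancel, rule Lim_null_comparison)
      show "(\<lambda>r. 1 / real (Suc r)) \<longlonglongrightarrow> 0" using LIMSEQ_Suc[OF lim_1_over_n] by simp
      show "eventually (\<lambda>r. norm (ca_norm (cmat (k r)) (ncp_eval (cmat (k r)) G (B r)) - ca_norm (mat_alg A n) (ncp_eval (mat_alg A n) G ys)) \<le> 1 / real (Suc r)) sequentially"
        using eventually_ge_at_top[of j]
      proof eventually_elim
        case (elim r)
        then have "j \<in> {1..Suc r}" using j by simp
        from Gamma_topD(4)[OF B this] show ?case by (simp only: j real_norm_def)
      qed
    qed
  qed
  have "P j \<in> rat_ncpolys (length xs)" if "j \<in> {1..r'}" for j
    using P that unfolding bij_betw_def by auto
  then have "eventually (\<lambda>r. \<exists>l D T. lifted n (length ys) f \<delta> (k r) (B r) l D T \<and> D \<in> Gamma_top A xs P R l \<epsilon>' r') sequentially"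
    by (intro m.eventually_lifted f fd R e')
  from eventually_happens'[OF sequentially_bot this] no show False by blast
qed

text \<open>An \<open>l\<close>-matrix seen inside \<open>M\<^sub>k\<close> keeps its
  Hilbert-Schmidt sum but is normalised by the larger \<open>k\<close>, so distances do not
  grow.\<close>

lemma orbit_ball_close:
  assumes "As \<in> orbit_ball l \<omega> Bs" and Bs: "\<forall>B\<in>set Bs. B \<in> cc l" and lk: "l \<le> k" and l0: "0 < l"
  shows "\<exists>U. unitary_mat l U \<and> length As = length Bs \<and>
    (\<forall>i<length Bs. hn k (cem k (As ! i) - cem k U * cem k (Bs ! i) * adj (cem k U)) < \<omega>)"
proof -
  obtain W where W: "unitary_mat l W" and len: "length As = length Bs" and As: "\<forall>B\<in>set As. B \<in> cc l"
    and nm: "norm2 l (map2 (\<lambda>A B. ca_sub (cmat l) A (ca_mul (cmat l) (ca_mul (cmat l) W B) (ca_star (cmat l) W))) As Bs) < \<omega>"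
    using assms(1) by (auto simp: orbit_ball_def)
  define Z where "Z = map2 (\<lambda>A B. ca_sub (cmat l) A (ca_mul (cmat l) (ca_mul (cmat l) W B) (ca_star (cmat l) W))) As Bs"
  have Wc: "W \<in> cc l" using W by (simp add: unitary_mat_iff)
  have lenZ: "length Z = length Bs" by (simp add: Z_def len)
  have Zi: "Z ! i = ca_sub (cmat l) (As ! i) (ca_mul (cmat l) (ca_mul (cmat l) W (Bs ! i)) (ca_star (cmat l) W))"
    if "i < length Bs" for i using that len by (simp add: Z_def)
  have ab: "As ! i \<in> cc l" "Bs ! i \<in> cc l" if "i < length Bs" for i using that len As Bs by auto
  have Zc: "Z ! i \<in> cc l" if "i < length Bs" for i
    unfolding Zi[OF that] using ab[OF that] Wc by (intro cm.sub_in cm.closed)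
  interpret cn: crep "cmat l" "cem k" using lk by (rule crep_nested)
  have "hn k (cem k (As ! i) - cem k W * cem k (Bs ! i) * adj (cem k W)) < \<omega>" if i: "i < length Bs" for i
  proof -
    have "cem k (Z ! i) = cem k (As ! i) - cem k W * cem k (Bs ! i) * adj (cem k W)"
      unfolding Zi[OF i] using ab[OF i] Wc by (simp add: cn.e_sub cn.e_mul cn.e_star)
    moreover have "hn k (cem k (Z ! i)) \<le> hn l (cem l (Z ! i))"
      using lk l0 by (simp add: hn_cem cc_mono[OF lk Zc[OF i]] Zc[OF i] hs_nested[OF lk Zc[OF i]] frac_le)
    moreover have "hn l (cem l (Z ! i)) \<le> norm2 l Z"
      by (rule hn_le_norm2) (use Zc lenZ i in \<open>auto simp: in_set_conv_nth\<close>)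
    ultimately show ?thesis using nm unfolding Z_def[symmetric] by simp
  qed
  then show ?thesis using W len by blast
qed

lemma orbit_ballI:
  assumes As: "\<forall>B\<in>set As. B \<in> cc k" and Bs: "\<forall>B\<in>set Bs. B \<in> cc k" and len: "length As = length Bs"
    and z: "cem k (idm k) * z = z" "adj z * z = cem k (idm k)"
    and s: "(\<Sum>i<length Bs. hn k (cem k (As ! i) - z * cem k (Bs ! i) * adj z)) < \<omega>"
  shows "As \<in> orbit_ball k \<omega> Bs"
proof -
  define W where "W = ucs_at z (cmat k)"
  have W: "W \<in> cc k" "cem k W = z" using cem_range[OF z(1)] by (simp_all add: W_def)
  have "mmul k (madj W) W = idm k"
    by (rule cm.e_inj[of _ k]) (use W z in \<open>simp_all add: cc_closed cem_mmul cem_madj\<close>)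
  then have U: "unitary_mat k W" using W by (simp add: unitary_mat_iff)
  define Z where "Z = map2 (\<lambda>A B. ca_sub (cmat k) A (ca_mul (cmat k) (ca_mul (cmat k) W B) (ca_star (cmat k) W))) As Bs"
  have lenZ: "length Z = length Bs" by (simp add: Z_def len)
  have Zi: "Z ! i = ca_sub (cmat k) (As ! i) (ca_mul (cmat k) (ca_mul (cmat k) W (Bs ! i)) (ca_star (cmat k) W))"
    if "i < length Bs" for i using that len by (simp add: Z_def)
  have ab: "As ! i \<in> cc k" "Bs ! i \<in> cc k" if "i < length Bs" for i using that len As Bs by auto
  have Zc: "Z ! i \<in> cc k" if "i < length Bs" for i
    unfolding Zi[OF that] using ab[OF that] W by (intro cm.sub_in cm.closed)
  have "norm2 k Z \<le> (\<Sum>i<length Z. hn k (cem k (Z ! i)))"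
    by (rule norm2_le_sum) (use Zc lenZ in \<open>auto simp: in_set_conv_nth\<close>)
  also have "\<dots> = (\<Sum>i<length Bs. hn k (cem k (As ! i) - z * cem k (Bs ! i) * adj z))"
    unfolding lenZ using W ab by (intro sum.cong refl) (simp add: Zi cm.e_sub cm.e_mul cm.e_star)
  also note s
  finally show ?thesis unfolding orbit_ball_def using U As len by (auto simp: Z_def)
qed

lemma o2_le: "finite F \<Longrightarrow> F \<subseteq> \<Sigma> \<Longrightarrow> \<Sigma> \<subseteq> (\<Union>B\<in>F. orbit_ball k \<omega> B) \<Longrightarrow> o2 k \<Sigma> \<omega> \<le> card F"
  unfolding o2_def by (intro cInf_lower) auto

text \<open>An infimum of natural numbers is a minimum provided there is a competitor;
  \<open>finite_orbit_cover\<close> supplies one.\<close>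

lemma o2_attained:
  assumes "finite F" "F \<subseteq> \<Sigma>" "\<Sigma> \<subseteq> (\<Union>B\<in>F. orbit_ball k \<omega> B)"
  shows "\<exists>G. finite G \<and> G \<subseteq> \<Sigma> \<and> \<Sigma> \<subseteq> (\<Union>B\<in>G. orbit_ball k \<omega> B) \<and> card G = o2 k \<Sigma> \<omega>"
proof -
  have "o2 k \<Sigma> \<omega> \<in> {card F | F. finite F \<and> F \<subseteq> \<Sigma> \<and> \<Sigma> \<subseteq> (\<Union>B\<in>F. orbit_ball k \<omega> B)}"
    unfolding o2_def by (rule Inf_nat_def1) (use assms in blast)
  then show ?thesis by auto
qed

lemma orbit_ball_mono: "\<omega> \<le> \<omega>' \<Longrightarrow> orbit_ball k \<omega> B \<subseteq> orbit_ball k \<omega>' B"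
  unfolding orbit_ball_def by (auto intro: less_le_trans)

text \<open>Bounded entries fall into finitely many cells of a grid, and one element of the family
  is picked from every occupied cell, so the centres belong to it. The identity serves as the
  unitary.\<close>

lemma finite_orbit_cover:
  assumes S: "\<And>As. As \<in> \<Sigma> \<Longrightarrow> length As = m \<and> (\<forall>B\<in>set As. B \<in> cc k \<and> op_norm k B \<le> R)" and w: "\<omega> > 0"
  shows "\<exists>F. finite F \<and> F \<subseteq> \<Sigma> \<and> \<Sigma> \<subseteq> (\<Union>B\<in>F. orbit_ball k \<omega> B)"
proof -
  \<comment> \<open>Real and imaginary parts agree up to \<open>d\<close>, entries up to
    \<open>2 d\<close>, matrices up to \<open>2 d k\<^sup>2\<close>, and \<open>m\<close> of these
    are summed. The extra \<open>1\<close>s keep the denominator positive and the bound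
    strict.\<close>
  define d where "d = \<omega> / (2 * (real m + 1) * (real k * real k + 1))"
  have pos: "real m + 1 > 0" "real k * real k + 1 > 0" by (simp_all add: add_nonneg_pos)
  have d: "d > 0" using w pos by (simp add: d_def)
  define I where "I = {..<m} \<times> {..<k} \<times> {..<k}"
  define g where "g As = restrict (\<lambda>(i, a, b). (\<lfloor>Re ((As ! i) a b) / d\<rfloor>, \<lfloor>Im ((As ! i) a b) / d\<rfloor>)) I" for As :: "(nat \<Rightarrow> nat \<Rightarrow> complex) list"
  define J where "J = {\<lfloor>- \<bar>R\<bar> / d\<rfloor>..\<lfloor>\<bar>R\<bar> / d\<rfloor>}"
  have "g ` \<Sigma> \<subseteq> (\<Pi>\<^sub>E p\<in>I. J \<times> J)"
  proof (rule image_subsetI)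
    fix As assume As: "As \<in> \<Sigma>"
    have "\<lfloor>Re ((As ! i) a b) / d\<rfloor> \<in> J \<and> \<lfloor>Im ((As ! i) a b) / d\<rfloor> \<in> J" if "i < m" "a < k" "b < k" for i a b
    proof -
      have "As ! i \<in> set As" using S[OF As] that by auto
      then have "op_norm k (As ! i) \<le> R" using S[OF As] by blast
      then have R: "opn k (As ! i) \<le> \<bar>R\<bar>" unfolding op_norm_eq_opn by linarith
      have "cmod ((As ! i) a b) \<le> opn k (As ! i)" using that by (intro norm_le_opn)
      also note R
      finally have c: "cmod ((As ! i) a b) \<le> \<bar>R\<bar>" .
      have "- \<bar>R\<bar> \<le> Re ((As ! i) a b)" "Re ((As ! i) a b) \<le> \<bar>R\<bar>" "- \<bar>R\<bar> \<le> Im ((As ! i) a b)" "Im ((As ! i) a b) \<le> \<bar>R\<bar>"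
        using c abs_Re_le_cmod[of "(As ! i) a b"] abs_Im_le_cmod[of "(As ! i) a b"] by linarith+
      then show ?thesis unfolding J_def atLeastAtMost_iff
        using d by (intro conjI floor_mono divide_right_mono) auto
    qed
    then show "g As \<in> (\<Pi>\<^sub>E p\<in>I. J \<times> J)" by (auto simp: g_def I_def)
  qed
  moreover have "finite (\<Pi>\<^sub>E p\<in>I. J \<times> J)" by (intro finite_PiE) (auto simp: I_def J_def)
  ultimately have "finite (g ` \<Sigma>)" by (rule finite_subset)
  then obtain F where F: "F \<subseteq> \<Sigma>" "finite F" "g ` \<Sigma> = g ` F" using finite_subset_image[of "g ` \<Sigma>" g \<Sigma>] by blast
  have "As \<in> (\<Union>B\<in>F. orbit_ball k \<omega> B)" if As: "As \<in> \<Sigma>" for As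
  proof -
    obtain Bs where Bs: "Bs \<in> F" "g As = g Bs" using F(3) As by blast
    note sA = S[OF As] and sB = S[OF subsetD[OF F(1) Bs(1)]]
    have fl: "\<bar>x - y\<bar> \<le> d" if "\<lfloor>x / d\<rfloor> = \<lfloor>y / d\<rfloor>" for x y
    proof -
      have "\<bar>x / d - y / d\<bar> < 1" using that by linarith
      then have "\<bar>x - y\<bar> / d < 1" using d by (simp flip: diff_divide_distrib)
      then show ?thesis using d by (simp add: field_simps)
    qed
    have ent: "cmod ((As ! i) a b - (Bs ! i) a b) \<le> 2 * d" if "i < m" "a < k" "b < k" for i a b
    proof -
      have "g As (i, a, b) = g Bs (i, a, b)" using Bs(2) by simp
      then have "\<lfloor>Re ((As ! i) a b) / d\<rfloor> = \<lfloor>Re ((Bs ! i) a b) / d\<rfloor>" "\<lfloor>Im ((As ! i) a b) / d\<rfloor> = \<lfloor>Im ((Bs ! i) a b) / d\<rfloor>"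
        using that by (simp_all add: g_def I_def)
      from fl[OF this(1)] fl[OF this(2)] show ?thesis
        using cmod_le[of "(As ! i) a b - (Bs ! i) a b"] by simp
    qed
    have in': "As ! i \<in> cc k" "Bs ! i \<in> cc k" if "i < m" for i using that sA sB by auto
    have hi: "hn k (cem k (As ! i) - cem k (idm k) * cem k (Bs ! i) * adj (cem k (idm k))) \<le> real k * real k * (2 * d)"
      if i: "i < m" for i
    proof -
      have e: "cem k (As ! i) - cem k (idm k) * cem k (Bs ! i) * adj (cem k (idm k)) = cem k (\<lambda>a b. (As ! i) a b - (Bs ! i) a b)"
        using in'[OF i] by (simp add: cem_idm cem_idm_mult cem_sub)
      have "hn k (cem k (\<lambda>a b. (As ! i) a b - (Bs ! i) a b)) \<le> norm (cem k (\<lambda>a b. (As ! i) a b - (Bs ! i) a b))" by (rule hn_le_norm)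
      also have "\<dots> = opn k (\<lambda>a b. (As ! i) a b - (Bs ! i) a b)" using in'[OF i] by (simp add: norm_cem cc_closed)
      also have "\<dots> \<le> (\<Sum>a<k. \<Sum>b<k. cmod ((As ! i) a b - (Bs ! i) a b))" by (rule opn_le_sum)
      also have "\<dots> \<le> (\<Sum>a<k. \<Sum>b<k. 2 * d)" using ent[OF i] by (intro sum_mono) auto
      finally show ?thesis unfolding e by simp
    qed
    have lB: "length Bs = m" using sB by blast
    have "(\<Sum>i<length Bs. hn k (cem k (As ! i) - cem k (idm k) * cem k (Bs ! i) * adj (cem k (idm k)))) \<le> (\<Sum>i<m. real k * real k * (2 * d))"
      unfolding lB by (intro sum_mono hi) simp
    also have "\<dots> = real m * (real k * real k) * (2 * d)" by simp
    also have "\<dots> < (real m + 1) * (real k * real k + 1) * (2 * d)"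
      using d by (intro mult_strict_right_mono mult_strict_mono) auto
    also have "\<dots> = \<omega>"
    proof -
      have "a * b * (2 * (\<omega> / (2 * a * b))) = \<omega>" if "a > 0" "b > 0" for a b :: real using that by simp
      from this[OF pos] show ?thesis by (simp only: d_def)
    qed
    finally have sm: "(\<Sum>i<length Bs. hn k (cem k (As ! i) - cem k (idm k) * cem k (Bs ! i) * adj (cem k (idm k)))) < \<omega>" .
    have "As \<in> orbit_ball k \<omega> Bs"
    proof (rule orbit_ballI[OF _ _ _ _ _ sm])
      show "\<forall>B\<in>set As. B \<in> cc k" "\<forall>B\<in>set Bs. B \<in> cc k" "length As = length Bs" using sA sB by simp_all
      show "cem k (idm k) * cem k (idm k) = cem k (idm k)" "adj (cem k (idm k)) * cem k (idm k) = cem k (idm k)"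
        by (simp_all add: cem_idm)
    qed
    then show ?thesis using Bs(1) by blast
  qed
  then show ?thesis using F by blast
qed

text \<open>Centres must lie in \<open>\<Sigma>y\<close>, whereas the points of \<open>F\<close>
  need not lift anything. So each point of \<open>F\<close> that is close to some lifted
  \<open>D\<close> is traded for one microstate \<open>h\<close> chosen with this property, and two
  microstates sharing a point of \<open>F\<close> have \<open>D\<close> within
  \<open>2 * \<omega>'\<close> up to conjugation.\<close>

lemma o2_lift_le:
  assumes n: "0 < n" and k: "0 < k"
    and Sy: "\<And>Bs. Bs \<in> \<Sigma>y \<Longrightarrow> length Bs = p \<and> (\<forall>b\<in>set Bs. b \<in> cc k)"
    and Sx: "\<And>D. D \<in> \<Sigma>x \<Longrightarrow> length D = m \<and> (\<forall>d\<in>set D. d \<in> cc l \<and> op_norm l d \<le> R)"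
    and lift: "\<And>Bs. Bs \<in> \<Sigma>y \<Longrightarrow> \<exists>D T. lifted n p f \<delta> k Bs l D T \<and> D \<in> \<Sigma>x"
    and R: "R \<ge> 1" and f: "\<And>i s t. i < p \<Longrightarrow> s < n \<Longrightarrow> t < n \<Longrightarrow> f i s t \<in> rat_ncpolys m \<and> plip (f i s t) R \<le> M"
    and w: "\<omega>' > 0" "real p * (2 * \<delta> + real n * real n * (M * (2 * \<omega>'))) < \<omega>"
    and F: "finite F" "F \<subseteq> \<Sigma>x" "\<Sigma>x \<subseteq> (\<Union>B\<in>F. orbit_ball l \<omega>' B)"
  shows "o2 k \<Sigma>y \<omega> \<le> card F"
proof -
  have "\<exists>D T c. Bs \<in> \<Sigma>y \<longrightarrow> lifted n p f \<delta> k Bs l D T \<and> D \<in> \<Sigma>x \<and> c \<in> F \<and> D \<in> orbit_ball l \<omega>' c" for Bs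
    using lift[of Bs] F(3) by blast
  then obtain D T c where L: "\<And>Bs. Bs \<in> \<Sigma>y \<Longrightarrow> lifted n p f \<delta> k Bs l (D Bs) (T Bs)"
    and Din: "\<And>Bs. Bs \<in> \<Sigma>y \<Longrightarrow> D Bs \<in> \<Sigma>x" and c: "\<And>Bs. Bs \<in> \<Sigma>y \<Longrightarrow> c Bs \<in> F" "\<And>Bs. Bs \<in> \<Sigma>y \<Longrightarrow> D Bs \<in> orbit_ball l \<omega>' (c Bs)"
    by metis
  define h where "h b = (SOME Bs. Bs \<in> \<Sigma>y \<and> c Bs = b)" for b
  have h: "h (c Bs) \<in> \<Sigma>y \<and> c (h (c Bs)) = c Bs" if "Bs \<in> \<Sigma>y" for Bs
    unfolding h_def by (rule someI[of _ Bs]) (use that in simp)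
  define G where "G = h ` (c ` \<Sigma>y)"
  have cF: "c ` \<Sigma>y \<subseteq> F" using c(1) by blast
  then have fin: "finite (c ` \<Sigma>y)" using F(1) finite_subset by blast
  have Gc: "card G \<le> card F" unfolding G_def using card_image_le[OF fin, of h] card_mono[OF F(1) cF] by linarith
  have Gs: "G \<subseteq> \<Sigma>y" unfolding G_def using h by blast
  have "Bs \<in> (\<Union>B\<in>G. orbit_ball k \<omega> B)" if Bs: "Bs \<in> \<Sigma>y" for Bs
  proof -
    define B' where "B' = h (c Bs)"
    have B': "B' \<in> \<Sigma>y" "c B' = c Bs" "B' \<in> G" using h[OF Bs] Bs by (auto simp: B'_def G_def)
    have kl: "k = n * l" using L[OF Bs] unfolding lifted_def by blast
    have lk: "l \<le> k" "0 < l" using kl n k by auto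
    note sD = Sx[OF Din[OF Bs]] and sD' = Sx[OF Din[OF B'(1)]] and sc = Sx[OF subsetD[OF F(2) c(1)[OF Bs]]]
    have ccl: "\<forall>B\<in>set (c Bs). B \<in> cc l" using sc by blast
    obtain U1 where U1: "unitary_mat l U1" and c1: "\<And>i. i < m \<Longrightarrow> hn k (cem k (D Bs ! i) - cem k U1 * cem k (c Bs ! i) * adj (cem k U1)) < \<omega>'"
      using orbit_ball_close[OF c(2)[OF Bs] ccl lk] sc by auto
    have "D B' \<in> orbit_ball l \<omega>' (c Bs)" using c(2)[OF B'(1)] B'(2) by simp
    then obtain U2 where U2: "unitary_mat l U2" and c2: "\<And>i. i < m \<Longrightarrow> hn k (cem k (D B' ! i) - cem k U2 * cem k (c Bs ! i) * adj (cem k U2)) < \<omega>'"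
      using orbit_ball_close[OF _ ccl lk, of "D B'" \<omega>'] sc by auto
    define a where "a = cem k U1"
    define b where "b = cem k U2"
    define E where "E = cem k (idm l)"
    note ua = cem_unitary[OF U1 lk(1), folded a_def E_def] and ub = cem_unitary[OF U2 lk(1), folded b_def E_def]
    have E: "E * E = E" "adj E = E" using lk by (simp_all add: E_def cem_idm)
    have Eb: "E * adj b = adj b" "adj b * E = adj b" "adj a * E = adj a"
    proof -
      have "E * adj b = adj (b * E)" "adj b * E = adj (E * b)" "adj a * E = adj (E * a)" by (simp_all only: adj_mult E)
      then show "E * adj b = adj b" "adj b * E = adj b" "adj a * E = adj a" by (simp_all only: ua ub)
    qed
    \<comment> \<open>\<open>b\<close> conjugates the common centre to near \<open>D B'\<close> and
      \<open>a\<close> conjugates it to near \<open>D Bs\<close>, so \<open>a b\<^sup>*\<close>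
      conjugates \<open>D B'\<close> to near \<open>D Bs\<close>.\<close>
    define u where "u = a * adj b"
    have u1: "adj u * u = E"
    proof -
      have "adj u * u = b * (adj a * a) * adj b" by (simp add: u_def mult.assoc)
      then show ?thesis unfolding ua(1) ub(4) ub(2) .
    qed
    have u2: "u * adj u = E"
    proof -
      have "u * adj u = a * (adj b * b) * adj a" by (simp add: u_def mult.assoc)
      then show ?thesis unfolding ub(1) ua(4) ua(2) .
    qed
    have u3: "E * u = u" "u * E = u" unfolding u_def by (simp_all add: ua mult.assoc Eb flip: mult.assoc[of E a]) 
    have nu: "norm u \<le> 1" by (rule norm_partial_isometry_le[OF u1 E(1)])
    interpret cn: crep "cmat l" "cem k" using lk(1) by (rule crep_nested)
    have cl: "hn k (cem k (D Bs ! i) - u * cem k (D B' ! i) * adj u) \<le> 2 * \<omega>'" if i: "i < m" for i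
    proof -
      define x where "x = cem k (c Bs ! i)"
      define y where "y = cem k (D B' ! i)"
      have cb: "c Bs ! i \<in> cc l" using sc i by auto
      have xE: "E * x = x" "x * E = x" unfolding x_def E_def using cn.e_one_mult[OF cb] by (simp_all add: cmat_one)
      have "u * (b * x * adj b) * adj u = a * ((adj b * b) * x * (adj b * b)) * adj a" by (simp add: u_def mult.assoc)
      then have "u * (b * x * adj b) * adj u = a * x * adj a" unfolding ub(1) xE .
      then have "a * x * adj a - u * y * adj u = u * (b * x * adj b - y) * adj u" by (simp add: right_diff_distrib left_diff_distrib)
      also have "hn k \<dots> \<le> hn k (b * x * adj b - y)" using nu by (intro hn_sandwich) simp_all
      also have "\<dots> = hn k (y - b * x * adj b)" using hn_uminus[of k "y - b * x * adj b"] by simp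
      also have "\<dots> < \<omega>'" using c2[OF i] by (simp add: x_def y_def b_def)
      finally have "hn k (a * x * adj a - u * y * adj u) < \<omega>'" .
      moreover have "hn k (cem k (D Bs ! i) - a * x * adj a) < \<omega>'" using c1[OF i] by (simp add: x_def a_def)
      ultimately show ?thesis
        using hn_diff_triangle[of k "cem k (D Bs ! i)" "u * y * adj u" "a * x * adj a"] unfolding y_def by linarith
    qed
    have sB: "length Bs = p" "\<forall>b\<in>set Bs. b \<in> cc k" and sB': "length B' = p" "\<forall>b\<in>set B'. b \<in> cc k"
      using Sy[OF Bs] Sy[OF B'(1)] by auto
    have EB': "cem k (idm k) * cem k (B' ! i) = cem k (B' ! i)" if "i < p" for i
      using sB' that by (intro cem_idm_mult(1)) auto
    have len: "length (D Bs) = m" "length (D B') = m"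
      and Dc: "\<forall>d\<in>set (D Bs). d \<in> cc l \<and> op_norm l d \<le> R" "\<forall>d\<in>set (D B'). d \<in> cc l \<and> op_norm l d \<le> R"
      using sD sD' by blast+
    have w2: "0 \<le> 2 * \<omega>'" using w(1) by simp
    obtain z where z: "cem k (idm k) * z = z" "adj z * z = cem k (idm k)"
      and zb: "\<And>i. i < p \<Longrightarrow> hn k (cem k (Bs ! i) - z * cem k (B' ! i) * adj z) \<le> 2 * \<delta> + real n * real n * (M * (2 * \<omega>'))"
      using lifted_close[OF L[OF Bs] L[OF B'(1)] n len Dc R f u1[unfolded E_def] u2[unfolded E_def] u3[unfolded E_def] nu cl w2 EB'] by blast
    have "(\<Sum>i<length B'. hn k (cem k (Bs ! i) - z * cem k (B' ! i) * adj z)) \<le> (\<Sum>i<p. 2 * \<delta> + real n * real n * (M * (2 * \<omega>')))"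
      unfolding sB'(1) by (intro sum_mono zb) simp
    also have "\<dots> = real p * (2 * \<delta> + real n * real n * (M * (2 * \<omega>')))" by simp
    also note w(2)
    finally have sm: "(\<Sum>i<length B'. hn k (cem k (Bs ! i) - z * cem k (B' ! i) * adj z)) < \<omega>" .
    have "Bs \<in> orbit_ball k \<omega> B'"
      by (rule orbit_ballI[OF sB(2) sB'(2) _ z sm]) (simp only: sB(1) sB'(1))
    then show ?thesis using B'(3) by blast
  qed
  then have "o2 k \<Sigma>y \<omega> \<le> card G" using Gs fin by (intro o2_le) (auto simp: G_def)
  then show ?thesis using Gc by linarith
qed

section \<open>Comparison of the orbit dimensions\<close>

text \<open>A positive count has a nonnegative logarithm, so a smaller dimension only enlarges the
  quotient; a zero count gives \<open>-\<infinity>\<close>.\<close>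

lemma log_ratio_mono:
  assumes "c \<le> c'" "l \<le> k" "0 < l" shows "log_ratio c k \<le> log_ratio c' l"
proof (cases "c = 0")
  case False
  then have "ln (real c) / (real k)\<^sup>2 \<le> ln (real c') / (real l)\<^sup>2"
    using assms by (intro frac_le) (auto intro!: power_mono)
  then show ?thesis using False assms by (simp add: log_ratio_def)
qed (simp add: log_ratio_def)

text \<open>\<open>k div n\<close> tends to infinity, so the values of \<open>h\<close> there are
  eventually dominated by every tail supremum of \<open>h\<close>.\<close>

lemma limsup_div_le:
  fixes h :: "nat \<Rightarrow> ereal" assumes "0 < n" shows "limsup (\<lambda>k. h (k div n)) \<le> limsup h"
  unfolding limsup_INF_SUP[of h]
proof (rule INF_greatest)
  fix N
  have "eventually (\<lambda>k. h (k div n) \<le> (SUP m\<in>{N..}. h m)) sequentially"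
    using eventually_ge_at_top[of "N * n"]
  proof eventually_elim
    case (elim k)
    then have "N \<le> k div n" using assms by (simp add: less_eq_div_iff_mult_less_eq)
    then show ?case by (intro SUP_upper) simp
  qed
  then show "limsup (\<lambda>k. h (k div n)) \<le> (SUP m\<in>{N..}. h m)" by (rule Limsup_bounded)
qed

text \<open>Order of choices: \<open>\<omega>\<close> determines \<open>\<delta>\<close>, then come
  the polynomials \<open>f\<close>, the bounds \<open>R\<close> and \<open>M\<close>, and
  \<open>\<omega>'\<close>. All of them precede the cut-off \<open>R0\<close> and the pair
  \<open>(\<epsilon>', r')\<close>; only \<open>r0\<close> depends on those, and it works for every
  \<open>k\<close>.\<close>

lemma K_top_omega_le:
  fixes A :: "'a calg"
  assumes A: "unital_cstar_algebra A" and n: "0 < n" and xs: "\<forall>x\<in>set xs. self_adjoint A x" and gx: "generates A xs"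
    and ys: "\<forall>y\<in>set ys. self_adjoint (mat_alg A n) y" and gen: "generates (mat_alg A n) ys"
    and P: "bij_betw P {1..} (rat_ncpolys (length xs))" and Q: "bij_betw Q {1..} (rat_ncpolys (length ys))"
    and w: "\<omega> > 0"
  shows "\<exists>\<omega>'>0. K_top_omega (mat_alg A n) ys Q \<omega> \<le> K_top_omega A xs P \<omega>'"
proof -
  interpret m: matalg A n using A by (simp add: matalg_def ucalg_def)
  define p where "p = length ys"
  \<comment> \<open>Each of the \<open>p\<close> components costs \<open>2 * \<delta>\<close> for
    the two block approximations and at most another \<open>\<delta>\<close> for the Lipschitz term,
    and \<open>3 p \<delta> < 4 (p + 1) \<delta> = \<omega>\<close>.\<close>
  define \<delta> where "\<delta> = \<omega> / (4 * (real p + 1))"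
  have d: "\<delta> > 0" using w by (simp add: \<delta>_def)
  have xin: "set xs \<subseteq> ca_carrier A" using xs by (auto simp: self_adjoint_def)
  have yin: "ys ! i \<in> ca_carrier (mat_alg A n)" if "i < p" for i using ys that by (auto simp: self_adjoint_def p_def)
  have "\<forall>i. \<exists>g. i < p \<longrightarrow> (\<forall>s<n. \<forall>t<n. g s t \<in> rat_ncpolys (length xs)) \<and>
    norm (emb (mat_alg A n) (ys ! i) - (\<Sum>s<n. \<Sum>t<n. m.mu s t (ncp_eval A (g s t) xs))) < \<delta>"
    using m.entrywise_approx[OF xin gx yin d] by blast
  from choice[OF this] obtain f where f': "\<forall>i. i < p \<longrightarrow> (\<forall>s<n. \<forall>t<n. f i s t \<in> rat_ncpolys (length xs)) \<and>
    norm (emb (mat_alg A n) (ys ! i) - (\<Sum>s<n. \<Sum>t<n. m.mu s t (ncp_eval A (f i s t) xs))) < \<delta>" by blast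
  have f: "f i s t \<in> rat_ncpolys (length xs)" if "i < p" "s < n" "t < n" for i s t using f' that by blast
  have fd: "norm (emb (mat_alg A n) (ys ! i) - (\<Sum>s<n. \<Sum>t<n. m.mu s t (ncp_eval A (f i s t) xs))) < \<delta>"
    if "i < p" for i using f' that by blast
  \<comment> \<open>The summand \<open>1\<close> puts the norms of the \<open>xs\<close> strictly
    below \<open>R\<close>, as lifting requires, and gives \<open>R \<ge> 1\<close> for the
    Lipschitz estimate.\<close>
  define R where "R = 1 + (\<Sum>x\<in>set xs. ca_norm A x)"
  have nx: "0 \<le> ca_norm A x" if "x \<in> set xs" for x using m.norm_laws(1) xin that by blast
  have R1: "R \<ge> 1" unfolding R_def using nx by (simp add: sum_nonneg)
  have Rx: "ca_norm A x < R" if "x \<in> set xs" for x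
    using member_le_sum[of x "set xs" "ca_norm A"] nx that by (simp add: R_def)
  define M where "M = (\<Sum>i<p. \<Sum>s<n. \<Sum>t<n. plip (f i s t) R)"
  have pl: "plip (f i s t) R \<ge> 0" for i s t using R1 by (intro plip_nonneg) simp
  have M0: "M \<ge> 0" unfolding M_def by (intro sum_nonneg pl)
  have fM: "plip (f i s t) R \<le> M" if "i < p" "s < n" "t < n" for i s t
  proof -
    have "plip (f i s t) R \<le> (\<Sum>t<n. plip (f i s t) R)" using that pl by (intro member_le_sum) auto
    also have "\<dots> \<le> (\<Sum>s<n. \<Sum>t<n. plip (f i s t) R)"
      using that pl by (intro member_le_sum[of s "{..<n}" "\<lambda>s. \<Sum>t<n. plip (f i s t) R"]) (auto intro!: sum_nonneg)
    also have "\<dots> \<le> M" unfolding M_def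
      using that pl by (intro member_le_sum[of i "{..<p}" "\<lambda>i. \<Sum>s<n. \<Sum>t<n. plip (f i s t) R"]) (auto intro!: sum_nonneg)
    finally show ?thesis .
  qed
  \<comment> \<open>\<open>K\<close> absorbs the factor \<open>n\<^sup>2 M\<close> of the Lipschitz
    term and is positive even if \<open>M = 0\<close>; \<open>\<omega>'\<close> is then fixed by
    \<open>2 K \<omega>' = \<delta>\<close>.\<close>
  define K where "K = real n * real n * M + 1"
  have K: "K \<ge> 1" using M0 by (simp add: K_def)
  define \<omega>' where "\<omega>' = \<omega> / (8 * (real p + 1) * K)"
  have w': "\<omega>' > 0" using w K by (simp add: \<omega>'_def)
  have bound: "real p * (2 * \<delta> + real n * real n * (M * (2 * \<omega>'))) < \<omega>"
  proof -
    have "real n * real n * (M * (2 * \<omega>')) \<le> K * (2 * \<omega>')" using w' by (simp add: K_def algebra_simps)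
    also have "\<dots> = \<delta>"
    proof -
      have "c * (2 * (\<omega> / (8 * a * c))) = \<omega> / (4 * a)" if "a > 0" "c > 0" for a c :: real
        using that by (simp add: field_simps)
      from this[of "real p + 1" K] show ?thesis using K unfolding \<omega>'_def \<delta>_def by linarith
    qed
    finally have "real p * (2 * \<delta> + real n * real n * (M * (2 * \<omega>'))) \<le> real p * (3 * \<delta>)"
      by (intro mult_left_mono) auto
    also have "\<dots> < 4 * (real p + 1) * \<delta>" using d by (simp add: algebra_simps add_nonneg_pos)
    also have "\<dots> = \<omega>"
    proof -
      have "4 * a * (\<omega> / (4 * a)) = \<omega>" if "a > 0" for a :: real using that by simp
      from this[of "real p + 1"] show ?thesis unfolding \<delta>_def by linarith
    qed
    finally show ?thesis .
  qed
  have "K_top_omega (mat_alg A n) ys Q \<omega> \<le> K_top_omega A xs P \<omega>'"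
    unfolding K_top_omega_def[of "mat_alg A n"]
  proof (rule SUP_least)
    fix R0 :: real
    have "(INF p\<in>{0<..} \<times> {1..}. limsup (\<lambda>k. log_ratio (o2 k (Gamma_top (mat_alg A n) ys Q R0 k (fst p) (snd p)) \<omega>) k))
      \<le> (INF p\<in>{0<..} \<times> {1..}. limsup (\<lambda>k. log_ratio (o2 k (Gamma_top A xs P R k (fst p) (snd p)) \<omega>') k))"
    proof (rule INF_greatest)
      fix q :: "real \<times> nat" assume q: "q \<in> {0<..} \<times> {1..}"
      define \<epsilon>' where "\<epsilon>' = fst q"
      define r' where "r' = snd q"
      have e': "\<epsilon>' > 0" using q by (auto simp: \<epsilon>'_def)
      obtain r0 where r0: "r0 \<ge> 1" and lift: "\<And>k Bs. Bs \<in> Gamma_top (mat_alg A n) ys Q R0 k (1 / real r0) r0 \<Longrightarrow>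
        \<exists>l D T. lifted n (length ys) f \<delta> k Bs l D T \<and> D \<in> Gamma_top A xs P R l \<epsilon>' r'"
        using uniform_lift[OF A n xs ys gen P Q f[unfolded p_def] fd[unfolded p_def] Rx e', of R0 r'] by blast
      define h where "h l = log_ratio (o2 l (Gamma_top A xs P R l \<epsilon>' r') \<omega>') l" for l
      have "eventually (\<lambda>k. log_ratio (o2 k (Gamma_top (mat_alg A n) ys Q R0 k (1 / real r0) r0) \<omega>) k \<le> h (k div n)) sequentially"
        using eventually_gt_at_top[of 0]
      proof eventually_elim
        case (elim k)
        define Sy where "Sy = Gamma_top (mat_alg A n) ys Q R0 k (1 / real r0) r0"
        show ?case
        proof (cases "Sy = {}")
          case True
          \<comment> \<open>Every \<open>k\<close> not divisible by \<open>n\<close> ends up here,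
            because an element of \<open>Sy\<close> would lift and give \<open>k = n * l\<close>.
            The left side is then \<open>-\<infinity>\<close>.\<close>
          have "o2 k {} \<omega> = 0" using o2_le[of "{}" "{}" k \<omega>] by simp
          then show ?thesis using True unfolding Sy_def by (simp add: log_ratio_def)
        next
          case False
          define l where "l = k div n"
          have ll: "l' = l \<and> k = n * l" if "lifted n (length ys) f \<delta> k Bs l' D T" for Bs l' D T
          proof -
            have "k = n * l'" using that unfolding lifted_def by blast
            then show ?thesis using n by (simp add: l_def)
          qed
          define Sx where "Sx = Gamma_top A xs P R l \<epsilon>' r'"
          have liftS: "\<exists>D T. lifted n (length ys) f \<delta> k Bs l D T \<and> D \<in> Sx" if "Bs \<in> Sy" for Bs
            using lift[of Bs k] ll that unfolding Sy_def Sx_def by metis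
          have kl: "k = n * l" using False liftS ll by blast
          have lpos: "0 < l" using kl elim by (cases l) auto
          have lk: "l \<le> k" using kl n by (cases n) auto
          have Sxp: "length D = length xs \<and> (\<forall>d\<in>set D. d \<in> cc l \<and> op_norm l d \<le> R)" if "D \<in> Sx" for D
            using Gamma_topD(1,2)[OF that[unfolded Sx_def]] by blast
          have Syp: "length Bs = length ys \<and> (\<forall>b\<in>set Bs. b \<in> cc k)" if "Bs \<in> Sy" for Bs
            using Gamma_topD(1,2)[OF that[unfolded Sy_def]] by blast
          from finite_orbit_cover[OF Sxp w'] obtain F0 where
            F0: "finite F0 \<and> F0 \<subseteq> Sx \<and> Sx \<subseteq> (\<Union>B\<in>F0. orbit_ball l \<omega>' B)" ..
          from o2_attained[OF conjunct1[OF F0] conjunct1[OF conjunct2[OF F0]] conjunct2[OF conjunct2[OF F0]]]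
          obtain F where F: "finite F" "F \<subseteq> Sx" "Sx \<subseteq> (\<Union>B\<in>F. orbit_ball l \<omega>' B)" "card F = o2 l Sx \<omega>'"
            by (elim exE conjE)
          have fMr: "\<And>i s t. i < length ys \<Longrightarrow> s < n \<Longrightarrow> t < n \<Longrightarrow> f i s t \<in> rat_ncpolys (length xs) \<and> plip (f i s t) R \<le> M"
            using f fM unfolding p_def by blast
          have "o2 k Sy \<omega> \<le> card F"
            by (rule o2_lift_le[OF n elim Syp Sxp liftS R1 fMr w' bound[unfolded p_def] F(1-3)])
          then have "log_ratio (o2 k Sy \<omega>) k \<le> log_ratio (o2 l Sx \<omega>') l"
            unfolding F(4) using lk lpos by (rule log_ratio_mono)
          then show ?thesis by (simp add: Sy_def Sx_def h_def l_def)
        qed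
      qed
      then have "limsup (\<lambda>k. log_ratio (o2 k (Gamma_top (mat_alg A n) ys Q R0 k (1 / real r0) r0) \<omega>) k) \<le> limsup (\<lambda>k. h (k div n))"
        by (rule Limsup_mono)
      also have "\<dots> \<le> limsup h" by (rule limsup_div_le[OF n])
      finally have le: "limsup (\<lambda>k. log_ratio (o2 k (Gamma_top (mat_alg A n) ys Q R0 k (1 / real r0) r0) \<omega>) k) \<le> limsup h" .
      show "(INF p\<in>{0<..} \<times> {1..}. limsup (\<lambda>k. log_ratio (o2 k (Gamma_top (mat_alg A n) ys Q R0 k (fst p) (snd p)) \<omega>) k))
        \<le> limsup (\<lambda>k. log_ratio (o2 k (Gamma_top A xs P R k (fst q) (snd q)) \<omega>') k)"
        by (rule INF_lower2[of "(1 / real r0, r0)"]) (use r0 le in \<open>auto simp: h_def[abs_def] \<epsilon>'_def r'_def\<close>)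
    qed
    also have "\<dots> \<le> K_top_omega A xs P \<omega>'" unfolding K_top_omega_def
      by (rule SUP_upper[of R]) (use R1 in simp)
    finally show "(INF p\<in>{0<..} \<times> {1..}. limsup (\<lambda>k. log_ratio (o2 k (Gamma_top (mat_alg A n) ys Q R0 k (fst p) (snd p)) \<omega>) k))
      \<le> K_top_omega A xs P \<omega>'" .
  qed
  then show ?thesis using w' by blast
qed

text \<open>A minimal cover by the smaller balls, with its centres, also covers by the larger ones.
  Monotonicity is what places the value at a single radius below the limit superior at
  \<open>0\<close>.\<close>

lemma K_top_omega_antimono:
  assumes "0 < \<omega>" "\<omega> \<le> \<omega>'" shows "K_top_omega S xs P \<omega>' \<le> K_top_omega S xs P \<omega>"
  unfolding K_top_omega_def
proof (intro SUP_mono' INF_mono' Limsup_mono)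
  fix R :: real and q :: "real \<times> nat"
  show "eventually (\<lambda>k. log_ratio (o2 k (Gamma_top S xs P R k (fst q) (snd q)) \<omega>') k \<le> log_ratio (o2 k (Gamma_top S xs P R k (fst q) (snd q)) \<omega>) k) sequentially"
    using eventually_gt_at_top[of 0]
  proof eventually_elim
    case (elim k)
    define G where "G = Gamma_top S xs P R k (fst q) (snd q)"
    have "length D = length xs \<and> (\<forall>d\<in>set D. d \<in> cc k \<and> op_norm k d \<le> R)" if "D \<in> G" for D
      using Gamma_topD(1,2)[OF that[unfolded G_def]] by blast
    from finite_orbit_cover[OF this assms(1)] obtain F0 where
      F0: "finite F0 \<and> F0 \<subseteq> G \<and> G \<subseteq> (\<Union>B\<in>F0. orbit_ball k \<omega> B)" ..
    from o2_attained[OF conjunct1[OF F0] conjunct1[OF conjunct2[OF F0]] conjunct2[OF conjunct2[OF F0]]]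
    obtain F where F: "finite F" "F \<subseteq> G" "G \<subseteq> (\<Union>B\<in>F. orbit_ball k \<omega> B)" "card F = o2 k G \<omega>"
      by (elim exE conjE)
    have "G \<subseteq> (\<Union>B\<in>F. orbit_ball k \<omega>' B)" using F(3) orbit_ball_mono[OF assms(2)] by blast
    then have "o2 k G \<omega>' \<le> card F" using F(1,2) by (intro o2_le)
    then show ?case unfolding G_def[symmetric] F(4) using elim by (intro log_ratio_mono) auto
  qed
qed

theorem theorem3p4:
  fixes A :: "'a calg" and n :: nat and xs :: "'a list"
    and ys :: "(nat \<Rightarrow> nat \<Rightarrow> 'a) list"
    and P Q :: "nat \<Rightarrow> ncpoly"
  assumes "unital_cstar_algebra A"
    and "0 < n"
    and "\<forall>x\<in>set xs. self_adjoint A x" and "generates A xs"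
    and "\<forall>y\<in>set ys. self_adjoint (mat_alg A n) y" and "generates (mat_alg A n) ys"
    and "bij_betw P {1..} (rat_ncpolys (length xs))"
    and "bij_betw Q {1..} (rat_ncpolys (length ys))"
  shows "K_top (mat_alg A n) ys Q \<le> K_top A xs P"
  unfolding K_top_def[of "mat_alg A n"]
proof (rule Limsup_bounded)
  show "eventually (\<lambda>\<omega>. K_top_omega (mat_alg A n) ys Q \<omega> \<le> K_top A xs P) (at_right 0)"
    using eventually_at_right_less[of "0::real"]
  proof eventually_elim
    case (elim \<omega>)
    then obtain \<omega>' where w: "\<omega>' > 0" and le: "K_top_omega (mat_alg A n) ys Q \<omega> \<le> K_top_omega A xs P \<omega>'"
      using K_top_omega_le[OF assms] by blast
    \<comment> \<open>For the radius \<open>\<omega>'\<close> attached to a fixed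
      \<open>\<omega>\<close>, all sufficiently small radii give values at least as large, so
      \<open>K_top A xs P\<close> dominates.\<close>
    have "eventually (\<lambda>\<omega>. \<omega> < \<omega>') (at_right (0::real))" using w by (rule eventually_at_right_real[THEN eventually_mono]) simp
    then have "eventually (\<lambda>\<omega>. K_top_omega A xs P \<omega>' \<le> K_top_omega A xs P \<omega>) (at_right 0)"
      using eventually_at_right_less[of "0::real"] by eventually_elim (simp add: K_top_omega_antimono)
    then have "K_top_omega A xs P \<omega>' \<le> K_top A xs P" unfolding K_top_def by (intro le_Limsup) simp_all
    with le show ?case by (rule order_trans)
  qed
qed

end
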